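(* Let $A = R(\sigma,f)$ be a simple generalized Weyl algebra of the type described in the context, and let $\Gamma$ and the $\Gamma$-graded ring $B = B(R,\sigma,f) = \bigoplus_{\mathbf{J}\in\Gamma}\operatorname{Hom}_{\operatorname{grmod}\text{-}A}(A,\iota_{\mathbf{J}}A)$ be as defined in the context. Then there is an equivalence of categories \[ \operatorname{GrMod}\text{-}A \equiv \operatorname{GrMod}\text{-}(B,\Gamma). \]
   Context: $\Bbbk$ is an algebraically closed field of characteristic zero; categories and equivalences are $\Bbbk$-linear. Let either (1) $R=\Bbbk[z]$, $\sigma(z)=z+1$, or (2) $R=\Bbbk[z,z^{-1}]$, $\sigma(z)=\xi z$ with $\xi\in\Bbbk^\times$ not a root of unity. Let $f\in\Bbbk[z]$ be monic, with $f(0)\ne0$ in case (2). The generalized Weyl algebra $R(\sigma,f)$ is the quotient of $R\langle x,y\rangle$ by $xy=f$, $yx=\sigma^{-1}(f)$, $xr=\sigma(r)x$, $yr=\sigma^{-1}(r)y$ ($r\in R$), $\mathbb{Z}$-graded by $\deg x=1$, $\deg y=-1$, $\deg r=0$. Let $\sigma_\Bbbk(\lambda)=\lambda-1$ in case (1), $\sigma_\Bbbk(\lambda)=\xi^{-1}\lambda$ in case (2). Assume no two distinct roots of $f$ lie on the same $\sigma_\Bbbk$-orbit (equivalently, $A$ is simple). Let $\alpha_1,\dots,\alpha_r$ be the distinct roots of $f$, with $\alpha_i$ of multiplicity $n_i$. Modules: $\operatorname{GrMod}\text{-}A$ is the category of $\mathbb{Z}$-graded right $A$-modules with degree-$0$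 maps, $\operatorname{grmod}\text{-}A$ its full subcategory of finitely generated modules, and $\operatorname{GrMod}\text{-}(B,\Gamma)$ the category of $\Gamma$-graded right $B$-modules with degree-$0$ maps. The shift is $M\langle j\rangle_i=M_{i+j}$. For a root $\alpha$ of multiplicity $n_\alpha$ put $M_\alpha^{-n_\alpha}=\frac{A}{(z-\alpha)^{n_\alpha}A+xA}$ and $M_\alpha^{+n_\alpha}=\frac{A}{\sigma^{-1}((z-\alpha)^{n_\alpha})A+yA}\langle-1\rangle$. Autoequivalences: let $\mathcal{Q}_{\mathrm{gr}}(A)=\Bbbk(z)[x,x^{-1};\sigma]$ be the graded quotient division ring of $A$. For a root $\alpha$, $j\in\mathbb{Z}$, and a rank one graded projective submodule $P\subseteq\mathcal{Q}_{\mathrm{gr}}(A)$, there is a graded surjection from $P$ onto exactly one of $M_\alpha^{-n_\alpha}\langle j\rangle$, $M_\alpha^{+n_\alpha}\langle j\rangle$, and its kernel is independent of the surjection; $\iota_j^\alpha P$ is this kernel, and $\iota_j^\alpha$ acts on homomorphisms between such modules by restriction. This extends to an autoequivalence $\iota_j^\alpha$ of $\operatorname{grmod}\text{-}A$ with $(\iota_j^{\alpha})^2\cong\operatorname{Id}$, and the $\iota_j^\alpha$ commute with each other. Group: $\mathbb{Z}_{\mathrm{fin}}$ is the group of finite subsets of $\mathbb{Z}$ under symmetric difference $\oplus$, and $\Gamma=\bigoplus_{i=1}^r\mathbb{Z}_{\mathrm{fin}}$; intersections in $\Gamma$ are componentwise. For $\mathbf{J}=(J_1,\dots,J_r)\in\Gamma$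 let $\iota_{\mathbf{J}}=\prod_{i=1}^r\prod_{j\in J_i}\iota_j^{\alpha_i}$ and $h_{\mathbf{J}}=\prod_{i=1}^r\prod_{j\in J_i}\sigma^{-j}((z-\alpha_i)^{n_i})$. Then $\iota_{\mathbf{J}}^2A=h_{\mathbf{J}}A$; let $\tau_{\mathbf{J}}:\iota_{\mathbf{J}}^2A\to A$ be left multiplication by $h_{\mathbf{J}}^{-1}$. Ring: $B=\bigoplus_{\mathbf{J}\in\Gamma}B_{\mathbf{J}}$ with $B_{\mathbf{J}}=\operatorname{Hom}_{\operatorname{grmod}\text{-}A}(A,\iota_{\mathbf{J}}A)$, and for $a\in B_{\mathbf{I}}$, $b\in B_{\mathbf{J}}$ the product is $a\cdot b=\iota_{\mathbf{I}\oplus\mathbf{J}}(\tau_{\mathbf{I}\cap\mathbf{J}})\circ\iota_{\mathbf{J}}(a)\circ b\in B_{\mathbf{I}\oplus\mathbf{J}}$, using $\iota_{\mathbf{I}}\iota_{\mathbf{J}}A=\iota_{\mathbf{I}\oplus\mathbf{J}}\iota_{\mathbf{I}\cap\mathbf{J}}^2A$. This is a $\Gamma$-graded ring. *)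

theory Defs
  imports
    "HOL-Algebra.QuotRing"
    "HOL-Algebra.Product_Groups"
    "HOL-Computational_Algebra.Polynomial"
    "HOL-Computational_Algebra.Fraction_Field"
begin

section \<open>Linear categories and their equivalences\<close>

record ('o, 'a, 'k) linear_category =
  Obj :: "'o set"
  Hom :: "'o \<Rightarrow> 'o \<Rightarrow> 'a set"
  Ident :: "'o \<Rightarrow> 'a"
  Comp :: "'o \<Rightarrow> 'o \<Rightarrow> 'o \<Rightarrow> 'a \<Rightarrow> 'a \<Rightarrow> 'a"
    \<comment> \<open>\<open>Comp C X Y Z g f\<close> is the composite of \<open>f: X \<rightarrow> Y\<close> followed by \<open>g: Y \<rightarrow> Z\<close>\<close>
  Hom_add :: "'o \<Rightarrow> 'o \<Rightarrow> 'a \<Rightarrow> 'a \<Rightarrow> 'a"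
  Hom_scale :: "'o \<Rightarrow> 'o \<Rightarrow> 'k \<Rightarrow> 'a \<Rightarrow> 'a"

definition linear_functor ::
  "('o, 'a, 'k) linear_category \<Rightarrow> ('p, 'b, 'k) linear_category \<Rightarrow>
   ('o \<Rightarrow> 'p) \<Rightarrow> ('o \<Rightarrow> 'o \<Rightarrow> 'a \<Rightarrow> 'b) \<Rightarrow> bool" where
  "linear_functor C D F \<phi> \<longleftrightarrow>
    (\<forall>X\<in>Obj C. F X \<in> Obj D \<and> \<phi> X X (Ident C X) = Ident D (F X)) \<and>
    (\<forall>X\<in>Obj C. \<forall>Y\<in>Obj C. \<forall>f\<in>Hom C X Y. \<phi> X Y f \<in> Hom D (F X) (F Y)) \<and>
    (\<forall>X\<in>Obj C. \<forall>Y\<in>Obj C. \<forall>Z\<in>Obj C. \<forall>f\<in>Hom C X Y. \<forall>g\<in>Hom C Y Z.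
       \<phi> X Z (Comp C X Y Z g f) = Comp D (F X) (F Y) (F Z) (\<phi> Y Z g) (\<phi> X Y f)) \<and>
    (\<forall>X\<in>Obj C. \<forall>Y\<in>Obj C. \<forall>f\<in>Hom C X Y. \<forall>g\<in>Hom C X Y.
       \<phi> X Y (Hom_add C X Y f g) = Hom_add D (F X) (F Y) (\<phi> X Y f) (\<phi> X Y g)) \<and>
    (\<forall>X\<in>Obj C. \<forall>Y\<in>Obj C. \<forall>f\<in>Hom C X Y. \<forall>c.
       \<phi> X Y (Hom_scale C X Y c f) = Hom_scale D (F X) (F Y) c (\<phi> X Y f))"

definition isomorphism ::
  "('o, 'a, 'k) linear_category \<Rightarrow> 'o \<Rightarrow> 'o \<Rightarrow> 'a \<Rightarrow> bool" where
  "isomorphism C X Y f \<longleftrightarrow> f \<in> Hom C X Y \<and>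
    (\<exists>g\<in>Hom C Y X. Comp C X Y X g f = Ident C X \<and> Comp C Y X Y f g = Ident C Y)"

definition naturally_isomorphic ::
  "('o, 'a, 'k) linear_category \<Rightarrow> ('p, 'b, 'k) linear_category \<Rightarrow>
   ('o \<Rightarrow> 'p) \<Rightarrow> ('o \<Rightarrow> 'o \<Rightarrow> 'a \<Rightarrow> 'b) \<Rightarrow>
   ('o \<Rightarrow> 'p) \<Rightarrow> ('o \<Rightarrow> 'o \<Rightarrow> 'a \<Rightarrow> 'b) \<Rightarrow> bool" where
  "naturally_isomorphic C D F \<phi> G \<gamma> \<longleftrightarrow>
    (\<exists>\<eta>. (\<forall>X\<in>Obj C. isomorphism D (F X) (G X) (\<eta> X)) \<and>
      (\<forall>X\<in>Obj C. \<forall>Y\<in>Obj C. \<forall>f\<in>Hom C X Y.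
         Comp D (F X) (F Y) (G Y) (\<eta> Y) (\<phi> X Y f) =
         Comp D (F X) (G X) (G Y) (\<gamma> X Y f) (\<eta> X)))"

definition equivalent_categories ::
  "('o, 'a, 'k) linear_category \<Rightarrow> ('p, 'b, 'k) linear_category \<Rightarrow> bool" where
  "equivalent_categories C D \<longleftrightarrow>
    (\<exists>F \<phi> G \<gamma>. linear_functor C D F \<phi> \<and> linear_functor D C G \<gamma> \<and>
      naturally_isomorphic C C (\<lambda>X. G (F X)) (\<lambda>X Y f. \<gamma> (F X) (F Y) (\<phi> X Y f))
        (\<lambda>X. X) (\<lambda>X Y f. f) \<and>
      naturally_isomorphic D D (\<lambda>X. F (G X)) (\<lambda>X Y f. \<phi> (G X) (G Y) (\<gamma> X Y f))
        (\<lambda>X. X) (\<lambda>X Y f. f))"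


section \<open>Graded algebras and graded right modules\<close>

record ('a, 'i) graded = "'a ring" +
  piece :: "'i \<Rightarrow> 'a set"

record ('a, 'i, 'k) graded_algebra = "('a, 'i) graded" +
  scalar :: "'k \<Rightarrow> 'a"  \<comment> \<open>the structure map from the ground field\<close>

(* As for the library's modules, the fields mult and one of a module are unused. *)
record ('m, 'i, 'a) graded_module = "('m, 'i) graded" +
  act :: "'m \<Rightarrow> 'a \<Rightarrow> 'm"

(* M is the internal direct sum of the subgroups "piece M i", i in the group G. *)
definition graded_group :: "('i, 'g) monoid_scheme \<Rightarrow> ('m, 'i, 'b) graded_scheme \<Rightarrow> bool" where
  "graded_group G M \<longleftrightarrow> abelian_group M \<and>
    (\<forall>i\<in>carrier G. additive_subgroup (piece M i) M) \<and>
    (\<forall>m\<in>carrier M. \<exists>!c. c \<in> (\<Pi>\<^sub>E i\<in>carrier G. piece M i) \<and>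
       finite {i \<in> carrier G. c i \<noteq> \<zero>\<^bsub>M\<^esub>} \<and>
       m = finsum M c {i \<in> carrier G. c i \<noteq> \<zero>\<^bsub>M\<^esub>})"

definition graded_right_module ::
  "('i, 'g) monoid_scheme \<Rightarrow> ('a, 'i, 'b) graded_scheme \<Rightarrow> ('m, 'i, 'a) graded_module \<Rightarrow> bool" where
  "graded_right_module G A M \<longleftrightarrow> graded_group G M \<and>
    (\<forall>m\<in>carrier M. \<forall>a\<in>carrier A. act M m a \<in> carrier M) \<and>
    (\<forall>m\<in>carrier M. \<forall>n\<in>carrier M. \<forall>a\<in>carrier A.
       act M (m \<oplus>\<^bsub>M\<^esub> n) a = act M m a \<oplus>\<^bsub>M\<^esub> act M n a) \<and>
    (\<forall>m\<in>carrier M. \<forall>a\<in>carrier A. \<forall>b\<in>carrier A.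
       act M m (a \<oplus>\<^bsub>A\<^esub> b) = act M m a \<oplus>\<^bsub>M\<^esub> act M m b) \<and>
    (\<forall>m\<in>carrier M. \<forall>a\<in>carrier A. \<forall>b\<in>carrier A.
       act M m (a \<otimes>\<^bsub>A\<^esub> b) = act M (act M m a) b) \<and>
    (\<forall>m\<in>carrier M. act M m \<one>\<^bsub>A\<^esub> = m) \<and>
    (\<forall>i\<in>carrier G. \<forall>j\<in>carrier G. \<forall>m\<in>piece M i. \<forall>a\<in>piece A j.
       act M m a \<in> piece M (i \<otimes>\<^bsub>G\<^esub> j))"

(* Degree-0 homomorphisms, made extensional so that equality of maps is equality in HOL. *)
definition graded_hom ::
  "('i, 'g) monoid_scheme \<Rightarrow> ('a, 'i, 'b) graded_scheme \<Rightarrow>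
   ('m, 'i, 'a) graded_module \<Rightarrow> ('n, 'i, 'a) graded_module \<Rightarrow> ('m \<Rightarrow> 'n) set" where
  "graded_hom G A M N = {h \<in> carrier M \<rightarrow>\<^sub>E carrier N.
    (\<forall>m\<in>carrier M. \<forall>n\<in>carrier M. h (m \<oplus>\<^bsub>M\<^esub> n) = h m \<oplus>\<^bsub>N\<^esub> h n) \<and>
    (\<forall>m\<in>carrier M. \<forall>a\<in>carrier A. h (act M m a) = act N (h m) a) \<and>
    (\<forall>i\<in>carrier G. h ` piece M i \<subseteq> piece N i)}"

(* The category of G-graded right A-modules. HOL has no type of all modules, so underlying sets
   are taken from a collection U of subsets of a type 'm: U = UNIV gives all modules living on
   subsets of 'm, while for 'm a set-theoretic universe U may consist of its small subsets. *)
definition GrMod ::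
  "'m set set \<Rightarrow> ('i, 'g) monoid_scheme \<Rightarrow> ('a, 'i, 'k, 'b) graded_algebra_scheme \<Rightarrow>
   (('m, 'i, 'a) graded_module, 'm \<Rightarrow> 'm, 'k) linear_category" where
  "GrMod U G A = \<lparr>
     Obj = {M. graded_right_module G A M \<and> carrier M \<in> U},
     Hom = graded_hom G A,
     Ident = (\<lambda>M. \<lambda>m\<in>carrier M. m),
     Comp = (\<lambda>L M N g f. compose (carrier L) g f),
     Hom_add = (\<lambda>M N f g. \<lambda>m\<in>carrier M. f m \<oplus>\<^bsub>N\<^esub> g m),
     Hom_scale = (\<lambda>M N c f. \<lambda>m\<in>carrier M. act N (f m) (scalar A c))\<rparr>"

definition regular_module :: "('a, 'i, 'b) graded_scheme \<Rightarrow> ('a, 'i, 'a) graded_module" where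
  "regular_module A = \<lparr>carrier = carrier A, monoid.mult = monoid.mult A, one = one A,
     zero = zero A, add = add A, piece = piece A, act = monoid.mult A\<rparr>"

definition quotient_module ::
  "('m, 'i, 'a) graded_module \<Rightarrow> 'm set \<Rightarrow> ('m set, 'i, 'a) graded_module" where
  "quotient_module M N = \<lparr>carrier = a_rcosets\<^bsub>M\<^esub> N, monoid.mult = undefined, one = undefined,
     zero = N, add = set_add M,
     piece = (\<lambda>i. {N +>\<^bsub>M\<^esub> m |m. m \<in> piece M i}),
     act = (\<lambda>C a. \<Union>m\<in>C. N +>\<^bsub>M\<^esub> act M m a)\<rparr>"

definition shift :: "('m, int, 'a) graded_module \<Rightarrow> int \<Rightarrow> ('m, int, 'a) graded_module" where
  "shift M j = M\<lparr>piece := (\<lambda>i. piece M (i + j))\<rparr>"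


section \<open>Generalized Weyl algebras\<close>

(* The free (noncommutative) ring on the set G; an element is a finitely supported family of
   integer coefficients of words. *)
definition free_ring :: "'g set \<Rightarrow> ('g list \<Rightarrow> int) ring" where
  "free_ring G = \<lparr>
     carrier = {u. finite {w. u w \<noteq> 0} \<and> (\<forall>w. u w \<noteq> 0 \<longrightarrow> set w \<subseteq> G)},
     monoid.mult = (\<lambda>u v w. \<Sum>n\<le>length w. u (take n w) * v (drop n w)),
     one = (\<lambda>w. if w = [] then 1 else 0),
     zero = (\<lambda>w. 0),
     add = (\<lambda>u v w. u w + v w)\<rparr>"

definition gen :: "'g \<Rightarrow> 'g list \<Rightarrow> int" where
  "gen g = (\<lambda>w. if w = [g] then 1 else 0)"

datatype 'r letter = Coef 'r | X | Y

definition letters :: "('r, 'b) ring_scheme \<Rightarrow> 'r letter set" where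
  "letters R = Coef ` carrier R \<union> {X, Y}"

(* The first three families of relations present R<x,y>, the ring freely generated by the ring R
   and x, y (elements of R need not commute with x, y); the others are those of R(sigma,f). *)
definition gwa_relations ::
  "('r, 'b) ring_scheme \<Rightarrow> ('r \<Rightarrow> 'r) \<Rightarrow> 'r \<Rightarrow> ('r letter list \<Rightarrow> int) set" where
  "gwa_relations R \<sigma> f = (let F = free_ring (letters R); \<sigma>' = inv_into (carrier R) \<sigma> in
     {gen (Coef r) \<oplus>\<^bsub>F\<^esub> gen (Coef s) \<ominus>\<^bsub>F\<^esub> gen (Coef (r \<oplus>\<^bsub>R\<^esub> s)) |r s. r \<in> carrier R \<and> s \<in> carrier R} \<union>
     {gen (Coef r) \<otimes>\<^bsub>F\<^esub> gen (Coef s) \<ominus>\<^bsub>F\<^esub> gen (Coef (r \<otimes>\<^bsub>R\<^esub> s)) |r s. r \<in> carrier R \<and> s \<in> carrier R} \<union>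
     {gen (Coef \<one>\<^bsub>R\<^esub>) \<ominus>\<^bsub>F\<^esub> \<one>\<^bsub>F\<^esub>} \<union>
     {gen X \<otimes>\<^bsub>F\<^esub> gen Y \<ominus>\<^bsub>F\<^esub> gen (Coef f),
      gen Y \<otimes>\<^bsub>F\<^esub> gen X \<ominus>\<^bsub>F\<^esub> gen (Coef (\<sigma>' f))} \<union>
     {gen X \<otimes>\<^bsub>F\<^esub> gen (Coef r) \<ominus>\<^bsub>F\<^esub> gen (Coef (\<sigma> r)) \<otimes>\<^bsub>F\<^esub> gen X |r. r \<in> carrier R} \<union>
     {gen Y \<otimes>\<^bsub>F\<^esub> gen (Coef r) \<ominus>\<^bsub>F\<^esub> gen (Coef (\<sigma>' r)) \<otimes>\<^bsub>F\<^esub> gen Y |r. r \<in> carrier R})"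

definition gwa_ideal ::
  "('r, 'b) ring_scheme \<Rightarrow> ('r \<Rightarrow> 'r) \<Rightarrow> 'r \<Rightarrow> ('r letter list \<Rightarrow> int) set" where
  "gwa_ideal R \<sigma> f = Idl\<^bsub>free_ring (letters R)\<^esub> (gwa_relations R \<sigma> f)"

definition gwa_class ::
  "('r, 'b) ring_scheme \<Rightarrow> ('r \<Rightarrow> 'r) \<Rightarrow> 'r \<Rightarrow> 'r letter \<Rightarrow> ('r letter list \<Rightarrow> int) set" where
  "gwa_class R \<sigma> f l = gwa_ideal R \<sigma> f +>\<^bsub>free_ring (letters R)\<^esub> gen l"

fun letter_degree :: "'r letter \<Rightarrow> int" where
  "letter_degree (Coef r) = 0"
| "letter_degree X = 1"
| "letter_degree Y = -1"

definition gwa ::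
  "('r, 'b) ring_scheme \<Rightarrow> ('r \<Rightarrow> 'r) \<Rightarrow> 'r \<Rightarrow> ('k \<Rightarrow> 'r) \<Rightarrow>
   (('r letter list \<Rightarrow> int) set, int, 'k) graded_algebra" where
  "gwa R \<sigma> f e = (let F = free_ring (letters R); I = gwa_ideal R \<sigma> f in
     \<lparr>carrier = carrier (F Quot I), monoid.mult = monoid.mult (F Quot I), one = one (F Quot I),
      zero = zero (F Quot I), add = add (F Quot I),
      piece = (\<lambda>d. {I +>\<^bsub>F\<^esub> u |u. u \<in> carrier F \<and>
                      (\<forall>w. u w \<noteq> 0 \<longrightarrow> (\<Sum>l\<leftarrow>w. letter_degree l) = d)}),
      scalar = (\<lambda>c. gwa_class R \<sigma> f (Coef (e c)))\<rparr>)"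


section \<open>The two families of base rings\<close>

type_synonym 'k ratfun = "'k poly fract"

(* Shift: R = k[z], sigma(z) = z + 1.  QShift xi: R = k[z,1/z], sigma(z) = xi z. *)
datatype 'k base = Shift | QShift 'k

abbreviation of_poly :: "'k::field poly \<Rightarrow> 'k ratfun" where
  "of_poly p \<equiv> Fract p 1"

(* Substitution of s for z in a rational function; junk value 0 for constant s, where
   denominators may be sent to 0. *)
lift_definition subst_ratfun :: "'k::field poly \<Rightarrow> 'k ratfun \<Rightarrow> 'k ratfun" is
  "\<lambda>s (a, b). if degree s = 0 then (0, 1) else (pcompose a s, pcompose b s)"
proof -
  fix s :: "'k poly" and x y :: "'k poly \<times> 'k poly"
  assume xy: "fractrel x y"
  obtain a b c d where xy': "x = (a, b)" "y = (c, d)" by fastforce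
  have "pcompose a s * pcompose d s = pcompose c s * pcompose b s"
    using xy by (simp add: xy' flip: pcompose_mult)
  moreover have "pcompose b s \<noteq> 0" "pcompose d s \<noteq> 0" if "degree s \<noteq> 0"
    using xy that by (auto simp: xy' pcompose_eq_0_iff)
  ultimately show "fractrel
      (case x of (a, b) \<Rightarrow> if degree s = 0 then (0, 1) else (pcompose a s, pcompose b s))
      (case y of (a, b) \<Rightarrow> if degree s = 0 then (0, 1) else (pcompose a s, pcompose b s))"
    by (simp add: xy')
qed

fun sigma_arg :: "'k::field base \<Rightarrow> int \<Rightarrow> 'k poly" where
  "sigma_arg Shift i = [:of_int i, 1:]"
| "sigma_arg (QShift \<xi>) i = [:0, \<xi> powi i:]"

(* The i-th power of sigma, on all of k(z). *)
definition sigma :: "'k::field base \<Rightarrow> int \<Rightarrow> 'k ratfun \<Rightarrow> 'k ratfun" where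
  "sigma T i = subst_ratfun (sigma_arg T i)"

(* The i-th power of the map sigma_k on the ground field. *)
fun sigma_k :: "'k::field base \<Rightarrow> int \<Rightarrow> 'k \<Rightarrow> 'k" where
  "sigma_k Shift i c = c - of_int i"
| "sigma_k (QShift \<xi>) i c = \<xi> powi (-i) * c"

fun base_carrier :: "'k::field base \<Rightarrow> 'k ratfun set" where
  "base_carrier Shift = range of_poly"
| "base_carrier (QShift \<xi>) = {Fract p ([:0, 1:] ^ n) |p n. True}"

definition base_ring :: "'k::field base \<Rightarrow> 'k ratfun ring" where
  "base_ring T = \<lparr>carrier = base_carrier T, monoid.mult = (*), one = 1, zero = 0, add = (+)\<rparr>"

type_synonym 'k gwa_elem = "('k ratfun letter list \<Rightarrow> int) set"

definition GWA :: "'k::field base \<Rightarrow> 'k poly \<Rightarrow> ('k gwa_elem, int, 'k) graded_algebra" where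
  "GWA T f = gwa (base_ring T) (sigma T 1) (of_poly f) (\<lambda>c. of_poly [:c:])"

definition gwa_coef :: "'k::field base \<Rightarrow> 'k poly \<Rightarrow> 'k ratfun \<Rightarrow> 'k gwa_elem" where
  "gwa_coef T f r = gwa_class (base_ring T) (sigma T 1) (of_poly f) (Coef r)"

definition gwa_x :: "'k::field base \<Rightarrow> 'k poly \<Rightarrow> 'k gwa_elem" where
  "gwa_x T f = gwa_class (base_ring T) (sigma T 1) (of_poly f) X"

definition gwa_y :: "'k::field base \<Rightarrow> 'k poly \<Rightarrow> 'k gwa_elem" where
  "gwa_y T f = gwa_class (base_ring T) (sigma T 1) (of_poly f) Y"

definition roots :: "'k::field poly \<Rightarrow> 'k set" where
  "roots f = {\<alpha>. poly f \<alpha> = 0}"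

definition root_factor :: "'k::field poly \<Rightarrow> 'k \<Rightarrow> 'k ratfun" where
  "root_factor f \<alpha> = of_poly ([:-\<alpha>, 1:] ^ Polynomial.order \<alpha> f)"

definition right_ideal2 :: "('a, 'b) ring_scheme \<Rightarrow> 'a \<Rightarrow> 'a \<Rightarrow> 'a set" where
  "right_ideal2 A p q = {p \<otimes>\<^bsub>A\<^esub> a \<oplus>\<^bsub>A\<^esub> q \<otimes>\<^bsub>A\<^esub> b |a b. a \<in> carrier A \<and> b \<in> carrier A}"

definition M_minus ::
  "'k::field base \<Rightarrow> 'k poly \<Rightarrow> 'k \<Rightarrow> ('k gwa_elem set, int, 'k gwa_elem) graded_module" where
  "M_minus T f \<alpha> = quotient_module (regular_module (GWA T f))
     (right_ideal2 (GWA T f) (gwa_coef T f (root_factor f \<alpha>)) (gwa_x T f))"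

definition M_plus ::
  "'k::field base \<Rightarrow> 'k poly \<Rightarrow> 'k \<Rightarrow> ('k gwa_elem set, int, 'k gwa_elem) graded_module" where
  "M_plus T f \<alpha> = shift (quotient_module (regular_module (GWA T f))
     (right_ideal2 (GWA T f) (gwa_coef T f (sigma T (-1) (root_factor f \<alpha>))) (gwa_y T f))) (-1)"


section \<open>The graded quotient division ring\<close>

type_synonym 'k skew = "int \<Rightarrow> 'k ratfun"

(* The skew Laurent polynomial ring k(z)[x,1/x;sigma]: the family q stands for the sum of the
   q(i) x^i, and x^i p = sigma^i(p) x^i. *)
definition Qgr :: "'k::field base \<Rightarrow> 'k skew ring" where
  "Qgr T = \<lparr>
     carrier = {q. finite {i. q i \<noteq> 0}},
     monoid.mult = (\<lambda>p q n. \<Sum>i | p i \<noteq> 0. p i * sigma T i (q (n - i))),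
     one = (\<lambda>n. if n = 0 then 1 else 0),
     zero = (\<lambda>n. 0),
     add = (\<lambda>p q n. p n + q n)\<rparr>"

definition skew_monom :: "'k::field ratfun \<Rightarrow> int \<Rightarrow> 'k skew" where
  "skew_monom c i = (\<lambda>n. if n = i then c else 0)"

(* The canonical map from the algebra to its graded quotient ring; as xy = f, the letter y goes
   to x^(-1) f = sigma^(-1)(f) x^(-1). *)
fun letter_value :: "'k::field base \<Rightarrow> 'k poly \<Rightarrow> 'k ratfun letter \<Rightarrow> 'k skew" where
  "letter_value T f (Coef r) = skew_monom r 0"
| "letter_value T f X = skew_monom 1 1"
| "letter_value T f Y = skew_monom (sigma T (-1) (of_poly f)) (-1)"

definition word_value :: "'k::field base \<Rightarrow> 'k poly \<Rightarrow> 'k ratfun letter list \<Rightarrow> 'k skew" where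
  "word_value T f w = foldr (\<lambda>l q. letter_value T f l \<otimes>\<^bsub>Qgr T\<^esub> q) w \<one>\<^bsub>Qgr T\<^esub>"

definition free_value ::
  "'k::field base \<Rightarrow> 'k poly \<Rightarrow> ('k ratfun letter list \<Rightarrow> int) \<Rightarrow> 'k skew" where
  "free_value T f u = (\<lambda>n. \<Sum>w | u w \<noteq> 0. of_int (u w) * word_value T f w n)"

definition gwa_to_Q :: "'k::field base \<Rightarrow> 'k poly \<Rightarrow> 'k gwa_elem \<Rightarrow> 'k skew" where
  "gwa_to_Q T f a = the_elem (free_value T f ` a)"

definition A_in_Q :: "'k::field base \<Rightarrow> 'k poly \<Rightarrow> 'k skew set" where
  "A_in_Q T f = gwa_to_Q T f ` carrier (GWA T f)"

(* A graded right A-submodule P of the graded quotient ring, as a graded module. *)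
definition sub_Q ::
  "'k::field base \<Rightarrow> 'k poly \<Rightarrow> 'k skew set \<Rightarrow> ('k skew, int, 'k gwa_elem) graded_module" where
  "sub_Q T f P = \<lparr>carrier = P, monoid.mult = undefined, one = undefined,
     zero = zero (Qgr T), add = add (Qgr T),
     piece = (\<lambda>i. {q \<in> P. \<forall>n. n \<noteq> i \<longrightarrow> q n = 0}),
     act = (\<lambda>q a. q \<otimes>\<^bsub>Qgr T\<^esub> gwa_to_Q T f a)\<rparr>"

abbreviation hom_Q ::
  "'k::field base \<Rightarrow> 'k poly \<Rightarrow> 'k skew set \<Rightarrow> 'k skew set \<Rightarrow> ('k skew \<Rightarrow> 'k skew) set" where
  "hom_Q T f P P' \<equiv>
     graded_hom integer_group (GWA T f) (sub_Q T f P) (sub_Q T f P')"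


section \<open>The autoequivalences on rank one projectives\<close>

(* Only meaningful for rank one graded projective submodules P of the graded quotient ring. *)
definition iota :: "'k::field base \<Rightarrow> 'k poly \<Rightarrow> 'k \<Rightarrow> int \<Rightarrow> 'k skew set \<Rightarrow> 'k skew set" where
  "iota T f \<alpha> j P = (THE K. \<exists>M\<in>{shift (M_minus T f \<alpha>) j, shift (M_plus T f \<alpha>) j}.
     \<exists>\<phi>\<in>graded_hom integer_group (GWA T f) (sub_Q T f P) M.
       \<phi> ` P = carrier M \<and> K = {p \<in> P. \<phi> p = \<zero>\<^bsub>M\<^esub>})"

definition Zfin :: "int set monoid" where
  "Zfin = \<lparr>carrier = {S. finite S}, monoid.mult = sym_diff, one = {}\<rparr>"

(* The summands are indexed by the distinct roots themselves. *)
definition Gamma :: "'k::field poly \<Rightarrow> ('k \<Rightarrow> int set) monoid" where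
  "Gamma f = sum_group (roots f) (\<lambda>_. Zfin)"

definition Gamma_inter ::
  "'k::field poly \<Rightarrow> ('k \<Rightarrow> int set) \<Rightarrow> ('k \<Rightarrow> int set) \<Rightarrow> 'k \<Rightarrow> int set" where
  "Gamma_inter f I J = (\<lambda>\<alpha>\<in>roots f. I \<alpha> \<inter> J \<alpha>)"

definition iotas ::
  "'k::field base \<Rightarrow> 'k poly \<Rightarrow> ('k \<Rightarrow> int set) \<Rightarrow> 'k skew set \<Rightarrow> 'k skew set" where
  "iotas T f J P =
     Finite_Set.fold (\<lambda>(\<alpha>, j) K. iota T f \<alpha> j K) P (SIGMA \<alpha>:roots f. J \<alpha>)"

(* The action on a homomorphism g with source P. *)
definition iotas_map ::
  "'k::field base \<Rightarrow> 'k poly \<Rightarrow> ('k \<Rightarrow> int set) \<Rightarrow> 'k skew set \<Rightarrow> ('k skew \<Rightarrow> 'k skew) \<Rightarrow>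
   'k skew \<Rightarrow> 'k skew" where
  "iotas_map T f J P g = restrict g (iotas T f J P)"

definition h_elem :: "'k::field base \<Rightarrow> 'k poly \<Rightarrow> ('k \<Rightarrow> int set) \<Rightarrow> 'k ratfun" where
  "h_elem T f J = (\<Prod>\<alpha>\<in>roots f. \<Prod>j\<in>J \<alpha>. sigma T (-j) (root_factor f \<alpha>))"

definition tau ::
  "'k::field base \<Rightarrow> 'k poly \<Rightarrow> ('k \<Rightarrow> int set) \<Rightarrow> 'k skew \<Rightarrow> 'k skew" where
  "tau T f J = (\<lambda>q\<in>iotas T f J (iotas T f J (A_in_Q T f)).
     skew_monom (inverse (h_elem T f J)) 0 \<otimes>\<^bsub>Qgr T\<^esub> q)"


section \<open>The graded ring B\<close>

definition B_hom ::
  "'k::field base \<Rightarrow> 'k poly \<Rightarrow> ('k \<Rightarrow> int set) \<Rightarrow> ('k skew \<Rightarrow> 'k skew) set" where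
  "B_hom T f J = hom_Q T f (A_in_Q T f) (iotas T f J (A_in_Q T f))"

definition B_zero_hom :: "'k::field base \<Rightarrow> 'k poly \<Rightarrow> 'k skew \<Rightarrow> 'k skew" where
  "B_zero_hom T f = (\<lambda>q\<in>A_in_Q T f. \<zero>\<^bsub>Qgr T\<^esub>)"

(* The product of homogeneous elements a of degree I and b of degree J. *)
definition B_times ::
  "'k::field base \<Rightarrow> 'k poly \<Rightarrow> ('k \<Rightarrow> int set) \<Rightarrow> ('k \<Rightarrow> int set) \<Rightarrow>
   ('k skew \<Rightarrow> 'k skew) \<Rightarrow> ('k skew \<Rightarrow> 'k skew) \<Rightarrow> 'k skew \<Rightarrow> 'k skew" where
  "B_times T f I J a b = (let A = A_in_Q T f; N = Gamma_inter f I J in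
     compose A
       (iotas_map T f (I \<otimes>\<^bsub>Gamma f\<^esub> J) (iotas T f N (iotas T f N A)) (tau T f N))
       (compose A (iotas_map T f J A a) b))"

definition B_support ::
  "'k::field base \<Rightarrow> 'k poly \<Rightarrow> (('k \<Rightarrow> int set) \<Rightarrow> 'k skew \<Rightarrow> 'k skew) \<Rightarrow> ('k \<Rightarrow> int set) set" where
  "B_support T f b = {J \<in> carrier (Gamma f). b J \<noteq> B_zero_hom T f}"

definition B_carrier ::
  "'k::field base \<Rightarrow> 'k poly \<Rightarrow> (('k \<Rightarrow> int set) \<Rightarrow> 'k skew \<Rightarrow> 'k skew) set" where
  "B_carrier T f = {b \<in> (\<Pi>\<^sub>E J\<in>carrier (Gamma f). B_hom T f J). finite (B_support T f b)}"

type_synonym 'k B_elem = "('k \<Rightarrow> int set) \<Rightarrow> 'k skew \<Rightarrow> 'k skew"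

definition B_alg ::
  "'k::field base \<Rightarrow> 'k poly \<Rightarrow> ('k B_elem, 'k \<Rightarrow> int set, 'k) graded_algebra" where
  "B_alg T f = (let A = A_in_Q T f; \<Gamma> = Gamma f in \<lparr>
     carrier = B_carrier T f,
     monoid.mult = (\<lambda>a b. \<lambda>K\<in>carrier \<Gamma>. \<lambda>q\<in>A.
       finsum (Qgr T) (\<lambda>(I, J). B_times T f I J (a I) (b J) q)
         {(I, J) \<in> B_support T f a \<times> B_support T f b. I \<otimes>\<^bsub>\<Gamma>\<^esub> J = K}),
     one = (\<lambda>K\<in>carrier \<Gamma>. if K = \<one>\<^bsub>\<Gamma>\<^esub> then (\<lambda>q\<in>A. q) else B_zero_hom T f),
     zero = (\<lambda>K\<in>carrier \<Gamma>. B_zero_hom T f),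
     add = (\<lambda>a b. \<lambda>K\<in>carrier \<Gamma>. \<lambda>q\<in>A. a K q \<oplus>\<^bsub>Qgr T\<^esub> b K q),
     piece = (\<lambda>J. {b \<in> B_carrier T f. B_support T f b \<subseteq> {J}}),
     scalar = (\<lambda>c. \<lambda>K\<in>carrier \<Gamma>. if K = \<one>\<^bsub>\<Gamma>\<^esub>
       then (\<lambda>q\<in>A. q \<otimes>\<^bsub>Qgr T\<^esub> skew_monom (of_poly [:c:]) 0) else B_zero_hom T f)\<rparr>)"

end

theory Submission
  imports Defs "HOL-Algebra.Free_Abelian_Groups" "HOL-Computational_Algebra.Formal_Power_Series"
begin

text \<open>Inside the graded quotient ring, \<open>A\<close> and all \<open>\<iota>\<^sub>J A\<close> are described by one divisor per degree, a product of
  factors \<open>\<sigma>\<^sup>-\<^sup>j ((z - \<alpha>)\<^sup>n)\<close>, and \<open>\<iota>\<^sub>j\<close> switches a single factor on or off. Hence \<open>B\<^sub>J\<close> consists of the left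
  multiplications by elements of \<open>h\<^sub>J R\<close>, and the product of \<open>B\<close> is the ordinary one up to a cocycle. A graded
  algebra is a category whose objects are the degrees; for suitable degrees \<open>J(n)\<close> the shifts of \<open>A\<close> form the
  full subcategory of \<open>B\<close> on the \<open>J(n)\<close>, and since distinct factors are comaximal, every degree \<open>J\<close> is a
  summand of \<open>J(N) \<oplus> J(-N)\<close> for large \<open>N\<close>. Graded modules over \<open>B\<close> therefore restrict to graded modules over
  \<open>A\<close> and are recovered from them. A countable sum of copies of the subsets of an infinite module embeds in
  that module, which keeps both functors inside the given collection of underlying sets.\<close>

text \<open>The obstacle is \<open>iota\<close>: it is a definite description over all graded
  surjections onto either of two modules, so nothing in \<open>B\<close> can be evaluated before the
  target and the kernel are known to be unique. A surjection from a lattice amounts to one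
  coefficient per degree, and surjectivity makes these units modulo the relevant factor; hence the
  kernel does not see them. The degrees J(n) are chosen so that \<iota>_J(n) \<open>A\<close> is x^n
  \<open>A\<close> for n >= 0 and y^(-n) \<open>A\<close> for n < 0: they toggle, at every root, all
  indices between 0 and -n. Restricted to them the cocycle of \<open>B\<close> is a coboundary, and
  rescaling Hom sets by \<open>lam\<close> turns the product of \<open>B\<close> into that of
  \<open>A\<close>. J and J(N) differ, for large N, in indices disjoint from those in which J and
  J(-N) differ. Their factors are comaximal by the orbit hypothesis, and a Bezout identity becomes a
  decomposition of the identity of J. \<open>U\<close> is closed under subsets only, so objects
  cannot be given by a formula on carriers. They are fixed up to isomorphism by a relation, and
  morphisms correspond through it.\<close>

definition is_linear_category :: "('o, 'a, 'k) linear_category \<Rightarrow> bool" where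
  "is_linear_category C \<longleftrightarrow>
    (\<forall>P\<in>Obj C. Ident C P \<in> Hom C P P) \<and>
    (\<forall>P\<in>Obj C. \<forall>Q\<in>Obj C. \<forall>Z\<in>Obj C. \<forall>f\<in>Hom C P Q. \<forall>g\<in>Hom C Q Z. Comp C P Q Z g f \<in> Hom C P Z) \<and>
    (\<forall>P\<in>Obj C. \<forall>Q\<in>Obj C. \<forall>f\<in>Hom C P Q.
       Comp C P P Q f (Ident C P) = f \<and> Comp C P Q Q (Ident C Q) f = f) \<and>
    (\<forall>W\<in>Obj C. \<forall>P\<in>Obj C. \<forall>Q\<in>Obj C. \<forall>Z\<in>Obj C. \<forall>f\<in>Hom C W P. \<forall>g\<in>Hom C P Q. \<forall>h\<in>Hom C Q Z.
       Comp C W Q Z h (Comp C W P Q g f) = Comp C W P Z (Comp C P Q Z h g) f) \<and>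
    (\<forall>P\<in>Obj C. \<forall>Q\<in>Obj C. \<forall>f\<in>Hom C P Q. \<forall>g\<in>Hom C P Q. Hom_add C P Q f g \<in> Hom C P Q) \<and>
    (\<forall>P\<in>Obj C. \<forall>Q\<in>Obj C. \<forall>f\<in>Hom C P Q. \<forall>c. Hom_scale C P Q c f \<in> Hom C P Q) \<and>
    (\<forall>P\<in>Obj C. \<forall>Q\<in>Obj C. \<forall>Z\<in>Obj C. \<forall>f\<in>Hom C P Q. \<forall>f'\<in>Hom C P Q. \<forall>g\<in>Hom C Q Z.
       Comp C P Q Z g (Hom_add C P Q f f') = Hom_add C P Z (Comp C P Q Z g f) (Comp C P Q Z g f')) \<and>
    (\<forall>P\<in>Obj C. \<forall>Q\<in>Obj C. \<forall>Z\<in>Obj C. \<forall>f\<in>Hom C P Q. \<forall>g\<in>Hom C Q Z. \<forall>g'\<in>Hom C Q Z.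
       Comp C P Q Z (Hom_add C Q Z g g') f = Hom_add C P Z (Comp C P Q Z g f) (Comp C P Q Z g' f)) \<and>
    (\<forall>P\<in>Obj C. \<forall>Q\<in>Obj C. \<forall>Z\<in>Obj C. \<forall>f\<in>Hom C P Q. \<forall>g\<in>Hom C Q Z. \<forall>c.
       Comp C P Q Z g (Hom_scale C P Q c f) = Hom_scale C P Z c (Comp C P Q Z g f) \<and>
       Comp C P Q Z (Hom_scale C Q Z c g) f = Hom_scale C P Z c (Comp C P Q Z g f))"

text \<open>A value of the record \<open>linear_category\<close> need not satisfy any laws. Those
  consumed in building a quasi-inverse are assumed here and verified for graded modules in
  \<open>is_linear_category_GrMod\<close>.\<close>

locale lincat = fixes C :: "('o, 'a, 'k) linear_category" (structure)
  assumes lincat: "is_linear_category C"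
begin

lemma Ident_Hom [intro, simp]: "P \<in> Obj C \<Longrightarrow> Ident C P \<in> Hom C P P"
  using lincat unfolding is_linear_category_def by meson

lemma Comp_Hom [intro, simp]: "\<lbrakk>P \<in> Obj C; Q \<in> Obj C; Z \<in> Obj C; f \<in> Hom C P Q; g \<in> Hom C Q Z\<rbrakk>
    \<Longrightarrow> Comp C P Q Z g f \<in> Hom C P Z"
  using lincat unfolding is_linear_category_def by meson

lemma Comp_Ident: "\<lbrakk>P \<in> Obj C; Q \<in> Obj C; f \<in> Hom C P Q\<rbrakk>
    \<Longrightarrow> Comp C P P Q f (Ident C P) = f \<and> Comp C P Q Q (Ident C Q) f = f"
  using lincat unfolding is_linear_category_def by meson

lemma Comp_assoc: "\<lbrakk>W \<in> Obj C; P \<in> Obj C; Q \<in> Obj C; Z \<in> Obj C; f \<in> Hom C W P; g \<in> Hom C P Q;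
    h \<in> Hom C Q Z\<rbrakk> \<Longrightarrow> Comp C W Q Z h (Comp C W P Q g f) = Comp C W P Z (Comp C P Q Z h g) f"
  using lincat unfolding is_linear_category_def by meson

lemma Hom_add_Hom [intro, simp]: "\<lbrakk>P \<in> Obj C; Q \<in> Obj C; f \<in> Hom C P Q; g \<in> Hom C P Q\<rbrakk>
    \<Longrightarrow> Hom_add C P Q f g \<in> Hom C P Q"
  using lincat unfolding is_linear_category_def by meson

lemma Hom_scale_Hom [intro, simp]: "\<lbrakk>P \<in> Obj C; Q \<in> Obj C; f \<in> Hom C P Q\<rbrakk>
    \<Longrightarrow> Hom_scale C P Q c f \<in> Hom C P Q"
  using lincat unfolding is_linear_category_def by meson

lemma Comp_add_right: "\<lbrakk>P \<in> Obj C; Q \<in> Obj C; Z \<in> Obj C; f \<in> Hom C P Q; f' \<in> Hom C P Q; g \<in> Hom C Q Z\<rbrakk>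
    \<Longrightarrow> Comp C P Q Z g (Hom_add C P Q f f') = Hom_add C P Z (Comp C P Q Z g f) (Comp C P Q Z g f')"
  using lincat unfolding is_linear_category_def by meson

lemma Comp_add_left: "\<lbrakk>P \<in> Obj C; Q \<in> Obj C; Z \<in> Obj C; f \<in> Hom C P Q; g \<in> Hom C Q Z; g' \<in> Hom C Q Z\<rbrakk>
    \<Longrightarrow> Comp C P Q Z (Hom_add C Q Z g g') f = Hom_add C P Z (Comp C P Q Z g f) (Comp C P Q Z g' f)"
  using lincat unfolding is_linear_category_def by meson

lemma Comp_scale: "\<lbrakk>P \<in> Obj C; Q \<in> Obj C; Z \<in> Obj C; f \<in> Hom C P Q; g \<in> Hom C Q Z\<rbrakk>
    \<Longrightarrow> Comp C P Q Z g (Hom_scale C P Q c f) = Hom_scale C P Z c (Comp C P Q Z g f) \<and>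
       Comp C P Q Z (Hom_scale C Q Z c g) f = Hom_scale C P Z c (Comp C P Q Z g f)"
  using lincat unfolding is_linear_category_def by meson

lemma naturally_isomorphicI:
  assumes "\<And>P. P \<in> Obj B \<Longrightarrow> isomorphism C (F P) (G P) (\<eta> P)"
    and "\<And>P Q f. \<lbrakk>P \<in> Obj B; Q \<in> Obj B; f \<in> Hom B P Q\<rbrakk> \<Longrightarrow>
         Comp C (F P) (F Q) (G Q) (\<eta> Q) (\<phi> P Q f) = Comp C (F P) (G P) (G Q) (\<gamma> P Q f) (\<eta> P)"
  shows "naturally_isomorphic B C F \<phi> G \<gamma>"
  unfolding naturally_isomorphic_def using assms by blast

end

section \<open>Equivalences from fully faithful, essentially surjective linear functors\<close>

lemma equivalent_categories_sym:
  "equivalent_categories C D \<Longrightarrow> equivalent_categories D C"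
  unfolding equivalent_categories_def by blast

lemma linear_functorD:
  assumes "linear_functor C D F \<phi>" "P \<in> Obj C"
  shows "F P \<in> Obj D" "\<phi> P P (Ident C P) = Ident D (F P)"
    and "\<And>Q f. Q \<in> Obj C \<Longrightarrow> f \<in> Hom C P Q \<Longrightarrow> \<phi> P Q f \<in> Hom D (F P) (F Q)"
    and "\<And>Q Z f g. Q \<in> Obj C \<Longrightarrow> Z \<in> Obj C \<Longrightarrow> f \<in> Hom C P Q \<Longrightarrow> g \<in> Hom C Q Z \<Longrightarrow>
       \<phi> P Z (Comp C P Q Z g f) = Comp D (F P) (F Q) (F Z) (\<phi> Q Z g) (\<phi> P Q f)"
    and "\<And>Q f g. Q \<in> Obj C \<Longrightarrow> f \<in> Hom C P Q \<Longrightarrow> g \<in> Hom C P Q \<Longrightarrow>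
       \<phi> P Q (Hom_add C P Q f g) = Hom_add D (F P) (F Q) (\<phi> P Q f) (\<phi> P Q g)"
    and "\<And>Q f c. Q \<in> Obj C \<Longrightarrow> f \<in> Hom C P Q \<Longrightarrow>
       \<phi> P Q (Hom_scale C P Q c f) = Hom_scale D (F P) (F Q) c (\<phi> P Q f)"
  using assms unfolding linear_functor_def by meson+

text \<open>The quasi-inverse rests on choices: for each \<open>Q\<close> an object
  \<open>G Q\<close> and mutually inverse \<open>e Q\<close>, \<open>e' Q\<close> between
  \<open>F (G Q)\<close> and \<open>Q\<close>. A morphism of \<open>D\<close> is conjugated by them
  (\<open>\<kappa>\<close>) and lifted through the bijection on Hom sets (\<open>\<gamma>\<close>).
  Injectivity of \<open>\<phi>\<close> transfers every functor law from \<open>\<kappa>\<close> to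
  \<open>\<gamma>\<close>.\<close>

proposition equivalent_categoriesI:
  assumes C: "is_linear_category C" and D: "is_linear_category D"
    and F: "linear_functor C D F \<phi>"
    and ff: "\<And>P Q. \<lbrakk>P \<in> Obj C; Q \<in> Obj C\<rbrakk> \<Longrightarrow> bij_betw (\<phi> P Q) (Hom C P Q) (Hom D (F P) (F Q))"
    and es: "\<And>Q. Q \<in> Obj D \<Longrightarrow> \<exists>P\<in>Obj C. \<exists>e. isomorphism D (F P) Q e"
  shows "equivalent_categories C D"
proof -
  interpret C: lincat C by unfold_locales (rule C)
  interpret D: lincat D by unfold_locales (rule D)
  note FD = linear_functorD[OF F]
  define iso where "iso Q t \<longleftrightarrow> (case t of (P, e, e') \<Rightarrow> P \<in> Obj C \<and> e \<in> Hom D (F P) Q \<and> e' \<in> Hom D Q (F P) \<and>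
      Comp D (F P) Q (F P) e' e = Ident D (F P) \<and> Comp D Q (F P) Q e e' = Ident D Q)" for Q t
  have "\<exists>t. iso Q t" if "Q \<in> Obj D" for Q
  proof -
    obtain P e where "P \<in> Obj C" "isomorphism D (F P) Q e" using es[OF \<open>Q \<in> Obj D\<close>] by blast
    then obtain e' where "iso Q (P, e, e')" unfolding isomorphism_def iso_def by auto
    then show ?thesis ..
  qed
  then have t: "iso Q (SOME t. iso Q t)" if "Q \<in> Obj D" for Q
    using that by (rule_tac someI_ex)
  define G where "G Q = fst (SOME t. iso Q t)" for Q
  define e where "e Q = fst (snd (SOME t. iso Q t))" for Q
  define e' where "e' Q = snd (snd (SOME t. iso Q t))" for Q
  have Ge: "G Q \<in> Obj C \<and> e Q \<in> Hom D (F (G Q)) Q \<and> e' Q \<in> Hom D Q (F (G Q)) \<and>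
      Comp D (F (G Q)) Q (F (G Q)) (e' Q) (e Q) = Ident D (F (G Q)) \<and>
      Comp D Q (F (G Q)) Q (e Q) (e' Q) = Ident D Q" if "Q \<in> Obj D" for Q
    using t[OF that] by (simp add: iso_def case_prod_beta G_def e_def e'_def)
  then have G: "\<And>Q. Q \<in> Obj D \<Longrightarrow> G Q \<in> Obj C"
    and e: "\<And>Q. Q \<in> Obj D \<Longrightarrow> e Q \<in> Hom D (F (G Q)) Q"
    and e': "\<And>Q. Q \<in> Obj D \<Longrightarrow> e' Q \<in> Hom D Q (F (G Q))"
    and e'e: "\<And>Q. Q \<in> Obj D \<Longrightarrow> Comp D (F (G Q)) Q (F (G Q)) (e' Q) (e Q) = Ident D (F (G Q))"
    and ee': "\<And>Q. Q \<in> Obj D \<Longrightarrow> Comp D Q (F (G Q)) Q (e Q) (e' Q) = Ident D Q"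
    by blast+
  note [simp] = G e e' FD(1)
  define \<psi> where "\<psi> P Q = inv_into (Hom C P Q) (\<phi> P Q)" for P Q
  have \<psi>: "\<psi> P Q h \<in> Hom C P Q" "\<phi> P Q (\<psi> P Q h) = h"
    if "P \<in> Obj C" "Q \<in> Obj C" "h \<in> Hom D (F P) (F Q)" for P Q h
    using ff[OF that(1,2)] that(3) unfolding \<psi>_def bij_betw_def
    by (auto intro: inv_into_into f_inv_into_f)
  have inj: "f = g" if "P \<in> Obj C" "Q \<in> Obj C" "f \<in> Hom C P Q" "g \<in> Hom C P Q" "\<phi> P Q f = \<phi> P Q g"
    for P Q f g
    using ff[OF that(1,2)] that(3-5) unfolding bij_betw_def inj_on_def by blast
  define \<kappa> where "\<kappa> Q Q' f = Comp D (F (G Q)) Q (F (G Q')) (Comp D Q Q' (F (G Q')) (e' Q') f) (e Q)"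
    for Q Q' f
  define \<gamma> where "\<gamma> Q Q' f = \<psi> (G Q) (G Q') (\<kappa> Q Q' f)" for Q Q' f
  have \<kappa>: "\<kappa> Q Q' f \<in> Hom D (F (G Q)) (F (G Q'))" if "Q \<in> Obj D" "Q' \<in> Obj D" "f \<in> Hom D Q Q'" for Q Q' f
    unfolding \<kappa>_def using that by (meson D.Comp_Hom G e e' FD(1))
  have \<gamma>: "\<gamma> Q Q' f \<in> Hom C (G Q) (G Q')" "\<phi> (G Q) (G Q') (\<gamma> Q Q' f) = \<kappa> Q Q' f"
    if "Q \<in> Obj D" "Q' \<in> Obj D" "f \<in> Hom D Q Q'" for Q Q' f
    unfolding \<gamma>_def using \<psi>[OF _ _ \<kappa>] that by auto
  have e\<kappa>: "Comp D (F (G Q)) (F (G Q')) Q' (e Q') (\<kappa> Q Q' f) = Comp D (F (G Q)) Q Q' f (e Q)"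
    if [simp]: "Q \<in> Obj D" "Q' \<in> Obj D" "f \<in> Hom D Q Q'" for Q Q' f
  proof -
    have "Comp D (F (G Q)) (F (G Q')) Q' (e Q') (\<kappa> Q Q' f)
        = Comp D (F (G Q)) Q Q' (Comp D Q (F (G Q')) Q' (e Q') (Comp D Q Q' (F (G Q')) (e' Q') f)) (e Q)"
      unfolding \<kappa>_def by (rule D.Comp_assoc) auto
    also have "Comp D Q (F (G Q')) Q' (e Q') (Comp D Q Q' (F (G Q')) (e' Q') f)
        = Comp D Q Q' Q' (Comp D Q' (F (G Q')) Q' (e Q') (e' Q')) f"
      by (rule D.Comp_assoc) auto
    also have "\<dots> = f" using D.Comp_Ident[of Q Q' f] by (simp add: ee')
    finally show ?thesis .
  qed
  \<comment> \<open>Since \<open>e' Q\<close> is a left inverse, \<open>e Q\<close> is a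
    monomorphism: laws for \<open>\<kappa>\<close> may be tested after composing with
    \<open>e\<close>, where \<open>e\<kappa>\<close> slides \<open>e\<close> past
    \<open>\<kappa>\<close>.\<close>
  have cancel: "h = h'" if [simp]: "P \<in> Obj D" "Q \<in> Obj D" "h \<in> Hom D P (F (G Q))" "h' \<in> Hom D P (F (G Q))"
    and eq: "Comp D P (F (G Q)) Q (e Q) h = Comp D P (F (G Q)) Q (e Q) h'" for P Q h h'
  proof -
    have *: "Comp D P Q (F (G Q)) (e' Q) (Comp D P (F (G Q)) Q (e Q) h) = h"
      if [simp]: "h \<in> Hom D P (F (G Q))" for h
    proof -
      have "Comp D P Q (F (G Q)) (e' Q) (Comp D P (F (G Q)) Q (e Q) h)
        = Comp D P (F (G Q)) (F (G Q)) (Comp D (F (G Q)) Q (F (G Q)) (e' Q) (e Q)) h"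
        by (rule D.Comp_assoc) auto
      also have "\<dots> = h" using D.Comp_Ident[of P "F (G Q)" h] by (simp add: e'e)
      finally show ?thesis .
    qed
    show ?thesis using *[OF that(3)] *[OF that(4)] unfolding eq by (rule box_equals[OF refl])
  qed
  have \<kappa>_Ident: "\<kappa> Q Q (Ident D Q) = Ident D (F (G Q))" if [simp]: "Q \<in> Obj D" for Q
    using cancel[of "F (G Q)" Q "\<kappa> Q Q (Ident D Q)" "Ident D (F (G Q))"] \<kappa>[of Q Q "Ident D Q"]
      e\<kappa>[of Q Q "Ident D Q"] D.Comp_Ident[of "F (G Q)" Q "e Q"] by simp
  have \<kappa>_Comp: "\<kappa> P Z (Comp D P Q Z g f) = Comp D (F (G P)) (F (G Q)) (F (G Z)) (\<kappa> Q Z g) (\<kappa> P Q f)"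
    if [simp]: "P \<in> Obj D" "Q \<in> Obj D" "Z \<in> Obj D" "f \<in> Hom D P Q" "g \<in> Hom D Q Z" for P Q Z f g
  proof (rule cancel[of "F (G P)" Z])
    note [simp] = \<kappa>
    show "\<kappa> P Z (Comp D P Q Z g f) \<in> Hom D (F (G P)) (F (G Z))"
      by (meson that \<kappa> D.Comp_Hom)
    show "Comp D (F (G P)) (F (G Q)) (F (G Z)) (\<kappa> Q Z g) (\<kappa> P Q f) \<in> Hom D (F (G P)) (F (G Z))"
      by (rule D.Comp_Hom) auto
    have "Comp D (F (G P)) (F (G Z)) Z (e Z) (\<kappa> P Z (Comp D P Q Z g f))
        = Comp D (F (G P)) P Z (Comp D P Q Z g f) (e P)"
      by (rule e\<kappa>) auto
    also have "\<dots> = Comp D (F (G P)) Q Z g (Comp D (F (G P)) P Q f (e P))"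
      by (rule D.Comp_assoc[symmetric]) auto
    also have "\<dots> = Comp D (F (G P)) Q Z g (Comp D (F (G P)) (F (G Q)) Q (e Q) (\<kappa> P Q f))"
      by (simp add: e\<kappa>)
    also have "\<dots> = Comp D (F (G P)) (F (G Q)) Z (Comp D (F (G Q)) Q Z g (e Q)) (\<kappa> P Q f)"
      by (rule D.Comp_assoc) auto
    also have "\<dots> = Comp D (F (G P)) (F (G Q)) Z (Comp D (F (G Q)) (F (G Z)) Z (e Z) (\<kappa> Q Z g)) (\<kappa> P Q f)"
      by (simp add: e\<kappa>)
    also have "\<dots> = Comp D (F (G P)) (F (G Z)) Z (e Z) (Comp D (F (G P)) (F (G Q)) (F (G Z)) (\<kappa> Q Z g) (\<kappa> P Q f))"
      by (rule D.Comp_assoc[symmetric]) auto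
    finally show "Comp D (F (G P)) (F (G Z)) Z (e Z) (\<kappa> P Z (Comp D P Q Z g f)) = \<dots>" .
  qed auto
  have \<kappa>_add: "\<kappa> P Q (Hom_add D P Q f g) = Hom_add D (F (G P)) (F (G Q)) (\<kappa> P Q f) (\<kappa> P Q g)"
    if [simp]: "P \<in> Obj D" "Q \<in> Obj D" "f \<in> Hom D P Q" "g \<in> Hom D P Q" for P Q f g
    unfolding \<kappa>_def
    by (subst D.Comp_add_right, simp_all, subst D.Comp_add_left) (auto intro!: D.Comp_Hom)
  have \<kappa>_scale: "\<kappa> P Q (Hom_scale D P Q c f) = Hom_scale D (F (G P)) (F (G Q)) c (\<kappa> P Q f)"
    if [simp]: "P \<in> Obj D" "Q \<in> Obj D" "f \<in> Hom D P Q" for P Q f c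
  proof -
    have 1: "Comp D P Q (F (G Q)) (e' Q) (Hom_scale D P Q c f) = Hom_scale D P (F (G Q)) c (Comp D P Q (F (G Q)) (e' Q) f)"
      using D.Comp_scale[of P Q "F (G Q)" f "e' Q" c] by simp
    show ?thesis unfolding \<kappa>_def 1
      using D.Comp_scale[of "F (G P)" P "F (G Q)" "e P" "Comp D P Q (F (G Q)) (e' Q) f" c]
        D.Comp_Hom[of P Q "F (G Q)" f "e' Q"] by simp
  qed
  have Gfun: "linear_functor D C G \<gamma>"
    unfolding linear_functor_def
  proof (intro conjI ballI allI)
    fix P assume [simp]: "P \<in> Obj D"
    show "G P \<in> Obj C" by simp
    show "\<gamma> P P (Ident D P) = Ident C (G P)"
      using \<gamma>[of P P "Ident D P"] FD(2)[of "G P"] by (intro inj[of "G P" "G P"]) (auto simp: \<kappa>_Ident)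
  next
    fix P Q f assume [simp]: "P \<in> Obj D" "Q \<in> Obj D" "f \<in> Hom D P Q"
    show "\<gamma> P Q f \<in> Hom C (G P) (G Q)" by (rule \<gamma>) auto
    show "\<gamma> P Q (Hom_scale D P Q c f) = Hom_scale C (G P) (G Q) c (\<gamma> P Q f)" for c
      using \<gamma>[of P Q "Hom_scale D P Q c f"] \<gamma>[of P Q f] FD(6)[of "G P" "G Q" "\<gamma> P Q f" c]
      by (intro inj[of "G P" "G Q"]) (auto simp: \<kappa>_scale)
    fix g assume [simp]: "g \<in> Hom D P Q"
    show "\<gamma> P Q (Hom_add D P Q f g) = Hom_add C (G P) (G Q) (\<gamma> P Q f) (\<gamma> P Q g)"
      using \<gamma>[of P Q "Hom_add D P Q f g"] \<gamma>[of P Q f] \<gamma>[of P Q g] FD(5)[of "G P" "G Q" "\<gamma> P Q f" "\<gamma> P Q g"]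
      by (intro inj[of "G P" "G Q"]) (auto simp: \<kappa>_add)
  next
    fix P Q Z f g assume [simp]: "P \<in> Obj D" "Q \<in> Obj D" "Z \<in> Obj D" "f \<in> Hom D P Q" "g \<in> Hom D Q Z"
    have [simp]: "Comp D P Q Z g f \<in> Hom D P Z" by (rule D.Comp_Hom) auto
    have [simp]: "Comp C (G P) (G Q) (G Z) (\<gamma> Q Z g) (\<gamma> P Q f) \<in> Hom C (G P) (G Z)"
      by (rule C.Comp_Hom) (auto intro: \<gamma>)
    show "\<gamma> P Z (Comp D P Q Z g f) = Comp C (G P) (G Q) (G Z) (\<gamma> Q Z g) (\<gamma> P Q f)"
      using \<gamma>[of P Z "Comp D P Q Z g f"] \<gamma>[of P Q f] \<gamma>[of Q Z g]
        FD(4)[of "G P" "G Q" "G Z" "\<gamma> P Q f" "\<gamma> Q Z g"]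
      by (intro inj[of "G P" "G Z"]) (auto simp: \<kappa>_Comp)
  qed
  have natC: "naturally_isomorphic C C (\<lambda>P. G (F P)) (\<lambda>P Q f. \<gamma> (F P) (F Q) (\<phi> P Q f)) (\<lambda>P. P) (\<lambda>P Q f. f)"
  \<comment> \<open>The chosen isomorphism for the object \<open>F P\<close> is a morphism between
    images of \<open>F\<close>, so its preimage under \<open>\<phi>\<close> can serve as the
    component at \<open>P\<close>.\<close>
  proof (rule C.naturally_isomorphicI[where \<eta> = "\<lambda>P. \<psi> (G (F P)) P (e (F P))"])
    fix P assume [simp]: "P \<in> Obj C"
    note 1 = \<psi>[of "G (F P)" P "e (F P)"] and 2 = \<psi>[of P "G (F P)" "e' (F P)"]
    show "isomorphism C (G (F P)) P (\<psi> (G (F P)) P (e (F P)))"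
      unfolding isomorphism_def
    proof (intro conjI bexI[where x = "\<psi> P (G (F P)) (e' (F P))"])
      show "Comp C (G (F P)) P (G (F P)) (\<psi> P (G (F P)) (e' (F P))) (\<psi> (G (F P)) P (e (F P))) = Ident C (G (F P))"
        using 1 2 by (intro inj[of "G (F P)" "G (F P)"])
          (auto intro: C.Comp_Hom simp: FD(4)[of "G (F P)" P "G (F P)"] e'e FD(2))
      show "Comp C P (G (F P)) P (\<psi> (G (F P)) P (e (F P))) (\<psi> P (G (F P)) (e' (F P))) = Ident C P"
        using 1 2 by (intro inj[of P P])
          (auto intro: C.Comp_Hom simp: FD(4)[of P "G (F P)" P] ee' FD(2))
    qed (use 1 2 in auto)
  next
    fix P Q f assume [simp]: "P \<in> Obj C" "Q \<in> Obj C" "f \<in> Hom C P Q"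
    note 1 = \<psi>[of "G (F P)" P "e (F P)"] and 2 = \<psi>[of "G (F Q)" Q "e (F Q)"]
    have [simp]: "\<phi> P Q f \<in> Hom D (F P) (F Q)" by (rule FD) auto
    note 3 = \<gamma>[of "F P" "F Q" "\<phi> P Q f"]
    show "Comp C (G (F P)) (G (F Q)) Q (\<psi> (G (F Q)) Q (e (F Q))) (\<gamma> (F P) (F Q) (\<phi> P Q f)) =
          Comp C (G (F P)) P Q f (\<psi> (G (F P)) P (e (F P)))"
      using 1 2 3 by (intro inj[of "G (F P)" Q])
        (auto intro: C.Comp_Hom simp: FD(4)[of "G (F P)" "G (F Q)" Q] FD(4)[of "G (F P)" P Q] e\<kappa>)
  qed
  have natD: "naturally_isomorphic D D (\<lambda>P. F (G P)) (\<lambda>P Q f. \<phi> (G P) (G Q) (\<gamma> P Q f)) (\<lambda>P. P) (\<lambda>P Q f. f)"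
  proof (rule D.naturally_isomorphicI[where \<eta> = e])
    fix P assume "P \<in> Obj D"
    then show "isomorphism D (F (G P)) P (e P)"
      unfolding isomorphism_def using e e' e'e ee' by blast
  next
    fix P Q f assume "P \<in> Obj D" "Q \<in> Obj D" "f \<in> Hom D P Q"
    then show "Comp D (F (G P)) (F (G Q)) Q (e Q) (\<phi> (G P) (G Q) (\<gamma> P Q f)) = Comp D (F (G P)) P Q f (e P)"
      by (simp add: \<gamma> e\<kappa>)
  qed
  show ?thesis unfolding equivalent_categories_def using F Gfun natC natD by blast
qed

section \<open>Additive maps and finite sums\<close>

lemma additive_zero:
  assumes "abelian_group M" "abelian_group N" "h \<in> carrier M \<rightarrow> carrier N"
    and "\<And>x y. x \<in> carrier M \<Longrightarrow> y \<in> carrier M \<Longrightarrow> h (x \<oplus>\<^bsub>M\<^esub> y) = h x \<oplus>\<^bsub>N\<^esub> h y"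
  shows "h \<zero>\<^bsub>M\<^esub> = \<zero>\<^bsub>N\<^esub>"
proof -
  interpret M: abelian_group M by fact
  interpret N: abelian_group N by fact
  have "h \<zero>\<^bsub>M\<^esub> \<oplus>\<^bsub>N\<^esub> h \<zero>\<^bsub>M\<^esub> = h \<zero>\<^bsub>M\<^esub> \<oplus>\<^bsub>N\<^esub> \<zero>\<^bsub>N\<^esub>"
    using assms(4)[of "\<zero>\<^bsub>M\<^esub>" "\<zero>\<^bsub>M\<^esub>"] assms(3) by (auto simp: Pi_iff)
  then show ?thesis using assms(3) by (auto simp: Pi_iff)
qed

lemma additive_uminus:
  assumes "abelian_group M" "abelian_group N" "h \<in> carrier M \<rightarrow> carrier N"
    and "\<And>x y. x \<in> carrier M \<Longrightarrow> y \<in> carrier M \<Longrightarrow> h (x \<oplus>\<^bsub>M\<^esub> y) = h x \<oplus>\<^bsub>N\<^esub> h y"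
    and "x \<in> carrier M"
  shows "h (\<ominus>\<^bsub>M\<^esub> x) = \<ominus>\<^bsub>N\<^esub> h x"
proof -
  interpret M: abelian_group M by fact
  interpret N: abelian_group N by fact
  have "h (\<ominus>\<^bsub>M\<^esub> x) \<oplus>\<^bsub>N\<^esub> h x = \<zero>\<^bsub>N\<^esub>"
    using assms(4)[of "\<ominus>\<^bsub>M\<^esub> x" x] assms(5) additive_zero[OF assms(1-4)] by (simp add: M.l_neg)
  then show ?thesis using assms(3,5) by (metis N.minus_equality Pi_mem M.a_inv_closed)
qed

lemma finsum_additive:
  assumes "abelian_group M" "abelian_group N" "h \<in> carrier M \<rightarrow> carrier N"
    and "\<And>x y. x \<in> carrier M \<Longrightarrow> y \<in> carrier M \<Longrightarrow> h (x \<oplus>\<^bsub>M\<^esub> y) = h x \<oplus>\<^bsub>N\<^esub> h y"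
    and "finite S" "f \<in> S \<rightarrow> carrier M"
  shows "h (finsum M f S) = finsum N (\<lambda>i. h (f i)) S"
proof -
  interpret M: abelian_group M by fact
  interpret N: abelian_group N by fact
  show ?thesis using assms(5,6)
  proof (induction S rule: finite_induct)
    case empty
    show ?case using additive_zero[OF assms(1-4)] by simp
  next
    case (insert x S)
    then have "h (finsum M f (insert x S)) = h (f x) \<oplus>\<^bsub>N\<^esub> h (finsum M f S)"
      by (subst M.finsum_insert) (auto simp: assms(4))
    also have "\<dots> = finsum N (\<lambda>i. h (f i)) (insert x S)"
      using insert assms(3) by (subst N.finsum_insert) auto
    finally show ?case .
  qed
qed

lemma (in abelian_monoid) finsum_superset:
  assumes "finite T" "S \<subseteq> T" "f \<in> T \<rightarrow> carrier G" "\<And>i. i \<in> T - S \<Longrightarrow> f i = \<zero>"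
  shows "finsum G f S = finsum G f T"
  using assms by (intro add.finprod_mono_neutral_cong_left) auto

lemma (in abelian_monoid) finsum_delta:
  assumes "finite S" "j \<in> S" "x \<in> carrier G"
  shows "finsum G (\<lambda>i. if i = j then x else \<zero>) S = x"
  using add.finprod_singleton[OF assms(2,1), of "\<lambda>_. x"] assms(3) 
  by (simp add: eq_commute[of _ j])

section \<open>Graded groups\<close>

definition component :: "('i, 'g) monoid_scheme \<Rightarrow> ('m, 'i, 'b) graded_scheme \<Rightarrow> 'm \<Rightarrow> 'i \<Rightarrow> 'm" where
  "component G M m = (THE c. c \<in> (\<Pi>\<^sub>E i\<in>carrier G. piece M i) \<and>
       finite {i \<in> carrier G. c i \<noteq> \<zero>\<^bsub>M\<^esub>} \<and> m = finsum M c {i \<in> carrier G. c i \<noteq> \<zero>\<^bsub>M\<^esub>})"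

abbreviation csupp :: "('i, 'g) monoid_scheme \<Rightarrow> ('m, 'i, 'b) graded_scheme \<Rightarrow> 'm \<Rightarrow> 'i set" where
  "csupp G M m \<equiv> {i \<in> carrier G. component G M m i \<noteq> \<zero>\<^bsub>M\<^esub>}"

locale graded_grp = abelian_group M for G :: "('i, 'g) monoid_scheme" and M :: "('m, 'i, 'b) graded_scheme" (structure) +
  assumes graded: "graded_group G M"
begin

lemma piece_subgroup: "i \<in> carrier G \<Longrightarrow> additive_subgroup (piece M i) M"
  using graded unfolding graded_group_def by blast

lemma piece_carrier [simp]: "i \<in> carrier G \<Longrightarrow> m \<in> piece M i \<Longrightarrow> m \<in> carrier M"
  using additive_subgroup.a_Hcarr[OF piece_subgroup] .

lemma piece_add [simp, intro]: "i \<in> carrier G \<Longrightarrow> m \<in> piece M i \<Longrightarrow> n \<in> piece M i \<Longrightarrow> m \<oplus> n \<in> piece M i"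
  using additive_subgroup.a_closed[OF piece_subgroup] .

lemma piece_zero [simp, intro]: "i \<in> carrier G \<Longrightarrow> \<zero> \<in> piece M i"
  using additive_subgroup.zero_closed[OF piece_subgroup] .

lemma piece_uminus [simp, intro]: "i \<in> carrier G \<Longrightarrow> m \<in> piece M i \<Longrightarrow> \<ominus> m \<in> piece M i"
  using additive_subgroup.a_inv_closed[OF piece_subgroup] .

lemma component_props:
  assumes "m \<in> carrier M"
  shows "component G M m \<in> (\<Pi>\<^sub>E i\<in>carrier G. piece M i)" "finite (csupp G M m)"
    "m = finsum M (component G M m) (csupp G M m)"
proof -
  have "\<exists>!c. c \<in> (\<Pi>\<^sub>E i\<in>carrier G. piece M i) \<and>
       finite {i \<in> carrier G. c i \<noteq> \<zero>} \<and> m = finsum M c {i \<in> carrier G. c i \<noteq> \<zero>}"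
    using graded assms unfolding graded_group_def by blast
  from theI'[OF this] show "component G M m \<in> (\<Pi>\<^sub>E i\<in>carrier G. piece M i)" "finite (csupp G M m)"
    "m = finsum M (component G M m) (csupp G M m)"
    unfolding component_def[symmetric] by auto
qed

lemma component_piece [simp, intro]: "m \<in> carrier M \<Longrightarrow> i \<in> carrier G \<Longrightarrow> component G M m i \<in> piece M i"
  using component_props(1) by (auto simp: PiE_iff)

lemma component_carrier [simp, intro]: "m \<in> carrier M \<Longrightarrow> i \<in> carrier G \<Longrightarrow> component G M m i \<in> carrier M"
  by (meson component_piece piece_carrier)

lemma component_sum:
  assumes "m \<in> carrier M" "finite S" "S \<subseteq> carrier G" "csupp G M m \<subseteq> S"
  shows "m = finsum M (component G M m) S"
proof -
  have "finsum M (component G M m) (csupp G M m) = finsum M (component G M m) S"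
    using assms by (intro finsum_superset) auto
  then show ?thesis using component_props(3)[OF assms(1)] by simp
qed

lemma component_unique:
  assumes "m \<in> carrier M" "finite S" "S \<subseteq> carrier G" "\<And>i. i \<in> S \<Longrightarrow> c i \<in> piece M i"
    and m: "m = finsum M c S" and i: "i \<in> carrier G"
  shows "component G M m i = (if i \<in> S then c i else \<zero>)"
proof -
  define d where "d = (\<lambda>i\<in>carrier G. if i \<in> S then c i else \<zero>)"
  have 1: "{i \<in> carrier G. d i \<noteq> \<zero>} \<subseteq> S" unfolding d_def by auto
  have "finsum M d {i \<in> carrier G. d i \<noteq> \<zero>} = finsum M d S"
    using assms 1 by (intro finsum_superset) (auto simp: d_def)
  also have "\<dots> = finsum M c S"
    using assms by (intro finsum_cong) (auto simp: d_def simp_implies_def)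
  finally have 2: "m = finsum M d {i \<in> carrier G. d i \<noteq> \<zero>}" using m by simp
  have 3: "d \<in> (\<Pi>\<^sub>E i\<in>carrier G. piece M i)" using assms by (auto simp: d_def)
  have 4: "finite {i \<in> carrier G. d i \<noteq> \<zero>}" using 1 assms(2) finite_subset by blast
  have ex1: "\<exists>!c. c \<in> (\<Pi>\<^sub>E i\<in>carrier G. piece M i) \<and>
       finite {i \<in> carrier G. c i \<noteq> \<zero>} \<and> m = finsum M c {i \<in> carrier G. c i \<noteq> \<zero>}"
    using graded assms(1) unfolding graded_group_def by blast
  have "component G M m = d"
    unfolding component_def by (rule the1_equality[OF ex1]) (use 2 3 4 in blast)
  then show ?thesis using i by (simp add: d_def)
qed

lemma component_homog [simp]:
  assumes "i \<in> carrier G" "j \<in> carrier G" "m \<in> piece M i"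
  shows "component G M m j = (if j = i then m else \<zero>)"
  using component_unique[of m "{i}" "\<lambda>_. m" j] assms by auto

lemma component_add [simp]:
  assumes "m \<in> carrier M" "n \<in> carrier M" "i \<in> carrier G"
  shows "component G M (m \<oplus> n) i = component G M m i \<oplus> component G M n i"
proof -
  let ?S = "csupp G M m \<union> csupp G M n"
  have fin: "finite ?S" using component_props(2) assms by auto
  have "m \<oplus> n = finsum M (component G M m) ?S \<oplus> finsum M (component G M n) ?S"
    using component_sum[of m ?S] component_sum[of n ?S] assms fin by auto
  also have "\<dots> = finsum M (\<lambda>i. component G M m i \<oplus> component G M n i) ?S"
    using assms by (intro finsum_addf[symmetric]) auto
  finally have *: "m \<oplus> n = \<dots>" .
  have "component G M (m \<oplus> n) i = (if i \<in> ?S then component G M m i \<oplus> component G M n i else \<zero>)"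
    by (rule component_unique[OF _ fin _ _ * assms(3)]) (use assms in \<open>auto intro!: piece_add\<close>)
  also have "\<dots> = component G M m i \<oplus> component G M n i" using assms by simp
  finally show ?thesis .
qed

lemma component_zero [simp]: "i \<in> carrier G \<Longrightarrow> component G M \<zero> i = \<zero>"
  using component_homog[of i i \<zero>] by simp

text \<open>The empty sum has to count as a homogeneous element; \<open>one\<close> supplies a
  degree in which to place it.\<close>

lemma graded_induct [consumes 1, case_names homog add]:
  assumes "m \<in> carrier M"
    and homog: "\<And>i m. i \<in> carrier G \<Longrightarrow> m \<in> piece M i \<Longrightarrow> P m"
    and add: "\<And>m n. m \<in> carrier M \<Longrightarrow> n \<in> carrier M \<Longrightarrow> P m \<Longrightarrow> P n \<Longrightarrow> P (m \<oplus> n)"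
    and one: "carrier G \<noteq> {}"
  shows "P m"
proof -
  obtain i0 where i0: "i0 \<in> carrier G" using one by blast
  have "P (finsum M (component G M m) S)" if "finite S" "S \<subseteq> carrier G" for S
    using that
  proof (induction S rule: finite_induct)
    case empty
    then show ?case using homog[OF i0, of \<zero>] i0 by simp
  next
    case (insert i S)
    then show ?case using assms(1) homog[of i "component G M m i"]
      by (subst finsum_insert) (auto intro!: add finsum_closed)
  qed
  then show ?thesis using component_props[OF assms(1)] by (metis (no_types, lifting) mem_Collect_eq subsetI)
qed

end

lemma graded_grpI: "graded_group G M \<Longrightarrow> graded_grp G M"
  by (simp add: graded_grp_def graded_grp_axioms_def graded_group_def)

text \<open>A family of additive projections onto the pieces forces uniqueness of decompositions:
  applying \<open>\<pi> i\<close> to any decomposition \<open>c\<close> kills all terms except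
  \<open>c i\<close>.\<close>

lemma graded_groupI:
  assumes "abelian_group M" and sub: "\<And>i. i \<in> carrier G \<Longrightarrow> additive_subgroup (piece M i) M"
    and \<pi>: "\<And>i m. i \<in> carrier G \<Longrightarrow> m \<in> carrier M \<Longrightarrow> \<pi> i m \<in> piece M i"
    and \<pi>_add: "\<And>i m n. i \<in> carrier G \<Longrightarrow> m \<in> carrier M \<Longrightarrow> n \<in> carrier M \<Longrightarrow> \<pi> i (m \<oplus>\<^bsub>M\<^esub> n) = \<pi> i m \<oplus>\<^bsub>M\<^esub> \<pi> i n"
    and fin: "\<And>m. m \<in> carrier M \<Longrightarrow> finite {i \<in> carrier G. \<pi> i m \<noteq> \<zero>\<^bsub>M\<^esub>}"
    and sum: "\<And>m. m \<in> carrier M \<Longrightarrow> m = finsum M (\<lambda>i. \<pi> i m) {i \<in> carrier G. \<pi> i m \<noteq> \<zero>\<^bsub>M\<^esub>}"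
    and \<pi>_homog: "\<And>i j m. i \<in> carrier G \<Longrightarrow> j \<in> carrier G \<Longrightarrow> m \<in> piece M j \<Longrightarrow> \<pi> i m = (if i = j then m else \<zero>\<^bsub>M\<^esub>)"
  shows "graded_group G M"
  unfolding graded_group_def
proof (intro conjI ballI)
  interpret abelian_group M by fact
  fix m assume m: "m \<in> carrier M"
  have pc: "x \<in> carrier M" if "i \<in> carrier G" "x \<in> piece M i" for i x
    using additive_subgroup.a_Hcarr[OF sub] that by blast
  show "\<exists>!c. c \<in> (\<Pi>\<^sub>E i\<in>carrier G. piece M i) \<and>
       finite {i \<in> carrier G. c i \<noteq> \<zero>\<^bsub>M\<^esub>} \<and> m = finsum M c {i \<in> carrier G. c i \<noteq> \<zero>\<^bsub>M\<^esub>}"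
  proof (rule ex1I[where a = "\<lambda>i\<in>carrier G. \<pi> i m"])
    have *: "{i \<in> carrier G. (\<lambda>i\<in>carrier G. \<pi> i m) i \<noteq> \<zero>\<^bsub>M\<^esub>} = {i \<in> carrier G. \<pi> i m \<noteq> \<zero>\<^bsub>M\<^esub>}" by auto
    have "finsum M (\<lambda>i\<in>carrier G. \<pi> i m) {i \<in> carrier G. \<pi> i m \<noteq> \<zero>\<^bsub>M\<^esub>} = finsum M (\<lambda>i. \<pi> i m) {i \<in> carrier G. \<pi> i m \<noteq> \<zero>\<^bsub>M\<^esub>}"
      using \<pi> pc m by (intro finsum_cong) (auto simp: simp_implies_def)
    then show "(\<lambda>i\<in>carrier G. \<pi> i m) \<in> (\<Pi>\<^sub>E i\<in>carrier G. piece M i) \<and>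
       finite {i \<in> carrier G. (\<lambda>i\<in>carrier G. \<pi> i m) i \<noteq> \<zero>\<^bsub>M\<^esub>} \<and>
       m = finsum M (\<lambda>i\<in>carrier G. \<pi> i m) {i \<in> carrier G. (\<lambda>i\<in>carrier G. \<pi> i m) i \<noteq> \<zero>\<^bsub>M\<^esub>}"
      unfolding * using \<pi> fin sum m by auto
  next
    fix c assume c: "c \<in> (\<Pi>\<^sub>E i\<in>carrier G. piece M i) \<and>
       finite {i \<in> carrier G. c i \<noteq> \<zero>\<^bsub>M\<^esub>} \<and> m = finsum M c {i \<in> carrier G. c i \<noteq> \<zero>\<^bsub>M\<^esub>}"
    let ?S = "{i \<in> carrier G. c i \<noteq> \<zero>\<^bsub>M\<^esub>}"
    have cp: "c i \<in> piece M i" if "i \<in> carrier G" for i using c that by auto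
    have cc [simp]: "c i \<in> carrier M" if "i \<in> carrier G" for i using pc cp that by blast
    have "c i = \<pi> i m" if i: "i \<in> carrier G" for i
    proof -
      have "\<pi> i m = \<pi> i (finsum M c ?S)" using c by simp
      also have "\<dots> = finsum M (\<lambda>j. \<pi> i (c j)) ?S"
        by (rule finsum_additive) (use c i pc[OF i \<pi>[OF i]] \<pi>_add abelian_group_axioms in auto)
      also have "\<dots> = finsum M (\<lambda>j. if j = i then c i else \<zero>\<^bsub>M\<^esub>) ?S"
        using i by (intro finsum_cong) (auto simp: \<pi>_homog[OF i _ cp] simp_implies_def)
      also have "\<dots> = finsum M (\<lambda>j. if j = i then c i else \<zero>\<^bsub>M\<^esub>) (insert i ?S)"
        by (rule finsum_superset) (use c i in auto)
      also have "\<dots> = c i" by (rule finsum_delta) (use c i in auto)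
      finally show ?thesis ..
    qed
    then show "c = (\<lambda>i\<in>carrier G. \<pi> i m)" using c by (auto simp: PiE_iff extensional_def)
  qed
qed (use assms in auto)

section \<open>Graded rings and modules\<close>

locale graded_ring = ring A + graded_grp G A + G: group G
  for G :: "('i, 'g) monoid_scheme" and A :: "('a, 'i, 'b) graded_scheme" (structure) +
  assumes piece_mult [simp, intro]: "\<lbrakk>i \<in> carrier G; j \<in> carrier G; a \<in> piece A i; b \<in> piece A j\<rbrakk>
      \<Longrightarrow> a \<otimes> b \<in> piece A (i \<otimes>\<^bsub>G\<^esub> j)"
    and piece_one [simp, intro]: "\<one> \<in> piece A \<one>\<^bsub>G\<^esub>"

locale gmod = M: graded_grp G M for G :: "('i, 'g) monoid_scheme" and A :: "('a, 'i, 'b) graded_scheme"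
    and M :: "('m, 'i, 'a) graded_module" +
  assumes gmod: "graded_right_module G A M"
begin

lemma act_closed [simp, intro]: "m \<in> carrier M \<Longrightarrow> a \<in> carrier A \<Longrightarrow> act M m a \<in> carrier M"
  using gmod unfolding graded_right_module_def by meson
lemma act_add: "m \<in> carrier M \<Longrightarrow> n \<in> carrier M \<Longrightarrow> a \<in> carrier A \<Longrightarrow>
    act M (m \<oplus>\<^bsub>M\<^esub> n) a = act M m a \<oplus>\<^bsub>M\<^esub> act M n a"
  using gmod unfolding graded_right_module_def by meson
lemma act_add_right: "m \<in> carrier M \<Longrightarrow> a \<in> carrier A \<Longrightarrow> b \<in> carrier A \<Longrightarrow>
    act M m (a \<oplus>\<^bsub>A\<^esub> b) = act M m a \<oplus>\<^bsub>M\<^esub> act M m b"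
  using gmod unfolding graded_right_module_def by meson
lemma act_mult: "m \<in> carrier M \<Longrightarrow> a \<in> carrier A \<Longrightarrow> b \<in> carrier A \<Longrightarrow>
    act M m (a \<otimes>\<^bsub>A\<^esub> b) = act M (act M m a) b"
  using gmod unfolding graded_right_module_def by meson
lemma act_one [simp]: "m \<in> carrier M \<Longrightarrow> act M m \<one>\<^bsub>A\<^esub> = m"
  using gmod unfolding graded_right_module_def by meson
lemma act_piece: "i \<in> carrier G \<Longrightarrow> j \<in> carrier G \<Longrightarrow> m \<in> piece M i \<Longrightarrow> a \<in> piece A j \<Longrightarrow>
    act M m a \<in> piece M (i \<otimes>\<^bsub>G\<^esub> j)"
  using gmod unfolding graded_right_module_def by meson

end

lemma gmodI: "graded_right_module G A M \<Longrightarrow> gmod G A M"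
  unfolding gmod_def gmod_axioms_def using graded_grpI by (auto simp: graded_right_module_def)

lemma graded_homD:
  assumes "h \<in> graded_hom G A M N"
  shows "m \<in> carrier M \<Longrightarrow> h m \<in> carrier N"
    "m \<in> carrier M \<Longrightarrow> n \<in> carrier M \<Longrightarrow> h (m \<oplus>\<^bsub>M\<^esub> n) = h m \<oplus>\<^bsub>N\<^esub> h n"
    "m \<in> carrier M \<Longrightarrow> a \<in> carrier A \<Longrightarrow> h (act M m a) = act N (h m) a"
    "i \<in> carrier G \<Longrightarrow> m \<in> piece M i \<Longrightarrow> h m \<in> piece N i"
    "h \<in> carrier M \<rightarrow>\<^sub>E carrier N"
  using assms unfolding graded_hom_def by (auto simp: image_subset_iff)

context graded_ring
begin

text \<open>Closure under composition in the category whose objects are degrees and whose morphisms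
  from \<open>i\<close> to \<open>k\<close> form the piece of degree
  \<open>inv i \<otimes> k\<close>. The same indexing is used for systems and for the Morita
  context.\<close>

lemma inv_mult_piece [simp]:
  "\<lbrakk>i \<in> carrier G; k \<in> carrier G; l \<in> carrier G; a \<in> piece A (inv\<^bsub>G\<^esub> i \<otimes>\<^bsub>G\<^esub> k); b \<in> piece A (inv\<^bsub>G\<^esub> k \<otimes>\<^bsub>G\<^esub> l)\<rbrakk>
    \<Longrightarrow> a \<otimes> b \<in> piece A (inv\<^bsub>G\<^esub> i \<otimes>\<^bsub>G\<^esub> l)"
  using piece_mult[of "inv\<^bsub>G\<^esub> i \<otimes>\<^bsub>G\<^esub> k" "inv\<^bsub>G\<^esub> k \<otimes>\<^bsub>G\<^esub> l" a b]
  by (simp add: G.m_assoc) (simp add: G.m_assoc[symmetric])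

lemma additive_agree:
  assumes M: "graded_group G M" and N: "abelian_group N"
    and h: "h \<in> carrier M \<rightarrow> carrier N" "\<And>x y. x \<in> carrier M \<Longrightarrow> y \<in> carrier M \<Longrightarrow> h (x \<oplus>\<^bsub>M\<^esub> y) = h x \<oplus>\<^bsub>N\<^esub> h y"
    and k: "k \<in> carrier M \<rightarrow> carrier N" "\<And>x y. x \<in> carrier M \<Longrightarrow> y \<in> carrier M \<Longrightarrow> k (x \<oplus>\<^bsub>M\<^esub> y) = k x \<oplus>\<^bsub>N\<^esub> k y"
    and eq: "\<And>i m. i \<in> carrier G \<Longrightarrow> m \<in> piece M i \<Longrightarrow> h m = k m"
    and m: "m \<in> carrier M"
  shows "h m = k m"
proof -
  interpret M: graded_grp G M by (rule graded_grpI) fact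
  show ?thesis using m
    by (induction rule: M.graded_induct) (auto simp: eq h k)
qed

lemma graded_hom_eqI:
  assumes M: "graded_group G M" and N: "graded_group G N"
    and h: "h \<in> graded_hom G A M N" and k: "k \<in> graded_hom G A M N"
    and "\<And>i m. i \<in> carrier G \<Longrightarrow> m \<in> piece M i \<Longrightarrow> h m = k m"
  shows "h = k"
proof (rule extensionalityI[of _ "carrier M"])
  show "h \<in> extensional (carrier M)" "k \<in> extensional (carrier M)"
    using graded_homD(5)[OF h] graded_homD(5)[OF k] by (auto simp: PiE_iff)
  have "abelian_group N" using N by (simp add: graded_group_def)
  then show "h m = k m" if "m \<in> carrier M" for m
  proof (rule additive_agree[OF M])
    show "h \<in> carrier M \<rightarrow> carrier N" "k \<in> carrier M \<rightarrow> carrier N"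
      using graded_homD(1)[OF h] graded_homD(1)[OF k] by blast+
  qed (fact graded_homD(2)[OF h] graded_homD(2)[OF k] assms(5) that)+
qed

lemma graded_homI_homog:
  assumes M: "graded_right_module G A M" and N: "graded_right_module G A N"
    and h: "h \<in> carrier M \<rightarrow>\<^sub>E carrier N"
    and add: "\<And>x y. x \<in> carrier M \<Longrightarrow> y \<in> carrier M \<Longrightarrow> h (x \<oplus>\<^bsub>M\<^esub> y) = h x \<oplus>\<^bsub>N\<^esub> h y"
    and piece: "\<And>i m. i \<in> carrier G \<Longrightarrow> m \<in> piece M i \<Longrightarrow> h m \<in> piece N i"
    and act: "\<And>i j m a. i \<in> carrier G \<Longrightarrow> j \<in> carrier G \<Longrightarrow> m \<in> piece M i \<Longrightarrow> a \<in> piece A j \<Longrightarrow> h (act M m a) = act N (h m) a"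
  shows "h \<in> graded_hom G A M N"
proof -
  interpret M: gmod G A M by (rule gmodI) fact
  interpret N: gmod G A N by (rule gmodI) fact
  have hc: "h m \<in> carrier N" if "m \<in> carrier M" for m using h that by auto
  have 1: "h (act M m a) = act N (h m) a" if i: "i \<in> carrier G" "m \<in> piece M i" and a: "a \<in> carrier A" for i m a
    using a by (induction rule: graded_induct)
      (use i in \<open>auto simp: act M.act_add_right N.act_add_right add hc\<close>)
  have "h (act M m a) = act N (h m) a" if m: "m \<in> carrier M" and a: "a \<in> carrier A" for m a
    using m by (induction rule: M.M.graded_induct)
      (use a in \<open>auto simp: 1 M.act_add N.act_add add hc\<close>)
  then show ?thesis unfolding graded_hom_def using h add piece by auto
qed

definition hom_ext :: "('m, 'i, 'a) graded_module \<Rightarrow> ('n, 'i, 'a) graded_module \<Rightarrow> ('i \<Rightarrow> 'm \<Rightarrow> 'n) \<Rightarrow> 'm \<Rightarrow> 'n" where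
  "hom_ext M N k = (\<lambda>m\<in>carrier M. finsum N (\<lambda>i. k i (component G M m i)) (csupp G M m))"

text \<open>Turns a natural transformation between the functors of homogeneous components into a
  module homomorphism. It serves both to define restriction on morphisms and to prove that
  restriction is full, which is why \<open>k_act\<close> speaks of pairs of degrees.\<close>

lemma hom_ext:
  assumes M: "graded_right_module G A M" and N: "graded_right_module G A N"
    and k: "\<And>i m. i \<in> carrier G \<Longrightarrow> m \<in> piece M i \<Longrightarrow> k i m \<in> piece N i"
    and k_add: "\<And>i m n. i \<in> carrier G \<Longrightarrow> m \<in> piece M i \<Longrightarrow> n \<in> piece M i \<Longrightarrow> k i (m \<oplus>\<^bsub>M\<^esub> n) = k i m \<oplus>\<^bsub>N\<^esub> k i n"
    and k_act: "\<And>i j m a. i \<in> carrier G \<Longrightarrow> j \<in> carrier G \<Longrightarrow> m \<in> piece M i \<Longrightarrow> a \<in> piece A (inv\<^bsub>G\<^esub> i \<otimes>\<^bsub>G\<^esub> j) \<Longrightarrow>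
         k j (act M m a) = act N (k i m) a"
  shows "hom_ext M N k \<in> graded_hom G A M N"
    and "\<And>i m. i \<in> carrier G \<Longrightarrow> m \<in> piece M i \<Longrightarrow> hom_ext M N k m = k i m"
proof -
  interpret M: gmod G A M by (rule gmodI) fact
  interpret N: gmod G A N by (rule gmodI) fact
  have kc: "k i m \<in> carrier N" if "i \<in> carrier G" "m \<in> piece M i" for i m using k that N.M.piece_carrier by blast
  have k0: "k i \<zero>\<^bsub>M\<^esub> = \<zero>\<^bsub>N\<^esub>" if i: "i \<in> carrier G" for i
  proof -
    have "k i \<zero>\<^bsub>M\<^esub> \<oplus>\<^bsub>N\<^esub> k i \<zero>\<^bsub>M\<^esub> = k i \<zero>\<^bsub>M\<^esub> \<oplus>\<^bsub>N\<^esub> \<zero>\<^bsub>N\<^esub>"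
      using k_add[OF i, of "\<zero>\<^bsub>M\<^esub>" "\<zero>\<^bsub>M\<^esub>"] kc[OF i, of "\<zero>\<^bsub>M\<^esub>"] i by simp
    then show ?thesis using kc[OF i, of "\<zero>\<^bsub>M\<^esub>"] i by simp
  qed
  have sum: "hom_ext M N k m = finsum N (\<lambda>i. k i (component G M m i)) S"
    if "m \<in> carrier M" "finite S" "S \<subseteq> carrier G" "csupp G M m \<subseteq> S" for m S
  proof -
    have "hom_ext M N k m = finsum N (\<lambda>i. k i (component G M m i)) (csupp G M m)"
      using that by (simp add: hom_ext_def)
    also have "\<dots> = finsum N (\<lambda>i. k i (component G M m i)) S"
      by (rule N.M.finsum_superset) (use that k0 kc in auto)
    finally show ?thesis .
  qed
  have cl: "hom_ext M N k \<in> carrier M \<rightarrow>\<^sub>E carrier N"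
    unfolding hom_ext_def by (auto intro!: N.M.finsum_closed kc)
  have add: "hom_ext M N k (x \<oplus>\<^bsub>M\<^esub> y) = hom_ext M N k x \<oplus>\<^bsub>N\<^esub> hom_ext M N k y"
    if xy: "x \<in> carrier M" "y \<in> carrier M" for x y
  proof -
    let ?S = "csupp G M x \<union> csupp G M y \<union> csupp G M (x \<oplus>\<^bsub>M\<^esub> y)"
    have S: "finite ?S" "?S \<subseteq> carrier G" using xy M.M.component_props(2) by auto
    have "hom_ext M N k (x \<oplus>\<^bsub>M\<^esub> y) = finsum N (\<lambda>i. k i (component G M (x \<oplus>\<^bsub>M\<^esub> y) i)) ?S"
      by (rule sum) (use xy S in auto)
    also have "\<dots> = finsum N (\<lambda>i. k i (component G M x i) \<oplus>\<^bsub>N\<^esub> k i (component G M y i)) ?S"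
      by (rule N.M.finsum_cong') (use xy in \<open>auto simp: k_add kc\<close>)
    also have "\<dots> = finsum N (\<lambda>i. k i (component G M x i)) ?S \<oplus>\<^bsub>N\<^esub> finsum N (\<lambda>i. k i (component G M y i)) ?S"
      by (rule N.M.finsum_addf) (use xy in \<open>auto simp: kc\<close>)
    also have "finsum N (\<lambda>i. k i (component G M x i)) ?S = hom_ext M N k x"
      by (rule sum[symmetric]) (use xy S in auto)
    also have "finsum N (\<lambda>i. k i (component G M y i)) ?S = hom_ext M N k y"
      by (rule sum[symmetric]) (use xy S in auto)
    finally show ?thesis .
  qed
  have homog: "hom_ext M N k m = k i m" if "i \<in> carrier G" "m \<in> piece M i" for i m
  proof -
    have "hom_ext M N k m = finsum N (\<lambda>j. k j (component G M m j)) {i}"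
      by (rule sum) (use that in \<open>auto split: if_splits\<close>)
    then show ?thesis using that kc by simp
  qed
  show "hom_ext M N k m = k i m" if "i \<in> carrier G" "m \<in> piece M i" for i m using homog that .
  show "hom_ext M N k \<in> graded_hom G A M N"
  proof (rule graded_homI_homog[OF M N cl add])
    fix i j m a assume *: "i \<in> carrier G" "j \<in> carrier G" "m \<in> piece M i" "a \<in> piece A j"
    have "a \<in> piece A (inv\<^bsub>G\<^esub> i \<otimes>\<^bsub>G\<^esub> (i \<otimes>\<^bsub>G\<^esub> j))" using * by (simp add: G.m_assoc[symmetric])
    then show "hom_ext M N k (act M m a) = act N (hom_ext M N k m) a"
      using * homog[of "i \<otimes>\<^bsub>G\<^esub> j" "act M m a"] by (simp add: homog k_act M.act_piece)
  qed (auto simp: homog k)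
qed

end

section \<open>The linear category of graded modules\<close>

lemma GrMod_simps [simp]:
  "Obj (GrMod U G A) = {M. graded_right_module G A M \<and> carrier M \<in> U}"
  "Hom (GrMod U G A) = graded_hom G A"
  "Ident (GrMod U G A) = (\<lambda>M. \<lambda>m\<in>carrier M. m)"
  "Comp (GrMod U G A) = (\<lambda>L M N g f. compose (carrier L) g f)"
  "Hom_add (GrMod U G A) = (\<lambda>M N f g. \<lambda>m\<in>carrier M. f m \<oplus>\<^bsub>N\<^esub> g m)"
  "Hom_scale (GrMod U G A) = (\<lambda>M N c f. \<lambda>m\<in>carrier M. act N (f m) (scalar A c))"
  by (simp_all add: GrMod_def)

lemma compose_graded_hom:
  assumes "f \<in> graded_hom G A L M" "g \<in> graded_hom G A M N" "graded_right_module G A L"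
  shows "compose (carrier L) g f \<in> graded_hom G A L N"
proof -
  interpret L: gmod G A L by (rule gmodI) fact
  show ?thesis
    using graded_homD[OF assms(1)] graded_homD[OF assms(2)] 
    unfolding graded_hom_def by (auto simp: compose_def L.M.piece_carrier)
qed

lemma id_graded_hom:
  assumes "graded_right_module G A L"
  shows "(\<lambda>m\<in>carrier L. m) \<in> graded_hom G A L L"
proof -
  interpret L: gmod G A L by (rule gmodI) fact
  show ?thesis unfolding graded_hom_def by (auto simp: L.M.piece_carrier)
qed

locale graded_alg = graded_ring G A for G :: "('i, 'g) monoid_scheme"
    and A :: "('a, 'i, 'k::field) graded_algebra" (structure) +
  assumes scalar_piece [simp, intro]: "scalar A c \<in> piece A \<one>\<^bsub>G\<^esub>"
    and scalar_central: "a \<in> carrier A \<Longrightarrow> scalar A c \<otimes> a = a \<otimes> scalar A c"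
    and scalar_add: "scalar A (c + d) = scalar A c \<oplus> scalar A d"
    and scalar_mult: "scalar A (c * d) = scalar A c \<otimes> scalar A d"
    and scalar_one: "scalar A 1 = \<one>"
begin

lemma scalar_carrier [simp]: "scalar A c \<in> carrier A"
  by (rule piece_carrier[OF G.one_closed scalar_piece])

text \<open>Centrality of the scalars makes their action commute with that of the algebra, and their
  degree \<open>\<one>\<close> makes it preserve degrees.\<close>

lemma scale_graded_hom:
  assumes "f \<in> graded_hom G A M N" "graded_right_module G A M" "graded_right_module G A N"
  shows "(\<lambda>m\<in>carrier M. act N (f m) (scalar A c)) \<in> graded_hom G A M N"
proof -
  interpret M: gmod G A M by (rule gmodI) fact
  interpret N: gmod G A N by (rule gmodI) fact
  note f = graded_homD[OF assms(1)]
  have "act N (act N (f m) a) (scalar A c) = act N (act N (f m) (scalar A c)) a"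
    if "m \<in> carrier M" "a \<in> carrier A" for m a
    using that f(1) by (simp flip: N.act_mult add: scalar_central)
  moreover have "act N (f m) (scalar A c) \<in> piece N i" if "i \<in> carrier G" "m \<in> piece M i" for i m
    using that f(4)[OF that] N.act_piece[of i "\<one>\<^bsub>G\<^esub>" "f m" "scalar A c"] by simp
  ultimately show ?thesis using f(1-3) unfolding graded_hom_def
    by (auto simp: M.M.piece_carrier N.act_add)
qed

lemma add_graded_hom:
  assumes "f \<in> graded_hom G A M N" "g \<in> graded_hom G A M N" "graded_right_module G A M" "graded_right_module G A N"
  shows "(\<lambda>m\<in>carrier M. f m \<oplus>\<^bsub>N\<^esub> g m) \<in> graded_hom G A M N"
proof -
  interpret M: gmod G A M by (rule gmodI) fact
  interpret N: gmod G A N by (rule gmodI) fact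
  note f = graded_homD[OF assms(1)] and g = graded_homD[OF assms(2)]
  show ?thesis using f(1-4) g(1-4) unfolding graded_hom_def
    by (auto simp: M.M.piece_carrier N.act_add N.M.a_ac)
qed

lemma is_linear_category_GrMod: "is_linear_category (GrMod U G A)"
  unfolding is_linear_category_def
proof (intro conjI ballI allI; simp; (elim conjE)?)
  fix W P Q Z :: "('m, 'i, 'a) graded_module" and f f' g h
  assume P: "graded_right_module G A P" and Q: "graded_right_module G A Q" and f: "f \<in> graded_hom G A P Q"
  interpret Q: gmod G A Q by (rule gmodI) fact
  show "compose (carrier P) f (\<lambda>m\<in>carrier P. m) = f" "compose (carrier P) (\<lambda>m\<in>carrier Q. m) f = f"
    using graded_homD(5)[OF f] by (auto simp: compose_def fun_eq_iff PiE_iff extensional_def)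
  show "(\<lambda>m\<in>carrier P. act Q (f m) (scalar A c)) \<in> graded_hom G A P Q" for c
    by (rule scale_graded_hom) fact+
  {
    assume f': "f' \<in> graded_hom G A P Q"
    show "(\<lambda>m\<in>carrier P. f m \<oplus>\<^bsub>Q\<^esub> f' m) \<in> graded_hom G A P Q"
      by (rule add_graded_hom) fact+
    assume Z: "graded_right_module G A Z" and g: "g \<in> graded_hom G A Q Z"
    show "compose (carrier P) g (\<lambda>m\<in>carrier P. f m \<oplus>\<^bsub>Q\<^esub> f' m) =
       (\<lambda>m\<in>carrier P. compose (carrier P) g f m \<oplus>\<^bsub>Z\<^esub> compose (carrier P) g f' m)"
      using graded_homD(1,2)[OF f] graded_homD(1,2)[OF f'] graded_homD(2)[OF g] by (auto simp: compose_def fun_eq_iff)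
  }
  assume Z: "graded_right_module G A Z" and g: "g \<in> graded_hom G A Q Z"
  show "compose (carrier P) g f \<in> graded_hom G A P Z" by (rule compose_graded_hom) fact+
  show "compose (carrier P) g (\<lambda>m\<in>carrier P. act Q (f m) (scalar A c)) =
        (\<lambda>m\<in>carrier P. act Z (compose (carrier P) g f m) (scalar A c))"
    "compose (carrier P) (\<lambda>m\<in>carrier Q. act Z (g m) (scalar A c)) f =
        (\<lambda>m\<in>carrier P. act Z (compose (carrier P) g f m) (scalar A c))" for c
    using graded_homD(1)[OF f] graded_homD(3)[OF g] by (auto simp: compose_def fun_eq_iff)
  {
    assume f': "f' \<in> graded_hom G A Q Z"
    show "compose (carrier P) (\<lambda>m\<in>carrier Q. g m \<oplus>\<^bsub>Z\<^esub> f' m) f =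
       (\<lambda>m\<in>carrier P. compose (carrier P) g f m \<oplus>\<^bsub>Z\<^esub> compose (carrier P) f' f m)"
      using graded_homD(1)[OF f] by (auto simp: compose_def fun_eq_iff)
  }
  assume W: "graded_right_module G A W" and h: "h \<in> graded_hom G A Z W"
  show "compose (carrier P) h (compose (carrier P) g f) = compose (carrier P) (compose (carrier Q) h g) f"
    using graded_homD(1)[OF f] by (auto simp: compose_def fun_eq_iff)
qed (auto intro: id_graded_hom)

end

section \<open>Modules from systems of homogeneous components\<close>

text \<open>An external direct sum: the groups \<open>Vp i\<close> may overlap, or even coincide,
  inside \<open>V\<close>. The part of \<open>c a\<close> in degree \<open>k\<close> collects, for
  each \<open>i\<close>, what the component of \<open>a\<close> of degree
  \<open>inv i \<otimes> k\<close> makes of \<open>c i\<close>.\<close>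

definition system_module :: "('i, 'g) monoid_scheme \<Rightarrow> ('a, 'i, 'b) graded_scheme \<Rightarrow> ('x, 'c) ring_scheme \<Rightarrow>
    ('i \<Rightarrow> 'x set) \<Rightarrow> ('i \<Rightarrow> 'i \<Rightarrow> 'x \<Rightarrow> 'a \<Rightarrow> 'x) \<Rightarrow> ('i \<Rightarrow> 'x, 'i, 'a) graded_module" where
  "system_module G A V Vp ac = (let C = {c \<in> (\<Pi>\<^sub>E i\<in>carrier G. Vp i). finite {i \<in> carrier G. c i \<noteq> \<zero>\<^bsub>V\<^esub>}} in
     \<lparr>carrier = C, monoid.mult = undefined, monoid.one = undefined, ring.zero = (\<lambda>i\<in>carrier G. \<zero>\<^bsub>V\<^esub>),
      ring.add = (\<lambda>c d. \<lambda>i\<in>carrier G. c i \<oplus>\<^bsub>V\<^esub> d i),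
      piece = (\<lambda>g. {c \<in> C. \<forall>i\<in>carrier G. i \<noteq> g \<longrightarrow> c i = \<zero>\<^bsub>V\<^esub>}),
      act = (\<lambda>c a. \<lambda>k\<in>carrier G. finsum V (\<lambda>i. ac i k (c i) (component G A a (inv\<^bsub>G\<^esub> i \<otimes>\<^bsub>G\<^esub> k)))
         {i \<in> carrier G. c i \<noteq> \<zero>\<^bsub>V\<^esub>})\<rparr>)"

text \<open>An additive functor on the category of degrees, that is, a graded right module before
  its components are put into one carrier.\<close>

locale graded_system = graded_ring G A + V: abelian_group V
  for G :: "('i, 'g) monoid_scheme" and A :: "('a, 'i, 'b) graded_scheme" (structure) and V :: "('x, 'c) ring_scheme" +
  fixes Vp :: "'i \<Rightarrow> 'x set" and ac :: "'i \<Rightarrow> 'i \<Rightarrow> 'x \<Rightarrow> 'a \<Rightarrow> 'x"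
  assumes Vp: "i \<in> carrier G \<Longrightarrow> additive_subgroup (Vp i) V"
    and ac_closed: "\<lbrakk>i \<in> carrier G; k \<in> carrier G; v \<in> Vp i; a \<in> piece A (inv\<^bsub>G\<^esub> i \<otimes>\<^bsub>G\<^esub> k)\<rbrakk> \<Longrightarrow> ac i k v a \<in> Vp k"
    and ac_add: "\<lbrakk>i \<in> carrier G; k \<in> carrier G; v \<in> Vp i; w \<in> Vp i; a \<in> piece A (inv\<^bsub>G\<^esub> i \<otimes>\<^bsub>G\<^esub> k)\<rbrakk>
        \<Longrightarrow> ac i k (v \<oplus>\<^bsub>V\<^esub> w) a = ac i k v a \<oplus>\<^bsub>V\<^esub> ac i k w a"
    and ac_add_right: "\<lbrakk>i \<in> carrier G; k \<in> carrier G; v \<in> Vp i; a \<in> piece A (inv\<^bsub>G\<^esub> i \<otimes>\<^bsub>G\<^esub> k); b \<in> piece A (inv\<^bsub>G\<^esub> i \<otimes>\<^bsub>G\<^esub> k)\<rbrakk>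
        \<Longrightarrow> ac i k v (a \<oplus> b) = ac i k v a \<oplus>\<^bsub>V\<^esub> ac i k v b"
    and ac_mult: "\<lbrakk>i \<in> carrier G; k \<in> carrier G; l \<in> carrier G; v \<in> Vp i; a \<in> piece A (inv\<^bsub>G\<^esub> i \<otimes>\<^bsub>G\<^esub> k); b \<in> piece A (inv\<^bsub>G\<^esub> k \<otimes>\<^bsub>G\<^esub> l)\<rbrakk>
        \<Longrightarrow> ac i l v (a \<otimes> b) = ac k l (ac i k v a) b"
    and ac_one: "\<lbrakk>i \<in> carrier G; v \<in> Vp i\<rbrakk> \<Longrightarrow> ac i i v \<one> = v"
begin

lemma Vp_closed [simp]: "i \<in> carrier G \<Longrightarrow> v \<in> Vp i \<Longrightarrow> v \<in> carrier V"
  using additive_subgroup.a_Hcarr[OF Vp] .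
lemma Vp_add [simp, intro]: "i \<in> carrier G \<Longrightarrow> v \<in> Vp i \<Longrightarrow> w \<in> Vp i \<Longrightarrow> v \<oplus>\<^bsub>V\<^esub> w \<in> Vp i"
  using additive_subgroup.a_closed[OF Vp] .
lemma Vp_zero [simp, intro]: "i \<in> carrier G \<Longrightarrow> \<zero>\<^bsub>V\<^esub> \<in> Vp i"
  using additive_subgroup.zero_closed[OF Vp] .
lemma Vp_uminus [simp, intro]: "i \<in> carrier G \<Longrightarrow> v \<in> Vp i \<Longrightarrow> \<ominus>\<^bsub>V\<^esub> v \<in> Vp i"
  using additive_subgroup.a_inv_closed[OF Vp] .

lemma Vp_finsum [intro]:
  assumes "i \<in> carrier G" "finite S" "\<And>s. s \<in> S \<Longrightarrow> f s \<in> Vp i" shows "finsum V f S \<in> Vp i"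
  using assms(2,3)
proof (induction S rule: finite_induct)
  case (insert x S)
  then show ?case using assms(1) by (subst V.finsum_insert) auto
qed (use assms(1) in auto)

abbreviation D where "D \<equiv> system_module G A V Vp ac"
abbreviation supp where "supp c \<equiv> {i \<in> carrier G. c i \<noteq> \<zero>\<^bsub>V\<^esub>}"

definition single where "single i v = (\<lambda>j\<in>carrier G. if j = i then v else \<zero>\<^bsub>V\<^esub>)"

lemma D_simps:
  "carrier D = {c \<in> (\<Pi>\<^sub>E i\<in>carrier G. Vp i). finite (supp c)}"
  "\<zero>\<^bsub>D\<^esub> = (\<lambda>i\<in>carrier G. \<zero>\<^bsub>V\<^esub>)"
  "c \<oplus>\<^bsub>D\<^esub> d = (\<lambda>i\<in>carrier G. c i \<oplus>\<^bsub>V\<^esub> d i)"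
  "piece D g = {c \<in> carrier D. \<forall>i\<in>carrier G. i \<noteq> g \<longrightarrow> c i = \<zero>\<^bsub>V\<^esub>}"
  "act D c a = (\<lambda>k\<in>carrier G. finsum V (\<lambda>i. ac i k (c i) (component G A a (inv\<^bsub>G\<^esub> i \<otimes>\<^bsub>G\<^esub> k))) (supp c))"
  by (simp_all add: system_module_def Let_def)

lemma D_mem: "c \<in> carrier D \<Longrightarrow> i \<in> carrier G \<Longrightarrow> c i \<in> Vp i" 
  by (auto simp: D_simps)
lemma D_mem' [simp]: "c \<in> carrier D \<Longrightarrow> i \<in> carrier G \<Longrightarrow> c i \<in> carrier V"
  using D_mem Vp_closed by blast
lemma D_supp: "c \<in> carrier D \<Longrightarrow> finite (supp c)" 
  by (auto simp: D_simps)
lemma D_memI: "(\<And>i. i \<in> carrier G \<Longrightarrow> c i \<in> Vp i) \<Longrightarrow> finite S \<Longrightarrow> supp c \<subseteq> S \<Longrightarrow> (\<lambda>i\<in>carrier G. c i) \<in> carrier D"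
  by (auto simp: D_simps cong: conj_cong intro: finite_subset)
lemma D_eqI: "c \<in> carrier D \<Longrightarrow> d \<in> carrier D \<Longrightarrow> (\<And>i. i \<in> carrier G \<Longrightarrow> c i = d i) \<Longrightarrow> c = d"
  by (auto simp: D_simps intro: PiE_ext)

lemma D_add_closed: "c \<in> carrier D \<Longrightarrow> d \<in> carrier D \<Longrightarrow> c \<oplus>\<^bsub>D\<^esub> d \<in> carrier D"
  unfolding D_simps(3)
  by (rule D_memI[of _ "supp c \<union> supp d"]) (auto simp: D_mem D_supp)

lemma D_zero_closed: "\<zero>\<^bsub>D\<^esub> \<in> carrier D"
  unfolding D_simps(2) by (rule D_memI[of _ "{}"]) auto

lemma D_uminus_closed: "c \<in> carrier D \<Longrightarrow> (\<lambda>i\<in>carrier G. \<ominus>\<^bsub>V\<^esub> c i) \<in> carrier D"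
  by (rule D_memI[of _ "supp c"]) (auto simp: D_mem D_supp)

lemma D_abelian_group: "abelian_group D"
proof (rule abelian_groupI)
  fix x y z assume x: "x \<in> carrier D"
  show "\<zero>\<^bsub>D\<^esub> \<oplus>\<^bsub>D\<^esub> x = x"
    by (rule D_eqI[OF D_add_closed[OF D_zero_closed x] x]) (use x in \<open>simp add: D_simps(2,3)\<close>)
  show "\<exists>y\<in>carrier D. y \<oplus>\<^bsub>D\<^esub> x = \<zero>\<^bsub>D\<^esub>"
    by (rule bexI[OF _ D_uminus_closed[OF x]])
      (use x in \<open>auto simp: D_simps(2,3) V.l_neg intro!: restrict_ext\<close>)
  assume y: "y \<in> carrier D"
  show "x \<oplus>\<^bsub>D\<^esub> y \<in> carrier D" by (rule D_add_closed) fact+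
  show "x \<oplus>\<^bsub>D\<^esub> y = y \<oplus>\<^bsub>D\<^esub> x"
    using x y by (auto simp: D_simps(3) V.a_ac intro!: restrict_ext)
  assume z: "z \<in> carrier D"
  show "x \<oplus>\<^bsub>D\<^esub> y \<oplus>\<^bsub>D\<^esub> z = x \<oplus>\<^bsub>D\<^esub> (y \<oplus>\<^bsub>D\<^esub> z)"
    using x y z by (auto simp: D_simps(3) V.a_ac intro!: restrict_ext)
qed (rule D_zero_closed)

lemma D_finsum:
  assumes "finite S" "F \<in> S \<rightarrow> carrier D" "k \<in> carrier G"
  shows "finsum D F S k = finsum V (\<lambda>i. F i k) S"
  by (rule finsum_additive[OF D_abelian_group V.abelian_group_axioms, of "\<lambda>c. c k"])
    (use assms in \<open>auto simp: D_simps(3)\<close>)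

lemma single_carrier: "i \<in> carrier G \<Longrightarrow> v \<in> Vp i \<Longrightarrow> single i v \<in> carrier D"
  unfolding single_def by (rule D_memI[of _ "{i}"]) auto

lemma single_piece: "i \<in> carrier G \<Longrightarrow> v \<in> Vp i \<Longrightarrow> single i v \<in> piece D i"
  using single_carrier by (auto simp: D_simps(4) single_def)

lemma single_apply: "j \<in> carrier G \<Longrightarrow> single i v j = (if j = i then v else \<zero>\<^bsub>V\<^esub>)"
  by (simp add: single_def)

lemma piece_single:
  assumes "i \<in> carrier G" "c \<in> piece D i"
  shows "c = single i (c i)" "c i \<in> Vp i"
proof -
  show *: "c i \<in> Vp i" using assms by (auto simp: D_simps(4) D_mem)
  show "c = single i (c i)"
    by (rule D_eqI) (use assms single_carrier[OF assms(1) *] in \<open>auto simp: D_simps(4) single_apply\<close>)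
qed

lemma D_graded: "graded_group G D"
proof (rule graded_groupI[where \<pi> = "\<lambda>i c. single i (c i)"])
  show "abelian_group D" by (rule D_abelian_group)
  interpret D: abelian_group D by (rule D_abelian_group)
  fix i assume i: "i \<in> carrier G"
  show "additive_subgroup (piece D i) D"
  proof (rule additive_subgroup.intro, rule D.add.subgroupI)
    show "piece D i \<subseteq> carrier D" by (auto simp: D_simps(4))
    show "piece D i \<noteq> {}" using single_piece[OF i, of "\<zero>\<^bsub>V\<^esub>"] i by auto
    fix a assume a: "a \<in> piece D i"
    then have ac: "a \<in> carrier D" by (simp add: D_simps(4))
    have "\<ominus>\<^bsub>D\<^esub> a = (\<lambda>i\<in>carrier G. \<ominus>\<^bsub>V\<^esub> a i)"
      by (rule D.minus_equality) (use ac D_uminus_closed in \<open>auto simp: D_simps(2,3) V.l_neg intro!: restrict_ext\<close>)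
    then show "\<ominus>\<^bsub>D\<^esub> a \<in> piece D i" using a D_uminus_closed[OF ac] by (simp add: D_simps(4))
    fix b assume b: "b \<in> piece D i"
    show "a \<oplus>\<^bsub>D\<^esub> b \<in> piece D i" using a b D_add_closed[of a b] by (simp add: D_simps(3,4))
  qed
  fix m assume m: "m \<in> carrier D"
  show "single i (m i) \<in> piece D i" using i m by (intro single_piece) (auto simp: D_mem)
  fix n assume n: "n \<in> carrier D"
  show "single i ((m \<oplus>\<^bsub>D\<^esub> n) i) = single i (m i) \<oplus>\<^bsub>D\<^esub> single i (n i)"
    using i m n by (auto simp: D_simps(3) single_def intro!: restrict_ext)
next
  fix m assume m: "m \<in> carrier D"
  have *: "{i \<in> carrier G. single i (m i) \<noteq> \<zero>\<^bsub>D\<^esub>} = supp m"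
  proof -
    have "single i (m i) = \<zero>\<^bsub>D\<^esub> \<longleftrightarrow> m i = \<zero>\<^bsub>V\<^esub>" if "i \<in> carrier G" for i
      using that unfolding single_def D_simps(2) by (auto simp: fun_eq_iff)
    then show ?thesis by auto
  qed
  show "finite {i \<in> carrier G. single i (m i) \<noteq> \<zero>\<^bsub>D\<^esub>}" unfolding * by (rule D_supp[OF m])
  interpret D: abelian_group D by (rule D_abelian_group)
  have F: "(\<lambda>i. single i (m i)) \<in> supp m \<rightarrow> carrier D" using m by (auto intro!: single_carrier simp: D_mem)
  show "m = finsum D (\<lambda>i. single i (m i)) {i \<in> carrier G. single i (m i) \<noteq> \<zero>\<^bsub>D\<^esub>}"
    unfolding *
  proof (rule D_eqI[OF m D.finsum_closed[OF F]])
    fix k assume k: "k \<in> carrier G"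
    have "finsum D (\<lambda>i. single i (m i)) (supp m) k = finsum V (\<lambda>i. single i (m i) k) (supp m)"
      by (rule D_finsum) (use m F k D_supp in auto)
    also have "\<dots> = finsum V (\<lambda>i. if i = k then m k else \<zero>\<^bsub>V\<^esub>) (supp m)"
      by (rule V.finsum_cong') (use m k in \<open>auto simp: single_apply\<close>)
    also have "\<dots> = finsum V (\<lambda>i. if i = k then m k else \<zero>\<^bsub>V\<^esub>) (insert k (supp m))"
      by (rule V.finsum_superset) (use m k D_supp in auto)
    also have "\<dots> = m k" by (rule V.finsum_delta) (use m k D_supp in auto)
    finally show "m k = finsum D (\<lambda>i. single i (m i)) (supp m) k" ..
  qed
next
  fix i j m assume *: "i \<in> carrier G" "j \<in> carrier G" "m \<in> piece D j"
  show "single i (m i) = (if i = j then m else \<zero>\<^bsub>D\<^esub>)"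
    using * piece_single[of j m] by (auto simp: D_simps(2,4) single_def intro!: restrict_ext)
qed

lemma G_inv_mult [simp]: "i \<in> carrier G \<Longrightarrow> k \<in> carrier G \<Longrightarrow> inv\<^bsub>G\<^esub> i \<otimes>\<^bsub>G\<^esub> (i \<otimes>\<^bsub>G\<^esub> k) = k"
  "i \<in> carrier G \<Longrightarrow> k \<in> carrier G \<Longrightarrow> i \<otimes>\<^bsub>G\<^esub> (inv\<^bsub>G\<^esub> i \<otimes>\<^bsub>G\<^esub> k) = k"
  by (simp_all flip: G.m_assoc)

lemma comp_piece: "i \<in> carrier G \<Longrightarrow> k \<in> carrier G \<Longrightarrow> a \<in> carrier A \<Longrightarrow>
    component G A a (inv\<^bsub>G\<^esub> i \<otimes>\<^bsub>G\<^esub> k) \<in> piece A (inv\<^bsub>G\<^esub> i \<otimes>\<^bsub>G\<^esub> k)"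
  by simp

lemma ac_zero [simp]:
  assumes "i \<in> carrier G" "k \<in> carrier G" "a \<in> piece A (inv\<^bsub>G\<^esub> i \<otimes>\<^bsub>G\<^esub> k)"
  shows "ac i k \<zero>\<^bsub>V\<^esub> a = \<zero>\<^bsub>V\<^esub>"
proof -
  have c: "ac i k \<zero>\<^bsub>V\<^esub> a \<in> carrier V" using ac_closed[of i k "\<zero>\<^bsub>V\<^esub>" a] assms by auto
  have "ac i k \<zero>\<^bsub>V\<^esub> a \<oplus>\<^bsub>V\<^esub> ac i k \<zero>\<^bsub>V\<^esub> a = ac i k \<zero>\<^bsub>V\<^esub> a \<oplus>\<^bsub>V\<^esub> \<zero>\<^bsub>V\<^esub>"
    using ac_add[of i k "\<zero>\<^bsub>V\<^esub>" "\<zero>\<^bsub>V\<^esub>" a] assms c by simp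
  then show ?thesis using c by simp
qed

lemma ac_zero_right [simp]:
  assumes "i \<in> carrier G" "k \<in> carrier G" "v \<in> Vp i"
  shows "ac i k v \<zero> = \<zero>\<^bsub>V\<^esub>"
proof -
  have c: "ac i k v \<zero> \<in> carrier V" using ac_closed[of i k v \<zero>] assms by auto
  have "ac i k v \<zero> \<oplus>\<^bsub>V\<^esub> ac i k v \<zero> = ac i k v \<zero> \<oplus>\<^bsub>V\<^esub> \<zero>\<^bsub>V\<^esub>"
    using ac_add_right[of i k v \<zero> \<zero>] assms c by simp
  then show ?thesis using c by simp
qed

lemma acc_closed: "i \<in> carrier G \<Longrightarrow> k \<in> carrier G \<Longrightarrow> a \<in> carrier A \<Longrightarrow> v \<in> Vp i \<Longrightarrow>
    ac i k v (component G A a (inv\<^bsub>G\<^esub> i \<otimes>\<^bsub>G\<^esub> k)) \<in> Vp k"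
  by (intro ac_closed comp_piece)

lemma act_sum:
  assumes c: "c \<in> carrier D" and a: "a \<in> carrier A" and k: "k \<in> carrier G" and S: "finite S" "supp c \<subseteq> S" "S \<subseteq> carrier G"
  shows "act D c a k = finsum V (\<lambda>i. ac i k (c i) (component G A a (inv\<^bsub>G\<^esub> i \<otimes>\<^bsub>G\<^esub> k))) S"
proof -
  have "act D c a k = finsum V (\<lambda>i. ac i k (c i) (component G A a (inv\<^bsub>G\<^esub> i \<otimes>\<^bsub>G\<^esub> k))) (supp c)"
    using k by (simp add: D_simps(5))
  also have "\<dots> = finsum V (\<lambda>i. ac i k (c i) (component G A a (inv\<^bsub>G\<^esub> i \<otimes>\<^bsub>G\<^esub> k))) S"
  proof (rule V.finsum_superset)
    show "(\<lambda>i. ac i k (c i) (component G A a (inv\<^bsub>G\<^esub> i \<otimes>\<^bsub>G\<^esub> k))) \<in> S \<rightarrow> carrier V"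
      using acc_closed[OF _ k a D_mem[OF c]] S k by (auto intro: Vp_closed[OF k])
  qed (use S a k in auto)
  finally show ?thesis .
qed

lemma act_Vp:
  assumes c: "c \<in> carrier D" and a: "a \<in> carrier A" and k: "k \<in> carrier G"
  shows "act D c a k \<in> Vp k"
  using act_sum[OF assms D_supp[OF c] order.refl] acc_closed[OF _ k a D_mem[OF c]] D_supp[OF c] k
  by (auto intro!: Vp_finsum)

lemma act_closed:
  assumes c: "c \<in> carrier D" and a: "a \<in> carrier A"
  shows "act D c a \<in> carrier D"
proof -
  let ?S = "(\<lambda>(i, g). i \<otimes>\<^bsub>G\<^esub> g) ` (supp c \<times> csupp G A a)"
  have "supp (act D c a) \<subseteq> ?S"
  proof
    fix k assume "k \<in> supp (act D c a)"
    then have k: "k \<in> carrier G" "act D c a k \<noteq> \<zero>\<^bsub>V\<^esub>" by auto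
    have "\<exists>i\<in>supp c. ac i k (c i) (component G A a (inv\<^bsub>G\<^esub> i \<otimes>\<^bsub>G\<^esub> k)) \<noteq> \<zero>\<^bsub>V\<^esub>"
    proof (rule ccontr)
      assume "\<not> ?thesis"
      then have "finsum V (\<lambda>i. ac i k (c i) (component G A a (inv\<^bsub>G\<^esub> i \<otimes>\<^bsub>G\<^esub> k))) (supp c) = finsum V (\<lambda>i. \<zero>\<^bsub>V\<^esub>) (supp c)"
        by (intro V.finsum_cong') auto
      then show False using k by (simp add: D_simps(5))
    qed
    then obtain i where i: "i \<in> supp c" "ac i k (c i) (component G A a (inv\<^bsub>G\<^esub> i \<otimes>\<^bsub>G\<^esub> k)) \<noteq> \<zero>\<^bsub>V\<^esub>" by blast
    then have "component G A a (inv\<^bsub>G\<^esub> i \<otimes>\<^bsub>G\<^esub> k) \<noteq> \<zero>" using k c by (auto simp: D_mem)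
    then have "inv\<^bsub>G\<^esub> i \<otimes>\<^bsub>G\<^esub> k \<in> csupp G A a" using i k by auto
    moreover have "k = i \<otimes>\<^bsub>G\<^esub> (inv\<^bsub>G\<^esub> i \<otimes>\<^bsub>G\<^esub> k)" using i k by simp
    ultimately show "k \<in> ?S" using i(1) by (intro image_eqI[of _ _ "(i, inv\<^bsub>G\<^esub> i \<otimes>\<^bsub>G\<^esub> k)"]) auto
  qed
  moreover have "finite ?S" using D_supp[OF c] component_props(2)[OF a] by auto
  ultimately have "(\<lambda>i\<in>carrier G. act D c a i) \<in> carrier D"
    by (intro D_memI) (auto simp: act_Vp assms)
  moreover have "(\<lambda>i\<in>carrier G. act D c a i) = act D c a" by (auto simp: D_simps(5) fun_eq_iff)
  ultimately show ?thesis by simp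
qed

lemma act_add:
  assumes c: "c \<in> carrier D" and d: "d \<in> carrier D" and a: "a \<in> carrier A"
  shows "act D (c \<oplus>\<^bsub>D\<^esub> d) a = act D c a \<oplus>\<^bsub>D\<^esub> act D d a"
proof (rule D_eqI)
  show "act D (c \<oplus>\<^bsub>D\<^esub> d) a \<in> carrier D" "act D c a \<oplus>\<^bsub>D\<^esub> act D d a \<in> carrier D"
    using assms by (auto intro!: act_closed D_add_closed)
  fix k assume k: "k \<in> carrier G"
  let ?S = "supp c \<union> supp d \<union> supp (c \<oplus>\<^bsub>D\<^esub> d)"
  have S: "finite ?S" "?S \<subseteq> carrier G" using D_supp[of c] D_supp[of d] D_supp[OF D_add_closed[of c d]] assms by auto
  have "act D (c \<oplus>\<^bsub>D\<^esub> d) a k = finsum V (\<lambda>i. ac i k ((c \<oplus>\<^bsub>D\<^esub> d) i) (component G A a (inv\<^bsub>G\<^esub> i \<otimes>\<^bsub>G\<^esub> k))) ?S"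
    by (rule act_sum) (use assms S k in \<open>auto intro: D_add_closed\<close>)
  also have "\<dots> = finsum V (\<lambda>i. ac i k (c i) (component G A a (inv\<^bsub>G\<^esub> i \<otimes>\<^bsub>G\<^esub> k)) \<oplus>\<^bsub>V\<^esub>
      ac i k (d i) (component G A a (inv\<^bsub>G\<^esub> i \<otimes>\<^bsub>G\<^esub> k))) ?S"
    by (rule V.finsum_cong')
      (use S k a c d in \<open>auto simp: D_simps(3) ac_add D_mem intro!: V.a_closed Vp_closed[OF k acc_closed]\<close>)
  also have "\<dots> = finsum V (\<lambda>i. ac i k (c i) (component G A a (inv\<^bsub>G\<^esub> i \<otimes>\<^bsub>G\<^esub> k))) ?S \<oplus>\<^bsub>V\<^esub>
      finsum V (\<lambda>i. ac i k (d i) (component G A a (inv\<^bsub>G\<^esub> i \<otimes>\<^bsub>G\<^esub> k))) ?S"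
    by (rule V.finsum_addf) (use S k a c d in \<open>auto simp: D_mem intro!: Vp_closed[OF k acc_closed]\<close>)
  also have "finsum V (\<lambda>i. ac i k (c i) (component G A a (inv\<^bsub>G\<^esub> i \<otimes>\<^bsub>G\<^esub> k))) ?S = act D c a k"
    by (rule act_sum[symmetric]) (use assms S k in auto)
  also have "finsum V (\<lambda>i. ac i k (d i) (component G A a (inv\<^bsub>G\<^esub> i \<otimes>\<^bsub>G\<^esub> k))) ?S = act D d a k"
    by (rule act_sum[symmetric]) (use assms S k in auto)
  finally show "act D (c \<oplus>\<^bsub>D\<^esub> d) a k = (act D c a \<oplus>\<^bsub>D\<^esub> act D d a) k" unfolding D_simps(3)[of "act D c a"] using k by simp
qed

lemma act_add_right:
  assumes c: "c \<in> carrier D" and a: "a \<in> carrier A" and b: "b \<in> carrier A"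
  shows "act D c (a \<oplus> b) = act D c a \<oplus>\<^bsub>D\<^esub> act D c b"
proof (rule D_eqI)
  show "act D c (a \<oplus> b) \<in> carrier D" "act D c a \<oplus>\<^bsub>D\<^esub> act D c b \<in> carrier D"
    using assms by (auto intro!: act_closed D_add_closed)
  fix k assume k: "k \<in> carrier G"
  note S = D_supp[OF c]
  have "act D c (a \<oplus> b) k = finsum V (\<lambda>i. ac i k (c i) (component G A a (inv\<^bsub>G\<^esub> i \<otimes>\<^bsub>G\<^esub> k)) \<oplus>\<^bsub>V\<^esub>
      ac i k (c i) (component G A b (inv\<^bsub>G\<^esub> i \<otimes>\<^bsub>G\<^esub> k))) (supp c)"
    unfolding D_simps(5) using k apply simp
    apply (rule V.finsum_cong')
      using S k a b c by (auto simp: ac_add_right D_mem intro!: V.a_closed Vp_closed[OF k acc_closed])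
  also have "\<dots> = finsum V (\<lambda>i. ac i k (c i) (component G A a (inv\<^bsub>G\<^esub> i \<otimes>\<^bsub>G\<^esub> k))) (supp c) \<oplus>\<^bsub>V\<^esub>
      finsum V (\<lambda>i. ac i k (c i) (component G A b (inv\<^bsub>G\<^esub> i \<otimes>\<^bsub>G\<^esub> k))) (supp c)"
    by (rule V.finsum_addf) (use S k a b c in \<open>auto simp: D_mem intro!: Vp_closed[OF k acc_closed]\<close>)
  finally show "act D c (a \<oplus> b) k = (act D c a \<oplus>\<^bsub>D\<^esub> act D c b) k" unfolding D_simps(3)[of "act D c a"] using k by (simp add: D_simps(5))
qed

text \<open>Among the target degrees \<open>l\<close> only \<open>l = k\<close> makes
  \<open>inv i \<otimes> l\<close> the degree of \<open>a\<close>; all other components of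
  \<open>a\<close> vanish. The module laws on homogeneous elements are read off from this
  formula.\<close>

lemma act_single:
  assumes "i \<in> carrier G" "k \<in> carrier G" "v \<in> Vp i" "a \<in> piece A (inv\<^bsub>G\<^esub> i \<otimes>\<^bsub>G\<^esub> k)"
  shows "act D (single i v) a = single k (ac i k v a)"
proof (rule D_eqI)
  have a: "a \<in> carrier A" using assms(4) by (rule piece_carrier[rotated]) (use assms in auto)
  show "act D (single i v) a \<in> carrier D" by (intro act_closed single_carrier assms a)
  show "single k (ac i k v a) \<in> carrier D" by (intro single_carrier ac_closed assms)
  fix l assume l: "l \<in> carrier G"
  have eq: "inv\<^bsub>G\<^esub> i \<otimes>\<^bsub>G\<^esub> l = inv\<^bsub>G\<^esub> i \<otimes>\<^bsub>G\<^esub> k \<longleftrightarrow> l = k" using assms l by simp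
  have "act D (single i v) a l = finsum V (\<lambda>j. ac j l (single i v j) (component G A a (inv\<^bsub>G\<^esub> j \<otimes>\<^bsub>G\<^esub> l))) {i}"
    by (rule act_sum) (use assms l a single_carrier in \<open>auto simp: single_apply split: if_splits\<close>)
  also have "\<dots> = ac i l v (component G A a (inv\<^bsub>G\<^esub> i \<otimes>\<^bsub>G\<^esub> l))"
    using assms l a Vp_closed[OF l acc_closed[of i l a v]] by (simp add: single_apply)
  also have "\<dots> = single k (ac i k v a) l"
    using assms l component_homog[of "inv\<^bsub>G\<^esub> i \<otimes>\<^bsub>G\<^esub> k" "inv\<^bsub>G\<^esub> i \<otimes>\<^bsub>G\<^esub> l" a] by (auto simp: single_apply eq)
  finally show "act D (single i v) a l = single k (ac i k v a) l" .
qed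

lemma act_piece:
  assumes "i \<in> carrier G" "j \<in> carrier G" "c \<in> piece D i" "a \<in> piece A j"
  shows "act D c a = single (i \<otimes>\<^bsub>G\<^esub> j) (ac i (i \<otimes>\<^bsub>G\<^esub> j) (c i) a)" "ac i (i \<otimes>\<^bsub>G\<^esub> j) (c i) a \<in> Vp (i \<otimes>\<^bsub>G\<^esub> j)"
  using act_single[of i "i \<otimes>\<^bsub>G\<^esub> j" "c i" a] piece_single[OF assms(1,3)] assms
  by (auto intro!: ac_closed)

text \<open>Associativity is additive in each of its three arguments, so it is reduced one argument
  at a time to homogeneous elements, where it becomes \<open>ac_mult\<close>.\<close>

lemma system_module: "graded_right_module G A D"
proof -
  interpret D: graded_grp G D by (rule graded_grpI[OF D_graded])
  have one: "act D c \<one> = c" if "c \<in> carrier D" for c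
    using that
  proof (induction rule: D.graded_induct)
    case (homog i c)
    then show ?case
      using act_piece[of i "\<one>\<^bsub>G\<^esub>" c \<one>] piece_single[of i c] by (simp add: ac_one)
  qed (auto simp: act_add)
  have assoc1: "act D c (a \<otimes> b) = act D (act D c a) b"
    if c: "i \<in> carrier G" "c \<in> piece D i" and a: "j \<in> carrier G" "a \<in> piece A j" and b: "k \<in> carrier G" "b \<in> piece A k" for c a b i j k
  proof -
    note ci = piece_single[OF c]
    have 1: "act D c a = single (i \<otimes>\<^bsub>G\<^esub> j) (ac i (i \<otimes>\<^bsub>G\<^esub> j) (c i) a)" and 2: "ac i (i \<otimes>\<^bsub>G\<^esub> j) (c i) a \<in> Vp (i \<otimes>\<^bsub>G\<^esub> j)"
      using act_piece[of i j c a] c a by auto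
    have [simp]: "inv\<^bsub>G\<^esub> (i \<otimes>\<^bsub>G\<^esub> j) \<otimes>\<^bsub>G\<^esub> (i \<otimes>\<^bsub>G\<^esub> (j \<otimes>\<^bsub>G\<^esub> k)) = k"
      using a b c by (simp add: G.inv_mult_group G.m_assoc)
    have 3: "act D (act D c a) b = single (i \<otimes>\<^bsub>G\<^esub> (j \<otimes>\<^bsub>G\<^esub> k)) (ac (i \<otimes>\<^bsub>G\<^esub> j) (i \<otimes>\<^bsub>G\<^esub> (j \<otimes>\<^bsub>G\<^esub> k)) (ac i (i \<otimes>\<^bsub>G\<^esub> j) (c i) a) b)"
      unfolding 1 by (rule act_single) (use 2 a b c in auto)
    have "act D c (a \<otimes> b) = single (i \<otimes>\<^bsub>G\<^esub> (j \<otimes>\<^bsub>G\<^esub> k)) (ac i (i \<otimes>\<^bsub>G\<^esub> (j \<otimes>\<^bsub>G\<^esub> k)) (c i) (a \<otimes> b))"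
      using act_piece[of i "j \<otimes>\<^bsub>G\<^esub> k" c "a \<otimes> b"] a b c by auto
    also have "ac i (i \<otimes>\<^bsub>G\<^esub> (j \<otimes>\<^bsub>G\<^esub> k)) (c i) (a \<otimes> b) = ac (i \<otimes>\<^bsub>G\<^esub> j) (i \<otimes>\<^bsub>G\<^esub> (j \<otimes>\<^bsub>G\<^esub> k)) (ac i (i \<otimes>\<^bsub>G\<^esub> j) (c i) a) b"
      by (rule ac_mult) (use a b c ci in auto)
    finally show ?thesis using 3 by simp
  qed
  have assoc2: "act D c (a \<otimes> b) = act D (act D c a) b"
    if c: "i \<in> carrier G" "c \<in> piece D i" and a: "j \<in> carrier G" "a \<in> piece A j" and b: "b \<in> carrier A" for c a b i j
    using b
  proof (induction rule: graded_induct)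
    case (add x y)
    have "a \<in> carrier A" "c \<in> carrier D" using a c by auto
    with add show ?case by (simp add: r_distr act_add_right act_closed)
  qed (auto intro: assoc1 a c)
  have assoc3: "act D c (a \<otimes> b) = act D (act D c a) b"
    if c: "i \<in> carrier G" "c \<in> piece D i" and a: "a \<in> carrier A" and b: "b \<in> carrier A" for c a b i
    using a
  proof (induction rule: graded_induct)
    case (add x y)
    have "c \<in> carrier D" using c by auto
    with add b show ?case by (simp add: l_distr act_add act_add_right act_closed)
  qed (auto intro: assoc2 b c)
  have assoc: "act D c (a \<otimes> b) = act D (act D c a) b"
    if c: "c \<in> carrier D" and a: "a \<in> carrier A" and b: "b \<in> carrier A" for c a b
    using c
  proof (induction rule: D.graded_induct)
    case (add x y)
    with a b show ?case by (simp add: act_add act_closed)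
  qed (auto intro: assoc3 a b)
  show ?thesis unfolding graded_right_module_def
    using D_graded act_closed act_add act_add_right assoc one act_piece single_piece
    by auto
qed

end

section \<open>Transport of structure\<close>

text \<open>Objects of \<open>GrMod U\<close> are constrained by their carriers. Moving the
  structure along an injection places a module on a prescribed set.\<close>

definition transport :: "('m \<Rightarrow> 'n) \<Rightarrow> ('m, 'i, 'a) graded_module \<Rightarrow> ('n, 'i, 'a) graded_module" where
  "transport t M = (let u = inv_into (carrier M) t in
     \<lparr>carrier = t ` carrier M, monoid.mult = undefined, monoid.one = undefined, ring.zero = t \<zero>\<^bsub>M\<^esub>,
      ring.add = (\<lambda>x y. t (u x \<oplus>\<^bsub>M\<^esub> u y)), piece = (\<lambda>i. t ` piece M i), act = (\<lambda>x a. t (act M (u x) a))\<rparr>)"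

lemma transport_module:
  assumes M: "graded_right_module G A M" and inj: "inj_on t (carrier M)"
  shows "graded_right_module G A (transport t M)"
proof -
  interpret M: gmod G A M by (rule gmodI) fact
  let ?N = "transport t M"
  let ?u = "inv_into (carrier M) t"
  have u [simp]: "?u (t m) = m" if "m \<in> carrier M" for m using inj that by simp
  have N: "carrier ?N = t ` carrier M" "\<zero>\<^bsub>?N\<^esub> = t \<zero>\<^bsub>M\<^esub>" "\<And>x y. x \<oplus>\<^bsub>?N\<^esub> y = t (?u x \<oplus>\<^bsub>M\<^esub> ?u y)"
    "\<And>i. piece ?N i = t ` piece M i" "\<And>x a. act ?N x a = t (act M (?u x) a)"
    by (simp_all add: transport_def Let_def)
  have ab: "abelian_group ?N"
  proof (rule abelian_groupI; (simp only: N)?)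
    fix x assume "x \<in> t ` carrier M"
    then obtain m where m: "m \<in> carrier M" "x = t m" by auto
    show "\<exists>y\<in>t ` carrier M. t (?u y \<oplus>\<^bsub>M\<^esub> ?u x) = t \<zero>\<^bsub>M\<^esub>"
      by (rule bexI[where x = "t (\<ominus>\<^bsub>M\<^esub> m)"]) (use m in \<open>auto simp: M.M.l_neg\<close>)
  qed (auto simp: M.M.a_ac)
  interpret N: abelian_group ?N by (rule ab)
  have um: "\<ominus>\<^bsub>?N\<^esub> t m = t (\<ominus>\<^bsub>M\<^esub> m)" if "m \<in> carrier M" for m
    by (rule N.minus_equality) (use that in \<open>auto simp: N M.M.l_neg\<close>)
  have gg: "graded_group G ?N"
  proof (rule graded_groupI[where \<pi> = "\<lambda>i x. t (component G M (?u x) i)"])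
    fix i assume i: "i \<in> carrier G"
    show "additive_subgroup (piece ?N i) ?N"
    proof (rule additive_subgroup.intro, rule N.add.subgroupI)
      show "piece ?N i \<subseteq> carrier ?N" using i by (auto simp: N M.M.piece_carrier)
      show "piece ?N i \<noteq> {}" using M.M.piece_zero[OF i] by (auto simp: N)
      fix a assume "a \<in> piece ?N i"
      then obtain m where m: "a = t m" "m \<in> piece M i" "m \<in> carrier M" using i by (auto simp: N)
      then show "\<ominus>\<^bsub>?N\<^esub> a \<in> piece ?N i" using i by (auto simp: um N)
      fix b assume "b \<in> piece ?N i"
      then obtain n where n: "b = t n" "n \<in> piece M i" "n \<in> carrier M" using i by (auto simp: N)
      show "a \<oplus>\<^bsub>?N\<^esub> b \<in> piece ?N i" using m n i by (auto simp: N)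
    qed
  next
    fix x assume "x \<in> carrier ?N"
    then obtain m where m: "x = t m" "m \<in> carrier M" by (auto simp: N)
    have ux: "?u x = m" using m by simp
    have eq: "{i \<in> carrier G. t (component G M m i) \<noteq> \<zero>\<^bsub>?N\<^esub>} = csupp G M m"
      using m inj by (auto simp: N inj_on_eq_iff)
    show "finite {i \<in> carrier G. t (component G M (?u x) i) \<noteq> \<zero>\<^bsub>?N\<^esub>}"
      unfolding ux eq using M.M.component_props(2) m by auto
    have "x = t (finsum M (component G M m) (csupp G M m))"
      using M.M.component_props(3)[of m] m by simp
    also have "\<dots> = finsum ?N (\<lambda>i. t (component G M m i)) (csupp G M m)"
      by (rule finsum_additive[OF M.M.abelian_group_axioms ab])
        (use m M.M.component_props(2) in \<open>auto simp: N\<close>)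
    finally show "x = finsum ?N (\<lambda>i. t (component G M (?u x) i)) {i \<in> carrier G. t (component G M (?u x) i) \<noteq> \<zero>\<^bsub>?N\<^esub>}"
      unfolding ux eq .
  qed (auto simp: N ab)
  show ?thesis unfolding graded_right_module_def
    by (intro conjI gg ballI; auto simp: N M.act_add M.act_add_right M.act_mult M.act_piece)
qed

section \<open>Cardinalities\<close>

lemma lepoll_times_infinite:
  assumes "infinite S" "A \<lesssim> S" "B \<lesssim> S" shows "A \<times> B \<lesssim> S"
proof -
  have "A \<times> B \<lesssim> S \<times> S" using assms(2,3) by (rule times_lepoll_mono)
  also have "S \<times> S \<lesssim> S" using card_of_Times_same_infinite[OF assms(1)]
    by (simp add: eqpoll_iff_card_of_ordIso eqpoll_imp_lepoll)
  finally show ?thesis .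
qed

context graded_system
begin

text \<open>A finitely supported family is determined by its graph over the support, a finite subset
  of \<open>carrier G \<times> S\<close>; for infinite \<open>S\<close> there are no more such
  subsets than elements of \<open>S\<close>. For finite \<open>S\<close> the hypothesis
  \<open>triv\<close> leaves only the zero family.\<close>

lemma carrier_lepoll:
  assumes "countable (carrier G)" and "\<And>i. i \<in> carrier G \<Longrightarrow> Vp i \<lesssim> S"
    and S: "S \<noteq> {}" and triv: "finite S \<Longrightarrow> carrier V = {\<zero>\<^bsub>V\<^esub>}"
  shows "carrier D \<lesssim> S"
proof (cases "finite S")
  case True
  have "c = \<zero>\<^bsub>D\<^esub>" if "c \<in> carrier D" for c
    by (rule D_eqI) (use that D_zero_closed D_mem'[of c] triv[OF True] in \<open>auto simp: D_simps(2)\<close>)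
  then have "carrier D \<subseteq> {\<zero>\<^bsub>D\<^esub>}" by blast
  moreover obtain s where "s \<in> S" using S by blast
  ultimately have "inj_on (\<lambda>_. s) (carrier D) \<and> (\<lambda>_. s) ` carrier D \<subseteq> S" 
    using subset_singletonD by (fastforce simp: inj_on_def)
  then show ?thesis unfolding lepoll_def by blast
next
  case False
  have "\<forall>i\<in>carrier G. \<exists>j. inj_on j (Vp i) \<and> j ` Vp i \<subseteq> S" using assms(2) unfolding lepoll_def by blast
  then obtain j where j: "\<And>i. i \<in> carrier G \<Longrightarrow> inj_on (j i) (Vp i)" "\<And>i. i \<in> carrier G \<Longrightarrow> j i ` Vp i \<subseteq> S"
    by metis
  define F where "F c = (\<lambda>i. (i, j i (c i))) ` supp c" for c
  have "inj_on F (carrier D)"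
  proof (rule inj_onI)
    fix c d assume c: "c \<in> carrier D" and d: "d \<in> carrier D" and eq: "F c = F d"
    show "c = d"
    proof (rule D_eqI[OF c d])
      fix i assume i: "i \<in> carrier G"
      have fst_F: "fst ` F c = supp c" for c unfolding F_def image_image by simp
      have "i \<in> supp c \<longleftrightarrow> i \<in> supp d" using fst_F[of c] fst_F[of d] eq by simp
      moreover have "c i = d i" if "i \<in> supp c" "i \<in> supp d"
      proof -
        have "(i, j i (c i)) \<in> F d" using that eq unfolding F_def by blast
        then have "j i (c i) = j i (d i)" unfolding F_def by auto
        then show ?thesis using j(1)[OF i] D_mem[OF c i] D_mem[OF d i] by (simp add: inj_on_eq_iff)
      qed
      ultimately show "c i = d i" using i by auto
    qed
  qed
  moreover have "F ` carrier D \<subseteq> Fpow (carrier G \<times> S)"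
  proof -
    have "j i (c i) \<in> S" if "c \<in> carrier D" "i \<in> carrier G" for c i
      using j(2)[of i] D_mem[of c i] that by blast
    then show ?thesis unfolding F_def Fpow_def using D_supp by auto
  qed
  ultimately have "carrier D \<lesssim> Fpow (carrier G \<times> S)" unfolding lepoll_def by blast
  moreover have GS: "carrier G \<times> S \<lesssim> S"
  proof (rule lepoll_times_infinite[OF False])
    have "carrier G \<lesssim> (UNIV :: nat set)" using assms(1) unfolding countable_def lepoll_def by blast
    then show "carrier G \<lesssim> S" using False infinite_le_lepoll lepoll_trans by blast
  qed (rule lepoll_refl)
  moreover have "infinite (carrier G \<times> S)" using False G.one_closed by (auto simp: finite_cartesian_product_iff)
  ultimately show ?thesis by (meson eqpoll_Fpow eqpoll_imp_lepoll lepoll_trans)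
qed

text \<open>The form in which both restriction and coinduction receive their objects: the module
  lives on a subset of \<open>S\<close>, and \<open>\<psi>\<close> records how its pieces are
  identified with the groups \<open>Vp i\<close>.\<close>

proposition module_in_universe:
  assumes "countable (carrier G)" and "\<And>i. i \<in> carrier G \<Longrightarrow> Vp i \<lesssim> S"
    and S: "S \<noteq> {}" and triv: "finite S \<Longrightarrow> carrier V = {\<zero>\<^bsub>V\<^esub>}"
  shows "\<exists>M \<psi>. graded_right_module G A M \<and> carrier M \<subseteq> S \<and>
    (\<forall>i\<in>carrier G. bij_betw (\<psi> i) (Vp i) (piece M i) \<and>
      (\<forall>v\<in>Vp i. \<forall>w\<in>Vp i. \<psi> i (v \<oplus>\<^bsub>V\<^esub> w) = \<psi> i v \<oplus>\<^bsub>M\<^esub> \<psi> i w) \<and>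
      (\<forall>k\<in>carrier G. \<forall>v\<in>Vp i. \<forall>a\<in>piece A (inv\<^bsub>G\<^esub> i \<otimes>\<^bsub>G\<^esub> k). \<psi> k (ac i k v a) = act M (\<psi> i v) a))"
proof -
  obtain t where t: "inj_on t (carrier D)" "t ` carrier D \<subseteq> S"
    using carrier_lepoll[OF assms] unfolding lepoll_def by blast
  have u [simp]: "inv_into (carrier D) t (t c) = c" if "c \<in> carrier D" for c using t(1) that by simp
  define \<psi> where "\<psi> i v = t (single i v)" for i v
  have "bij_betw (\<psi> i) (Vp i) (t ` piece D i)" if i: "i \<in> carrier G" for i
  proof -
    have "bij_betw (single i) (Vp i) (piece D i)"
      by (rule bij_betw_byWitness[where f' = "\<lambda>c. c i"])
        (use i piece_single[OF i] single_piece[OF i] in \<open>auto simp: single_apply\<close>)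
    moreover have "bij_betw t (piece D i) (t ` piece D i)"
      using t(1) by (simp add: bij_betw_def D_simps(4) inj_on_subset[of _ "carrier D"])
    ultimately show ?thesis using bij_betw_trans unfolding \<psi>_def comp_def by fastforce
  qed
  moreover have "single i (v \<oplus>\<^bsub>V\<^esub> w) = single i v \<oplus>\<^bsub>D\<^esub> single i w" if "i \<in> carrier G" "v \<in> Vp i" "w \<in> Vp i" for i v w
    using that by (auto simp: single_def D_simps(3) intro!: restrict_ext)
  ultimately show ?thesis
    using t(2) single_carrier
    by (intro exI[of _ "transport t D"] exI[of _ \<psi>] conjI transport_module[OF system_module t(1)] ballI)
      (auto simp: transport_def Let_def \<psi>_def act_single)
qed

end

section \<open>Graded Morita equivalence\<close>

text \<open>A nonzero \<open>m\<close> would embed the infinite field by sending \<open>c\<close> to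
  its action on \<open>m\<close>: if two scalars act alike, their difference kills \<open>m\<close>,
  and it is invertible.\<close>

lemma (in graded_alg) finite_module_trivial:
  assumes M: "graded_right_module G A M" and fin: "finite (carrier M)" and inf: "infinite (UNIV :: 'k set)"
  shows "carrier M = {\<zero>\<^bsub>M\<^esub>}"
proof -
  interpret M: gmod G A M by (rule gmodI) fact
  have "m = \<zero>\<^bsub>M\<^esub>" if m: "m \<in> carrier M" for m
  proof (rule ccontr)
    assume nz: "m \<noteq> \<zero>\<^bsub>M\<^esub>"
    have zero: "act M m (scalar A 0) = \<zero>\<^bsub>M\<^esub>"
    proof -
      have "act M m (scalar A 0) \<oplus>\<^bsub>M\<^esub> act M m (scalar A 0) = act M m (scalar A 0) \<oplus>\<^bsub>M\<^esub> \<zero>\<^bsub>M\<^esub>"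
        using M.act_add_right[of m "scalar A 0" "scalar A 0"] scalar_add[of 0 0] m by simp
      then show ?thesis using m by simp
    qed
    have z: "act M \<zero>\<^bsub>M\<^esub> a = \<zero>\<^bsub>M\<^esub>" if "a \<in> carrier A" for a
    proof -
      have "act M \<zero>\<^bsub>M\<^esub> a \<oplus>\<^bsub>M\<^esub> act M \<zero>\<^bsub>M\<^esub> a = act M \<zero>\<^bsub>M\<^esub> a \<oplus>\<^bsub>M\<^esub> \<zero>\<^bsub>M\<^esub>"
        using M.act_add[of "\<zero>\<^bsub>M\<^esub>" "\<zero>\<^bsub>M\<^esub>" a] that by simp
      then show ?thesis using that by simp
    qed
    have "inj (\<lambda>c. act M m (scalar A c))"
    proof (rule injI, rule ccontr)
      fix c d assume eq: "act M m (scalar A c) = act M m (scalar A d)" and "c \<noteq> d"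
      have "act M m (scalar A c) = act M m (scalar A (c - d)) \<oplus>\<^bsub>M\<^esub> act M m (scalar A d)"
        using M.act_add_right[of m "scalar A (c - d)" "scalar A d"] scalar_add[of "c - d" d] m by simp
      then have "act M m (scalar A (c - d)) \<oplus>\<^bsub>M\<^esub> act M m (scalar A d) = \<zero>\<^bsub>M\<^esub> \<oplus>\<^bsub>M\<^esub> act M m (scalar A d)"
        using eq m by simp
      then have 0: "act M m (scalar A (c - d)) = \<zero>\<^bsub>M\<^esub>" using m by (simp del: M.M.l_zero)
      have "m = act M m (scalar A ((c - d) * inverse (c - d)))"
        using \<open>c \<noteq> d\<close> m by (simp add: scalar_one)
      also have "\<dots> = act M (act M m (scalar A (c - d))) (scalar A (inverse (c - d)))"
        using m by (simp only: scalar_mult M.act_mult scalar_carrier)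
      also have "\<dots> = \<zero>\<^bsub>M\<^esub>" using 0 z by simp
      finally show False using nz by simp
    qed
    moreover have "range (\<lambda>c. act M m (scalar A c)) \<subseteq> carrier M" using m by auto
    ultimately show False using inf fin by (meson finite_imageD finite_subset)
  qed
  then show ?thesis using M.M.zero_closed by blast
qed

text \<open>Write \<open>B(J, K)\<close> for the piece of \<open>B\<close> of degree \<open>J\<inverse>K\<close>. The maps \<open>\<Theta> n m\<close> identify \<open>A(n, m)\<close> with
  \<open>B(s n, s m)\<close>; the last assumption says that every object \<open>J\<close> is a direct summand of \<open>s n\<^sub>1 \<oplus> s n\<^sub>2\<close>
  for suitable \<open>n\<^sub>1\<close>, \<open>n\<^sub>2\<close>.\<close>

locale graded_morita = A: graded_alg H A + B: graded_alg \<Gamma> B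
  for H :: "('h, 'g) monoid_scheme" and A :: "('a, 'h, 'k::field) graded_algebra"
    and \<Gamma> :: "('j, 'l) monoid_scheme" and B :: "('b, 'j, 'k) graded_algebra" +
  fixes s :: "'h \<Rightarrow> 'j" and \<Theta> :: "'h \<Rightarrow> 'h \<Rightarrow> 'a \<Rightarrow> 'b"
  assumes s [simp, intro]: "n \<in> carrier H \<Longrightarrow> s n \<in> carrier \<Gamma>"
    and \<Theta>_bij: "\<lbrakk>n \<in> carrier H; m \<in> carrier H\<rbrakk> \<Longrightarrow>
        bij_betw (\<Theta> n m) (piece A (inv\<^bsub>H\<^esub> n \<otimes>\<^bsub>H\<^esub> m)) (piece B (inv\<^bsub>\<Gamma>\<^esub> s n \<otimes>\<^bsub>\<Gamma>\<^esub> s m))"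
    and \<Theta>_add: "\<lbrakk>n \<in> carrier H; m \<in> carrier H; a \<in> piece A (inv\<^bsub>H\<^esub> n \<otimes>\<^bsub>H\<^esub> m); a' \<in> piece A (inv\<^bsub>H\<^esub> n \<otimes>\<^bsub>H\<^esub> m)\<rbrakk> \<Longrightarrow>
        \<Theta> n m (a \<oplus>\<^bsub>A\<^esub> a') = \<Theta> n m a \<oplus>\<^bsub>B\<^esub> \<Theta> n m a'"
    and \<Theta>_mult: "\<lbrakk>n \<in> carrier H; m \<in> carrier H; p \<in> carrier H; a \<in> piece A (inv\<^bsub>H\<^esub> n \<otimes>\<^bsub>H\<^esub> m); a' \<in> piece A (inv\<^bsub>H\<^esub> m \<otimes>\<^bsub>H\<^esub> p)\<rbrakk> \<Longrightarrow>
        \<Theta> n p (a \<otimes>\<^bsub>A\<^esub> a') = \<Theta> n m a \<otimes>\<^bsub>B\<^esub> \<Theta> m p a'"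
    and \<Theta>_scalar: "n \<in> carrier H \<Longrightarrow> \<Theta> n n (scalar A c) = scalar B c"
    and summand: "J \<in> carrier \<Gamma> \<Longrightarrow> \<exists>n1\<in>carrier H. \<exists>n2\<in>carrier H. \<exists>u1\<in>piece B (inv\<^bsub>\<Gamma>\<^esub> J \<otimes>\<^bsub>\<Gamma>\<^esub> s n1).
        \<exists>v1\<in>piece B (inv\<^bsub>\<Gamma>\<^esub> s n1 \<otimes>\<^bsub>\<Gamma>\<^esub> J). \<exists>u2\<in>piece B (inv\<^bsub>\<Gamma>\<^esub> J \<otimes>\<^bsub>\<Gamma>\<^esub> s n2). \<exists>v2\<in>piece B (inv\<^bsub>\<Gamma>\<^esub> s n2 \<otimes>\<^bsub>\<Gamma>\<^esub> J).
        u1 \<otimes>\<^bsub>B\<^esub> v1 \<oplus>\<^bsub>B\<^esub> u2 \<otimes>\<^bsub>B\<^esub> v2 = \<one>\<^bsub>B\<^esub>"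
begin

section \<open>Restriction and coinduction of graded modules\<close>

lemma \<Theta>_one: "n \<in> carrier H \<Longrightarrow> \<Theta> n n \<one>\<^bsub>A\<^esub> = \<one>\<^bsub>B\<^esub>"
  using \<Theta>_scalar[of n 1] by (simp add: A.scalar_one B.scalar_one)

lemma \<Theta>_piece [simp]: "\<lbrakk>n \<in> carrier H; m \<in> carrier H; a \<in> piece A (inv\<^bsub>H\<^esub> n \<otimes>\<^bsub>H\<^esub> m)\<rbrakk> \<Longrightarrow>
    \<Theta> n m a \<in> piece B (inv\<^bsub>\<Gamma>\<^esub> s n \<otimes>\<^bsub>\<Gamma>\<^esub> s m)"
  using \<Theta>_bij by (meson bij_betwE)

lemma piece_A_carrier: "\<lbrakk>n \<in> carrier H; m \<in> carrier H; a \<in> piece A (inv\<^bsub>H\<^esub> n \<otimes>\<^bsub>H\<^esub> m)\<rbrakk> \<Longrightarrow> a \<in> carrier A"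
  by (rule A.piece_carrier[of "inv\<^bsub>H\<^esub> n \<otimes>\<^bsub>H\<^esub> m"]) auto
lemma piece_B_carrier: "\<lbrakk>J \<in> carrier \<Gamma>; K \<in> carrier \<Gamma>; b \<in> piece B (inv\<^bsub>\<Gamma>\<^esub> J \<otimes>\<^bsub>\<Gamma>\<^esub> K)\<rbrakk> \<Longrightarrow> b \<in> carrier B"
  by (rule B.piece_carrier[of "inv\<^bsub>\<Gamma>\<^esub> J \<otimes>\<^bsub>\<Gamma>\<^esub> K"]) auto

lemma \<Theta>_preimage:
  assumes "n \<in> carrier H" "m \<in> carrier H" "b \<in> piece B (inv\<^bsub>\<Gamma>\<^esub> s n \<otimes>\<^bsub>\<Gamma>\<^esub> s m)"
  obtains a where "a \<in> piece A (inv\<^bsub>H\<^esub> n \<otimes>\<^bsub>H\<^esub> m)" "b = \<Theta> n m a"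
  using \<Theta>_bij[OF assms(1,2)] assms(3) by (auto simp: bij_betw_def)

lemma summandE:
  assumes "J \<in> carrier \<Gamma>"
  obtains n1 n2 u1 v1 u2 v2 where "n1 \<in> carrier H" "n2 \<in> carrier H"
    "u1 \<in> piece B (inv\<^bsub>\<Gamma>\<^esub> J \<otimes>\<^bsub>\<Gamma>\<^esub> s n1)" "v1 \<in> piece B (inv\<^bsub>\<Gamma>\<^esub> s n1 \<otimes>\<^bsub>\<Gamma>\<^esub> J)"
    "u2 \<in> piece B (inv\<^bsub>\<Gamma>\<^esub> J \<otimes>\<^bsub>\<Gamma>\<^esub> s n2)" "v2 \<in> piece B (inv\<^bsub>\<Gamma>\<^esub> s n2 \<otimes>\<^bsub>\<Gamma>\<^esub> J)"
    "u1 \<otimes>\<^bsub>B\<^esub> v1 \<oplus>\<^bsub>B\<^esub> u2 \<otimes>\<^bsub>B\<^esub> v2 = \<one>\<^bsub>B\<^esub>"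
    "u1 \<in> carrier B" "v1 \<in> carrier B" "u2 \<in> carrier B" "v2 \<in> carrier B"
  using summand[OF assms] assms by (meson piece_B_carrier s)

text \<open>Through the bijections \<open>\<psi>\<close>, \<open>M\<close> is the restriction of
  \<open>N\<close> along \<open>s\<close> and \<open>\<Theta>\<close>. It is a relation because the
  carrier of \<open>M\<close> is moved onto a subset of that of \<open>N\<close>; the functor arises
  by choice in \<open>graded_morita_equivalence\<close>.\<close>

definition represents :: "('m, 'j, 'b) graded_module \<Rightarrow> ('n, 'h, 'a) graded_module \<Rightarrow> ('h \<Rightarrow> 'm \<Rightarrow> 'n) \<Rightarrow> bool" where
  "represents N M \<psi> \<longleftrightarrow> (\<forall>n\<in>carrier H. bij_betw (\<psi> n) (piece N (s n)) (piece M n) \<and>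
     (\<forall>v\<in>piece N (s n). \<forall>w\<in>piece N (s n). \<psi> n (v \<oplus>\<^bsub>N\<^esub> w) = \<psi> n v \<oplus>\<^bsub>M\<^esub> \<psi> n w) \<and>
     (\<forall>m\<in>carrier H. \<forall>v\<in>piece N (s n). \<forall>a\<in>piece A (inv\<^bsub>H\<^esub> n \<otimes>\<^bsub>H\<^esub> m). \<psi> m (act N v (\<Theta> n m a)) = act M (\<psi> n v) a))"

lemma act_piece_B:
  assumes "graded_right_module \<Gamma> B N" "J \<in> carrier \<Gamma>" "K \<in> carrier \<Gamma>" "v \<in> piece N J" "b \<in> piece B (inv\<^bsub>\<Gamma>\<^esub> J \<otimes>\<^bsub>\<Gamma>\<^esub> K)"
  shows "act N v b \<in> piece N K"
proof -
  interpret N: gmod \<Gamma> B N by (rule gmodI) fact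
  show ?thesis using N.act_piece[of J "inv\<^bsub>\<Gamma>\<^esub> J \<otimes>\<^bsub>\<Gamma>\<^esub> K" v b] assms by (simp flip: B.G.m_assoc)
qed

text \<open>The same piece of \<open>N\<close> may occur in several degrees (for instance when
  \<open>f\<close> has no roots), whence the external sum. Every summand lies in
  \<open>carrier N\<close>, so the countable sum fits into that set again.\<close>

lemma restriction_exists:
  assumes N: "graded_right_module \<Gamma> B N" and H: "countable (carrier H)" and inf: "infinite (UNIV :: 'k set)"
  obtains M \<psi> where "graded_right_module H A M" "carrier M \<subseteq> carrier N" "represents N M \<psi>"
proof -
  interpret N: gmod \<Gamma> B N by (rule gmodI) fact
  let ?ac = "\<lambda>n m v a. act N v (\<Theta> n m a)"
  interpret S: graded_system H A N "\<lambda>n. piece N (s n)" ?ac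
  proof (intro graded_system.intro graded_system_axioms.intro)
    show "graded_ring H A" "abelian_group N" by (rule A.graded_ring_axioms N.M.abelian_group_axioms)+
    fix n assume n: "n \<in> carrier H"
    show "additive_subgroup (piece N (s n)) N" by (rule N.M.piece_subgroup[OF s[OF n]])
    fix m v a assume m: "m \<in> carrier H" and v: "v \<in> piece N (s n)" and a: "a \<in> piece A (inv\<^bsub>H\<^esub> n \<otimes>\<^bsub>H\<^esub> m)"
    have vc: "v \<in> carrier N" using v n by (auto intro: N.M.piece_carrier[OF s])
    have \<Theta>a: "\<Theta> n m a \<in> carrier B" using piece_B_carrier[OF s s \<Theta>_piece] n m a by auto
    show "act N v (\<Theta> n m a) \<in> piece N (s m)" by (rule act_piece_B[OF N s[OF n] s[OF m] v \<Theta>_piece[OF n m a]])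
    {
      fix w assume w: "w \<in> piece N (s n)"
      then have "w \<in> carrier N" using n by (auto intro: N.M.piece_carrier[OF s])
      then show "act N (v \<oplus>\<^bsub>N\<^esub> w) (\<Theta> n m a) = act N v (\<Theta> n m a) \<oplus>\<^bsub>N\<^esub> act N w (\<Theta> n m a)"
        using vc \<Theta>a by (simp add: N.act_add)
    next
      fix b assume b: "b \<in> piece A (inv\<^bsub>H\<^esub> n \<otimes>\<^bsub>H\<^esub> m)"
      have "\<Theta> n m b \<in> carrier B" using piece_B_carrier[OF s s \<Theta>_piece] n m b by auto
      then show "act N v (\<Theta> n m (a \<oplus>\<^bsub>A\<^esub> b)) = act N v (\<Theta> n m a) \<oplus>\<^bsub>N\<^esub> act N v (\<Theta> n m b)"
        using vc \<Theta>a \<Theta>_add[OF n m a b] by (simp add: N.act_add_right)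
    next
      fix l b assume l: "l \<in> carrier H" and b: "b \<in> piece A (inv\<^bsub>H\<^esub> m \<otimes>\<^bsub>H\<^esub> l)"
      have "\<Theta> m l b \<in> carrier B" using piece_B_carrier[OF s s \<Theta>_piece] l m b by auto
      then show "act N v (\<Theta> n l (a \<otimes>\<^bsub>A\<^esub> b)) = act N (act N v (\<Theta> n m a)) (\<Theta> m l b)"
        using vc \<Theta>a \<Theta>_mult[OF n m l a b] by (simp add: N.act_mult)
    }
  next
    fix n v assume "n \<in> carrier H" "v \<in> piece N (s n)"
    then show "act N v (\<Theta> n n \<one>\<^bsub>A\<^esub>) = v" by (simp add: \<Theta>_one N.M.piece_carrier[OF s])
  qed
  have "piece N (s i) \<lesssim> carrier N" if "i \<in> carrier H" for i
    by (rule subset_imp_lepoll) (use that in \<open>auto intro: N.M.piece_carrier[OF s]\<close>)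
  from S.module_in_universe[OF H this _ B.finite_module_trivial[OF N _ inf]] N.M.zero_closed
  obtain M \<psi> where "graded_right_module H A M" "carrier M \<subseteq> carrier N"
    "(\<forall>i\<in>carrier H. bij_betw (\<psi> i) (piece N (s i)) (piece M i) \<and>
      (\<forall>v\<in>piece N (s i). \<forall>w\<in>piece N (s i). \<psi> i (v \<oplus>\<^bsub>N\<^esub> w) = \<psi> i v \<oplus>\<^bsub>M\<^esub> \<psi> i w) \<and>
      (\<forall>k\<in>carrier H. \<forall>v\<in>piece N (s i). \<forall>a\<in>piece A (inv\<^bsub>H\<^esub> i \<otimes>\<^bsub>H\<^esub> k). \<psi> k (act N v (\<Theta> i k a)) = act M (\<psi> i v) a))"
    by blast
  then show ?thesis using that unfolding represents_def by blast
qed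

definition coind_group :: "('m, 'h, 'a) graded_module \<Rightarrow> ('h \<times> 'b \<Rightarrow> 'm) ring" where
  "coind_group M = \<lparr>carrier = (carrier H \<times> carrier B) \<rightarrow>\<^sub>E carrier M, monoid.mult = undefined, monoid.one = undefined,
     ring.zero = (\<lambda>x\<in>carrier H \<times> carrier B. \<zero>\<^bsub>M\<^esub>), ring.add = (\<lambda>\<phi> \<chi>. \<lambda>x\<in>carrier H \<times> carrier B. \<phi> x \<oplus>\<^bsub>M\<^esub> \<chi> x)\<rparr>"

text \<open>An element of degree \<open>J\<close> is a natural transformation from \<open>n \<mapsto> B(J, s n)\<close> to \<open>n \<mapsto> M\<^sub>n\<close>.\<close>

definition coind :: "('m, 'h, 'a) graded_module \<Rightarrow> 'j \<Rightarrow> ('h \<times> 'b \<Rightarrow> 'm) set" where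
  "coind M J = {\<phi> \<in> carrier (coind_group M). \<forall>n\<in>carrier H.
     (\<forall>b\<in>carrier B. b \<notin> piece B (inv\<^bsub>\<Gamma>\<^esub> J \<otimes>\<^bsub>\<Gamma>\<^esub> s n) \<longrightarrow> \<phi> (n, b) = \<zero>\<^bsub>M\<^esub>) \<and>
     (\<forall>b\<in>piece B (inv\<^bsub>\<Gamma>\<^esub> J \<otimes>\<^bsub>\<Gamma>\<^esub> s n). \<phi> (n, b) \<in> piece M n \<and>
        (\<forall>b'\<in>piece B (inv\<^bsub>\<Gamma>\<^esub> J \<otimes>\<^bsub>\<Gamma>\<^esub> s n). \<phi> (n, b \<oplus>\<^bsub>B\<^esub> b') = \<phi> (n, b) \<oplus>\<^bsub>M\<^esub> \<phi> (n, b')) \<and>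
        (\<forall>m\<in>carrier H. \<forall>a\<in>piece A (inv\<^bsub>H\<^esub> n \<otimes>\<^bsub>H\<^esub> m). \<phi> (m, b \<otimes>\<^bsub>B\<^esub> \<Theta> n m a) = act M (\<phi> (n, b)) a))}"

lemma coindD:
  assumes "\<phi> \<in> coind M J"
  shows "\<phi> \<in> carrier (coind_group M)"
    "\<And>n b. n \<in> carrier H \<Longrightarrow> b \<in> carrier B \<Longrightarrow> b \<notin> piece B (inv\<^bsub>\<Gamma>\<^esub> J \<otimes>\<^bsub>\<Gamma>\<^esub> s n) \<Longrightarrow> \<phi> (n, b) = \<zero>\<^bsub>M\<^esub>"
    "\<And>n b. n \<in> carrier H \<Longrightarrow> b \<in> piece B (inv\<^bsub>\<Gamma>\<^esub> J \<otimes>\<^bsub>\<Gamma>\<^esub> s n) \<Longrightarrow> \<phi> (n, b) \<in> piece M n"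
    "\<And>n b b'. n \<in> carrier H \<Longrightarrow> b \<in> piece B (inv\<^bsub>\<Gamma>\<^esub> J \<otimes>\<^bsub>\<Gamma>\<^esub> s n) \<Longrightarrow> b' \<in> piece B (inv\<^bsub>\<Gamma>\<^esub> J \<otimes>\<^bsub>\<Gamma>\<^esub> s n) \<Longrightarrow>
        \<phi> (n, b \<oplus>\<^bsub>B\<^esub> b') = \<phi> (n, b) \<oplus>\<^bsub>M\<^esub> \<phi> (n, b')"
    "\<And>n b m a. n \<in> carrier H \<Longrightarrow> b \<in> piece B (inv\<^bsub>\<Gamma>\<^esub> J \<otimes>\<^bsub>\<Gamma>\<^esub> s n) \<Longrightarrow> m \<in> carrier H \<Longrightarrow> a \<in> piece A (inv\<^bsub>H\<^esub> n \<otimes>\<^bsub>H\<^esub> m) \<Longrightarrow>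
        \<phi> (m, b \<otimes>\<^bsub>B\<^esub> \<Theta> n m a) = act M (\<phi> (n, b)) a"
  using assms unfolding coind_def mem_Collect_eq by meson+

lemma coindI:
  assumes "\<phi> \<in> carrier (coind_group M)"
    "\<And>n b. n \<in> carrier H \<Longrightarrow> b \<in> carrier B \<Longrightarrow> b \<notin> piece B (inv\<^bsub>\<Gamma>\<^esub> J \<otimes>\<^bsub>\<Gamma>\<^esub> s n) \<Longrightarrow> \<phi> (n, b) = \<zero>\<^bsub>M\<^esub>"
    "\<And>n b. n \<in> carrier H \<Longrightarrow> b \<in> piece B (inv\<^bsub>\<Gamma>\<^esub> J \<otimes>\<^bsub>\<Gamma>\<^esub> s n) \<Longrightarrow> \<phi> (n, b) \<in> piece M n"
    "\<And>n b b'. n \<in> carrier H \<Longrightarrow> b \<in> piece B (inv\<^bsub>\<Gamma>\<^esub> J \<otimes>\<^bsub>\<Gamma>\<^esub> s n) \<Longrightarrow> b' \<in> piece B (inv\<^bsub>\<Gamma>\<^esub> J \<otimes>\<^bsub>\<Gamma>\<^esub> s n) \<Longrightarrow>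
        \<phi> (n, b \<oplus>\<^bsub>B\<^esub> b') = \<phi> (n, b) \<oplus>\<^bsub>M\<^esub> \<phi> (n, b')"
    "\<And>n b m a. n \<in> carrier H \<Longrightarrow> b \<in> piece B (inv\<^bsub>\<Gamma>\<^esub> J \<otimes>\<^bsub>\<Gamma>\<^esub> s n) \<Longrightarrow> m \<in> carrier H \<Longrightarrow> a \<in> piece A (inv\<^bsub>H\<^esub> n \<otimes>\<^bsub>H\<^esub> m) \<Longrightarrow>
        \<phi> (m, b \<otimes>\<^bsub>B\<^esub> \<Theta> n m a) = act M (\<phi> (n, b)) a"
  shows "\<phi> \<in> coind M J"
  unfolding coind_def mem_Collect_eq using assms by meson

lemma coind_group_simps:
  "carrier (coind_group M) = (carrier H \<times> carrier B) \<rightarrow>\<^sub>E carrier M"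
  "\<zero>\<^bsub>coind_group M\<^esub> = (\<lambda>x\<in>carrier H \<times> carrier B. \<zero>\<^bsub>M\<^esub>)"
  "\<phi> \<oplus>\<^bsub>coind_group M\<^esub> \<chi> = (\<lambda>x\<in>carrier H \<times> carrier B. \<phi> x \<oplus>\<^bsub>M\<^esub> \<chi> x)"
  by (simp_all add: coind_group_def)

lemma coind_group:
  assumes "abelian_group M" shows "abelian_group (coind_group M)"
proof -
  interpret M: abelian_group M by fact
  show ?thesis
  proof (rule abelian_groupI; (simp only: coind_group_simps)?)
    fix x assume x: "x \<in> (carrier H \<times> carrier B) \<rightarrow>\<^sub>E carrier M"
    then have "x y \<in> carrier M" if "y \<in> carrier H \<times> carrier B" for y using that by (rule PiE_mem)
    then show "\<exists>y\<in>carrier H \<times> carrier B \<rightarrow>\<^sub>E carrier M.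
             (\<lambda>z\<in>carrier H \<times> carrier B. y z \<oplus>\<^bsub>M\<^esub> x z) = (\<lambda>x\<in>carrier H \<times> carrier B. \<zero>\<^bsub>M\<^esub>)"
      by (intro bexI[where x = "\<lambda>y\<in>carrier H \<times> carrier B. \<ominus>\<^bsub>M\<^esub> x y"] restrict_ext)
        (auto simp: M.l_neg)
    show "(\<lambda>z\<in>carrier H \<times> carrier B. (\<lambda>x\<in>carrier H \<times> carrier B. \<zero>\<^bsub>M\<^esub>) z \<oplus>\<^bsub>M\<^esub> x z) = x"
      using x by (auto simp: fun_eq_iff PiE_iff extensional_def)
  qed (auto simp: fun_eq_iff M.a_ac PiE_iff)
qed

text \<open>Coinduction, the right adjoint of restriction, with \<open>B\<close> acting by
  precomposition. At the degrees \<open>s n\<close> the Yoneda lemma returns \<open>M\<close>,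
  because \<open>\<Theta>\<close> identifies the morphisms from \<open>s n\<close> to
  \<open>s m\<close> with those from \<open>n\<close> to \<open>m\<close>. The assumption
  \<open>summand\<close> bounds the size of each degree.\<close>

lemma coinduction_exists:
  assumes M: "graded_right_module H A M" and \<Gamma>: "countable (carrier \<Gamma>)" and inf: "infinite (UNIV :: 'k set)"
  obtains N \<psi> where "graded_right_module \<Gamma> B N" "carrier N \<subseteq> carrier M" "represents N M \<psi>"
proof -
  interpret M: gmod H A M by (rule gmodI) fact
  let ?V = "coind_group M"
  interpret V: abelian_group ?V by (rule coind_group) (rule M.M.abelian_group_axioms)
  note Vs = coind_group_simps
  have Vc: "\<phi> (n, b) \<in> carrier M" if "\<phi> \<in> carrier ?V" "n \<in> carrier H" "b \<in> carrier B" for \<phi> n b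
    using that by (auto simp: Vs PiE_iff)
  have Vum: "\<ominus>\<^bsub>?V\<^esub> \<phi> = (\<lambda>x\<in>carrier H \<times> carrier B. \<ominus>\<^bsub>M\<^esub> \<phi> x)" if "\<phi> \<in> carrier ?V" for \<phi>
    by (rule V.minus_equality) (use that in \<open>auto simp: Vs fun_eq_iff M.M.l_neg PiE_iff\<close>)
  \<comment> \<open>Precomposition with left multiplication by \<open>b'\<close>; the case
    distinction restores the extension by zero.\<close>
  let ?ac = "\<lambda>J K \<phi> b'. (\<lambda>(n, b)\<in>carrier H \<times> carrier B. if b \<in> piece B (inv\<^bsub>\<Gamma>\<^esub> K \<otimes>\<^bsub>\<Gamma>\<^esub> s n) then \<phi> (n, b' \<otimes>\<^bsub>B\<^esub> b) else \<zero>\<^bsub>M\<^esub>)"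
  note pc = piece_B_carrier[OF _ s]
  have act0: "act M \<zero>\<^bsub>M\<^esub> a = \<zero>\<^bsub>M\<^esub>" if "a \<in> carrier A" for a
    using additive_zero[OF M.M.abelian_group_axioms M.M.abelian_group_axioms, of "\<lambda>m. act M m a"] that
    by (auto simp: M.act_add)
  have act_um: "act M (\<ominus>\<^bsub>M\<^esub> m) a = \<ominus>\<^bsub>M\<^esub> act M m a" if "a \<in> carrier A" "m \<in> carrier M" for m a
    using additive_uminus[OF M.M.abelian_group_axioms M.M.abelian_group_axioms, of "\<lambda>m. act M m a"] that
    by (auto simp: M.act_add)
  have b\<Theta>: "b \<otimes>\<^bsub>B\<^esub> \<Theta> n m a \<in> piece B (inv\<^bsub>\<Gamma>\<^esub> J \<otimes>\<^bsub>\<Gamma>\<^esub> s m)"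
    if "J \<in> carrier \<Gamma>" "n \<in> carrier H" "m \<in> carrier H" "b \<in> piece B (inv\<^bsub>\<Gamma>\<^esub> J \<otimes>\<^bsub>\<Gamma>\<^esub> s n)" "a \<in> piece A (inv\<^bsub>H\<^esub> n \<otimes>\<^bsub>H\<^esub> m)"
    for J n m a b
    by (rule B.inv_mult_piece[of J "s n" "s m"]) (use that in auto)
  have padd: "b \<oplus>\<^bsub>B\<^esub> b' \<in> piece B (inv\<^bsub>\<Gamma>\<^esub> J \<otimes>\<^bsub>\<Gamma>\<^esub> K)" if "J \<in> carrier \<Gamma>" "K \<in> carrier \<Gamma>"
    "b \<in> piece B (inv\<^bsub>\<Gamma>\<^esub> J \<otimes>\<^bsub>\<Gamma>\<^esub> K)" "b' \<in> piece B (inv\<^bsub>\<Gamma>\<^esub> J \<otimes>\<^bsub>\<Gamma>\<^esub> K)" for J K b b'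
    by (rule B.piece_add) (use that in auto)
  interpret S: graded_system \<Gamma> B ?V "coind M" ?ac
  proof (intro graded_system.intro graded_system_axioms.intro)
    show "graded_ring \<Gamma> B" "abelian_group ?V" by (rule B.graded_ring_axioms V.abelian_group_axioms)+
    fix J assume J: "J \<in> carrier \<Gamma>"
    show "additive_subgroup (coind M J) ?V"
    proof (rule additive_subgroup.intro, rule V.add.subgroupI)
      show "coind M J \<subseteq> carrier ?V" by (auto simp: coind_def)
      have "\<zero>\<^bsub>?V\<^esub> \<in> coind M J"
        by (rule coindI) (auto simp: Vs pc[OF J] padd[OF J] piece_A_carrier act0 pc[OF J _ b\<Theta>[OF J]])
      then show "coind M J \<noteq> {}" by blast
      fix \<phi> assume \<phi>: "\<phi> \<in> coind M J"
      note \<phi>D = coindD[OF \<phi>]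
      show "\<ominus>\<^bsub>?V\<^esub> \<phi> \<in> coind M J"
        unfolding Vum[OF \<phi>D(1)]
        by (rule coindI)
          (use \<phi>D(2-5) Vc[OF \<phi>D(1)] in
            \<open>auto simp: Vs pc[OF J] padd[OF J] piece_A_carrier act_um M.M.minus_add pc[OF J _ b\<Theta>[OF J]]\<close>)
      fix \<chi> assume \<chi>: "\<chi> \<in> coind M J"
      note \<chi>D = coindD[OF \<chi>]
      show "\<phi> \<oplus>\<^bsub>?V\<^esub> \<chi> \<in> coind M J"
        unfolding Vs(3)
        by (rule coindI)
          (use \<phi>D(2-5) Vc[OF \<phi>D(1)] \<chi>D(2-5) Vc[OF \<chi>D(1)] in
            \<open>auto simp: Vs pc[OF J] padd[OF J] piece_A_carrier M.act_add M.M.a_ac pc[OF J _ b\<Theta>[OF J]]\<close>)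
    qed
    {
      fix \<phi> assume \<phi>: "\<phi> \<in> coind M J"
      show "?ac J J \<phi> \<one>\<^bsub>B\<^esub> = \<phi>"
        using coindD(1,2)[OF \<phi>] by (auto simp: fun_eq_iff Vs PiE_iff extensional_def)
    }
    fix K \<phi> b assume K: "K \<in> carrier \<Gamma>" and \<phi>: "\<phi> \<in> coind M J" and b: "b \<in> piece B (inv\<^bsub>\<Gamma>\<^esub> J \<otimes>\<^bsub>\<Gamma>\<^esub> K)"
    note \<phi>D = coindD[OF \<phi>]
    have bc: "b \<in> carrier B" using piece_B_carrier[OF J K b] .
    have mp: "b \<otimes>\<^bsub>B\<^esub> c \<in> piece B (inv\<^bsub>\<Gamma>\<^esub> J \<otimes>\<^bsub>\<Gamma>\<^esub> s n)" if "n \<in> carrier H" "c \<in> piece B (inv\<^bsub>\<Gamma>\<^esub> K \<otimes>\<^bsub>\<Gamma>\<^esub> s n)" for n c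
      by (rule B.inv_mult_piece[of J K]) (use J K b that in auto)
    have \<Theta>c: "\<Theta> n m a \<in> carrier B" if "n \<in> carrier H" "m \<in> carrier H" "a \<in> piece A (inv\<^bsub>H\<^esub> n \<otimes>\<^bsub>H\<^esub> m)" for n m a
      using piece_B_carrier[OF s s \<Theta>_piece] that by auto
    show "?ac J K \<phi> b \<in> coind M K"
    proof (rule coindI)
      show "?ac J K \<phi> b \<in> carrier ?V"
        using Vc[OF \<phi>D(1)] bc by (auto simp: Vs)
    qed (auto simp: pc[OF K] padd[OF K] b\<Theta>[OF K] mp bc \<phi>D(3,4) B.r_distr pc[OF K _ b\<Theta>[OF K]] \<phi>D(5) \<Theta>c simp flip: B.m_assoc)
    {
      fix \<chi> assume \<chi>: "\<chi> \<in> coind M J"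
      show "?ac J K (\<phi> \<oplus>\<^bsub>?V\<^esub> \<chi>) b = ?ac J K \<phi> b \<oplus>\<^bsub>?V\<^esub> ?ac J K \<chi> b"
        using bc by (auto simp: Vs fun_eq_iff)
    next
      fix b' assume b': "b' \<in> piece B (inv\<^bsub>\<Gamma>\<^esub> J \<otimes>\<^bsub>\<Gamma>\<^esub> K)"
      have b'c: "b' \<in> carrier B" using piece_B_carrier[OF J K b'] .
      have mp': "b' \<otimes>\<^bsub>B\<^esub> c \<in> piece B (inv\<^bsub>\<Gamma>\<^esub> J \<otimes>\<^bsub>\<Gamma>\<^esub> s n)" if "n \<in> carrier H" "c \<in> piece B (inv\<^bsub>\<Gamma>\<^esub> K \<otimes>\<^bsub>\<Gamma>\<^esub> s n)" for n c
        by (rule B.inv_mult_piece[of J K]) (use J K b' that in auto)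
      show "?ac J K \<phi> (b \<oplus>\<^bsub>B\<^esub> b') = ?ac J K \<phi> b \<oplus>\<^bsub>?V\<^esub> ?ac J K \<phi> b'"
        using bc b'c mp mp' by (auto simp: Vs fun_eq_iff B.l_distr \<phi>D(4))
    next
      fix L b' assume L: "L \<in> carrier \<Gamma>" and b': "b' \<in> piece B (inv\<^bsub>\<Gamma>\<^esub> K \<otimes>\<^bsub>\<Gamma>\<^esub> L)"
      have b'c: "b' \<in> carrier B" using piece_B_carrier[OF K L b'] .
      have mp': "b' \<otimes>\<^bsub>B\<^esub> c \<in> piece B (inv\<^bsub>\<Gamma>\<^esub> K \<otimes>\<^bsub>\<Gamma>\<^esub> s n)" if "n \<in> carrier H" "c \<in> piece B (inv\<^bsub>\<Gamma>\<^esub> L \<otimes>\<^bsub>\<Gamma>\<^esub> s n)" for n c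
        by (rule B.inv_mult_piece[of K L]) (use K L b' that in auto)
      show "?ac J L \<phi> (b \<otimes>\<^bsub>B\<^esub> b') = ?ac K L (?ac J K \<phi> b) b'"
        using bc b'c mp' by (auto simp: fun_eq_iff B.m_assoc)
    }
  qed
  \<comment> \<open>A transformation is determined by its values at \<open>u1\<close> and
    \<open>u2\<close>, so each degree embeds into the square of \<open>carrier M\<close>.\<close>
  have lep: "coind M J \<lesssim> carrier M" if J: "J \<in> carrier \<Gamma>" for J
  proof -
    obtain n1 n2 u1 v1 u2 v2 where n: "n1 \<in> carrier H" "n2 \<in> carrier H"
      and uv: "u1 \<in> piece B (inv\<^bsub>\<Gamma>\<^esub> J \<otimes>\<^bsub>\<Gamma>\<^esub> s n1)" "v1 \<in> piece B (inv\<^bsub>\<Gamma>\<^esub> s n1 \<otimes>\<^bsub>\<Gamma>\<^esub> J)"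
       "u2 \<in> piece B (inv\<^bsub>\<Gamma>\<^esub> J \<otimes>\<^bsub>\<Gamma>\<^esub> s n2)" "v2 \<in> piece B (inv\<^bsub>\<Gamma>\<^esub> s n2 \<otimes>\<^bsub>\<Gamma>\<^esub> J)"
      and one: "u1 \<otimes>\<^bsub>B\<^esub> v1 \<oplus>\<^bsub>B\<^esub> u2 \<otimes>\<^bsub>B\<^esub> v2 = \<one>\<^bsub>B\<^esub>"
      and uvc: "u1 \<in> carrier B" "v1 \<in> carrier B" "u2 \<in> carrier B" "v2 \<in> carrier B"
      by (rule summandE[OF J])
    \<comment> \<open>Write \<open>b\<close> as \<open>u1 (v1 b) + u2 (v2 b)\<close>. Both
      \<open>v1 b\<close> and \<open>v2 b\<close> are morphisms between degrees of the form
      \<open>s n\<close>, hence come from \<open>A\<close>, and naturality pulls them out as actions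
      on \<open>M\<close>.\<close>
    have det: "\<exists>a1 a2. \<forall>\<phi>\<in>coind M J. \<phi> (m, b) = act M (\<phi> (n1, u1)) a1 \<oplus>\<^bsub>M\<^esub> act M (\<phi> (n2, u2)) a2"
      if m: "m \<in> carrier H" and b: "b \<in> piece B (inv\<^bsub>\<Gamma>\<^esub> J \<otimes>\<^bsub>\<Gamma>\<^esub> s m)" for m b
    proof -
      have bc: "b \<in> carrier B" using pc[OF J m b] .
      have 1: "v1 \<otimes>\<^bsub>B\<^esub> b \<in> piece B (inv\<^bsub>\<Gamma>\<^esub> s n1 \<otimes>\<^bsub>\<Gamma>\<^esub> s m)" "v2 \<otimes>\<^bsub>B\<^esub> b \<in> piece B (inv\<^bsub>\<Gamma>\<^esub> s n2 \<otimes>\<^bsub>\<Gamma>\<^esub> s m)"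
        by (rule B.inv_mult_piece[of _ J]; use n m J uv b in auto)+
      obtain a1 where a1: "a1 \<in> piece A (inv\<^bsub>H\<^esub> n1 \<otimes>\<^bsub>H\<^esub> m)" "v1 \<otimes>\<^bsub>B\<^esub> b = \<Theta> n1 m a1"
        using \<Theta>_preimage[OF n(1) m 1(1)] by blast
      obtain a2 where a2: "a2 \<in> piece A (inv\<^bsub>H\<^esub> n2 \<otimes>\<^bsub>H\<^esub> m)" "v2 \<otimes>\<^bsub>B\<^esub> b = \<Theta> n2 m a2"
        using \<Theta>_preimage[OF n(2) m 1(2)] by blast
      have "b = (u1 \<otimes>\<^bsub>B\<^esub> v1 \<oplus>\<^bsub>B\<^esub> u2 \<otimes>\<^bsub>B\<^esub> v2) \<otimes>\<^bsub>B\<^esub> b" using bc by (simp add: one)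
      also have "\<dots> = u1 \<otimes>\<^bsub>B\<^esub> \<Theta> n1 m a1 \<oplus>\<^bsub>B\<^esub> u2 \<otimes>\<^bsub>B\<^esub> \<Theta> n2 m a2"
        using bc uvc by (simp add: B.l_distr B.m_assoc a1 a2)
      finally have beq: "b = u1 \<otimes>\<^bsub>B\<^esub> \<Theta> n1 m a1 \<oplus>\<^bsub>B\<^esub> u2 \<otimes>\<^bsub>B\<^esub> \<Theta> n2 m a2" .
      have "\<phi> (m, b) = act M (\<phi> (n1, u1)) a1 \<oplus>\<^bsub>M\<^esub> act M (\<phi> (n2, u2)) a2" if \<phi>: "\<phi> \<in> coind M J" for \<phi>
      proof -
        have "\<phi> (m, b) = \<phi> (m, u1 \<otimes>\<^bsub>B\<^esub> \<Theta> n1 m a1) \<oplus>\<^bsub>M\<^esub> \<phi> (m, u2 \<otimes>\<^bsub>B\<^esub> \<Theta> n2 m a2)"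
          unfolding beq by (rule coindD(4)[OF \<phi>]) (use b\<Theta> J n m uv a1 a2 in auto)
        then show ?thesis using coindD(5)[OF \<phi>] n m uv a1 a2 by simp
      qed
      then show ?thesis by blast
    qed
    have "inj_on (\<lambda>\<phi>. (\<phi> (n1, u1), \<phi> (n2, u2))) (coind M J)"
    proof (rule inj_onI)
      fix \<phi> \<chi> assume \<phi>: "\<phi> \<in> coind M J" and \<chi>: "\<chi> \<in> coind M J"
        and eq: "(\<phi> (n1, u1), \<phi> (n2, u2)) = (\<chi> (n1, u1), \<chi> (n2, u2))"
      show "\<phi> = \<chi>"
      proof (rule PiE_ext[of _ "carrier H \<times> carrier B"])
        show "\<phi> \<in> Pi\<^sub>E (carrier H \<times> carrier B) (\<lambda>_. carrier M)" "\<chi> \<in> Pi\<^sub>E (carrier H \<times> carrier B) (\<lambda>_. carrier M)"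
          using coindD(1)[OF \<phi>] coindD(1)[OF \<chi>] by (simp_all add: Vs)
        fix x assume "x \<in> carrier H \<times> carrier B"
        then obtain m b where x: "x = (m, b)" "m \<in> carrier H" "b \<in> carrier B" by blast
        show "\<phi> x = \<chi> x"
        proof (cases "b \<in> piece B (inv\<^bsub>\<Gamma>\<^esub> J \<otimes>\<^bsub>\<Gamma>\<^esub> s m)")
          case True
          from det[OF x(2) True] \<phi> \<chi> eq show ?thesis unfolding x(1) by (metis prod.inject)
        qed (use x coindD(2)[OF \<phi>] coindD(2)[OF \<chi>] in simp)
      qed
    qed
    moreover have "(\<lambda>\<phi>. (\<phi> (n1, u1), \<phi> (n2, u2))) ` coind M J \<subseteq> carrier M \<times> carrier M"
      using Vc[OF coindD(1)] n uvc by auto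
    ultimately have le: "coind M J \<lesssim> carrier M \<times> carrier M" unfolding lepoll_def by blast
    show ?thesis
    proof (cases "finite (carrier M)")
      case True
      then have "carrier M = {\<zero>\<^bsub>M\<^esub>}" using A.finite_module_trivial[OF M _ inf] by blast
      then have "carrier M \<times> carrier M \<lesssim> carrier M"
        unfolding lepoll_def by (intro exI[of _ fst]) (auto simp: inj_on_def)
      with le show ?thesis by (rule lepoll_trans)
    next
      case False
      then show ?thesis using le lepoll_times_infinite[OF False lepoll_refl lepoll_refl] lepoll_trans by blast
    qed
  qed
  have triv: "carrier ?V = {\<zero>\<^bsub>?V\<^esub>}" if "finite (carrier M)"
  proof -
    have "carrier M = {\<zero>\<^bsub>M\<^esub>}" using A.finite_module_trivial[OF M that inf] .
    then have "\<phi> = \<zero>\<^bsub>?V\<^esub>" if "\<phi> \<in> carrier ?V" for \<phi>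
      using that by (auto simp: Vs fun_eq_iff PiE_iff extensional_def)
    then show ?thesis using V.zero_closed by blast
  qed
  have ne: "carrier M \<noteq> {}" using M.M.zero_closed by blast
  obtain N \<chi> where N: "graded_right_module \<Gamma> B N" "carrier N \<subseteq> carrier M"
    and *: "\<forall>J\<in>carrier \<Gamma>. bij_betw (\<chi> J) (coind M J) (piece N J) \<and>
      (\<forall>v\<in>coind M J. \<forall>w\<in>coind M J. \<chi> J (v \<oplus>\<^bsub>?V\<^esub> w) = \<chi> J v \<oplus>\<^bsub>N\<^esub> \<chi> J w) \<and>
      (\<forall>K\<in>carrier \<Gamma>. \<forall>v\<in>coind M J. \<forall>a\<in>piece B (inv\<^bsub>\<Gamma>\<^esub> J \<otimes>\<^bsub>\<Gamma>\<^esub> K). \<chi> K (?ac J K v a) = act N (\<chi> J v) a)"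
    by (rule exE[OF S.module_in_universe[OF \<Gamma> lep ne triv]], assumption, assumption, elim exE conjE, rule that)
  have \<chi>: "\<And>J. J \<in> carrier \<Gamma> \<Longrightarrow> bij_betw (\<chi> J) (coind M J) (piece N J)"
    and \<chi>_add: "\<And>J v w. J \<in> carrier \<Gamma> \<Longrightarrow> v \<in> coind M J \<Longrightarrow> w \<in> coind M J \<Longrightarrow> \<chi> J (v \<oplus>\<^bsub>?V\<^esub> w) = \<chi> J v \<oplus>\<^bsub>N\<^esub> \<chi> J w"
    using * by blast+
  have \<chi>_ac: "\<chi> K (?ac J K v a) = act N (\<chi> J v) a"
    if "J \<in> carrier \<Gamma>" "K \<in> carrier \<Gamma>" "v \<in> coind M J" "a \<in> piece B (inv\<^bsub>\<Gamma>\<^esub> J \<otimes>\<^bsub>\<Gamma>\<^esub> K)" for J K v a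
    using *[THEN bspec, OF that(1), THEN conjunct2, THEN conjunct2, THEN bspec, OF that(2), THEN bspec, OF that(3), THEN bspec, OF that(4)] .
  define \<chi>' where "\<chi>' J = inv_into (coind M J) (\<chi> J)" for J
  have \<chi>': "\<chi>' J v \<in> coind M J" "\<chi> J (\<chi>' J v) = v" if "J \<in> carrier \<Gamma>" "v \<in> piece N J" for J v
    using bij_betwE[OF bij_betw_inv_into[OF \<chi>[OF that(1)]]] bij_betw_inv_into_right[OF \<chi>[OF that(1)]] that(2)
    unfolding \<chi>'_def by auto
  have \<chi>'\<chi>: "\<chi>' J (\<chi> J v) = v" if "J \<in> carrier \<Gamma>" "v \<in> coind M J" for J v
    using \<chi>[OF that(1)] that(2) unfolding \<chi>'_def bij_betw_def by simp
  define \<psi> where "\<psi> n v = \<chi>' (s n) v (n, \<one>\<^bsub>B\<^esub>)" for n v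
  have one_piece: "\<one>\<^bsub>B\<^esub> \<in> piece B (inv\<^bsub>\<Gamma>\<^esub> s n \<otimes>\<^bsub>\<Gamma>\<^esub> s n)" if "n \<in> carrier H" for n
    using that by simp
  \<comment> \<open>The Yoneda lemma: every \<open>b\<close> out of \<open>s n\<close> is the
    identity followed by some \<open>\<Theta> n m a\<close>, so the value at the identity determines
    the transformation and may be prescribed.\<close>
  have ev: "bij_betw (\<lambda>\<phi>. \<phi> (n, \<one>\<^bsub>B\<^esub>)) (coind M (s n)) (piece M n)" if n: "n \<in> carrier H" for n
    unfolding bij_betw_def
  proof (intro conjI inj_onI equalityI subsetI)
    fix \<phi> \<chi> assume \<phi>: "\<phi> \<in> coind M (s n)" and \<chi>: "\<chi> \<in> coind M (s n)" and eq: "\<phi> (n, \<one>\<^bsub>B\<^esub>) = \<chi> (n, \<one>\<^bsub>B\<^esub>)"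
    show "\<phi> = \<chi>"
    proof (rule PiE_ext[of _ "carrier H \<times> carrier B"])
      show "\<phi> \<in> Pi\<^sub>E (carrier H \<times> carrier B) (\<lambda>_. carrier M)" "\<chi> \<in> Pi\<^sub>E (carrier H \<times> carrier B) (\<lambda>_. carrier M)"
        using coindD(1)[OF \<phi>] coindD(1)[OF \<chi>] by (simp_all add: Vs)
      fix x assume "x \<in> carrier H \<times> carrier B"
      then obtain m b where x: "x = (m, b)" "m \<in> carrier H" "b \<in> carrier B" by blast
      show "\<phi> x = \<chi> x"
      proof (cases "b \<in> piece B (inv\<^bsub>\<Gamma>\<^esub> s n \<otimes>\<^bsub>\<Gamma>\<^esub> s m)")
        case True
        then obtain a where a: "a \<in> piece A (inv\<^bsub>H\<^esub> n \<otimes>\<^bsub>H\<^esub> m)" "b = \<Theta> n m a" using \<Theta>_preimage n x(2) by blast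
        then have "b = \<one>\<^bsub>B\<^esub> \<otimes>\<^bsub>B\<^esub> \<Theta> n m a" using x(3) by simp
        then show ?thesis
          using coindD(5)[OF \<phi> n one_piece[OF n] x(2) a(1)] coindD(5)[OF \<chi> n one_piece[OF n] x(2) a(1)] eq x(1) by simp
      qed (use x coindD(2)[OF \<phi>] coindD(2)[OF \<chi>] in simp)
    qed
  next
    fix x assume "x \<in> (\<lambda>\<phi>. \<phi> (n, \<one>\<^bsub>B\<^esub>)) ` coind M (s n)"
    then show "x \<in> piece M n" using coindD(3)[OF _ n one_piece[OF n]] by blast
  next
    fix x assume x: "x \<in> piece M n"
    then have xc: "x \<in> carrier M" using n by (rule M.M.piece_carrier[rotated])
    define \<Theta>' where "\<Theta>' m = inv_into (piece A (inv\<^bsub>H\<^esub> n \<otimes>\<^bsub>H\<^esub> m)) (\<Theta> n m)" for m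
    have \<Theta>': "\<Theta>' m b \<in> piece A (inv\<^bsub>H\<^esub> n \<otimes>\<^bsub>H\<^esub> m)" "\<Theta> n m (\<Theta>' m b) = b"
      if "m \<in> carrier H" "b \<in> piece B (inv\<^bsub>\<Gamma>\<^esub> s n \<otimes>\<^bsub>\<Gamma>\<^esub> s m)" for m b
      using bij_betwE[OF bij_betw_inv_into[OF \<Theta>_bij[OF n that(1)]]] bij_betw_inv_into_right[OF \<Theta>_bij[OF n that(1)]] that(2)
      unfolding \<Theta>'_def by auto
    have \<Theta>'\<Theta>: "\<Theta>' m (\<Theta> n m a) = a" if "m \<in> carrier H" "a \<in> piece A (inv\<^bsub>H\<^esub> n \<otimes>\<^bsub>H\<^esub> m)" for m a
      using \<Theta>_bij[OF n that(1)] that(2) unfolding \<Theta>'_def bij_betw_def by simp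
    have \<Theta>'_add: "\<Theta>' m (b \<oplus>\<^bsub>B\<^esub> b') = \<Theta>' m b \<oplus>\<^bsub>A\<^esub> \<Theta>' m b'"
      if m: "m \<in> carrier H" and b: "b \<in> piece B (inv\<^bsub>\<Gamma>\<^esub> s n \<otimes>\<^bsub>\<Gamma>\<^esub> s m)" "b' \<in> piece B (inv\<^bsub>\<Gamma>\<^esub> s n \<otimes>\<^bsub>\<Gamma>\<^esub> s m)" for m b b'
    proof -
      have "\<Theta>' m b \<oplus>\<^bsub>A\<^esub> \<Theta>' m b' \<in> piece A (inv\<^bsub>H\<^esub> n \<otimes>\<^bsub>H\<^esub> m)" by (rule A.piece_add) (use n m \<Theta>' b in auto)
      then show ?thesis using \<Theta>'\<Theta>[OF m, of "\<Theta>' m b \<oplus>\<^bsub>A\<^esub> \<Theta>' m b'"] \<Theta>_add[OF n m] \<Theta>' m b by simp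
    qed
    have \<Theta>'_mult: "\<Theta>' l (b \<otimes>\<^bsub>B\<^esub> \<Theta> m l a) = \<Theta>' m b \<otimes>\<^bsub>A\<^esub> a"
      if m: "m \<in> carrier H" "l \<in> carrier H" and b: "b \<in> piece B (inv\<^bsub>\<Gamma>\<^esub> s n \<otimes>\<^bsub>\<Gamma>\<^esub> s m)" "a \<in> piece A (inv\<^bsub>H\<^esub> m \<otimes>\<^bsub>H\<^esub> l)" for m l b a
    proof -
      have "\<Theta>' m b \<otimes>\<^bsub>A\<^esub> a \<in> piece A (inv\<^bsub>H\<^esub> n \<otimes>\<^bsub>H\<^esub> l)" by (rule A.inv_mult_piece[of n m l]) (use n m \<Theta>' b in auto)
      then show ?thesis using \<Theta>'\<Theta>[of l "\<Theta>' m b \<otimes>\<^bsub>A\<^esub> a"] \<Theta>_mult[OF n m, of "\<Theta>' m b" a] \<Theta>' m b by simp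
    qed
    \<comment> \<open>The transformation with value \<open>x\<close> at the identity:
      \<open>b\<close> is carried back to \<open>A\<close> and acts on \<open>x\<close>.\<close>
    define \<phi> where "\<phi> = (\<lambda>(m, b)\<in>carrier H \<times> carrier B. if b \<in> piece B (inv\<^bsub>\<Gamma>\<^esub> s n \<otimes>\<^bsub>\<Gamma>\<^esub> s m) then act M x (\<Theta>' m b) else \<zero>\<^bsub>M\<^esub>)"
    have \<Theta>'c: "\<Theta>' m b \<in> carrier A" if "m \<in> carrier H" "b \<in> piece B (inv\<^bsub>\<Gamma>\<^esub> s n \<otimes>\<^bsub>\<Gamma>\<^esub> s m)" for m b
      using piece_A_carrier n that \<Theta>' by blast
    have \<phi>1: "\<phi> (m, b) = act M x (\<Theta>' m b)" if "m \<in> carrier H" "b \<in> piece B (inv\<^bsub>\<Gamma>\<^esub> s n \<otimes>\<^bsub>\<Gamma>\<^esub> s m)" for m b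
      using that n pc[OF s[OF n] that] unfolding \<phi>_def by simp
    have "\<phi> \<in> coind M (s n)"
    proof (rule coindI)
      show "\<phi> \<in> carrier ?V" using xc by (auto simp: \<phi>_def Vs \<Theta>'c)
      fix m b assume m: "m \<in> carrier H"
      show "\<phi> (m, b) = \<zero>\<^bsub>M\<^esub>" if "b \<in> carrier B" "b \<notin> piece B (inv\<^bsub>\<Gamma>\<^esub> s n \<otimes>\<^bsub>\<Gamma>\<^esub> s m)"
        using that m by (simp add: \<phi>_def)
      assume b: "b \<in> piece B (inv\<^bsub>\<Gamma>\<^esub> s n \<otimes>\<^bsub>\<Gamma>\<^esub> s m)"
      show "\<phi> (m, b) \<in> piece M m"
        using M.act_piece[OF n _ x \<Theta>'(1)[OF m b]] n m b by (simp add: \<phi>1 flip: A.G.m_assoc)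
      show "\<phi> (m, b \<oplus>\<^bsub>B\<^esub> b') = \<phi> (m, b) \<oplus>\<^bsub>M\<^esub> \<phi> (m, b')" if b': "b' \<in> piece B (inv\<^bsub>\<Gamma>\<^esub> s n \<otimes>\<^bsub>\<Gamma>\<^esub> s m)" for b'
        using m b b' n xc by (simp add: \<phi>1 padd \<Theta>'_add M.act_add_right \<Theta>'c)
      show "\<phi> (l, b \<otimes>\<^bsub>B\<^esub> \<Theta> m l a) = act M (\<phi> (m, b)) a" if "l \<in> carrier H" "a \<in> piece A (inv\<^bsub>H\<^esub> m \<otimes>\<^bsub>H\<^esub> l)" for l a
        using m b that n xc by (simp add: \<phi>1 b\<Theta> \<Theta>'_mult M.act_mult \<Theta>'c piece_A_carrier[of m l])
    qed
    moreover have "\<Theta>' n \<one>\<^bsub>B\<^esub> = \<one>\<^bsub>A\<^esub>" using \<Theta>'\<Theta>[of n "\<one>\<^bsub>A\<^esub>"] \<Theta>_one n by simp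
    then have "\<phi> (n, \<one>\<^bsub>B\<^esub>) = x" using \<phi>1[OF n one_piece[OF n]] xc by simp
    ultimately show "x \<in> (\<lambda>\<phi>. \<phi> (n, \<one>\<^bsub>B\<^esub>)) ` coind M (s n)" by blast
  qed
  have "represents N M \<psi>"
    unfolding represents_def
  proof (intro ballI conjI)
    fix n assume n: "n \<in> carrier H"
    have sn: "s n \<in> carrier \<Gamma>" using n by simp
    have "bij_betw (\<chi>' (s n)) (piece N (s n)) (coind M (s n))"
      unfolding \<chi>'_def using \<chi>[OF sn] by (rule bij_betw_inv_into)
    from bij_betw_trans[OF this ev[OF n]] show "bij_betw (\<psi> n) (piece N (s n)) (piece M n)"
      by (simp add: \<psi>_def[abs_def] comp_def)
    fix v assume v: "v \<in> piece N (s n)"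
    note v' = \<chi>'[OF sn v]
    {
      fix w assume w: "w \<in> piece N (s n)"
      note w' = \<chi>'[OF sn w]
      have "v \<oplus>\<^bsub>N\<^esub> w = \<chi> (s n) (\<chi>' (s n) v \<oplus>\<^bsub>?V\<^esub> \<chi>' (s n) w)" using \<chi>_add[OF sn v'(1) w'(1)] v' w' by simp
      then have "\<chi>' (s n) (v \<oplus>\<^bsub>N\<^esub> w) = \<chi>' (s n) v \<oplus>\<^bsub>?V\<^esub> \<chi>' (s n) w"
        using \<chi>'\<chi>[OF sn S.Vp_add[OF sn v'(1) w'(1)]] by simp
      then show "\<psi> n (v \<oplus>\<^bsub>N\<^esub> w) = \<psi> n v \<oplus>\<^bsub>M\<^esub> \<psi> n w" using n by (simp add: \<psi>_def Vs)
    }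
    fix m a assume m: "m \<in> carrier H" and a: "a \<in> piece A (inv\<^bsub>H\<^esub> n \<otimes>\<^bsub>H\<^esub> m)"
    have sm: "s m \<in> carrier \<Gamma>" using m by simp
    have \<Theta>a: "\<Theta> n m a \<in> piece B (inv\<^bsub>\<Gamma>\<^esub> s n \<otimes>\<^bsub>\<Gamma>\<^esub> s m)" using n m a by simp
    have \<Theta>ac: "\<Theta> n m a \<in> carrier B" using piece_B_carrier[OF sn sm \<Theta>a] .
    have "act N v (\<Theta> n m a) = \<chi> (s m) (?ac (s n) (s m) (\<chi>' (s n) v) (\<Theta> n m a))"
      using \<chi>_ac[OF sn sm v'(1) \<Theta>a] v'(2) by simp
    then have "\<chi>' (s m) (act N v (\<Theta> n m a)) = ?ac (s n) (s m) (\<chi>' (s n) v) (\<Theta> n m a)"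
      using \<chi>'\<chi>[OF sm S.ac_closed[OF sn sm v'(1) \<Theta>a]] by simp
    then have "\<psi> m (act N v (\<Theta> n m a)) = \<chi>' (s n) v (m, \<one>\<^bsub>B\<^esub> \<otimes>\<^bsub>B\<^esub> \<Theta> n m a)"
      using m \<Theta>ac by (simp add: \<psi>_def)
    also have "\<dots> = act M (\<psi> n v) a" unfolding \<psi>_def
      by (rule coindD(5)[OF v'(1) n one_piece[OF n] m a])
    finally show "\<psi> m (act N v (\<Theta> n m a)) = act M (\<psi> n v) a" .
  qed
  with N that show ?thesis by blast
qed

end

section \<open>Morphisms under restriction, and the Morita equivalence\<close>

context graded_morita
begin

lemma representsD:
  assumes "represents N M \<psi>" "n \<in> carrier H"
  shows "bij_betw (\<psi> n) (piece N (s n)) (piece M n)"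
    "\<And>v. v \<in> piece N (s n) \<Longrightarrow> \<psi> n v \<in> piece M n"
    "\<And>v w. v \<in> piece N (s n) \<Longrightarrow> w \<in> piece N (s n) \<Longrightarrow> \<psi> n (v \<oplus>\<^bsub>N\<^esub> w) = \<psi> n v \<oplus>\<^bsub>M\<^esub> \<psi> n w"
    "\<And>m v a. m \<in> carrier H \<Longrightarrow> v \<in> piece N (s n) \<Longrightarrow> a \<in> piece A (inv\<^bsub>H\<^esub> n \<otimes>\<^bsub>H\<^esub> m) \<Longrightarrow> \<psi> m (act N v (\<Theta> n m a)) = act M (\<psi> n v) a"
proof -
  show b: "bij_betw (\<psi> n) (piece N (s n)) (piece M n)" using assms unfolding represents_def by blast
  show "\<And>v. v \<in> piece N (s n) \<Longrightarrow> \<psi> n v \<in> piece M n" using bij_betwE[OF b] by blast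
qed (use assms in \<open>unfold represents_def, blast+\<close>)

text \<open>The correspondence between morphisms upstairs (\<open>h\<close>) and downstairs
  (\<open>k\<close>). Existence and uniqueness of \<open>k\<close> for given \<open>h\<close> define
  the functor on morphisms; existence and uniqueness of \<open>h\<close> for given \<open>k\<close>
  say that it is full and faithful.\<close>

definition linked :: "('m, 'j, 'b) graded_module \<Rightarrow> ('h \<Rightarrow> 'm \<Rightarrow> 'n) \<Rightarrow> ('h \<Rightarrow> 'm' \<Rightarrow> 'n') \<Rightarrow> ('m \<Rightarrow> 'm') \<Rightarrow> ('n \<Rightarrow> 'n') \<Rightarrow> bool" where
  "linked N \<psi> \<psi>' h k \<longleftrightarrow> (\<forall>n\<in>carrier H. \<forall>v\<in>piece N (s n). k (\<psi> n v) = \<psi>' n (h v))"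

lemma linkedD: "linked N \<psi> \<psi>' h k \<Longrightarrow> n \<in> carrier H \<Longrightarrow> v \<in> piece N (s n) \<Longrightarrow> k (\<psi> n v) = \<psi>' n (h v)"
  unfolding linked_def by blast

text \<open>By \<open>summand\<close> an element satisfies \<open>u = (u u1) v1 + (u u2) v2\<close>,
  so it is recovered from two products that lie in degrees of the form \<open>s n\<close>.\<close>

lemma piece_separation:
  assumes N: "graded_right_module \<Gamma> B N" and K: "K \<in> carrier \<Gamma>" and u: "u \<in> piece N K" "u' \<in> piece N K"
    and eq: "\<And>p b. p \<in> carrier H \<Longrightarrow> b \<in> piece B (inv\<^bsub>\<Gamma>\<^esub> K \<otimes>\<^bsub>\<Gamma>\<^esub> s p) \<Longrightarrow> act N u b = act N u' b"
  shows "u = u'"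
proof -
  interpret N: gmod \<Gamma> B N by (rule gmodI) fact
  obtain n1 n2 u1 v1 u2 v2 where n: "n1 \<in> carrier H" "n2 \<in> carrier H"
    and uv: "u1 \<in> piece B (inv\<^bsub>\<Gamma>\<^esub> K \<otimes>\<^bsub>\<Gamma>\<^esub> s n1)" "v1 \<in> piece B (inv\<^bsub>\<Gamma>\<^esub> s n1 \<otimes>\<^bsub>\<Gamma>\<^esub> K)"
      "u2 \<in> piece B (inv\<^bsub>\<Gamma>\<^esub> K \<otimes>\<^bsub>\<Gamma>\<^esub> s n2)" "v2 \<in> piece B (inv\<^bsub>\<Gamma>\<^esub> s n2 \<otimes>\<^bsub>\<Gamma>\<^esub> K)"
    and one: "u1 \<otimes>\<^bsub>B\<^esub> v1 \<oplus>\<^bsub>B\<^esub> u2 \<otimes>\<^bsub>B\<^esub> v2 = \<one>\<^bsub>B\<^esub>"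
    and c: "u1 \<in> carrier B" "v1 \<in> carrier B" "u2 \<in> carrier B" "v2 \<in> carrier B"
    by (rule summandE[OF K])
  have *: "w = act N (act N w u1) v1 \<oplus>\<^bsub>N\<^esub> act N (act N w u2) v2" if "w \<in> carrier N" for w
  proof -
    have "w = act N w (u1 \<otimes>\<^bsub>B\<^esub> v1 \<oplus>\<^bsub>B\<^esub> u2 \<otimes>\<^bsub>B\<^esub> v2)" unfolding one using that by simp
    also have "\<dots> = act N (act N w u1) v1 \<oplus>\<^bsub>N\<^esub> act N (act N w u2) v2"
      using that c by (simp add: N.act_add_right N.act_mult)
    finally show ?thesis .
  qed
  have "u \<in> carrier N" "u' \<in> carrier N" using u K by auto
  then show ?thesis using *[of u] *[of u'] eq[OF n(1) uv(1)] eq[OF n(2) uv(3)] by simp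
qed

lemma linked_unique_right:
  assumes M: "graded_right_module H A M" and M': "graded_right_module H A M'"
    and r: "represents N M \<psi>" and k: "k \<in> graded_hom H A M M'" "k' \<in> graded_hom H A M M'"
    and l: "linked N \<psi> \<psi>' h k" "linked N \<psi> \<psi>' h k'"
  shows "k = k'"
proof (rule A.graded_hom_eqI[OF _ _ k])
  show "graded_group H M" "graded_group H M'" using M M' by (auto simp: graded_right_module_def)
  fix n m assume n: "n \<in> carrier H" and "m \<in> piece M n"
  then obtain v where "v \<in> piece N (s n)" "m = \<psi> n v"
    using representsD(1)[OF r n] by (auto simp: bij_betw_def)
  then show "k m = k' m" using linkedD[OF l(1) n] linkedD[OF l(2) n] by simp
qed

text \<open>Faithfulness: a homogeneous \<open>v\<close> of any degree is multiplied into the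
  degrees \<open>s p\<close>, where \<open>k\<close> dictates the image, and
  \<open>piece_separation\<close> carries the agreement back to \<open>v\<close>.\<close>

lemma linked_unique_left:
  assumes N: "graded_right_module \<Gamma> B N" and N': "graded_right_module \<Gamma> B N'"
    and r: "represents N' M' \<psi>'" and h: "h \<in> graded_hom \<Gamma> B N N'" "h' \<in> graded_hom \<Gamma> B N N'"
    and l: "linked N \<psi> \<psi>' h k" "linked N \<psi> \<psi>' h' k"
  shows "h = h'"
proof (rule B.graded_hom_eqI[OF _ _ h])
  interpret N: gmod \<Gamma> B N by (rule gmodI) fact
  show "graded_group \<Gamma> N" "graded_group \<Gamma> N'" using N N' by (auto simp: graded_right_module_def)
  fix J v assume J: "J \<in> carrier \<Gamma>" and v: "v \<in> piece N J"
  have vc: "v \<in> carrier N" using J v by simp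
  note hD = graded_homD[OF h(1)] and hD' = graded_homD[OF h(2)]
  show "h v = h' v"
  proof (rule piece_separation[OF N' J hD(4)[OF J v] hD'(4)[OF J v]])
    fix p b assume p: "p \<in> carrier H" and b: "b \<in> piece B (inv\<^bsub>\<Gamma>\<^esub> J \<otimes>\<^bsub>\<Gamma>\<^esub> s p)"
    have bc: "b \<in> carrier B" using piece_B_carrier[OF J s[OF p] b] .
    have vb: "act N v b \<in> piece N (s p)" by (rule act_piece_B[OF N J s[OF p] v b])
    have "\<psi>' p (h (act N v b)) = \<psi>' p (h' (act N v b))"
      using linkedD[OF l(1) p vb] linkedD[OF l(2) p vb] by simp
    then have "h (act N v b) = h' (act N v b)"
      by (rule inj_onD[OF bij_betw_imp_inj_on[OF representsD(1)[OF r p]] _ hD(4)[OF s[OF p] vb] hD'(4)[OF s[OF p] vb]])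
    then show "act N' (h v) b = act N' (h' v) b" using hD(3)[OF vc bc] hD'(3)[OF vc bc] by simp
  qed
qed

text \<open>Conjugating \<open>h\<close> by the identifications on each piece gives a natural
  family, which \<open>hom_ext\<close> assembles into a homomorphism.\<close>

lemma linked_exists_right:
  assumes N: "graded_right_module \<Gamma> B N" and N': "graded_right_module \<Gamma> B N'"
    and M: "graded_right_module H A M" and M': "graded_right_module H A M'"
    and r: "represents N M \<psi>" and r': "represents N' M' \<psi>'"
    and h: "h \<in> graded_hom \<Gamma> B N N'"
  obtains k where "k \<in> graded_hom H A M M'" "linked N \<psi> \<psi>' h k"
proof -
  interpret N: gmod \<Gamma> B N by (rule gmodI) fact
  interpret M: gmod H A M by (rule gmodI) fact
  note hD = graded_homD[OF h]
  define i where "i n = inv_into (piece N (s n)) (\<psi> n)" for n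
  have i: "i n m \<in> piece N (s n)" "\<psi> n (i n m) = m" if "n \<in> carrier H" "m \<in> piece M n" for n m
    using bij_betwE[OF bij_betw_inv_into[OF representsD(1)[OF r that(1)]]] bij_betw_inv_into_right[OF representsD(1)[OF r that(1)]] that(2)
    unfolding i_def by auto
  have i\<psi>: "i n (\<psi> n v) = v" if "n \<in> carrier H" "v \<in> piece N (s n)" for n v
    using bij_betw_inv_into_left[OF representsD(1)[OF r that(1)]] that(2) unfolding i_def by auto
  have nc: "v \<in> carrier N" if "n \<in> carrier H" "v \<in> piece N (s n)" for n v
    by (rule N.M.piece_carrier[OF s[OF that(1)] that(2)])
  have i_add: "i n (m \<oplus>\<^bsub>M\<^esub> m') = i n m \<oplus>\<^bsub>N\<^esub> i n m'" if n: "n \<in> carrier H" and m: "m \<in> piece M n" "m' \<in> piece M n" for n m m'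
  proof -
    have "i n m \<oplus>\<^bsub>N\<^esub> i n m' \<in> piece N (s n)" by (rule N.M.piece_add) (use i n m in auto)
    then show ?thesis using i\<psi>[OF n, of "i n m \<oplus>\<^bsub>N\<^esub> i n m'"] representsD(3)[OF r n] i[OF n] m by simp
  qed
  have i_act: "i p (act M m a) = act N (i n m) (\<Theta> n p a)"
    if n: "n \<in> carrier H" "p \<in> carrier H" and m: "m \<in> piece M n" "a \<in> piece A (inv\<^bsub>H\<^esub> n \<otimes>\<^bsub>H\<^esub> p)" for n p m a
  proof -
    have "act N (i n m) (\<Theta> n p a) \<in> piece N (s p)"
      by (rule act_piece_B[OF N s[OF n(1)] s[OF n(2)]]) (use i n m in auto)
    then show ?thesis using i\<psi>[OF n(2)] representsD(4)[OF r n(1,2) i(1)[OF n(1) m(1)] m(2)] i[OF n(1) m(1)] by metis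
  qed
  let ?k = "\<lambda>n m. \<psi>' n (h (i n m))"
  have hi: "h (i n m) \<in> piece N' (s n)" if "n \<in> carrier H" "m \<in> piece M n" for n m
    using hD(4)[OF s[OF that(1)] i(1)[OF that]] .
  have 1: "?k n m \<in> piece M' n" if "n \<in> carrier H" "m \<in> piece M n" for n m
    by (rule representsD(2)[OF r' that(1) hi[OF that]])
  have 2: "?k n (m \<oplus>\<^bsub>M\<^esub> m') = ?k n m \<oplus>\<^bsub>M'\<^esub> ?k n m'"
    if "n \<in> carrier H" "m \<in> piece M n" "m' \<in> piece M n" for n m m'
    using that i nc by (simp add: i_add hD(2) representsD(3)[OF r'] hi)
  have 3: "?k p (act M m a) = act M' (?k n m) a"
    if n: "n \<in> carrier H" "p \<in> carrier H" and m: "m \<in> piece M n" "a \<in> piece A (inv\<^bsub>H\<^esub> n \<otimes>\<^bsub>H\<^esub> p)" for n p m a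
  proof -
    have "\<Theta> n p a \<in> carrier B" using piece_B_carrier[OF s s \<Theta>_piece] n m by auto
    then show ?thesis using n m i nc by (simp add: i_act hD(3) representsD(4)[OF r'] hi)
  qed
  note E = A.hom_ext[OF M M', of ?k, OF 1 2 3]
  have "linked N \<psi> \<psi>' h (A.hom_ext M M' ?k)"
    unfolding linked_def using E(2) representsD(2)[OF r] by (simp add: i\<psi>)
  with E(1) that show ?thesis by blast
qed

text \<open>Fullness. In degrees \<open>s n\<close> the map is forced to be \<open>\<kappa>\<close>.
  In degree \<open>J\<close> the image of \<open>v\<close> has to satisfy
  \<open>act N' (h J v) b = \<kappa> p (act N v b)\<close> for every \<open>b\<close> into a degree
  \<open>s p\<close>. At most one element does, by \<open>piece_separation\<close>; this uniqueness
  then yields additivity and compatibility with the action.\<close>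

lemma linked_exists_left:
  assumes N: "graded_right_module \<Gamma> B N" and N': "graded_right_module \<Gamma> B N'"
    and M: "graded_right_module H A M" and M': "graded_right_module H A M'"
    and r: "represents N M \<psi>" and r': "represents N' M' \<psi>'"
    and k: "k \<in> graded_hom H A M M'"
  obtains h where "h \<in> graded_hom \<Gamma> B N N'" "linked N \<psi> \<psi>' h k"
proof -
  interpret N: gmod \<Gamma> B N by (rule gmodI) fact
  interpret N': gmod \<Gamma> B N' by (rule gmodI) fact
  interpret M: gmod H A M by (rule gmodI) fact
  interpret M': gmod H A M' by (rule gmodI) fact
  note kD = graded_homD[OF k]
  define i where "i n = inv_into (piece N' (s n)) (\<psi>' n)" for n
  have i: "i n m \<in> piece N' (s n)" "\<psi>' n (i n m) = m" if "n \<in> carrier H" "m \<in> piece M' n" for n m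
    using bij_betwE[OF bij_betw_inv_into[OF representsD(1)[OF r' that(1)]]] bij_betw_inv_into_right[OF representsD(1)[OF r' that(1)]] that(2)
    unfolding i_def by auto
  have inj: "v = w" if "n \<in> carrier H" "v \<in> piece N' (s n)" "w \<in> piece N' (s n)" "\<psi>' n v = \<psi>' n w" for n v w
    using representsD(1)[OF r' that(1)] that(2-4) by (auto simp: bij_betw_def inj_on_def)
  have nc: "v \<in> carrier N" if "J \<in> carrier \<Gamma>" "v \<in> piece N J" for J v
    by (rule N.M.piece_carrier[OF that])
  have nc': "v \<in> carrier N'" if "J \<in> carrier \<Gamma>" "v \<in> piece N' J" for J v
    by (rule N'.M.piece_carrier[OF that])
  have mc: "v \<in> carrier M" if "n \<in> carrier H" "v \<in> piece M n" for n v
    by (rule M.M.piece_carrier[OF that])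
  define \<kappa> where "\<kappa> n w = i n (k (\<psi> n w))" for n w
  have k\<psi>: "k (\<psi> n w) \<in> piece M' n" if "n \<in> carrier H" "w \<in> piece N (s n)" for n w
    using kD(4)[OF that(1) representsD(2)[OF r that]] .
  have \<kappa>: "\<kappa> n w \<in> piece N' (s n)" "\<psi>' n (\<kappa> n w) = k (\<psi> n w)" if "n \<in> carrier H" "w \<in> piece N (s n)" for n w
    unfolding \<kappa>_def using i[OF that(1) k\<psi>[OF that]] by auto
  have \<kappa>_add: "\<kappa> n (v \<oplus>\<^bsub>N\<^esub> w) = \<kappa> n v \<oplus>\<^bsub>N'\<^esub> \<kappa> n w"
    if n: "n \<in> carrier H" and v: "v \<in> piece N (s n)" "w \<in> piece N (s n)" for n v w
  proof (rule inj[OF n])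
    have vw: "v \<oplus>\<^bsub>N\<^esub> w \<in> piece N (s n)" using n v by (intro N.M.piece_add) auto
    then show "\<kappa> n (v \<oplus>\<^bsub>N\<^esub> w) \<in> piece N' (s n)" using \<kappa> n by simp
    show "\<kappa> n v \<oplus>\<^bsub>N'\<^esub> \<kappa> n w \<in> piece N' (s n)" using n \<kappa> v by (intro N'.M.piece_add) auto
    have "\<psi>' n (\<kappa> n (v \<oplus>\<^bsub>N\<^esub> w)) = k (\<psi> n v \<oplus>\<^bsub>M\<^esub> \<psi> n w)" using vw n v \<kappa> representsD(3)[OF r] by simp
    also have "\<dots> = k (\<psi> n v) \<oplus>\<^bsub>M'\<^esub> k (\<psi> n w)"
      using mc[OF n representsD(2)[OF r n]] v by (simp add: kD(2))
    also have "\<dots> = \<psi>' n (\<kappa> n v \<oplus>\<^bsub>N'\<^esub> \<kappa> n w)" using n v \<kappa> representsD(3)[OF r'] by simp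
    finally show "\<psi>' n (\<kappa> n (v \<oplus>\<^bsub>N\<^esub> w)) = \<psi>' n (\<kappa> n v \<oplus>\<^bsub>N'\<^esub> \<kappa> n w)" .
  qed
  have \<kappa>_act: "\<kappa> p (act N w b) = act N' (\<kappa> n w) b"
    if n: "n \<in> carrier H" "p \<in> carrier H" and w: "w \<in> piece N (s n)" and b: "b \<in> piece B (inv\<^bsub>\<Gamma>\<^esub> s n \<otimes>\<^bsub>\<Gamma>\<^esub> s p)" for n p w b
  proof (rule inj[OF n(2)])
    obtain a where a: "a \<in> piece A (inv\<^bsub>H\<^esub> n \<otimes>\<^bsub>H\<^esub> p)" "b = \<Theta> n p a" using \<Theta>_preimage[OF n b] by blast
    have ac: "a \<in> carrier A" using piece_A_carrier[OF n a(1)] .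
    have wb: "act N w b \<in> piece N (s p)" by (rule act_piece_B[OF N s[OF n(1)] s[OF n(2)] w b])
    then show "\<kappa> p (act N w b) \<in> piece N' (s p)" using \<kappa> n by simp
    show "act N' (\<kappa> n w) b \<in> piece N' (s p)" by (rule act_piece_B[OF N' s[OF n(1)] s[OF n(2)] _ b]) (use \<kappa> n w in auto)
    have "\<psi>' p (\<kappa> p (act N w b)) = k (act M (\<psi> n w) a)"
      using \<kappa>(2)[OF n(2) wb] representsD(4)[OF r n w a(1)] a(2) by simp
    also have "\<dots> = act M' (k (\<psi> n w)) a" using mc[OF n(1) representsD(2)[OF r n(1) w]] ac by (simp add: kD(3))
    also have "\<dots> = \<psi>' p (act N' (\<kappa> n w) b)"
      using \<kappa>[OF n(1) w] representsD(4)[OF r' n \<kappa>(1)[OF n(1) w] a(1)] a(2) by simp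
    finally show "\<psi>' p (\<kappa> p (act N w b)) = \<psi>' p (act N' (\<kappa> n w) b)" .
  qed
  have "\<exists>h\<in>piece N' J. \<forall>p\<in>carrier H. \<forall>b\<in>piece B (inv\<^bsub>\<Gamma>\<^esub> J \<otimes>\<^bsub>\<Gamma>\<^esub> s p). act N' h b = \<kappa> p (act N v b)"
    if J: "J \<in> carrier \<Gamma>" and v: "v \<in> piece N J" for J v
  proof -
    obtain n1 n2 u1 v1 u2 v2 where n: "n1 \<in> carrier H" "n2 \<in> carrier H"
      and uv: "u1 \<in> piece B (inv\<^bsub>\<Gamma>\<^esub> J \<otimes>\<^bsub>\<Gamma>\<^esub> s n1)" "v1 \<in> piece B (inv\<^bsub>\<Gamma>\<^esub> s n1 \<otimes>\<^bsub>\<Gamma>\<^esub> J)"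
       "u2 \<in> piece B (inv\<^bsub>\<Gamma>\<^esub> J \<otimes>\<^bsub>\<Gamma>\<^esub> s n2)" "v2 \<in> piece B (inv\<^bsub>\<Gamma>\<^esub> s n2 \<otimes>\<^bsub>\<Gamma>\<^esub> J)"
      and one: "u1 \<otimes>\<^bsub>B\<^esub> v1 \<oplus>\<^bsub>B\<^esub> u2 \<otimes>\<^bsub>B\<^esub> v2 = \<one>\<^bsub>B\<^esub>"
      and uvc: "u1 \<in> carrier B" "v1 \<in> carrier B" "u2 \<in> carrier B" "v2 \<in> carrier B"
      by (rule summandE[OF J])
    have vc: "v \<in> carrier N" using nc J v .
    have vu: "act N v u1 \<in> piece N (s n1)" "act N v u2 \<in> piece N (s n2)"
      by (rule act_piece_B[OF N J _ v]; use n uv in simp)+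
    \<comment> \<open>The candidate is dictated by \<open>v = (v u1) v1 + (v u2) v2\<close>: apply
      \<open>\<kappa>\<close> to the two factors in restricted degrees and multiply back by
      \<open>v1\<close> and \<open>v2\<close>.\<close>
    define x1 where "x1 = \<kappa> n1 (act N v u1)"
    define x2 where "x2 = \<kappa> n2 (act N v u2)"
    have x: "x1 \<in> piece N' (s n1)" "x2 \<in> piece N' (s n2)" unfolding x1_def x2_def using \<kappa> n vu by auto
    have xc: "x1 \<in> carrier N'" "x2 \<in> carrier N'" using nc'[OF s] n x by blast+
    have xv: "act N' x1 v1 \<in> piece N' J" "act N' x2 v2 \<in> piece N' J"
      by (rule act_piece_B[OF N' s[OF n(1)] J x(1) uv(2)], rule act_piece_B[OF N' s[OF n(2)] J x(2) uv(4)])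
    show ?thesis
    proof (intro bexI ballI)
      show "act N' x1 v1 \<oplus>\<^bsub>N'\<^esub> act N' x2 v2 \<in> piece N' J" using xv J by simp
      fix p b assume p: "p \<in> carrier H" and b: "b \<in> piece B (inv\<^bsub>\<Gamma>\<^esub> J \<otimes>\<^bsub>\<Gamma>\<^esub> s p)"
      have bc: "b \<in> carrier B" using piece_B_carrier[OF J s[OF p] b] .
      have vb: "v1 \<otimes>\<^bsub>B\<^esub> b \<in> piece B (inv\<^bsub>\<Gamma>\<^esub> s n1 \<otimes>\<^bsub>\<Gamma>\<^esub> s p)" "v2 \<otimes>\<^bsub>B\<^esub> b \<in> piece B (inv\<^bsub>\<Gamma>\<^esub> s n2 \<otimes>\<^bsub>\<Gamma>\<^esub> s p)"
        by (rule B.inv_mult_piece[of _ J]; use n p J uv b in auto)+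
      have y: "act N (act N v u1) (v1 \<otimes>\<^bsub>B\<^esub> b) \<in> piece N (s p)" "act N (act N v u2) (v2 \<otimes>\<^bsub>B\<^esub> b) \<in> piece N (s p)"
        by (rule act_piece_B[OF N s[OF n(1)] s[OF p] vu(1) vb(1)], rule act_piece_B[OF N s[OF n(2)] s[OF p] vu(2) vb(2)])
      have "act N' (act N' x1 v1 \<oplus>\<^bsub>N'\<^esub> act N' x2 v2) b = act N' x1 (v1 \<otimes>\<^bsub>B\<^esub> b) \<oplus>\<^bsub>N'\<^esub> act N' x2 (v2 \<otimes>\<^bsub>B\<^esub> b)"
        using xc uvc bc by (simp add: N'.act_add N'.act_mult)
      also have "\<dots> = \<kappa> p (act N (act N v u1) (v1 \<otimes>\<^bsub>B\<^esub> b)) \<oplus>\<^bsub>N'\<^esub> \<kappa> p (act N (act N v u2) (v2 \<otimes>\<^bsub>B\<^esub> b))"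
        unfolding x1_def x2_def using \<kappa>_act[OF n(1) p vu(1) vb(1)] \<kappa>_act[OF n(2) p vu(2) vb(2)] by simp
      also have "\<dots> = \<kappa> p (act N (act N v u1) (v1 \<otimes>\<^bsub>B\<^esub> b) \<oplus>\<^bsub>N\<^esub> act N (act N v u2) (v2 \<otimes>\<^bsub>B\<^esub> b))"
        using \<kappa>_add[OF p y] by simp
      also have "act N (act N v u1) (v1 \<otimes>\<^bsub>B\<^esub> b) \<oplus>\<^bsub>N\<^esub> act N (act N v u2) (v2 \<otimes>\<^bsub>B\<^esub> b) =
          act N v ((u1 \<otimes>\<^bsub>B\<^esub> v1 \<oplus>\<^bsub>B\<^esub> u2 \<otimes>\<^bsub>B\<^esub> v2) \<otimes>\<^bsub>B\<^esub> b)"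
        using vc uvc bc by (simp add: N.act_mult N.act_add N.act_add_right)
      also have "\<dots> = act N v b" using bc one by simp
      finally show "act N' (act N' x1 v1 \<oplus>\<^bsub>N'\<^esub> act N' x2 v2) b = \<kappa> p (act N v b)" .
    qed
  qed
  then obtain h where h: "\<And>J v. J \<in> carrier \<Gamma> \<Longrightarrow> v \<in> piece N J \<Longrightarrow> h J v \<in> piece N' J"
    and hb: "\<And>J v p b. J \<in> carrier \<Gamma> \<Longrightarrow> v \<in> piece N J \<Longrightarrow> p \<in> carrier H \<Longrightarrow> b \<in> piece B (inv\<^bsub>\<Gamma>\<^esub> J \<otimes>\<^bsub>\<Gamma>\<^esub> s p) \<Longrightarrow>
        act N' (h J v) b = \<kappa> p (act N v b)"
    by metis
  have h_add: "h J (v \<oplus>\<^bsub>N\<^esub> w) = h J v \<oplus>\<^bsub>N'\<^esub> h J w"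
    if J: "J \<in> carrier \<Gamma>" and v: "v \<in> piece N J" "w \<in> piece N J" for J v w
  proof (rule piece_separation[OF N' J])
    have vw: "v \<oplus>\<^bsub>N\<^esub> w \<in> piece N J" using J v by simp
    show "h J (v \<oplus>\<^bsub>N\<^esub> w) \<in> piece N' J" "h J v \<oplus>\<^bsub>N'\<^esub> h J w \<in> piece N' J" using h J v vw by auto
    fix p b assume p: "p \<in> carrier H" and b: "b \<in> piece B (inv\<^bsub>\<Gamma>\<^esub> J \<otimes>\<^bsub>\<Gamma>\<^esub> s p)"
    have bc: "b \<in> carrier B" using piece_B_carrier[OF J s[OF p] b] .
    have vb: "act N v b \<in> piece N (s p)" "act N w b \<in> piece N (s p)"
      using act_piece_B[OF N J s[OF p] _ b] v by auto
    show "act N' (h J (v \<oplus>\<^bsub>N\<^esub> w)) b = act N' (h J v \<oplus>\<^bsub>N'\<^esub> h J w) b"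
      using J v vw h nc nc' bc p b vb by (simp add: hb N.act_add N'.act_add \<kappa>_add)
  qed
  have h_act: "h K (act N v b) = act N' (h J v) b"
    if J: "J \<in> carrier \<Gamma>" "K \<in> carrier \<Gamma>" and v: "v \<in> piece N J" and b: "b \<in> piece B (inv\<^bsub>\<Gamma>\<^esub> J \<otimes>\<^bsub>\<Gamma>\<^esub> K)" for J K v b
  proof (rule piece_separation[OF N' J(2)])
    have vb: "act N v b \<in> piece N K" by (rule act_piece_B[OF N J v b])
    then show "h K (act N v b) \<in> piece N' K" using h J by simp
    show "act N' (h J v) b \<in> piece N' K" by (rule act_piece_B[OF N' J _ b]) (use h J v in auto)
    fix p c assume p: "p \<in> carrier H" and c: "c \<in> piece B (inv\<^bsub>\<Gamma>\<^esub> K \<otimes>\<^bsub>\<Gamma>\<^esub> s p)"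
    have bc: "b \<in> carrier B" "c \<in> carrier B" using piece_B_carrier J b s[OF p] c by blast+
    have "b \<otimes>\<^bsub>B\<^esub> c \<in> piece B (inv\<^bsub>\<Gamma>\<^esub> J \<otimes>\<^bsub>\<Gamma>\<^esub> s p)" by (rule B.inv_mult_piece[of J K]) (use J p b c in auto)
    then show "act N' (h K (act N v b)) c = act N' (act N' (h J v) b) c"
      using J v vb p c hb[OF J(1) v p] hb[OF J(2) vb p c] bc nc[OF J(1) v] nc'[OF J(1) h[OF J(1) v]]
      by (simp add: N.act_mult flip: N'.act_mult)
  qed
  have E1: "B.hom_ext N N' h \<in> graded_hom \<Gamma> B N N'"
    by (rule B.hom_ext(1)[OF N N' h h_add h_act])
  have E2: "B.hom_ext N N' h v = h J v" if "J \<in> carrier \<Gamma>" "v \<in> piece N J" for J v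
    using that by (rule B.hom_ext(2)[OF N N' h h_add h_act, rotated -2])
  have "linked N \<psi> \<psi>' (B.hom_ext N N' h) k"
    unfolding linked_def
  proof (intro ballI)
    fix n v assume n: "n \<in> carrier H" and v: "v \<in> piece N (s n)"
    have "\<one>\<^bsub>B\<^esub> \<in> piece B (inv\<^bsub>\<Gamma>\<^esub> s n \<otimes>\<^bsub>\<Gamma>\<^esub> s n)" using n by simp
    from hb[OF s[OF n] v n this] have "h (s n) v = \<kappa> n v"
      using nc'[OF s[OF n] h[OF s[OF n] v]] nc[OF s[OF n] v] by simp
    then show "k (\<psi> n v) = \<psi>' n (B.hom_ext N N' h v)"
      using E2[OF s[OF n] v] \<kappa>(2)[OF n v] by simp
  qed
  with E1 that show ?thesis by blast
qed

lemma linked_Ident: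
  assumes "graded_right_module \<Gamma> B N" "represents N M \<psi>" "graded_right_module H A M"
  shows "linked N \<psi> \<psi> (\<lambda>m\<in>carrier N. m) (\<lambda>m\<in>carrier M. m)"
proof -
  interpret N: gmod \<Gamma> B N by (rule gmodI) fact
  interpret M: gmod H A M by (rule gmodI) fact
  show ?thesis unfolding linked_def
    using M.M.piece_carrier[OF _ representsD(2)[OF assms(2)]] by (auto simp: N.M.piece_carrier[OF s])
qed

lemma linked_compose:
  assumes "graded_right_module \<Gamma> B N" "represents N M \<psi>" "graded_right_module H A M"
    and h: "h \<in> graded_hom \<Gamma> B N N'"
    and l: "linked N \<psi> \<psi>' h k" "linked N' \<psi>' \<psi>'' h' k'"
  shows "linked N \<psi> \<psi>'' (compose (carrier N) h' h) (compose (carrier M) k' k)"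
proof -
  interpret N: gmod \<Gamma> B N by (rule gmodI) fact
  interpret M: gmod H A M by (rule gmodI) fact
  show ?thesis unfolding linked_def
    using M.M.piece_carrier[OF _ representsD(2)[OF assms(2)]] linkedD[OF l(1)] linkedD[OF l(2)] graded_homD(4)[OF h s]
    by (auto simp: N.M.piece_carrier[OF s] compose_def)
qed

text \<open>The functor is restriction, with objects chosen inside \<open>U\<close> and morphisms
  determined by \<open>linked\<close>. Linked morphisms exist and are unique in both directions,
  which gives full faithfulness; coinduction gives essential surjectivity.\<close>

theorem graded_morita_equivalence:
  fixes U :: "'m set set"
  assumes H: "countable (carrier H)" and \<Gamma>: "countable (carrier \<Gamma>)" and inf: "infinite (UNIV :: 'k set)"
    and U: "\<And>S S'. \<lbrakk>S \<in> U; S' \<subseteq> S\<rbrakk> \<Longrightarrow> S' \<in> U"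
  shows "equivalent_categories (GrMod U \<Gamma> B) (GrMod U H A)"
proof -
  define Rel where "Rel N t \<longleftrightarrow> graded_right_module H A (fst t) \<and> carrier (fst t) \<in> U \<and> represents N (fst t) (snd t)"
    for N :: "('m, 'j, 'b) graded_module" and t :: "('m, 'h, 'a) graded_module \<times> ('h \<Rightarrow> 'm \<Rightarrow> 'm)"
  define F where "F N = fst (SOME t. Rel N t)" for N
  define \<psi> where "\<psi> N = snd (SOME t. Rel N t)" for N
  define good where "good N \<longleftrightarrow> graded_right_module \<Gamma> B N \<and> carrier N \<in> U" for N :: "('m, 'j, 'b) graded_module"
  have F: "graded_right_module H A (F N)" "carrier (F N) \<in> U" "represents N (F N) (\<psi> N)" if "good N" for N
  proof -
    have gN: "graded_right_module \<Gamma> B N" using that by (simp add: good_def)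
    obtain M \<psi>0 where "graded_right_module H A M" "carrier M \<subseteq> carrier N" "represents N M \<psi>0"
      by (rule restriction_exists[OF gN H inf])
    then have "Rel N (M, \<psi>0)" unfolding Rel_def using that U[of "carrier N" "carrier M"] by (simp add: good_def)
    then have "Rel N (SOME t. Rel N t)" by (rule someI)
    then show "graded_right_module H A (F N)" "carrier (F N) \<in> U" "represents N (F N) (\<psi> N)"
      unfolding Rel_def F_def \<psi>_def by auto
  qed
  have gN: "graded_right_module \<Gamma> B N" if "good N" for N using that by (simp add: good_def)
  define \<phi> where "\<phi> N N' h = (THE k. k \<in> graded_hom H A (F N) (F N') \<and> linked N (\<psi> N) (\<psi> N') h k)" for N N' h
  have \<phi>_eq: "\<phi> N N' h = k" if "good N" "good N'" "k \<in> graded_hom H A (F N) (F N')" "linked N (\<psi> N) (\<psi> N') h k" for N N' h k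
    unfolding \<phi>_def
    by (rule the_equality) (use that linked_unique_right[OF F(1)[OF that(1)] F(1)[OF that(2)] F(3)[OF that(1)]] in blast)+
  have \<phi>: "\<phi> N N' h \<in> graded_hom H A (F N) (F N')" "linked N (\<psi> N) (\<psi> N') h (\<phi> N N' h)"
    if g: "good N" "good N'" and h: "h \<in> graded_hom \<Gamma> B N N'" for N N' h
  proof -
    obtain k where "k \<in> graded_hom H A (F N) (F N')" "linked N (\<psi> N) (\<psi> N') h k"
      by (rule linked_exists_right[OF gN[OF g(1)] gN[OF g(2)] F(1)[OF g(1)] F(1)[OF g(2)] F(3)[OF g(1)] F(3)[OF g(2)] h])
    then show "\<phi> N N' h \<in> graded_hom H A (F N) (F N')" "linked N (\<psi> N) (\<psi> N') h (\<phi> N N' h)"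
      using \<phi>_eq[OF g] by auto
  qed
  have Obj: "N \<in> Obj (GrMod U \<Gamma> B) \<longleftrightarrow> good N" for N by (simp add: good_def)
  show ?thesis
  proof (rule equivalent_categoriesI[OF B.is_linear_category_GrMod A.is_linear_category_GrMod])
    show "linear_functor (GrMod U \<Gamma> B) (GrMod U H A) F \<phi>"
      unfolding linear_functor_def
    proof (intro conjI ballI allI; (simp only: Obj)?)
      fix N assume N: "good N"
      then show "F N \<in> Obj (GrMod U H A)" using F by simp
      show "\<phi> N N (Ident (GrMod U \<Gamma> B) N) = Ident (GrMod U H A) (F N)"
        using \<phi>_eq[OF N N id_graded_hom[OF F(1)[OF N]] linked_Ident[OF gN[OF N] F(3)[OF N] F(1)[OF N]]] by simp
    next
      fix N N' h assume N: "good N" "good N'" and "h \<in> Hom (GrMod U \<Gamma> B) N N'"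
      then have h: "h \<in> graded_hom \<Gamma> B N N'" by simp
      interpret N: gmod \<Gamma> B N by (rule gmodI gN)+ fact
      interpret M: gmod H A "F N" by (rule gmodI F(1))+ fact
      interpret N': gmod \<Gamma> B N' by (rule gmodI gN)+ fact
      note mc = M.M.piece_carrier[OF _ representsD(2)[OF F(3)[OF N(1)]]]
      note hp = graded_homD(4)[OF h s]
      show "\<phi> N N' h \<in> Hom (GrMod U H A) (F N) (F N')" using \<phi>[OF N h] by simp
      {
        fix c
        let ?k = "\<lambda>m\<in>carrier (F N). act (F N') (\<phi> N N' h m) (scalar A c)"
        \<comment> \<open>Scaling is the action of a scalar of the algebra, and
          \<open>\<Theta>_scalar\<close> matches the scalars on the two sides.\<close>
        have l: "linked N (\<psi> N) (\<psi> N') (\<lambda>m\<in>carrier N. act N' (h m) (scalar B c)) ?k"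
          unfolding linked_def
        proof (intro ballI)
          fix n v assume n: "n \<in> carrier H" and v: "v \<in> piece N (s n)"
          have "?k (\<psi> N n v) = act (F N') (\<psi> N' n (h v)) (scalar A c)"
            using linkedD[OF \<phi>(2)[OF N h] n v] mc[OF n n v] by simp
          also have "\<dots> = \<psi> N' n (act N' (h v) (\<Theta> n n (scalar A c)))"
            using representsD(4)[OF F(3)[OF N(2)] n n hp[OF n v], of "scalar A c"] n by simp
          also have "\<dots> = \<psi> N' n ((\<lambda>m\<in>carrier N. act N' (h m) (scalar B c)) v)"
            using N.M.piece_carrier[OF s[OF n] v] \<Theta>_scalar[OF n] by simp
          finally show "?k (\<psi> N n v) = \<psi> N' n ((\<lambda>m\<in>carrier N. act N' (h m) (scalar B c)) v)" .
        qed
        show "\<phi> N N' (Hom_scale (GrMod U \<Gamma> B) N N' c h) = Hom_scale (GrMod U H A) (F N) (F N') c (\<phi> N N' h)"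
          using \<phi>_eq[OF N A.scale_graded_hom[OF \<phi>(1)[OF N h] F(1)[OF N(1)] F(1)[OF N(2)]] l] by simp
      }
      fix h' assume "h' \<in> Hom (GrMod U \<Gamma> B) N N'"
      then have h': "h' \<in> graded_hom \<Gamma> B N N'" by simp
      note hp' = graded_homD(4)[OF h' s]
      let ?k = "\<lambda>m\<in>carrier (F N). \<phi> N N' h m \<oplus>\<^bsub>F N'\<^esub> \<phi> N N' h' m"
      have l: "linked N (\<psi> N) (\<psi> N') (\<lambda>m\<in>carrier N. h m \<oplus>\<^bsub>N'\<^esub> h' m) ?k"
        unfolding linked_def
      proof (intro ballI)
        fix n v assume n: "n \<in> carrier H" and v: "v \<in> piece N (s n)"
        show "?k (\<psi> N n v) = \<psi> N' n ((\<lambda>m\<in>carrier N. h m \<oplus>\<^bsub>N'\<^esub> h' m) v)"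
          using linkedD[OF \<phi>(2)[OF N h] n v] linkedD[OF \<phi>(2)[OF N h'] n v] mc[OF n n v]
            representsD(3)[OF F(3)[OF N(2)] n hp[OF n v] hp'[OF n v]] N.M.piece_carrier[OF s[OF n] v] by simp
      qed
      show "\<phi> N N' (Hom_add (GrMod U \<Gamma> B) N N' h h') = Hom_add (GrMod U H A) (F N) (F N') (\<phi> N N' h) (\<phi> N N' h')"
        using \<phi>_eq[OF N A.add_graded_hom[OF \<phi>(1)[OF N h] \<phi>(1)[OF N h'] F(1)[OF N(1)] F(1)[OF N(2)]] l] by simp
    next
      fix N N' N'' h h' assume N: "good N" "good N'" "good N''"
        and "h \<in> Hom (GrMod U \<Gamma> B) N N'" "h' \<in> Hom (GrMod U \<Gamma> B) N' N''"
      then have h: "h \<in> graded_hom \<Gamma> B N N'" "h' \<in> graded_hom \<Gamma> B N' N''" by simp_all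
      note p = \<phi>[OF N(1,2) h(1)] and p' = \<phi>[OF N(2,3) h(2)]
      show "\<phi> N N'' (Comp (GrMod U \<Gamma> B) N N' N'' h' h) =
            Comp (GrMod U H A) (F N) (F N') (F N'') (\<phi> N' N'' h') (\<phi> N N' h)"
        using \<phi>_eq[OF N(1,3) compose_graded_hom[OF p(1) p'(1) F(1)[OF N(1)]]
            linked_compose[OF gN[OF N(1)] F(3)[OF N(1)] F(1)[OF N(1)] h(1) p(2) p'(2)]] by simp
    qed
  next
    fix N N' assume "N \<in> Obj (GrMod U \<Gamma> B)" "N' \<in> Obj (GrMod U \<Gamma> B)"
    then have N: "good N" "good N'" by (simp_all only: Obj)
    have "bij_betw (\<phi> N N') (graded_hom \<Gamma> B N N') (graded_hom H A (F N) (F N'))"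
      unfolding bij_betw_def
    proof (intro conjI inj_onI equalityI subsetI)
      fix h h' assume h: "h \<in> graded_hom \<Gamma> B N N'" "h' \<in> graded_hom \<Gamma> B N N'" and eq: "\<phi> N N' h = \<phi> N N' h'"
      show "h = h'"
        by (rule linked_unique_left[OF gN[OF N(1)] gN[OF N(2)] F(3)[OF N(2)] h \<phi>(2)[OF N h(1)]])
          (use \<phi>(2)[OF N h(2)] eq in simp)
    next
      fix k assume "k \<in> \<phi> N N' ` graded_hom \<Gamma> B N N'"
      then show "k \<in> graded_hom H A (F N) (F N')" using \<phi>(1)[OF N] by blast
    next
      fix k assume k: "k \<in> graded_hom H A (F N) (F N')"
      obtain h where "h \<in> graded_hom \<Gamma> B N N'" "linked N (\<psi> N) (\<psi> N') h k"
        by (rule linked_exists_left[OF gN[OF N(1)] gN[OF N(2)] F(1)[OF N(1)] F(1)[OF N(2)] F(3)[OF N(1)] F(3)[OF N(2)] k])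
      then show "k \<in> \<phi> N N' ` graded_hom \<Gamma> B N N'" using \<phi>_eq[OF N k] by blast
    qed
    then show "bij_betw (\<phi> N N') (Hom (GrMod U \<Gamma> B) N N') (Hom (GrMod U H A) (F N) (F N'))" by simp
  next
    fix M assume "M \<in> Obj (GrMod U H A)"
    then have M: "graded_right_module H A M" "carrier M \<in> U" by auto
    obtain N \<psi>0 where "graded_right_module \<Gamma> B N" "carrier N \<subseteq> carrier M" and r: "represents N M \<psi>0"
      by (rule coinduction_exists[OF M(1) \<Gamma> inf])
    then have N: "good N" using M(2) U[of "carrier M" "carrier N"] by (simp add: good_def)
    note gN' = gN[OF N] and FN = F[OF N]
    note id = id_graded_hom[OF gN']
    \<comment> \<open>\<open>F N\<close> and \<open>M\<close> represent the same \<open>N\<close>,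
      so the identity of \<open>N\<close> is linked to maps in both directions. Their composites and
      the identities are linked to the same map, hence equal.\<close>
    obtain k where k: "k \<in> graded_hom H A (F N) M" "linked N (\<psi> N) \<psi>0 (\<lambda>m\<in>carrier N. m) k"
      by (rule linked_exists_right[OF gN' gN' FN(1) M(1) FN(3) r id])
    obtain k' where k': "k' \<in> graded_hom H A M (F N)" "linked N \<psi>0 (\<psi> N) (\<lambda>m\<in>carrier N. m) k'"
      by (rule linked_exists_right[OF gN' gN' M(1) FN(1) r FN(3) id])
    have idid: "compose (carrier N) (\<lambda>m\<in>carrier N. m) (\<lambda>m\<in>carrier N. m) = (\<lambda>m\<in>carrier N. m)"
      by (auto simp: compose_def fun_eq_iff)
    have 1: "compose (carrier (F N)) k' k = (\<lambda>m\<in>carrier (F N). m)"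
      by (rule linked_unique_right[OF FN(1) FN(1) FN(3) compose_graded_hom[OF k(1) k'(1) FN(1)] id_graded_hom[OF FN(1)]
            linked_compose[OF gN' FN(3) FN(1) id k(2) k'(2), unfolded idid] linked_Ident[OF gN' FN(3) FN(1)]])
    have 2: "compose (carrier M) k k' = (\<lambda>m\<in>carrier M. m)"
      by (rule linked_unique_right[OF M(1) M(1) r compose_graded_hom[OF k'(1) k(1) M(1)] id_graded_hom[OF M(1)]
            linked_compose[OF gN' r M(1) id k'(2) k(2), unfolded idid] linked_Ident[OF gN' r M(1)]])
    have "isomorphism (GrMod U H A) (F N) M k"
      unfolding isomorphism_def using k k' 1 2 by auto
    then show "\<exists>N\<in>Obj (GrMod U \<Gamma> B). \<exists>e. isomorphism (GrMod U H A) (F N) M e" using N Obj by blast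
  qed
qed

end

section \<open>The base ring and its automorphism\<close>

lemma Fract_eq_0_iff: "b \<noteq> 0 \<Longrightarrow> Fract a b = 0 \<longleftrightarrow> a = 0"
  by (simp add: Zero_fract_def eq_fract)

lemma Fract_eq_1_iff: "b \<noteq> 0 \<Longrightarrow> Fract a b = 1 \<longleftrightarrow> a = b"
  by (simp add: One_fract_def eq_fract)

lemma Fract_power: "Fract a b ^ n = Fract (a ^ n) (b ^ n)"
  by (induction n) (simp_all add: One_fract_def)

lemma of_poly_add: "of_poly (p + q) = of_poly p + of_poly q"
  and of_poly_mult: "of_poly (p * q) = of_poly p * of_poly q"
  and of_poly_power: "of_poly (p ^ n) = of_poly p ^ n"
  by (simp_all add: Fract_power)

lemma of_poly_prod: "of_poly (prod g A) = (\<Prod>x\<in>A. of_poly (g x))"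
  by (induction A rule: infinite_finite_induct) (simp_all add: One_fract_def[symmetric] of_poly_mult del: mult_fract)

lemma pcompose_power: "pcompose (p ^ n) q = pcompose p q ^ n"
  by (induction n) (simp_all add: pcompose_1 pcompose_mult)

lemma subst_ratfun_Fract:
  assumes "degree s \<noteq> 0" "b \<noteq> 0"
  shows "subst_ratfun s (Fract a b) = Fract (pcompose a s) (pcompose b s)"
  using assms by transfer (auto simp: pcompose_eq_0_iff)

context
  fixes s :: "'k::field poly" assumes s: "degree s \<noteq> 0"
begin

lemma pcompose_nonzero: "b \<noteq> 0 \<Longrightarrow> pcompose b s \<noteq> 0"
  using s by (auto simp: pcompose_eq_0_iff)

lemma subst_ratfun_add: "subst_ratfun s (u + v) = subst_ratfun s u + subst_ratfun s v"
  by (cases u rule: Fract_cases, cases v rule: Fract_cases)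
    (simp add: subst_ratfun_Fract s pcompose_nonzero pcompose_add pcompose_mult)

lemma subst_ratfun_mult: "subst_ratfun s (u * v) = subst_ratfun s u * subst_ratfun s v"
  by (cases u rule: Fract_cases, cases v rule: Fract_cases)
    (simp add: subst_ratfun_Fract s pcompose_mult)

lemma subst_ratfun_of_poly: "subst_ratfun s (of_poly p) = of_poly (pcompose p s)"
  by (simp add: subst_ratfun_Fract s pcompose_1)

end

lemma subst_ratfun_subst:
  assumes "degree s \<noteq> 0" "degree t \<noteq> 0"
  shows "subst_ratfun s (subst_ratfun t r) = subst_ratfun (pcompose t s) r"
  using assms
  by (cases r rule: Fract_cases) (simp add: subst_ratfun_Fract pcompose_nonzero degree_pcompose pcompose_assoc)

lemma subst_ratfun_X: "subst_ratfun [:0, 1:] r = r"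
  by (cases r rule: Fract_cases) (simp add: subst_ratfun_Fract)

locale gwa_setting =
  fixes T :: "'k::{alg_closed_field, field_char_0} base" and f :: "'k poly"
  assumes base: "T = Shift \<or>
      (\<exists>\<xi>. T = QShift \<xi> \<and> \<xi> \<noteq> 0 \<and> (\<forall>n>0. \<xi> ^ n \<noteq> 1) \<and> poly f 0 \<noteq> 0)"
    and monic: "lead_coeff f = 1"
    and simple: "\<And>\<alpha> \<beta> n. \<lbrakk>\<alpha> \<in> roots f; \<beta> \<in> roots f; \<beta> = sigma_k T n \<alpha>\<rbrakk> \<Longrightarrow> \<beta> = \<alpha>"
begin

abbreviation \<sigma> where "\<sigma> \<equiv> sigma T"
abbreviation R where "R \<equiv> base_carrier T"

lemma degree_sigma_arg [simp]: "degree (sigma_arg T i) = 1"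
  using base by auto

lemma \<sigma>_add: "\<sigma> i (u + v) = \<sigma> i u + \<sigma> i v"
  unfolding sigma_def by (rule subst_ratfun_add) simp
lemma \<sigma>_mult: "\<sigma> i (u * v) = \<sigma> i u * \<sigma> i v"
  unfolding sigma_def by (rule subst_ratfun_mult) simp
lemma \<sigma>_of_poly: "\<sigma> i (of_poly p) = of_poly (pcompose p (sigma_arg T i))"
  unfolding sigma_def by (rule subst_ratfun_of_poly) simp
lemma \<sigma>_const [simp]: "\<sigma> i (of_poly [:c:]) = of_poly [:c:]"
  by (simp add: \<sigma>_of_poly)
lemma \<sigma>_0 [simp]: "\<sigma> i 0 = 0"
  using \<sigma>_const[of i 0] by (simp add: Zero_fract_def)
lemma \<sigma>_1 [simp]: "\<sigma> i 1 = 1"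
  using \<sigma>_const[of i 1] by (simp add: One_fract_def one_pCons)
lemma \<sigma>_uminus: "\<sigma> i (- u) = - \<sigma> i u"
  using \<sigma>_add[of i u "- u"] by (simp add: eq_neg_iff_add_eq_0 add.commute)
lemma \<sigma>_diff: "\<sigma> i (u - v) = \<sigma> i u - \<sigma> i v"
  using \<sigma>_add[of i u "- v"] by (simp add: \<sigma>_uminus)
lemma \<sigma>_sum: "\<sigma> i (sum g S) = (\<Sum>x\<in>S. \<sigma> i (g x))"
  by (induction S rule: infinite_finite_induct) (simp_all add: \<sigma>_add)
lemma \<sigma>_prod: "\<sigma> i (prod g S) = (\<Prod>x\<in>S. \<sigma> i (g x))"
  by (induction S rule: infinite_finite_induct) (simp_all add: \<sigma>_mult)
lemma \<sigma>_of_int [simp]: "\<sigma> i (of_int n) = of_int n"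
proof -
  have "\<sigma> i (of_nat m) = of_nat m" for m by (induction m) (simp_all add: \<sigma>_add)
  then show ?thesis by (cases n) (simp_all add: \<sigma>_uminus \<sigma>_diff)
qed

lemma \<xi>_nonzero: "T = QShift \<xi> \<Longrightarrow> \<xi> \<noteq> 0"
  using base by auto

lemma \<sigma>_\<sigma> [simp]: "\<sigma> i (\<sigma> j r) = \<sigma> (i + j) r"
proof -
  have "pcompose (sigma_arg T j) (sigma_arg T i) = sigma_arg T (i + j)"
    by (cases T) (auto simp: pcompose_pCons \<xi>_nonzero power_int_add)
  then show ?thesis unfolding sigma_def by (simp add: subst_ratfun_subst)
qed

lemma \<sigma>_zero [simp]: "\<sigma> 0 r = r"
proof -
  have "sigma_arg T 0 = [:0, 1:]" by (cases T) auto
  then show ?thesis by (simp add: sigma_def subst_ratfun_X)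
qed

lemma \<sigma>_eq_iff: "\<sigma> i u = \<sigma> i v \<longleftrightarrow> u = v"
proof
  assume "\<sigma> i u = \<sigma> i v"
  then have "\<sigma> (- i) (\<sigma> i u) = \<sigma> (- i) (\<sigma> i v)" by (rule arg_cong)
  then show "u = v" by simp
qed simp

lemma \<sigma>_eq_0 [simp]: "\<sigma> i u = 0 \<longleftrightarrow> u = 0"
  using \<sigma>_eq_iff[of i u 0] by simp

lemma \<sigma>_inverse: "\<sigma> i (inverse u) = inverse (\<sigma> i u)"
proof (cases "u = 0")
  case False
  then have "\<sigma> i u * \<sigma> i (inverse u) = 1" by (simp flip: \<sigma>_mult)
  then show ?thesis by (simp add: inverse_unique)
qed simp

lemma \<sigma>_divide: "\<sigma> i (u / v) = \<sigma> i u / \<sigma> i v"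
  by (simp add: divide_inverse \<sigma>_mult \<sigma>_inverse)

lemma of_poly_R [simp, intro]: "of_poly p \<in> R"
proof (cases T)
  case (QShift \<xi>)
  have "of_poly p = Fract p ([:0, 1:] ^ 0)" by simp
  then show ?thesis unfolding QShift base_carrier.simps by blast
qed auto

lemma R_0 [simp, intro]: "0 \<in> R"
  using of_poly_R[of 0] by (simp add: Zero_fract_def)
lemma R_1 [simp, intro]: "1 \<in> R"
  using of_poly_R[of 1] by (simp add: One_fract_def)

lemma R_add [simp, intro]: assumes "u \<in> R" "v \<in> R" shows "u + v \<in> R"
proof (cases T)
  case Shift
  then show ?thesis using assms by (auto simp flip: of_poly_add simp del: add_fract)
next
  case (QShift \<xi>)
  then obtain p n q m where "u = Fract p ([:0, 1:] ^ n)" "v = Fract q ([:0, 1:] ^ m)" using assms by auto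
  then have "u + v = Fract (p * [:0, 1:] ^ m + q * [:0, 1:] ^ n) ([:0, 1:] ^ (n + m))" by (simp add: power_add)
  then show ?thesis using QShift by auto
qed

lemma R_mult [simp, intro]: assumes "u \<in> R" "v \<in> R" shows "u * v \<in> R"
proof (cases T)
  case Shift
  then show ?thesis using assms by (auto simp flip: of_poly_mult simp del: mult_fract)
next
  case (QShift \<xi>)
  then obtain p n q m where "u = Fract p ([:0, 1:] ^ n)" "v = Fract q ([:0, 1:] ^ m)" using assms by auto
  then have "u * v = Fract (p * q) ([:0, 1:] ^ (n + m))" by (simp add: power_add)
  then show ?thesis using QShift by auto
qed

lemma R_uminus [simp, intro]: "u \<in> R \<Longrightarrow> - u \<in> R"
  using R_mult[OF of_poly_R[of "-1"], of u] by (simp add: One_fract_def[symmetric] del: mult_fract flip: minus_fract)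
lemma R_diff [simp, intro]: "u \<in> R \<Longrightarrow> v \<in> R \<Longrightarrow> u - v \<in> R"
  using R_add[of u "- v"] by simp
lemma R_power [simp, intro]: "u \<in> R \<Longrightarrow> u ^ n \<in> R" by (induction n) auto
lemma R_sum [intro]: "(\<And>x. x \<in> S \<Longrightarrow> g x \<in> R) \<Longrightarrow> sum g S \<in> R"
  by (induction S rule: infinite_finite_induct) auto
lemma R_prod [intro]: "(\<And>x. x \<in> S \<Longrightarrow> g x \<in> R) \<Longrightarrow> prod g S \<in> R"
  by (induction S rule: infinite_finite_induct) auto
lemma R_of_int [simp, intro]: "of_int n \<in> R"
proof -
  have "of_nat m \<in> R" for m by (induction m) auto
  then show ?thesis by (cases n) auto
qed

lemma \<sigma>_R [simp, intro]: assumes "u \<in> R" shows "\<sigma> i u \<in> R"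
proof (cases T)
  case Shift
  then obtain p where "u = of_poly p" using assms by auto
  then show ?thesis by (simp add: \<sigma>_of_poly)
next
  case (QShift \<xi>)
  then obtain p n where u: "u = Fract p ([:0, 1:] ^ n)" using assms by auto
  let ?s = "[:0, \<xi> powi i:]"
  have \<xi>: "\<xi> \<noteq> 0" using \<xi>_nonzero QShift by simp
  \<comment> \<open>The denominator z^n goes to a unit multiple of itself, and the unit can be moved
    to the numerator.\<close>
  have pn: "pcompose ([:0, 1:] ^ n) ?s = smult ((\<xi> powi i) ^ n) ([:0, 1:] ^ n)"
  proof (induction n)
    case (Suc n)
    have "[:0, \<xi> powi i:] = smult (\<xi> powi i) [:0, 1:]" by simp
    then show ?case using Suc by (simp add: pcompose_mult pcompose_pCons mult.commute)
  qed (simp add: pcompose_1)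
  have "\<sigma> i u = Fract (pcompose p ?s) (smult ((\<xi> powi i) ^ n) ([:0, 1:] ^ n))"
    unfolding u using QShift \<xi> by (simp add: sigma_def subst_ratfun_Fract pn del: pcompose_pCons)
  also have "\<dots> = Fract (smult (inverse ((\<xi> powi i) ^ n)) (pcompose p ?s)) ([:0, 1:] ^ n)"
    using \<xi> by (simp add: eq_fract)
  finally show ?thesis using QShift by auto
qed

text \<open>Both arguments range over k(z), so this is membership of \<open>c\<close> in the
  fractional ideal \<open>a\<close> \<open>R\<close>. Divisors of lattices may thus contain inverses
  such as that of \<open>h_elem\<close>.\<close>

definition dvdR (infix "dvdR" 50) where "a dvdR c \<longleftrightarrow> (\<exists>r\<in>R. c = a * r)"

lemma dvdRI [intro]: "r \<in> R \<Longrightarrow> c = a * r \<Longrightarrow> a dvdR c" unfolding dvdR_def by blast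
lemma dvdRE [elim]: "a dvdR c \<Longrightarrow> (\<And>r. r \<in> R \<Longrightarrow> c = a * r \<Longrightarrow> P) \<Longrightarrow> P" unfolding dvdR_def by blast
lemma dvdR_refl [simp]: "a dvdR a" by (rule dvdRI[of 1]) auto
lemma dvdR_0 [simp]: "a dvdR 0" by (rule dvdRI[of 0]) auto
lemma dvdR_add: "a dvdR c \<Longrightarrow> a dvdR d \<Longrightarrow> a dvdR c + d"
  unfolding dvdR_def by (metis R_add distrib_left)
lemma dvdR_uminus: "a dvdR c \<Longrightarrow> a dvdR - c"
  unfolding dvdR_def by (metis R_uminus mult_minus_right)
lemma dvdR_diff: "a dvdR c \<Longrightarrow> a dvdR d \<Longrightarrow> a dvdR c - d"
  using dvdR_add[of a c "- d"] dvdR_uminus by simp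
lemma dvdR_sum: "(\<And>x. x \<in> S \<Longrightarrow> a dvdR g x) \<Longrightarrow> a dvdR sum g S"
  by (induction S rule: infinite_finite_induct) (auto intro: dvdR_add)
lemma dvdR_mult: "a dvdR c \<Longrightarrow> r \<in> R \<Longrightarrow> a dvdR c * r"
  unfolding dvdR_def by (metis R_mult mult.assoc)
lemma dvdR_mult_mono: "a dvdR c \<Longrightarrow> b dvdR d \<Longrightarrow> a * b dvdR c * d"
  unfolding dvdR_def by (metis (no_types, opaque_lifting) R_mult mult.assoc mult.left_commute)
lemma dvdR_trans: "a dvdR b \<Longrightarrow> b dvdR c \<Longrightarrow> a dvdR c"
  unfolding dvdR_def by (metis R_mult mult.assoc)
lemma dvdR_\<sigma>: "a dvdR c \<Longrightarrow> \<sigma> i a dvdR \<sigma> i c"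
  unfolding dvdR_def by (metis \<sigma>_R \<sigma>_mult)
lemma one_dvdR [simp]: "1 dvdR c \<longleftrightarrow> c \<in> R" unfolding dvdR_def by simp
lemma dvdR_cancel: "a \<noteq> 0 \<Longrightarrow> a * b dvdR a * c \<longleftrightarrow> b dvdR c"
  unfolding dvdR_def by (simp add: mult.assoc)
lemma dvdR_divide: "a \<noteq> 0 \<Longrightarrow> a dvdR c \<longleftrightarrow> c / a \<in> R"
  unfolding dvdR_def by (metis nonzero_mult_div_cancel_left nonzero_eq_divide_eq mult.commute)

section \<open>Comaximality in the base ring\<close>

definition comax where "comax a b \<longleftrightarrow> (\<exists>u\<in>R. \<exists>v\<in>R. a * u + b * v = 1)"

lemma comax_sym: "comax a b \<Longrightarrow> comax b a"
  unfolding comax_def by (metis add.commute)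

lemma comax_1 [simp]: "comax a 1" unfolding comax_def by (rule bexI[of _ 0], rule bexI[of _ 1]) auto

text \<open>The product of the two Bezout identities, with every term containing \<open>a\<close>
  collected.\<close>

lemma comax_mult:
  assumes "a \<in> R" "b \<in> R" "c \<in> R" "comax a b" "comax a c"
  shows "comax a (b * c)"
proof -
  obtain u v where uv: "u \<in> R" "v \<in> R" "a * u + b * v = 1" using assms unfolding comax_def by blast
  obtain x y where xy: "x \<in> R" "y \<in> R" "a * x + c * y = 1" using assms unfolding comax_def by blast
  have "a * (u * (a * x + c * y) + b * v * x) + b * c * (v * y) = (a * u + b * v) * (a * x + c * y)"
    by (simp add: algebra_simps)
  then show ?thesis unfolding comax_def using assms uv xy by (metis R_add R_mult mult_1)
qed

lemma comax_prod:
  assumes "a \<in> R" "\<And>x. x \<in> S \<Longrightarrow> g x \<in> R" "\<And>x. x \<in> S \<Longrightarrow> comax a (g x)"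
  shows "comax a (prod g S)"
  using assms(2,3) by (induction S rule: infinite_finite_induct) (auto intro!: comax_mult assms(1) R_prod)

lemma comax_power: "a \<in> R \<Longrightarrow> b \<in> R \<Longrightarrow> comax a b \<Longrightarrow> comax a (b ^ n)"
  by (induction n) (auto intro!: comax_mult)

section \<open>The translated root factors of f and their products\<close>

lemma f_nonzero: "f \<noteq> 0" using monic by auto

lemma finite_roots [simp, intro]: "finite (roots f)"
  unfolding roots_def by (rule poly_roots_finite[OF f_nonzero])

text \<open>Algebraic closedness splits the monic \<open>f\<close> into linear factors; the
  multiplicities in the resulting multiset are the orders of the roots.\<close>

lemma f_factorization: "of_poly f = (\<Prod>\<alpha>\<in>roots f. root_factor f \<alpha>)"
proof -
  obtain A where "f = smult (lead_coeff f) (\<Prod>x\<in>#A. [:- x, 1:])"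
    using alg_closed_imp_factorization[OF f_nonzero] by blast
  then have f: "f = (\<Prod>x\<in>#A. [:- x, 1:])" using monic by simp
  have "proots f = A"
    unfolding f
  proof (induction A)
    case (add x A)
    have "[:- x, 1:] * (\<Prod>x\<in>#A. [:- x, 1:]) \<noteq> 0" by (auto simp: prod_mset_zero_iff simp del: mult_pCons_left)
    then show ?case using add by (simp add: proots_mult del: mult_pCons_left)
  qed simp
  then have count: "count A x = Polynomial.order x f" for x using count_proots[OF f_nonzero, of x] by simp
  have "set_mset A = roots f"
    using \<open>proots f = A\<close> set_count_proots[OF f_nonzero] by (auto simp: roots_def)
  then have "(\<Prod>x\<in>#A. [:- x, 1:]) = (\<Prod>\<alpha>\<in>roots f. [:- \<alpha>, 1:] ^ Polynomial.order \<alpha> f)"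
    by (simp add: image_prod_mset_multiplicity count)
  with f have "f = (\<Prod>\<alpha>\<in>roots f. [:- \<alpha>, 1:] ^ Polynomial.order \<alpha> f)" by (rule trans)
  then have "of_poly f = of_poly (\<Prod>\<alpha>\<in>roots f. [:- \<alpha>, 1:] ^ Polynomial.order \<alpha> f)" by (rule arg_cong)
  then show ?thesis unfolding root_factor_def of_poly_prod .
qed

text \<open>The contribution of the label \<open>(\<alpha>, j)\<close> to \<open>h_elem\<close>.
  With labels as indices, the divisor of a lattice in each degree is governed by a set of labels,
  and \<open>iota\<close> toggles a single one.\<close>

definition gfac :: "'k \<times> int \<Rightarrow> 'k ratfun" where
  "gfac e = \<sigma> (- snd e) (root_factor f (fst e))"

text \<open>For the label \<open>(\<alpha>, j)\<close>, the linear polynomial with root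
  \<open>sigma_k T (-j) \<alpha>\<close>.\<close>

definition lin :: "'k \<times> int \<Rightarrow> 'k poly" where
  "lin e = pcompose [:- fst e, 1:] (sigma_arg T (- snd e))"

lemma gfac_lin: "gfac e = of_poly (lin e) ^ Polynomial.order (fst e) f"
  unfolding gfac_def root_factor_def \<sigma>_of_poly lin_def pcompose_power by (rule of_poly_power)

lemma lin_nonzero: "lin e \<noteq> 0"
  unfolding lin_def by (rule pcompose_nonzero) auto

lemma gfac_nonzero [simp]: "gfac e \<noteq> 0"
  using lin_nonzero by (simp add: gfac_lin Fract_eq_0_iff)

lemma gfac_R [simp, intro]: "gfac e \<in> R" by (simp add: gfac_lin)

lemma \<sigma>_gfac: "\<sigma> i (gfac (\<alpha>, j)) = gfac (\<alpha>, j - i)"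
  by (simp add: gfac_def)

lemma root_nonzero: "T = QShift \<xi> \<Longrightarrow> \<alpha> \<in> roots f \<Longrightarrow> \<alpha> \<noteq> 0"
  using base by (auto simp: roots_def)

text \<open>Eliminating z from a + b z and c + d z leaves the determinant a d - b c, a nonzero
  constant.\<close>

lemma comax_linear:
  assumes "a * d \<noteq> b * c"
  shows "comax (of_poly [:a, b:]) (of_poly [:c, d:])"
proof -
  let ?i = "inverse (a * d - b * c)"
  have "[:a, b:] * [:d * ?i:] + [:c, d:] * [:- (b * ?i):] = [:(a * d - b * c) * ?i:]"
    by (simp add: algebra_simps)
  also have "\<dots> = 1" using assms by (simp add: one_pCons)
  finally have "of_poly ([:a, b:] * [:d * ?i:] + [:c, d:] * [:- (b * ?i):]) = 1" by (simp add: One_fract_def)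
  then show ?thesis unfolding comax_def
    by (intro bexI[of _ "of_poly [:d * ?i:]"] bexI[of _ "of_poly [:- (b * ?i):]"]) (simp_all only: of_poly_add of_poly_mult of_poly_R)
qed

text \<open>Distinct labels have distinct linear roots: a common root would put \<alpha> and \<beta>
  on one orbit, so \<alpha> = \<beta> by \<open>simple\<close>. Then j = l, by characteristic zero
  for the shift, and for the scaling because \<alpha> is nonzero and \<xi> is not a root of
  unity.\<close>

lemma comax_gfac:
  assumes e: "e \<in> roots f \<times> UNIV" "e' \<in> roots f \<times> UNIV" and ne: "e \<noteq> e'"
  shows "comax (gfac e) (gfac e')"
proof -
  obtain \<alpha> j \<beta> l where ee: "e = (\<alpha>, j)" "e' = (\<beta>, l)" by (cases e, cases e')
  have "comax (of_poly (lin e)) (of_poly (lin e'))"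
  proof (cases T)
    case Shift
    have "\<beta> + of_int l \<noteq> \<alpha> + of_int j"
    proof
      assume *: "\<beta> + of_int l = \<alpha> + of_int j"
      then have "\<beta> = sigma_k T (l - j) \<alpha>" using Shift by (simp add: algebra_simps)
      then have "\<beta> = \<alpha>" using simple e ee by blast
      then show False using * ne ee by simp
    qed
    then have ne': "(- \<alpha> - of_int j) * 1 \<noteq> 1 * (- \<beta> - of_int l)" by (simp add: algebra_simps)
    have "lin e = [:- \<alpha> - of_int j, 1:]" "lin e' = [:- \<beta> - of_int l, 1:]"
      unfolding lin_def ee by (simp_all add: Shift pcompose_pCons)
    then show ?thesis using comax_linear[OF ne'] by simp
  next
    case (QShift \<xi>)
    have \<xi>: "\<xi> \<noteq> 0" "\<And>n. n > 0 \<Longrightarrow> \<xi> ^ n \<noteq> 1" using base QShift by auto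
    have \<alpha>: "\<alpha> \<noteq> 0" using root_nonzero[OF QShift] e ee by auto
    have "\<alpha> * \<xi> powi (- l) \<noteq> \<beta> * \<xi> powi (- j)"
    proof
      assume *: "\<alpha> * \<xi> powi (- l) = \<beta> * \<xi> powi (- j)"
      then have "\<beta> = \<alpha> * (\<xi> powi (- l) * \<xi> powi j)" using \<xi> by (simp add: power_int_minus field_simps)
      also have "\<xi> powi (- l) * \<xi> powi j = \<xi> powi (- (l - j))" using \<xi> by (simp flip: power_int_add)
      finally have b: "\<beta> = \<alpha> * \<xi> powi (- (l - j))" .
      then have "\<beta> = sigma_k T (l - j) \<alpha>" using QShift by (simp add: mult.commute)
      then have "\<beta> = \<alpha>" using simple e ee by blast
      then have 1: "\<xi> powi (j - l) = 1" using b \<alpha> by simp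
      have "j \<noteq> l" using ne ee \<open>\<beta> = \<alpha>\<close> by simp
      then consider "j > l" | "l > j" by linarith
      then show False
      proof cases
        case 1
        then have "\<xi> ^ nat (j - l) = 1" using \<open>\<xi> powi (j - l) = 1\<close> by (simp add: power_int_def)
        then show False using \<xi>(2)[of "nat (j - l)"] 1 by simp
      next
        case 2
        then have "\<xi> ^ nat (l - j) = 1" using \<open>\<xi> powi (j - l) = 1\<close> by (simp add: power_int_def power_inverse)
        then show False using \<xi>(2)[of "nat (l - j)"] 2 by simp
      qed
    qed
    then have ne': "- \<alpha> * \<xi> powi (- l) \<noteq> \<xi> powi (- j) * - \<beta>" by (simp add: mult.commute)
    have "lin e = [:- \<alpha>, \<xi> powi (- j):]" "lin e' = [:- \<beta>, \<xi> powi (- l):]"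
      unfolding lin_def ee by (simp_all add: QShift pcompose_pCons)
    then show ?thesis using comax_linear[OF ne'] by simp
  qed
  then have "comax (of_poly (lin e)) (of_poly (lin e') ^ Polynomial.order (fst e') f)"
    by (intro comax_power) auto
  then have "comax (of_poly (lin e') ^ Polynomial.order (fst e') f) (of_poly (lin e) ^ Polynomial.order (fst e) f)"
    by (intro comax_power[OF R_power[OF of_poly_R] of_poly_R comax_sym])
  then show ?thesis unfolding gfac_lin by (rule comax_sym)
qed

lemma order_pos: "\<alpha> \<in> roots f \<Longrightarrow> Polynomial.order \<alpha> f > 0"
  using f_nonzero by (simp add: roots_def order_root)

text \<open>After applying \<sigma>^j the factor vanishes at \<alpha>, whereas elements of
  \<open>R\<close> have no pole there: if denominators z^n occur, then \<alpha> is nonzero.\<close>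

lemma gfac_not_unit:
  assumes "fst e \<in> roots f" shows "\<not> gfac e dvdR 1"
proof
  obtain \<alpha> j where e: "e = (\<alpha>, j)" by (cases e)
  have \<alpha>: "\<alpha> \<in> roots f" using assms e by simp
  assume "gfac e dvdR 1"
  then obtain r where r: "r \<in> R" "1 = gfac e * r" by blast
  have "\<sigma> j 1 = \<sigma> j (gfac e) * \<sigma> j r" unfolding r(2) by (rule \<sigma>_mult)
  then have 1: "1 = root_factor f \<alpha> * \<sigma> j r" by (simp add: gfac_def e)
  obtain p q where pq: "\<sigma> j r = Fract p q" "poly q \<alpha> \<noteq> 0"
  proof (cases T)
    case Shift
    then obtain p where "\<sigma> j r = of_poly p" using \<sigma>_R[OF r(1)] by auto
    with that[of p 1] show ?thesis by simp
  next
    case (QShift \<xi>)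
    then obtain p n where "\<sigma> j r = Fract p ([:0, 1:] ^ n)" using \<sigma>_R[OF r(1), of j] by auto
    with that[of p "[:0, 1:] ^ n"] root_nonzero[OF QShift \<alpha>] show ?thesis by (simp add: poly_power)
  qed
  have q: "q \<noteq> 0" using pq by auto
  have "Fract ([:- \<alpha>, 1:] ^ Polynomial.order \<alpha> f * p) q = 1" using 1 pq by (simp add: root_factor_def)
  then have "[:- \<alpha>, 1:] ^ Polynomial.order \<alpha> f * p = q" using q by (simp add: Fract_eq_1_iff)
  then have "poly q \<alpha> = 0" using order_pos[OF \<alpha>] by (auto simp: poly_power power_0_left)
  then show False using pq by simp
qed

definition gprod :: "('k \<times> int) set \<Rightarrow> 'k ratfun" where "gprod S = prod gfac S"

lemma gprod_R [simp, intro]: "gprod S \<in> R" unfolding gprod_def by (rule R_prod) simp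
lemma gprod_nonzero [simp]: "gprod S \<noteq> 0"
  unfolding gprod_def by (cases "finite S") auto
lemma gprod_empty [simp]: "gprod {} = 1" by (simp add: gprod_def)
lemma gprod_single [simp]: "gprod {e} = gfac e" by (simp add: gprod_def)

lemma gprod_union: "finite S \<Longrightarrow> finite S' \<Longrightarrow> S \<inter> S' = {} \<Longrightarrow> gprod (S \<union> S') = gprod S * gprod S'"
  unfolding gprod_def by (rule prod.union_disjoint)

lemma comax_gfac_gprod:
  assumes "S \<subseteq> roots f \<times> UNIV" "e \<in> roots f \<times> UNIV" "e \<notin> S" shows "comax (gfac e) (gprod S)"
  unfolding gprod_def
proof (rule comax_prod)
  fix x assume "x \<in> S"
  then have "x \<in> roots f \<times> UNIV" "e \<noteq> x" using assms by blast+
  then show "comax (gfac e) (gfac x)" using comax_gfac[OF assms(2)] by blast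
qed auto

lemma comax_gprod:
  assumes "S \<subseteq> roots f \<times> UNIV" "S' \<subseteq> roots f \<times> UNIV" "S \<inter> S' = {}" shows "comax (gprod S) (gprod S')"
  unfolding gprod_def[of S']
proof (rule comax_prod)
  fix x assume "x \<in> S'"
  then have "x \<in> roots f \<times> UNIV" "x \<notin> S" using assms by blast+
  then show "comax (gprod S) (gfac x)" using comax_gfac_gprod[OF assms(1)] comax_sym by blast
qed auto

lemma gfac_not_dvd_gprod:
  assumes "S \<subseteq> roots f \<times> UNIV" "e \<in> roots f \<times> UNIV" "e \<notin> S" shows "\<not> gfac e dvdR gprod S"
proof
  assume *: "gfac e dvdR gprod S"
  obtain u v where "u \<in> R" "v \<in> R" "gfac e * u + gprod S * v = 1"
    using comax_gfac_gprod[OF assms] unfolding comax_def by blast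
  then have "gfac e dvdR 1" using dvdR_add[OF dvdR_mult[OF dvdR_refl] dvdR_mult[OF *]] by metis
  then show False using gfac_not_unit assms by auto
qed

lemma \<sigma>_gprod: "\<sigma> i (gprod S) = gprod ((\<lambda>(\<alpha>, j). (\<alpha>, j - i)) ` S)"
proof -
  have "inj_on (\<lambda>(\<alpha>, j). (\<alpha>, j - i)) S" by (auto simp: inj_on_def)
  then have "gprod ((\<lambda>(\<alpha>, j). (\<alpha>, j - i)) ` S) = (\<Prod>x\<in>S. gfac ((\<lambda>(\<alpha>, j). (\<alpha>, j - i)) x))"
    unfolding gprod_def by (simp add: prod.reindex)
  also have "\<dots> = (\<Prod>x\<in>S. \<sigma> i (gfac x))"
    by (rule prod.cong) (auto simp: \<sigma>_gfac)
  finally show ?thesis unfolding gprod_def \<sigma>_prod by simp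
qed

lemma \<sigma>_f: "\<sigma> i (of_poly f) = gprod (roots f \<times> {- i})"
proof -
  have "gprod (roots f \<times> {- i}) = (\<Prod>\<alpha>\<in>roots f. gfac (\<alpha>, - i))"
    unfolding gprod_def
    by (rule prod.reindex_bij_witness[of _ "\<lambda>\<alpha>. (\<alpha>, - i)" fst]) auto
  then show ?thesis by (simp add: f_factorization \<sigma>_prod gfac_def)
qed

text \<open>Products of the \<open>gfac e\<close> are compared by comparing exponents over a common finite set.\<close>

lemma gprod_superset: "finite W \<Longrightarrow> S \<subseteq> W \<Longrightarrow> gprod S = (\<Prod>e\<in>W. gfac e ^ of_bool (e \<in> S))"
proof -
  assume W: "finite W" "S \<subseteq> W"
  have "gprod S = (\<Prod>e\<in>S. gfac e ^ of_bool (e \<in> S))" unfolding gprod_def by (intro prod.cong) auto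
  also have "\<dots> = (\<Prod>e\<in>W. gfac e ^ of_bool (e \<in> S))" using W by (intro prod.mono_neutral_left) auto
  finally show ?thesis .
qed

lemma gprod_eq2:
  assumes "finite S1" "finite S2" "finite S3" "finite S4"
    and "\<And>e. (of_bool (e \<in> S1) + of_bool (e \<in> S2) :: nat) = of_bool (e \<in> S3) + of_bool (e \<in> S4)"
  shows "gprod S1 * gprod S2 = gprod S3 * gprod S4"
proof -
  let ?W = "S1 \<union> S2 \<union> S3 \<union> S4"
  have W: "finite ?W" using assms by simp
  have g: "gprod S * gprod S' = (\<Prod>e\<in>?W. gfac e ^ (of_bool (e \<in> S) + of_bool (e \<in> S')))" if "S \<subseteq> ?W" "S' \<subseteq> ?W" for S S'
    using gprod_superset[OF W that(1)] gprod_superset[OF W that(2)] by (simp only: power_add prod.distrib)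
  have "gprod S1 * gprod S2 = (\<Prod>e\<in>?W. gfac e ^ (of_bool (e \<in> S1) + of_bool (e \<in> S2)))" by (rule g) auto
  also have "\<dots> = gprod S3 * gprod S4" unfolding assms(5) by (rule g[symmetric]) auto
  finally show ?thesis .
qed

text \<open>Divisibility becomes an inequality of multiplicities at each label, which is a
  propositional matter. Three factors per side cover all uses; shorter products are padded with
  \<open>gprod {}\<close>.\<close>

lemma gprod_dvd3:
  assumes "finite S1" "finite S2" "finite S3" "finite S4" "finite S5" "finite S6"
    and le: "\<And>e. (of_bool (e \<in> S1) + of_bool (e \<in> S2) + of_bool (e \<in> S3) :: nat) \<le> of_bool (e \<in> S4) + of_bool (e \<in> S5) + of_bool (e \<in> S6)"
  shows "gprod S1 * gprod S2 * gprod S3 dvdR gprod S4 * gprod S5 * gprod S6"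
proof -
  let ?W = "S1 \<union> S2 \<union> S3 \<union> S4 \<union> S5 \<union> S6"
  have W: "finite ?W" using assms by simp
  let ?m = "\<lambda>S S' S'' e. of_bool (e \<in> S) + of_bool (e \<in> S') + of_bool (e \<in> S'') :: nat"
  have g: "gprod S * gprod S' * gprod S'' = (\<Prod>e\<in>?W. gfac e ^ ?m S S' S'' e)" if "S \<subseteq> ?W" "S' \<subseteq> ?W" "S'' \<subseteq> ?W" for S S' S''
    using gprod_superset[OF W that(1)] gprod_superset[OF W that(2)] gprod_superset[OF W that(3)]
    by (simp only: power_add prod.distrib)
  have 1: "gprod S1 * gprod S2 * gprod S3 = (\<Prod>e\<in>?W. gfac e ^ ?m S1 S2 S3 e)" by (rule g) auto
  have 2: "gprod S4 * gprod S5 * gprod S6 = (\<Prod>e\<in>?W. gfac e ^ ?m S4 S5 S6 e)" by (rule g) auto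
  have "(\<Prod>e\<in>?W. gfac e ^ ?m S4 S5 S6 e) = (\<Prod>e\<in>?W. gfac e ^ ?m S1 S2 S3 e) * (\<Prod>e\<in>?W. gfac e ^ (?m S4 S5 S6 e - ?m S1 S2 S3 e))"
    by (simp only: le le_add_diff_inverse flip: prod.distrib power_add)
  then show ?thesis unfolding 1 2 by (intro dvdRI[of "\<Prod>e\<in>?W. gfac e ^ (?m S4 S5 S6 e - ?m S1 S2 S3 e)"]) (auto intro!: R_prod)
qed

end

section \<open>The free ring\<close>

definition word :: "'g list \<Rightarrow> 'g list \<Rightarrow> int" where
  "word w = (\<lambda>w'. if w' = w then 1 else 0)"

lemma free_ring_simps:
  "carrier (free_ring L) = {u. finite {w. u w \<noteq> 0} \<and> (\<forall>w. u w \<noteq> 0 \<longrightarrow> set w \<subseteq> L)}"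
  "u \<otimes>\<^bsub>free_ring L\<^esub> v = (\<lambda>w. \<Sum>n\<le>length w. u (take n w) * v (drop n w))"
  "\<one>\<^bsub>free_ring L\<^esub> = word []" "\<zero>\<^bsub>free_ring L\<^esub> = (\<lambda>w. 0)" "u \<oplus>\<^bsub>free_ring L\<^esub> v = (\<lambda>w. u w + v w)"
  by (simp_all add: free_ring_def word_def)

lemma gen_word: "gen g = word [g]"
  by (simp add: gen_def word_def)

lemma word_carrier: "set w \<subseteq> L \<Longrightarrow> word w \<in> carrier (free_ring L)"
  by (simp add: free_ring_simps word_def)

lemma word_mult: "word w \<otimes>\<^bsub>free_ring L\<^esub> word w' = word (w @ w')"
proof
  fix x
  have "(\<Sum>n\<le>length x. word w (take n x) * word w' (drop n x)) = (\<Sum>n\<le>length x. if n = length w then word (w @ w') x else 0)"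
  proof (rule sum.cong)
    fix n assume "n \<in> {..length x}"
    moreover have "word w (take n x) * word w' (drop n x) = (if take n x = w \<and> drop n x = w' then 1 else 0)"
      by (simp add: word_def)
    moreover have "take n x = w \<and> drop n x = w' \<longleftrightarrow> n = length w \<and> x = w @ w'" if "n \<le> length x"
      using that by (metis append_eq_conv_conj append_take_drop_id length_take min.absorb2)
    ultimately show "word w (take n x) * word w' (drop n x) = (if n = length w then word (w @ w') x else 0)"
      by (auto simp: word_def)
  qed simp
  also have "\<dots> = word (w @ w') x" by (auto simp: word_def)
  finally show "(word w \<otimes>\<^bsub>free_ring L\<^esub> word w') x = word (w @ w') x" by (simp add: free_ring_simps)
qed

lemma free_ring_mult_closed:
  assumes u: "u \<in> carrier (free_ring L)" and v: "v \<in> carrier (free_ring L)"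
  shows "u \<otimes>\<^bsub>free_ring L\<^esub> v \<in> carrier (free_ring L)"
proof -
  have *: "\<exists>a b. w = a @ b \<and> u a \<noteq> 0 \<and> v b \<noteq> 0" if "(u \<otimes>\<^bsub>free_ring L\<^esub> v) w \<noteq> 0" for w
  proof -
    obtain n where "n \<le> length w" "u (take n w) * v (drop n w) \<noteq> 0"
      using \<open>(u \<otimes>\<^bsub>free_ring L\<^esub> v) w \<noteq> 0\<close> by (auto simp: free_ring_simps elim!: sum.not_neutral_contains_not_neutral)
    then show ?thesis by (intro exI[of _ "take n w"] exI[of _ "drop n w"]) auto
  qed
  have "finite {w. (u \<otimes>\<^bsub>free_ring L\<^esub> v) w \<noteq> 0}"
  proof (rule finite_subset)
    show "{w. (u \<otimes>\<^bsub>free_ring L\<^esub> v) w \<noteq> 0} \<subseteq> (\<lambda>(a, b). a @ b) ` ({a. u a \<noteq> 0} \<times> {b. v b \<noteq> 0})"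
      using * by fast
  qed (use u v in \<open>auto simp: free_ring_simps\<close>)
  moreover have "set w \<subseteq> L" if "(u \<otimes>\<^bsub>free_ring L\<^esub> v) w \<noteq> 0" for w
  proof -
    note nz = that
    obtain a b where ab: "w = a @ b" "u a \<noteq> 0" "v b \<noteq> 0" using *[OF nz] by blast
    then have "set a \<subseteq> L" "set b \<subseteq> L" using u v unfolding free_ring_simps(1) by blast+
    then show ?thesis using ab by simp
  qed
  ultimately show ?thesis unfolding free_ring_simps(1) by blast
qed

text \<open>Both sides sum over the ways of cutting a word into three consecutive parts. The
  exchange of the two cut points is the same reindexing as for power series.\<close>

lemma free_ring_assoc:
  "(u \<otimes>\<^bsub>free_ring L\<^esub> v) \<otimes>\<^bsub>free_ring L\<^esub> t = u \<otimes>\<^bsub>free_ring L\<^esub> (v \<otimes>\<^bsub>free_ring L\<^esub> t)"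
proof
  fix w :: "'a list"
  let ?g = "\<lambda>i p q. u (take i w) * (v (take p (drop i w)) * t (drop (i + p) w))"
  have "((u \<otimes>\<^bsub>free_ring L\<^esub> v) \<otimes>\<^bsub>free_ring L\<^esub> t) w = (\<Sum>j=0..length w. \<Sum>i=0..j. ?g i (j - i) (length w - j))"
    unfolding free_ring_simps atMost_atLeast0
    by (intro sum.cong) (auto simp: sum_distrib_right mult.assoc drop_take min_def intro!: sum.cong)
  also have "\<dots> = (\<Sum>j=0..length w. \<Sum>i=0..length w - j. ?g j i (length w - j - i))"
    by (rule fps_mult_assoc_lemma)
  also have "\<dots> = (u \<otimes>\<^bsub>free_ring L\<^esub> (v \<otimes>\<^bsub>free_ring L\<^esub> t)) w"
    unfolding free_ring_simps atMost_atLeast0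
    by (intro sum.cong) (auto simp: sum_distrib_left add.commute intro!: sum.cong)
  finally show "((u \<otimes>\<^bsub>free_ring L\<^esub> v) \<otimes>\<^bsub>free_ring L\<^esub> t) w = (u \<otimes>\<^bsub>free_ring L\<^esub> (v \<otimes>\<^bsub>free_ring L\<^esub> t)) w" .
qed

lemma free_ring_add_closed:
  assumes "u \<in> carrier (free_ring L)" "v \<in> carrier (free_ring L)"
  shows "u \<oplus>\<^bsub>free_ring L\<^esub> v \<in> carrier (free_ring L)"
proof -
  have "{w. u w + v w \<noteq> 0} \<subseteq> {w. u w \<noteq> 0} \<union> {w. v w \<noteq> 0}" by auto
  then have "finite {w. u w + v w \<noteq> 0}" using assms by (auto simp: free_ring_simps intro: finite_subset)
  moreover have "set w \<subseteq> L" if "u w + v w \<noteq> 0" for w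
  proof -
    have "u w \<noteq> 0 \<or> v w \<noteq> 0" using that by auto
    then show ?thesis using assms unfolding free_ring_simps by blast
  qed
  ultimately show ?thesis by (simp add: free_ring_simps)
qed

lemma ring_free_ring: "ring (free_ring L)"
proof (rule ringI)
  show "abelian_group (free_ring L)"
  proof (rule abelian_groupI)
    show "\<exists>y\<in>carrier (free_ring L). y \<oplus>\<^bsub>free_ring L\<^esub> u = \<zero>\<^bsub>free_ring L\<^esub>" if "u \<in> carrier (free_ring L)" for u
      by (rule bexI[of _ "\<lambda>w. - u w"]) (use that in \<open>auto simp: free_ring_simps\<close>)
  qed (rule free_ring_add_closed, assumption+, auto simp: free_ring_simps algebra_simps)
  show "Group.monoid (free_ring L)"
  proof (rule monoidI)
    fix u assume u: "u \<in> carrier (free_ring L)"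
    show "\<one>\<^bsub>free_ring L\<^esub> \<otimes>\<^bsub>free_ring L\<^esub> u = u"
    proof
      fix w
      have "(\<one>\<^bsub>free_ring L\<^esub> \<otimes>\<^bsub>free_ring L\<^esub> u) w = (\<Sum>n\<le>length w. if n = 0 then u w else 0)"
        unfolding free_ring_simps word_def by (intro sum.cong) auto
      then show "(\<one>\<^bsub>free_ring L\<^esub> \<otimes>\<^bsub>free_ring L\<^esub> u) w = u w" by simp
    qed
    show "u \<otimes>\<^bsub>free_ring L\<^esub> \<one>\<^bsub>free_ring L\<^esub> = u"
    proof
      fix w
      have "(u \<otimes>\<^bsub>free_ring L\<^esub> \<one>\<^bsub>free_ring L\<^esub>) w = (\<Sum>n\<le>length w. if n = length w then u w else 0)"
        unfolding free_ring_simps word_def by (intro sum.cong) auto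
      then show "(u \<otimes>\<^bsub>free_ring L\<^esub> \<one>\<^bsub>free_ring L\<^esub>) w = u w" by simp
    qed
  qed (auto intro: free_ring_mult_closed simp: free_ring_assoc simp: free_ring_simps(3) intro: word_carrier)
qed (auto simp: free_ring_simps sum.distrib algebra_simps)

lemma free_ring_uminus: "u \<in> carrier (free_ring L) \<Longrightarrow> \<ominus>\<^bsub>free_ring L\<^esub> u = (\<lambda>w. - u w)"
proof -
  interpret ring "free_ring L" by (rule ring_free_ring)
  assume "u \<in> carrier (free_ring L)"
  then show ?thesis by (intro minus_equality) (auto simp: free_ring_simps)
qed

text \<open>Coefficients are integers, so an integer multiple of a word is reached by repeated
  addition and one negation; the support is then removed word by word.\<close>

lemma free_ring_induct [consumes 1, case_names zero word add uminus]:
  assumes u: "u \<in> carrier (free_ring L)"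
    and zero: "P \<zero>\<^bsub>free_ring L\<^esub>" and word: "\<And>w. set w \<subseteq> L \<Longrightarrow> P (word w)"
    and add: "\<And>u v. u \<in> carrier (free_ring L) \<Longrightarrow> v \<in> carrier (free_ring L) \<Longrightarrow> P u \<Longrightarrow> P v \<Longrightarrow> P (u \<oplus>\<^bsub>free_ring L\<^esub> v)"
    and uminus: "\<And>u. u \<in> carrier (free_ring L) \<Longrightarrow> P u \<Longrightarrow> P (\<ominus>\<^bsub>free_ring L\<^esub> u)"
  shows "P u"
proof -
  interpret ring "free_ring L" by (rule ring_free_ring)
  have nat: "P (\<lambda>x. int n * word w x) \<and> (\<lambda>x. int n * word w x) \<in> carrier (free_ring L)" if w: "set w \<subseteq> L" for w n
  proof (induction n)
    case 0
    show ?case using zero zero_closed by (simp add: free_ring_simps(4))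
  next
    case (Suc n)
    have "(\<lambda>x. int (Suc n) * word w x) = (\<lambda>x. int n * word w x) \<oplus>\<^bsub>free_ring L\<^esub> word w"
      by (auto simp: free_ring_simps algebra_simps)
    then show ?case using Suc add[of "\<lambda>x. int n * word w x" "word w"] word[OF w] word_carrier[OF w] by auto
  qed
  have int: "P (\<lambda>x. c * word w x) \<and> (\<lambda>x. c * word w x) \<in> carrier (free_ring L)" if w: "set w \<subseteq> L" for w c
  proof (cases c)
    case (nonneg n)
    then show ?thesis using nat[OF w] by simp
  next
    case (neg n)
    have "\<ominus>\<^bsub>free_ring L\<^esub> (\<lambda>x. int (Suc n) * word w x) = (\<lambda>x. c * word w x)"
      using nat[OF w, of "Suc n"] neg by (subst free_ring_uminus) (simp_all only: minus_mult_left)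
    then show ?thesis using nat[OF w, of "Suc n"] uminus[of "\<lambda>x. int (Suc n) * word w x"]
      a_inv_closed[of "\<lambda>x. int (Suc n) * word w x"] by auto
  qed
  have "P u" if "finite S" "{w. u w \<noteq> 0} \<subseteq> S" "u \<in> carrier (free_ring L)" for S u
    using that
  proof (induction S arbitrary: u rule: finite_induct)
    case empty
    then have "u = \<zero>\<^bsub>free_ring L\<^esub>" by (auto simp: free_ring_simps)
    then show ?case using zero by simp
  next
    case (insert w S)
    define v where "v = u(w := 0)"
    have "{w. v w \<noteq> 0} \<subseteq> {w. u w \<noteq> 0}" unfolding v_def by auto
    then have v: "v \<in> carrier (free_ring L)" "{w. v w \<noteq> 0} \<subseteq> S"
      using insert by (auto simp: free_ring_simps v_def intro: finite_subset)
    show ?case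
    proof (cases "u w = 0")
      case True
      then show ?thesis using insert by (intro insert.IH) auto
    next
      case False
      then have w: "set w \<subseteq> L" using insert by (simp add: free_ring_simps)
      have "u = v \<oplus>\<^bsub>free_ring L\<^esub> (\<lambda>x. u w * word w x)" by (auto simp: v_def free_ring_simps word_def)
      then show ?thesis using add[OF v(1) _ insert.IH[OF v(2,1)]] int[OF w] by metis
    qed
  qed
  from this[of "{w. u w \<noteq> 0}"] show ?thesis using u by (simp add: free_ring_simps)
qed

section \<open>The graded quotient ring\<close>

context gwa_setting
begin

abbreviation Q where "Q \<equiv> Qgr T"

lemma Q_simps:
  "carrier Q = {q. finite {i. q i \<noteq> 0}}"
  "p \<otimes>\<^bsub>Q\<^esub> q = (\<lambda>n. \<Sum>i | p i \<noteq> 0. p i * \<sigma> i (q (n - i)))"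
  "\<one>\<^bsub>Q\<^esub> = (\<lambda>n. if n = 0 then 1 else 0)" "\<zero>\<^bsub>Q\<^esub> = (\<lambda>n. 0)" "p \<oplus>\<^bsub>Q\<^esub> q = (\<lambda>n. p n + q n)"
  by (simp_all add: Qgr_def)

lemma Q_mult_sum:
  assumes "finite W" "{i. p i \<noteq> 0} \<subseteq> W"
  shows "(p \<otimes>\<^bsub>Q\<^esub> q) n = (\<Sum>i\<in>W. p i * \<sigma> i (q (n - i)))"
  unfolding Q_simps using assms by (intro sum.mono_neutral_left) auto

lemma Q_mult_supp:
  assumes "(p \<otimes>\<^bsub>Q\<^esub> q) n \<noteq> 0" shows "\<exists>i. p i \<noteq> 0 \<and> q (n - i) \<noteq> 0"
proof -
  have "(\<Sum>i | p i \<noteq> 0. p i * \<sigma> i (q (n - i))) \<noteq> 0" using assms by (simp add: Q_simps)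
  then obtain i where "p i * \<sigma> i (q (n - i)) \<noteq> 0" by (rule sum.not_neutral_contains_not_neutral)
  then show ?thesis by auto
qed

lemma Q_mult_closed:
  assumes "p \<in> carrier Q" "q \<in> carrier Q" shows "p \<otimes>\<^bsub>Q\<^esub> q \<in> carrier Q"
proof -
  have "{n. (p \<otimes>\<^bsub>Q\<^esub> q) n \<noteq> 0} \<subseteq> (\<lambda>(i, j). i + j) ` ({i. p i \<noteq> 0} \<times> {i. q i \<noteq> 0})"
  proof
    fix n assume "n \<in> {n. (p \<otimes>\<^bsub>Q\<^esub> q) n \<noteq> 0}"
    then obtain i where "p i \<noteq> 0" "q (n - i) \<noteq> 0" using Q_mult_supp by blast
    then show "n \<in> (\<lambda>(i, j). i + j) ` ({i. p i \<noteq> 0} \<times> {i. q i \<noteq> 0})"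
      by (intro image_eqI[of _ _ "(i, n - i)"]) auto
  qed
  then show ?thesis using assms unfolding Q_simps(1) by (auto intro: finite_subset)
qed

lemma Q_add_closed:
  assumes "p \<in> carrier Q" "q \<in> carrier Q" shows "p \<oplus>\<^bsub>Q\<^esub> q \<in> carrier Q"
proof -
  have "{n. p n + q n \<noteq> 0} \<subseteq> {n. p n \<noteq> 0} \<union> {n. q n \<noteq> 0}" by auto
  then show ?thesis using assms unfolding Q_simps by (auto intro: finite_subset)
qed

lemma Q_assoc:
  assumes p: "p \<in> carrier Q" and q: "q \<in> carrier Q"
  shows "(p \<otimes>\<^bsub>Q\<^esub> q) \<otimes>\<^bsub>Q\<^esub> r = p \<otimes>\<^bsub>Q\<^esub> (q \<otimes>\<^bsub>Q\<^esub> r)"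
proof
  fix n
  define P where "P = {i. p i \<noteq> 0}"
  define S where "S = {i. q i \<noteq> 0}"
  \<comment> \<open>A finite set containing the support of the product. The support itself would not
    do for reindexing, since terms may cancel.\<close>
  define W where "W = (\<lambda>(i, j). i + j) ` (P \<times> S)"
  have fin: "finite P" "finite S" "finite W" using p q by (auto simp: P_def S_def W_def Q_simps)
  have W: "{n. (p \<otimes>\<^bsub>Q\<^esub> q) n \<noteq> 0} \<subseteq> W"
  proof
    fix n assume "n \<in> {n. (p \<otimes>\<^bsub>Q\<^esub> q) n \<noteq> 0}"
    then obtain i where "p i \<noteq> 0" "q (n - i) \<noteq> 0" using Q_mult_supp by blast
    then show "n \<in> W" unfolding W_def P_def S_def by (intro image_eqI[of _ _ "(i, n - i)"]) auto
  qed
  have pq: "(p \<otimes>\<^bsub>Q\<^esub> q) k = (\<Sum>i\<in>P. p i * \<sigma> i (q (k - i)))" for k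
    by (rule Q_mult_sum[OF fin(1)]) (simp add: P_def)
  have "((p \<otimes>\<^bsub>Q\<^esub> q) \<otimes>\<^bsub>Q\<^esub> r) n = (\<Sum>k\<in>W. (p \<otimes>\<^bsub>Q\<^esub> q) k * \<sigma> k (r (n - k)))"
    by (rule Q_mult_sum[OF fin(3) W])
  also have "\<dots> = (\<Sum>k\<in>W. (\<Sum>i\<in>P. p i * \<sigma> i (q (k - i))) * \<sigma> k (r (n - k)))"
    by (simp only: pq)
  also have "\<dots> = (\<Sum>i\<in>P. \<Sum>k\<in>W. p i * \<sigma> i (q (k - i)) * \<sigma> k (r (n - k)))"
    by (simp add: sum_distrib_right sum.swap[of _ W])
  also have "\<dots> = (\<Sum>i\<in>P. \<Sum>j\<in>S. p i * \<sigma> i (q j) * \<sigma> (i + j) (r (n - (i + j))))"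
  proof (rule sum.cong[OF refl])
    fix i assume i: "i \<in> P"
    let ?g = "\<lambda>k. p i * \<sigma> i (q (k - i)) * \<sigma> k (r (n - k))"
    have "(\<Sum>k\<in>W. ?g k) = (\<Sum>k\<in>(\<lambda>j. i + j) ` S. ?g k)"
    proof (rule sum.mono_neutral_right[OF fin(3)])
      show "(\<lambda>j. i + j) ` S \<subseteq> W" using i unfolding W_def by force
      show "\<forall>k\<in>W - (\<lambda>j. i + j) ` S. ?g k = 0"
      proof
        fix k assume "k \<in> W - (\<lambda>j. i + j) ` S"
        then have "k - i \<notin> S" by (metis DiffD2 add_diff_cancel_left' diff_add_cancel add.commute image_eqI)
        then show "?g k = 0" by (simp add: S_def)
      qed
    qed
    also have "\<dots> = (\<Sum>j\<in>S. ?g (i + j))" by (subst sum.reindex) (auto simp: inj_on_def)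
    finally show "(\<Sum>k\<in>W. ?g k) = (\<Sum>j\<in>S. p i * \<sigma> i (q j) * \<sigma> (i + j) (r (n - (i + j))))" by simp
  qed
  also have "\<dots> = (p \<otimes>\<^bsub>Q\<^esub> (q \<otimes>\<^bsub>Q\<^esub> r)) n"
    unfolding Q_simps P_def S_def
    by (simp add: \<sigma>_sum \<sigma>_mult sum_distrib_left mult.assoc diff_diff_eq)
  finally show "((p \<otimes>\<^bsub>Q\<^esub> q) \<otimes>\<^bsub>Q\<^esub> r) n = (p \<otimes>\<^bsub>Q\<^esub> (q \<otimes>\<^bsub>Q\<^esub> r)) n" .
qed

abbreviation mon where "mon \<equiv> (skew_monom :: 'k ratfun \<Rightarrow> int \<Rightarrow> 'k skew)"

lemma mon_carrier [simp]: "mon c i \<in> carrier Q"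
  by (simp add: skew_monom_def Q_simps)

lemma mon_0 [simp]: "mon 0 i = \<zero>\<^bsub>Q\<^esub>" by (auto simp: skew_monom_def Q_simps)

lemma mon_apply: "mon c i n = (if n = i then c else 0)" by (simp add: skew_monom_def)

lemma mon_mult: "mon c i \<otimes>\<^bsub>Q\<^esub> q = (\<lambda>n. c * \<sigma> i (q (n - i)))"
  by (rule ext, subst Q_mult_sum[of "{i}"]) (auto simp: mon_apply split: if_splits)

lemma mon_mon: "mon c i \<otimes>\<^bsub>Q\<^esub> mon d j = mon (c * \<sigma> i d) (i + j)"
  by (auto simp: mon_mult mon_apply fun_eq_iff)

lemma mult_mon: 
  assumes "p \<in> carrier Q" shows "p \<otimes>\<^bsub>Q\<^esub> mon d j = (\<lambda>n. p (n - j) * \<sigma> (n - j) d)"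
proof
  fix n
  let ?W = "insert (n - j) {i. p i \<noteq> 0}"
  have "(p \<otimes>\<^bsub>Q\<^esub> mon d j) n = (\<Sum>i\<in>?W. p i * \<sigma> i (mon d j (n - i)))"
    by (rule Q_mult_sum) (use assms in \<open>auto simp: Q_simps\<close>)
  also have "\<dots> = (\<Sum>i\<in>?W. if i = n - j then p (n - j) * \<sigma> (n - j) d else 0)"
    by (rule sum.cong) (auto simp: mon_apply)
  also have "\<dots> = p (n - j) * \<sigma> (n - j) d" using assms by (subst sum.delta) (auto simp: Q_simps)
  finally show "(p \<otimes>\<^bsub>Q\<^esub> mon d j) n = p (n - j) * \<sigma> (n - j) d" .
qed

lemma Q_one_mon: "\<one>\<^bsub>Q\<^esub> = mon 1 0" by (simp add: Q_simps skew_monom_def)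

lemma ring_Q: "ring Q"
proof (rule ringI)
  show "abelian_group Q"
  proof (rule abelian_groupI)
    show "\<exists>y\<in>carrier Q. y \<oplus>\<^bsub>Q\<^esub> u = \<zero>\<^bsub>Q\<^esub>" if "u \<in> carrier Q" for u
      by (rule bexI[of _ "\<lambda>n. - u n"]) (use that in \<open>auto simp: Q_simps\<close>)
  qed (rule Q_add_closed, assumption+, auto simp: Q_simps algebra_simps)
  show "Group.monoid Q"
  proof (rule monoidI)
    fix q assume q: "q \<in> carrier Q"
    show "\<one>\<^bsub>Q\<^esub> \<otimes>\<^bsub>Q\<^esub> q = q" unfolding Q_one_mon mon_mult by simp
    show "q \<otimes>\<^bsub>Q\<^esub> \<one>\<^bsub>Q\<^esub> = q" unfolding Q_one_mon mult_mon[OF q] by simp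
  qed (auto intro: Q_mult_closed simp: Q_assoc Q_one_mon)
next
  fix p q r assume p: "p \<in> carrier Q" "q \<in> carrier Q" "r \<in> carrier Q"
  let ?W = "{i. p i \<noteq> 0} \<union> {i. q i \<noteq> 0}"
  have W: "finite ?W" using p by (simp add: Q_simps)
  have s: "{i. (p \<oplus>\<^bsub>Q\<^esub> q) i \<noteq> 0} \<subseteq> ?W" by (auto simp: Q_simps)
  show "(p \<oplus>\<^bsub>Q\<^esub> q) \<otimes>\<^bsub>Q\<^esub> r = p \<otimes>\<^bsub>Q\<^esub> r \<oplus>\<^bsub>Q\<^esub> q \<otimes>\<^bsub>Q\<^esub> r"
  proof
    fix n
    have "((p \<oplus>\<^bsub>Q\<^esub> q) \<otimes>\<^bsub>Q\<^esub> r) n = (\<Sum>i\<in>?W. p i * \<sigma> i (r (n - i)) + q i * \<sigma> i (r (n - i)))"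
      by (subst Q_mult_sum[OF W s]) (simp add: Q_simps algebra_simps)
    also have "\<dots> = (p \<otimes>\<^bsub>Q\<^esub> r) n + (q \<otimes>\<^bsub>Q\<^esub> r) n"
      using Q_mult_sum[OF W, of p r n] Q_mult_sum[OF W, of q r n] by (simp add: sum.distrib)
    finally show "((p \<oplus>\<^bsub>Q\<^esub> q) \<otimes>\<^bsub>Q\<^esub> r) n = (p \<otimes>\<^bsub>Q\<^esub> r \<oplus>\<^bsub>Q\<^esub> q \<otimes>\<^bsub>Q\<^esub> r) n" by (simp add: Q_simps(5))
  qed
  show "r \<otimes>\<^bsub>Q\<^esub> (p \<oplus>\<^bsub>Q\<^esub> q) = r \<otimes>\<^bsub>Q\<^esub> p \<oplus>\<^bsub>Q\<^esub> r \<otimes>\<^bsub>Q\<^esub> q"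
    by (auto simp: Q_simps \<sigma>_add distrib_left sum.distrib)
qed

interpretation Q: ring Q by (rule ring_Q)

lemma Q_uminus: "q \<in> carrier Q \<Longrightarrow> \<ominus>\<^bsub>Q\<^esub> q = (\<lambda>n. - q n)"
  by (rule Q.minus_equality) (auto simp: Q_simps)

lemma Q_finsum: "finite S \<Longrightarrow> F \<in> S \<rightarrow> carrier Q \<Longrightarrow> finsum Q F S n = (\<Sum>x\<in>S. F x n)"
  by (induction S rule: finite_induct) (auto simp: Q_simps(4,5))

section \<open>The generalized Weyl algebra inside its graded quotient ring\<close>

abbreviation "L \<equiv> letters (base_ring T)"
abbreviation "F \<equiv> free_ring L"
abbreviation "Igwa \<equiv> gwa_ideal (base_ring T) (sigma T 1) (of_poly f)"
abbreviation "K \<equiv> F Quot Igwa"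
abbreviation "A \<equiv> GWA T f"
abbreviation "lv \<equiv> letter_value T f"

interpretation F: ring F by (rule ring_free_ring)

lemma base_ring_simps: "carrier (base_ring T) = R" "r \<oplus>\<^bsub>base_ring T\<^esub> t = r + t"
    "r \<otimes>\<^bsub>base_ring T\<^esub> t = r * t" "\<one>\<^bsub>base_ring T\<^esub> = 1"
  by (simp_all add: base_ring_def)

lemma sigma_inverse: "r \<in> R \<Longrightarrow> inv_into R (sigma T 1) r = \<sigma> (- 1) r"
  using inv_into_f_f[of "sigma T 1" R "\<sigma> (- 1) r"] by (simp add: base_ring_simps inj_on_def \<sigma>_eq_iff)

lemma L_letters: "Coef r \<in> L \<longleftrightarrow> r \<in> R" "X \<in> L" "Y \<in> L"
  by (auto simp: letters_def base_ring_simps)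

lemma gen_carrier [simp]: "gen (Coef r) \<in> carrier F \<longleftrightarrow> r \<in> R" "gen X \<in> carrier F" "gen Y \<in> carrier F"
proof -
  show "gen (Coef r) \<in> carrier F \<longleftrightarrow> r \<in> R"
    using L_letters(1)[of r] by (auto simp: gen_word free_ring_simps word_def)
qed (auto simp: gen_word L_letters intro!: word_carrier)

text \<open>The coefficient in y^m = \<open>\<omega> (-m)\<close> x^(-m), namely the product of
  \<sigma>^(-j)(f) for j = 1, ..., m; it is 1 in nonnegative degrees. It generates the coefficients
  of \<open>A\<close> in each degree.\<close>

definition \<omega> :: "int \<Rightarrow> 'k ratfun" where "\<omega> n = gprod (roots f \<times> {0<..-n})"

lemma \<omega>_nonzero [simp]: "\<omega> n \<noteq> 0" and \<omega>_R [simp]: "\<omega> n \<in> R" by (simp_all add: \<omega>_def)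
lemma \<omega>_nonneg: "n \<ge> 0 \<Longrightarrow> \<omega> n = 1" by (simp add: \<omega>_def)

lemma \<sigma>_\<omega>: "\<sigma> i (\<omega> n) = gprod (roots f \<times> {-i<..-n-i})"
proof -
  have "(\<lambda>(\<alpha>, j). (\<alpha>, j - i)) ` (roots f \<times> {0<..-n}) = roots f \<times> {-i<..-n-i}"
  proof (intro equalityI subsetI)
    fix x assume "x \<in> roots f \<times> {-i<..-n-i}"
    then show "x \<in> (\<lambda>(\<alpha>, j). (\<alpha>, j - i)) ` (roots f \<times> {0<..-n})"
      by (intro image_eqI[of _ _ "(fst x, snd x + i)"]) auto
  qed auto
  then show ?thesis by (simp add: \<omega>_def \<sigma>_gprod)
qed

lemma \<sigma>_\<omega>_neg: "n < 0 \<Longrightarrow> \<sigma> 1 (\<omega> n) = of_poly f * \<omega> (n + 1)"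
proof -
  assume "n < 0"
  then have "roots f \<times> {-1<..-n-1} = roots f \<times> {0} \<union> roots f \<times> {0<..-(n+1)}" by auto
  then have "\<sigma> 1 (\<omega> n) = gprod (roots f \<times> {0} \<union> roots f \<times> {0<..-(n+1)})"
    unfolding \<sigma>_\<omega> by (rule arg_cong)
  also have "\<dots> = gprod (roots f \<times> {0}) * \<omega> (n + 1)"
    unfolding \<omega>_def by (rule gprod_union) auto
  finally show ?thesis using \<sigma>_f[of 0] by simp
qed

lemma \<sigma>_f_R [simp]: "\<sigma> i (of_poly f) \<in> R" by simp

text \<open>The expected image of \<open>A\<close>, described by divisibility alone; that it is the
  image is \<open>A_in_Q_eq\<close>.\<close>

definition AQ :: "'k skew set" where "AQ = {q \<in> carrier Q. \<forall>n. \<omega> n dvdR q n}"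

lemma AQ_add: "p \<in> AQ \<Longrightarrow> q \<in> AQ \<Longrightarrow> p \<oplus>\<^bsub>Q\<^esub> q \<in> AQ"
  unfolding AQ_def using Q_add_closed by (auto simp: Q_simps(5) intro: dvdR_add)
lemma AQ_zero: "\<zero>\<^bsub>Q\<^esub> \<in> AQ" unfolding AQ_def by (simp add: Q_simps)
lemma AQ_carrier: "q \<in> AQ \<Longrightarrow> q \<in> carrier Q" by (simp add: AQ_def)
lemma AQ_dvd: "q \<in> AQ \<Longrightarrow> \<omega> n dvdR q n" by (simp add: AQ_def)
lemma AQ_uminus: "q \<in> AQ \<Longrightarrow> \<ominus>\<^bsub>Q\<^esub> q \<in> AQ"
  using Q.a_inv_closed[of q] by (auto simp: AQ_def Q_uminus intro: dvdR_uminus)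
lemma mon_AQ: "\<omega> n dvdR c \<Longrightarrow> mon c n \<in> AQ" by (auto simp: AQ_def mon_apply)

lemma lv_carrier [simp]: "lv l \<in> carrier Q"
  by (cases l) auto

lemma word_value_carrier [simp]: "word_value T f w \<in> carrier Q"
  by (induction w) (auto simp: word_value_def)

lemma word_value_Cons: "word_value T f (l # w) = lv l \<otimes>\<^bsub>Q\<^esub> word_value T f w"
  by (simp add: word_value_def)

lemma word_value_append: "word_value T f (w @ w') = word_value T f w \<otimes>\<^bsub>Q\<^esub> word_value T f w'"
proof (induction w)
  case Nil
  then show ?case by (simp add: word_value_def[of _ _ "[]"])
next
  case (Cons l w)
  then show ?case using Q.m_assoc[of "lv l" "word_value T f w" "word_value T f w'"] by (simp add: word_value_Cons)
qed

abbreviation "fv \<equiv> free_value T f"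

lemma fv_sum:
  assumes "finite W" "{w. u w \<noteq> 0} \<subseteq> W"
  shows "fv u n = (\<Sum>w\<in>W. of_int (u w) * word_value T f w n)"
  unfolding free_value_def using assms by (intro sum.mono_neutral_left) auto

lemma fv_word: "fv (word w) = word_value T f w"
proof
  show "fv (word w) n = word_value T f w n" for n
    by (subst fv_sum[of "{w}"]) (auto simp: word_def)
qed

lemma fv_add:
  assumes "u \<in> carrier F" "v \<in> carrier F" shows "fv (u \<oplus>\<^bsub>F\<^esub> v) = fv u \<oplus>\<^bsub>Q\<^esub> fv v"
proof
  fix n
  let ?W = "{w. u w \<noteq> 0} \<union> {w. v w \<noteq> 0}"
  have W: "finite ?W" using assms by (simp add: free_ring_simps)
  have "fv (u \<oplus>\<^bsub>F\<^esub> v) n = (\<Sum>w\<in>?W. of_int (u w) * word_value T f w n + of_int (v w) * word_value T f w n)"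
    by (subst fv_sum[OF W]) (auto simp: free_ring_simps algebra_simps intro!: sum.cong)
  also have "\<dots> = fv u n + fv v n" by (simp add: sum.distrib fv_sum[OF W, of u] fv_sum[OF W, of v])
  finally show "fv (u \<oplus>\<^bsub>F\<^esub> v) n = (fv u \<oplus>\<^bsub>Q\<^esub> fv v) n" by (simp add: Q_simps)
qed

lemma fv_zero: "fv \<zero>\<^bsub>F\<^esub> = \<zero>\<^bsub>Q\<^esub>"
  by (auto simp: free_value_def free_ring_simps Q_simps)

lemma fv_uminus: "u \<in> carrier F \<Longrightarrow> fv (\<ominus>\<^bsub>F\<^esub> u) = (\<lambda>n. - fv u n)"
  by (auto simp: free_ring_uminus free_value_def sum_negf)

lemma fv_carrier: "u \<in> carrier F \<Longrightarrow> fv u \<in> carrier Q"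
proof (induction u rule: free_ring_induct)
  case (add u v)
  then show ?case using Q.a_closed by (simp add: fv_add)
next
  case (uminus u)
  then show ?case by (simp add: fv_uminus Q_simps)
qed (auto simp: fv_zero fv_word)

lemma fv_mult:
  assumes u: "u \<in> carrier F" and v: "v \<in> carrier F" shows "fv (u \<otimes>\<^bsub>F\<^esub> v) = fv u \<otimes>\<^bsub>Q\<^esub> fv v"
proof -
  have 1: "fv (word w \<otimes>\<^bsub>F\<^esub> v) = fv (word w) \<otimes>\<^bsub>Q\<^esub> fv v" if w: "set w \<subseteq> L" for w
    using v
  proof (induction v rule: free_ring_induct)
    case zero
    then show ?case using word_carrier[OF w] fv_carrier[OF word_carrier[OF w]] by (simp add: fv_zero)
  next
    case (word w')
    then show ?case by (simp add: word_mult fv_word word_value_append)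
  next
    case (add u v)
    then show ?case using word_carrier[OF w] fv_carrier
      by (simp add: F.r_distr fv_add F.m_closed Q.r_distr)
  next
    case (uminus u)
    have "fv (word w \<otimes>\<^bsub>F\<^esub> \<ominus>\<^bsub>F\<^esub> u) = \<ominus>\<^bsub>Q\<^esub> fv (word w \<otimes>\<^bsub>F\<^esub> u)"
      using uminus word_carrier[OF w] by (simp add: F.r_minus fv_uminus Q_uminus fv_carrier)
    then show ?case using uminus word_carrier[OF w] fv_carrier
      by (simp add: fv_uminus Q.r_minus flip: Q_uminus)
  qed
  show ?thesis using u
  proof (induction u rule: free_ring_induct)
    case zero
    then show ?case using v fv_carrier[OF v] by (simp add: fv_zero)
  next
    case (add u v')
    then show ?case using v fv_carrier
      by (simp add: F.l_distr fv_add F.m_closed Q.l_distr)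
  next
    case (uminus u)
    have "fv (\<ominus>\<^bsub>F\<^esub> u \<otimes>\<^bsub>F\<^esub> v) = \<ominus>\<^bsub>Q\<^esub> fv (u \<otimes>\<^bsub>F\<^esub> v)"
      using uminus v by (simp add: F.l_minus fv_uminus Q_uminus fv_carrier)
    then show ?case using uminus v fv_carrier
      by (simp add: fv_uminus Q.l_minus flip: Q_uminus)
  qed (rule 1)
qed

lemma fv_hom: "ring_hom_ring F Q fv"
proof (rule ring_hom_ringI)
  show "fv \<one>\<^bsub>F\<^esub> = \<one>\<^bsub>Q\<^esub>" by (simp add: free_ring_simps(3) fv_word word_value_def)
qed (auto simp: F.ring_axioms Q.ring_axioms fv_carrier fv_mult fv_add)

lemma fv_gen: "fv (gen l) = lv l"
  by (simp add: gen_word fv_word word_value_def)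

lemma fv_minus: "u \<in> carrier F \<Longrightarrow> v \<in> carrier F \<Longrightarrow> fv (u \<ominus>\<^bsub>F\<^esub> v) = (\<lambda>n. fv u n - fv v n)"
  by (simp add: a_minus_def fv_add fv_uminus Q_simps(5))

lemma fv_minus_eq_0: "u \<in> carrier F \<Longrightarrow> v \<in> carrier F \<Longrightarrow> fv u = fv v \<Longrightarrow> fv (u \<ominus>\<^bsub>F\<^esub> v) = \<zero>\<^bsub>Q\<^esub>"
  by (simp add: fv_minus Q_simps(4))

lemma fv_one: "fv \<one>\<^bsub>F\<^esub> = mon 1 0"
  by (simp add: free_ring_simps(3) fv_word word_value_def Q_one_mon)

lemma mon_add: "mon c i \<oplus>\<^bsub>Q\<^esub> mon d i = mon (c + d) i"
  by (auto simp: Q_simps(5) mon_apply fun_eq_iff)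

lemma relations_carrier: "gwa_relations (base_ring T) (sigma T 1) (of_poly f) \<subseteq> carrier F"
  unfolding gwa_relations_def Let_def by (auto simp: base_ring_simps sigma_inverse)

lemma ideal_Igwa: "ideal Igwa F"
  unfolding gwa_ideal_def by (rule F.genideal_ideal[OF relations_carrier])

interpretation I: ideal Igwa F by (rule ideal_Igwa)

lemma relations_Igwa: "gwa_relations (base_ring T) (sigma T 1) (of_poly f) \<subseteq> Igwa"
  unfolding gwa_ideal_def by (rule F.genideal_self[OF relations_carrier])

text \<open>Each defining relation evaluates to zero, and the kernel of a ring homomorphism is an
  ideal.\<close>

lemma fv_Igwa: "u \<in> Igwa \<Longrightarrow> fv u = \<zero>\<^bsub>Q\<^esub>"
proof -
  interpret ring_hom_ring F Q fv by (rule fv_hom)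
  have "gwa_relations (base_ring T) (sigma T 1) (of_poly f) \<subseteq> a_kernel F Q fv"
  proof
    fix u assume u: "u \<in> gwa_relations (base_ring T) (sigma T 1) (of_poly f)"
    then have uc: "u \<in> carrier F" using relations_carrier by blast
    have "fv u = \<zero>\<^bsub>Q\<^esub>"
      using u unfolding gwa_relations_def Let_def
      by (auto simp: base_ring_simps sigma_inverse fv_add fv_mult fv_gen fv_one Q_one_mon mon_mon mon_add mult.commute
          intro!: fv_minus_eq_0)
    with uc show "u \<in> a_kernel F Q fv" unfolding a_kernel_def' by (intro CollectI conjI)
  qed
  then have "Igwa \<subseteq> a_kernel F Q fv"
    unfolding gwa_ideal_def by (rule F.genideal_minimal[OF kernel_is_ideal])
  then show "u \<in> Igwa \<Longrightarrow> fv u = \<zero>\<^bsub>Q\<^esub>" unfolding a_kernel_def' by blast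
qed

end

section \<open>Normal forms and the embedding of the generalized Weyl algebra\<close>

context gwa_setting
begin

interpretation Q: ring Q by (rule ring_Q)
interpretation F: ring F by (rule ring_free_ring)
interpretation I: ideal Igwa F by (rule ideal_Igwa)
interpretation K: ring K by (rule I.quotient_is_ring)

abbreviation cls where "cls u \<equiv> Igwa +>\<^bsub>F\<^esub> u"
abbreviation "\<rho> \<equiv> gwa_to_Q T f"

lemma A_simps:
  "carrier A = carrier K" "a \<otimes>\<^bsub>A\<^esub> b = a \<otimes>\<^bsub>K\<^esub> b" "\<one>\<^bsub>A\<^esub> = \<one>\<^bsub>K\<^esub>" "\<zero>\<^bsub>A\<^esub> = \<zero>\<^bsub>K\<^esub>" "a \<oplus>\<^bsub>A\<^esub> b = a \<oplus>\<^bsub>K\<^esub> b"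
  "scalar A c = cls (gen (Coef (of_poly [:c:])))"
  "piece A d = {cls u |u. u \<in> carrier F \<and> (\<forall>w. u w \<noteq> 0 \<longrightarrow> (\<Sum>l\<leftarrow>w. letter_degree l) = d)}"
  by (simp_all add: GWA_def gwa_def gwa_class_def Let_def)

lemma K_carrierE:
  assumes "a \<in> carrier K" obtains u where "u \<in> carrier F" "a = cls u"
  using assms unfolding FactRing_def A_RCOSETS_def' by auto

lemma cls_carrier [simp]: "u \<in> carrier F \<Longrightarrow> cls u \<in> carrier K"
  unfolding FactRing_def A_RCOSETS_def' by auto

lemma cls_ring_hom: "u \<in> carrier F \<Longrightarrow> v \<in> carrier F \<Longrightarrow> cls (u \<oplus>\<^bsub>F\<^esub> v) = cls u \<oplus>\<^bsub>K\<^esub> cls v"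
    "u \<in> carrier F \<Longrightarrow> v \<in> carrier F \<Longrightarrow> cls (u \<otimes>\<^bsub>F\<^esub> v) = cls u \<otimes>\<^bsub>K\<^esub> cls v" "cls \<one>\<^bsub>F\<^esub> = \<one>\<^bsub>K\<^esub>"
  using I.rcos_ring_hom by (auto simp: ring_hom_def)

lemma cls_zero: "cls \<zero>\<^bsub>F\<^esub> = \<zero>\<^bsub>K\<^esub>"
  by (rule additive_zero[OF F.abelian_group_axioms K.abelian_group_axioms]) (auto simp: cls_ring_hom)

lemma cls_uminus: "u \<in> carrier F \<Longrightarrow> cls (\<ominus>\<^bsub>F\<^esub> u) = \<ominus>\<^bsub>K\<^esub> cls u"
  by (rule additive_uminus[OF F.abelian_group_axioms K.abelian_group_axioms]) (auto simp: cls_ring_hom)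

lemma cls_eqI: "u \<in> carrier F \<Longrightarrow> v \<in> carrier F \<Longrightarrow> u \<ominus>\<^bsub>F\<^esub> v \<in> Igwa \<Longrightarrow> cls u = cls v"
  using F.quotient_eq_iff_same_a_r_cos[OF ideal_Igwa] by blast

text \<open>\<open>gwa_to_Q\<close> extracts the only element of the image of a coset, so evaluation
  has to be constant on it; this is where \<open>fv_Igwa\<close> enters.\<close>

lemma \<rho>_cls: assumes "u \<in> carrier F" shows "\<rho> (cls u) = fv u"
proof -
  have "fv x = fv u" if "x \<in> cls u" for x
  proof -
    obtain i where i: "i \<in> Igwa" "x = i \<oplus>\<^bsub>F\<^esub> u" using \<open>x \<in> cls u\<close> unfolding a_r_coset_def' by blast
    then have "fv x = \<zero>\<^bsub>Q\<^esub> \<oplus>\<^bsub>Q\<^esub> fv u" using assms by (simp add: fv_add fv_Igwa)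
    then show ?thesis using fv_carrier[OF assms] by simp
  qed
  then have "fv ` cls u = (\<lambda>_. fv u) ` cls u" by (rule image_cong[OF refl])
  also have "\<dots> = {fv u}" by (rule image_constant[OF I.a_rcos_self[OF assms]])
  finally show ?thesis unfolding gwa_to_Q_def by simp
qed

definition Cc where "Cc r = cls (gen (Coef r))"
definition xc where "xc = cls (gen X)"
definition yc where "yc = cls (gen Y)"

lemma Cc_carrier [simp]: "r \<in> R \<Longrightarrow> Cc r \<in> carrier K" and xc_carrier [simp]: "xc \<in> carrier K"
  and yc_carrier [simp]: "yc \<in> carrier K"
  by (simp_all add: Cc_def xc_def yc_def)

lemma gwa_relations_cls:
  assumes r: "r \<in> R"
  shows "t \<in> R \<Longrightarrow> Cc (r + t) = Cc r \<oplus>\<^bsub>K\<^esub> Cc t" "t \<in> R \<Longrightarrow> Cc (r * t) = Cc r \<otimes>\<^bsub>K\<^esub> Cc t"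
    "xc \<otimes>\<^bsub>K\<^esub> Cc r = Cc (\<sigma> 1 r) \<otimes>\<^bsub>K\<^esub> xc" "yc \<otimes>\<^bsub>K\<^esub> Cc r = Cc (\<sigma> (- 1) r) \<otimes>\<^bsub>K\<^esub> yc"
    "Cc 1 = \<one>\<^bsub>K\<^esub>" "xc \<otimes>\<^bsub>K\<^esub> yc = Cc (of_poly f)" "yc \<otimes>\<^bsub>K\<^esub> xc = Cc (\<sigma> (- 1) (of_poly f))"
proof -
  let ?rel = "gwa_relations (base_ring T) (sigma T 1) (of_poly f)"
  have *: "cls u = cls v" if "u \<ominus>\<^bsub>F\<^esub> v \<in> ?rel" "u \<in> carrier F" "v \<in> carrier F" for u v
    using cls_eqI[OF that(2,3)] relations_Igwa that(1) by blast
  note D = gwa_relations_def Let_def base_ring_simps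
  {
    assume t: "t \<in> R"
    have "gen (Coef r) \<oplus>\<^bsub>F\<^esub> gen (Coef t) \<ominus>\<^bsub>F\<^esub> gen (Coef (r + t)) \<in> ?rel" unfolding D using r t by blast
    from *[OF this] show "Cc (r + t) = Cc r \<oplus>\<^bsub>K\<^esub> Cc t"
      using r t by (simp add: Cc_def cls_ring_hom)
    have "gen (Coef r) \<otimes>\<^bsub>F\<^esub> gen (Coef t) \<ominus>\<^bsub>F\<^esub> gen (Coef (r * t)) \<in> ?rel" unfolding D using r t by blast
    from *[OF this] show "Cc (r * t) = Cc r \<otimes>\<^bsub>K\<^esub> Cc t"
      using r t by (simp add: Cc_def cls_ring_hom)
  }
  have "gen X \<otimes>\<^bsub>F\<^esub> gen (Coef r) \<ominus>\<^bsub>F\<^esub> gen (Coef (\<sigma> 1 r)) \<otimes>\<^bsub>F\<^esub> gen X \<in> ?rel" unfolding D using r by blast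
  from *[OF this] show "xc \<otimes>\<^bsub>K\<^esub> Cc r = Cc (\<sigma> 1 r) \<otimes>\<^bsub>K\<^esub> xc"
    using r by (simp add: Cc_def xc_def cls_ring_hom)
  have "gen Y \<otimes>\<^bsub>F\<^esub> gen (Coef r) \<ominus>\<^bsub>F\<^esub> gen (Coef (inv_into R (\<sigma> 1) r)) \<otimes>\<^bsub>F\<^esub> gen Y \<in> ?rel" unfolding D using r by blast
  from *[OF this] show "yc \<otimes>\<^bsub>K\<^esub> Cc r = Cc (\<sigma> (- 1) r) \<otimes>\<^bsub>K\<^esub> yc"
    using r by (simp add: sigma_inverse Cc_def yc_def cls_ring_hom)
  have "gen (Coef 1) \<ominus>\<^bsub>F\<^esub> \<one>\<^bsub>F\<^esub> \<in> ?rel" unfolding D by blast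
  from *[OF this] show "Cc 1 = \<one>\<^bsub>K\<^esub>" by (simp add: Cc_def cls_ring_hom)
  have "gen X \<otimes>\<^bsub>F\<^esub> gen Y \<ominus>\<^bsub>F\<^esub> gen (Coef (of_poly f)) \<in> ?rel" unfolding D by blast
  from *[OF this] show "xc \<otimes>\<^bsub>K\<^esub> yc = Cc (of_poly f)" by (simp add: Cc_def xc_def yc_def cls_ring_hom)
  have "gen Y \<otimes>\<^bsub>F\<^esub> gen X \<ominus>\<^bsub>F\<^esub> gen (Coef (inv_into R (\<sigma> 1) (of_poly f))) \<in> ?rel" unfolding D by blast
  from *[OF this] show "yc \<otimes>\<^bsub>K\<^esub> xc = Cc (\<sigma> (- 1) (of_poly f))"
    by (simp add: sigma_inverse Cc_def xc_def yc_def cls_ring_hom)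
qed

lemma Cc_0: "Cc 0 = \<zero>\<^bsub>K\<^esub>"
proof -
  have "Cc 0 \<oplus>\<^bsub>K\<^esub> Cc 0 = Cc 0 \<oplus>\<^bsub>K\<^esub> \<zero>\<^bsub>K\<^esub>" using gwa_relations_cls(1)[of 0 0] by simp
  then show ?thesis by simp
qed

definition pw :: "'k gwa_elem \<Rightarrow> nat \<Rightarrow> 'k gwa_elem" where
  "pw a m = ((\<lambda>z. a \<otimes>\<^bsub>K\<^esub> z) ^^ m) \<one>\<^bsub>K\<^esub>"

lemma pw_Suc: "pw a (Suc m) = a \<otimes>\<^bsub>K\<^esub> pw a m" and pw_0 [simp]: "pw a 0 = \<one>\<^bsub>K\<^esub>"
  by (simp_all add: pw_def)

lemma pw_carrier [simp]: "a \<in> carrier K \<Longrightarrow> pw a m \<in> carrier K"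
  by (induction m) (simp_all add: pw_Suc)

text \<open>The monomials x^n and y^(-n), which span \<open>A\<close> over \<open>R\<close>. In the
  quotient ring \<open>ux n\<close> becomes \<open>\<omega> n\<close> x^n.\<close>

definition ux :: "int \<Rightarrow> 'k gwa_elem" where
  "ux n = (if n \<ge> 0 then pw xc (nat n) else pw yc (nat (- n)))"

lemma ux_carrier [simp]: "ux n \<in> carrier K" by (simp add: ux_def)

text \<open>The quotient is 1 for n >= 0 and f for n < 0; one formula thus covers x x^n = x^(n+1)
  and x y^m = f y^(m-1).\<close>

lemma xc_ux: "xc \<otimes>\<^bsub>K\<^esub> ux n = Cc (\<sigma> 1 (\<omega> n) / \<omega> (n + 1)) \<otimes>\<^bsub>K\<^esub> ux (n + 1)"
proof (cases "n \<ge> 0")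
  case True
  then have "ux (n + 1) = xc \<otimes>\<^bsub>K\<^esub> ux n"
    by (simp add: ux_def nat_add_distrib pw_Suc)
  then show ?thesis using True by (simp add: \<omega>_nonneg gwa_relations_cls(5)[OF R_1])
next
  case False
  then obtain m where m: "nat (- n) = Suc m" "nat (- (n + 1)) = m" by (cases "nat (- n)") auto
  have "ux n = yc \<otimes>\<^bsub>K\<^esub> pw yc m" using False m by (simp add: ux_def pw_Suc)
  moreover have "ux (n + 1) = pw yc m" using False m by (auto simp: ux_def)
  ultimately have "xc \<otimes>\<^bsub>K\<^esub> ux n = (xc \<otimes>\<^bsub>K\<^esub> yc) \<otimes>\<^bsub>K\<^esub> ux (n + 1)" by (simp add: K.m_assoc)
  then show ?thesis using False by (simp add: \<sigma>_\<omega>_neg gwa_relations_cls(6)[OF R_1])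
qed

lemma \<omega>_Suc: "n \<le> 0 \<Longrightarrow> \<omega> (n - 1) = \<sigma> (- 1) (of_poly f * \<omega> n)"
  using arg_cong[OF \<sigma>_\<omega>_neg[of "n - 1"], of "\<sigma> (- 1)"] by simp

text \<open>Here the quotient is 1 for n <= 0 and \<sigma>^(-1)(f) for n > 0, the latter from y x =
  \<sigma>^(-1)(f).\<close>

lemma yc_ux: "yc \<otimes>\<^bsub>K\<^esub> ux n = Cc (\<sigma> (- 1) (of_poly f * \<omega> n) / \<omega> (n - 1)) \<otimes>\<^bsub>K\<^esub> ux (n - 1)"
proof (cases "n \<le> 0")
  case True
  have "ux n = pw yc (nat (- n))" using True by (auto simp: ux_def)
  then have "ux (n - 1) = yc \<otimes>\<^bsub>K\<^esub> ux n"
    using True pw_Suc[of yc "nat (- n)"] by (simp add: ux_def Suc_nat_eq_nat_zadd1)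
  moreover have "\<sigma> (- 1) (of_poly f * \<omega> n) / \<omega> (n - 1) = 1" using True \<omega>_nonzero[of "n - 1"] by (simp add: \<omega>_Suc[symmetric])
  ultimately show ?thesis by (simp add: gwa_relations_cls(5)[OF R_1])
next
  case False
  then obtain m where m: "nat n = Suc m" "nat (n - 1) = m" by (cases "nat n") auto
  have "ux n = xc \<otimes>\<^bsub>K\<^esub> pw xc m" using False m by (simp add: ux_def pw_Suc)
  moreover have "ux (n - 1) = pw xc m" using False m by (auto simp: ux_def)
  ultimately have "yc \<otimes>\<^bsub>K\<^esub> ux n = (yc \<otimes>\<^bsub>K\<^esub> xc) \<otimes>\<^bsub>K\<^esub> ux (n - 1)" by (simp add: K.m_assoc)
  then show ?thesis using False by (simp add: \<omega>_nonneg gwa_relations_cls(7)[OF R_1])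
qed

text \<open>The element of \<open>A\<close> whose value in the quotient ring is c x^n, available
  when \<open>\<omega> n\<close> divides c.\<close>

definition nf where "nf c n = Cc (c / \<omega> n) \<otimes>\<^bsub>K\<^esub> ux n"

lemma nf_carrier [simp]: "\<omega> n dvdR c \<Longrightarrow> nf c n \<in> carrier K"
  by (simp add: nf_def dvdR_divide)

lemma nf_add: "\<omega> n dvdR c \<Longrightarrow> \<omega> n dvdR d \<Longrightarrow> nf (c + d) n = nf c n \<oplus>\<^bsub>K\<^esub> nf d n"
  by (simp add: nf_def dvdR_divide add_divide_distrib gwa_relations_cls(1) K.l_distr)

lemma nf_0 [simp]: "nf 0 n = \<zero>\<^bsub>K\<^esub>" by (simp add: nf_def Cc_0)

abbreviation "deg w \<equiv> (\<Sum>l\<leftarrow>w. letter_degree l)"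

text \<open>The word is evaluated letter by letter in the quotient ring and in \<open>A\<close> at
  the same time. As the coefficient \<open>c\<close> of the value also determines the class, the
  class of a word is a function of its value; this is the core of the injectivity of
  \<open>gwa_to_Q\<close>.\<close>

lemma word_normal_form:
  "set w \<subseteq> L \<Longrightarrow> \<exists>c. \<omega> (deg w) dvdR c \<and> word_value T f w = mon c (deg w) \<and> cls (word w) = nf c (deg w)"
proof (induction w)
  case Nil
  have "word [] = \<one>\<^bsub>F\<^esub>" by (simp add: free_ring_simps)
  then show ?case
    by (intro exI[of _ 1])
      (simp add: word_value_def Q_one_mon nf_def \<omega>_nonneg ux_def gwa_relations_cls(5)[OF R_1] cls_ring_hom)
next
  case (Cons l w)
  then obtain c where c: "\<omega> (deg w) dvdR c" "word_value T f w = mon c (deg w)" "cls (word w) = nf c (deg w)" by auto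
  have w: "word w \<in> carrier F" "l \<in> L" using Cons word_carrier[of w] by auto
  have "word (l # w) = gen l \<otimes>\<^bsub>F\<^esub> word w" by (simp add: gen_word word_mult)
  moreover have gl: "gen l \<in> carrier F" using w(2) by (simp add: gen_word word_carrier)
  ultimately have cls: "cls (word (l # w)) = cls (gen l) \<otimes>\<^bsub>K\<^esub> nf c (deg w)" using w c by (simp add: cls_ring_hom)
  let ?n = "deg w"
  have cR: "c / \<omega> ?n \<in> R" using c(1) by (simp add: dvdR_divide)
  show ?case
  proof (cases l)
    case (Coef r)
    then have r: "r \<in> R" using w by (simp add: L_letters)
    have "cls (word (l # w)) = nf (r * c) ?n"
      unfolding cls using Coef r cR gwa_relations_cls(2)[OF r cR]
      by (simp add: nf_def K.m_assoc Cc_def[symmetric])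
    moreover have "\<omega> ?n dvdR r * c" using dvdR_mult[OF c(1) r] by (simp add: mult.commute)
    ultimately show ?thesis using Coef c by (intro exI[of _ "r * c"]) (simp add: word_value_Cons mon_mon)
  next
    case X
    have q: "\<sigma> 1 (\<omega> ?n) / \<omega> (?n + 1) \<in> R"
      using \<sigma>_\<omega>_neg[of ?n] by (cases "?n < 0") (simp_all add: \<omega>_nonneg)
    have "cls (word (l # w)) = Cc (\<sigma> 1 (c / \<omega> ?n)) \<otimes>\<^bsub>K\<^esub> (Cc (\<sigma> 1 (\<omega> ?n) / \<omega> (?n + 1)) \<otimes>\<^bsub>K\<^esub> ux (?n + 1))"
      unfolding cls using X cR gwa_relations_cls(3)[OF cR] xc_ux[of ?n]
      by (simp add: nf_def K.m_assoc[symmetric] xc_def[symmetric]) (simp add: K.m_assoc)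
    also have "\<dots> = Cc (\<sigma> 1 (c / \<omega> ?n) * (\<sigma> 1 (\<omega> ?n) / \<omega> (?n + 1))) \<otimes>\<^bsub>K\<^esub> ux (?n + 1)"
      by (subst gwa_relations_cls(2)[OF \<sigma>_R[OF cR] q], subst K.m_assoc) (use cR q in simp_all)
    also have "\<sigma> 1 (c / \<omega> ?n) * (\<sigma> 1 (\<omega> ?n) / \<omega> (?n + 1)) = \<sigma> 1 c / \<omega> (?n + 1)"
      by (simp add: \<sigma>_divide)
    finally have e: "cls (word (l # w)) = nf (\<sigma> 1 c) (?n + 1)" unfolding nf_def .
    have "\<sigma> 1 (c / \<omega> ?n) * (\<sigma> 1 (\<omega> ?n) / \<omega> (?n + 1)) \<in> R" using cR q by blast
    then have "\<omega> (?n + 1) dvdR \<sigma> 1 c" by (simp add: dvdR_divide \<sigma>_divide)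
    then show ?thesis using X c e by (intro exI[of _ "\<sigma> 1 c"]) (simp add: word_value_Cons mon_mon add.commute)
  next
    case Y
    have q: "\<sigma> (- 1) (of_poly f * \<omega> ?n) / \<omega> (?n - 1) \<in> R"
    proof (cases "?n \<le> 0")
      case True
      then show ?thesis using \<omega>_Suc[OF True] \<omega>_nonzero[of "?n - 1"] by simp
    next
      case False
      then show ?thesis by (simp add: \<omega>_nonneg)
    qed
    have "cls (word (l # w)) = Cc (\<sigma> (- 1) (c / \<omega> ?n)) \<otimes>\<^bsub>K\<^esub> (Cc (\<sigma> (- 1) (of_poly f * \<omega> ?n) / \<omega> (?n - 1)) \<otimes>\<^bsub>K\<^esub> ux (?n - 1))"
      unfolding cls using Y cR gwa_relations_cls(4)[OF cR] yc_ux[of ?n]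
      by (simp add: nf_def K.m_assoc[symmetric] yc_def[symmetric]) (simp add: K.m_assoc)
    also have "\<dots> = Cc (\<sigma> (- 1) (c / \<omega> ?n) * (\<sigma> (- 1) (of_poly f * \<omega> ?n) / \<omega> (?n - 1))) \<otimes>\<^bsub>K\<^esub> ux (?n - 1)"
      by (subst gwa_relations_cls(2)[OF \<sigma>_R[OF cR] q], subst K.m_assoc) (use cR q in simp_all)
    also have eq: "\<sigma> (- 1) (c / \<omega> ?n) * (\<sigma> (- 1) (of_poly f * \<omega> ?n) / \<omega> (?n - 1)) = \<sigma> (- 1) (of_poly f) * \<sigma> (- 1) c / \<omega> (?n - 1)"
      by (simp add: \<sigma>_divide \<sigma>_mult)
    finally have e: "cls (word (l # w)) = nf (\<sigma> (- 1) (of_poly f) * \<sigma> (- 1) c) (?n - 1)" unfolding nf_def .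
    have "\<sigma> (- 1) (c / \<omega> ?n) * (\<sigma> (- 1) (of_poly f * \<omega> ?n) / \<omega> (?n - 1)) \<in> R" using cR q by blast
    then have "\<omega> (?n - 1) dvdR \<sigma> (- 1) (of_poly f) * \<sigma> (- 1) c" unfolding eq by (simp add: dvdR_divide)
    then show ?thesis using Y c e
      by (intro exI[of _ "\<sigma> (- 1) (of_poly f) * \<sigma> (- 1) c"]) (simp add: word_value_Cons mon_mon)
  qed
qed

definition Nf where "Nf q = finsum K (\<lambda>n. nf (q n) n) {n. q n \<noteq> 0}"

lemma Nf_sum:
  assumes "q \<in> AQ" "finite W" "{n. q n \<noteq> 0} \<subseteq> W"
  shows "Nf q = finsum K (\<lambda>n. nf (q n) n) W"
  unfolding Nf_def by (rule K.finsum_superset) (use assms AQ_dvd in auto)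

lemma Nf_carrier: "q \<in> AQ \<Longrightarrow> Nf q \<in> carrier K"
  unfolding Nf_def by (rule K.finsum_closed) (use AQ_dvd in auto)

lemma Nf_add:
  assumes "p \<in> AQ" "q \<in> AQ" shows "Nf (p \<oplus>\<^bsub>Q\<^esub> q) = Nf p \<oplus>\<^bsub>K\<^esub> Nf q"
proof -
  let ?W = "{n. p n \<noteq> 0} \<union> {n. q n \<noteq> 0}"
  have W: "finite ?W" using assms AQ_carrier by (auto simp: Q_simps)
  have "Nf (p \<oplus>\<^bsub>Q\<^esub> q) = finsum K (\<lambda>n. nf ((p \<oplus>\<^bsub>Q\<^esub> q) n) n) ?W"
    by (rule Nf_sum[OF AQ_add[OF assms] W]) (auto simp: Q_simps)
  also have "\<dots> = finsum K (\<lambda>n. nf (p n) n \<oplus>\<^bsub>K\<^esub> nf (q n) n) ?W"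
    by (rule K.finsum_cong') (use assms AQ_dvd in \<open>auto simp: Q_simps(5) nf_add\<close>)
  also have "\<dots> = finsum K (\<lambda>n. nf (p n) n) ?W \<oplus>\<^bsub>K\<^esub> finsum K (\<lambda>n. nf (q n) n) ?W"
    by (rule K.finsum_addf) (use assms AQ_dvd in auto)
  also have "finsum K (\<lambda>n. nf (p n) n) ?W = Nf p" by (rule Nf_sum[OF assms(1) W, symmetric]) auto
  also have "finsum K (\<lambda>n. nf (q n) n) ?W = Nf q" by (rule Nf_sum[OF assms(2) W, symmetric]) auto
  finally show ?thesis .
qed

lemma Nf_zero: "Nf \<zero>\<^bsub>Q\<^esub> = \<zero>\<^bsub>K\<^esub>" by (simp add: Nf_def Q_simps)

lemma Nf_mon:
  assumes "\<omega> n dvdR c" shows "Nf (mon c n) = nf c n"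
proof -
  have "Nf (mon c n) = finsum K (\<lambda>m. nf (mon c n m) m) {n}"
    by (rule Nf_sum[OF mon_AQ[OF assms]]) (auto simp: mon_apply split: if_splits)
  then show ?thesis using assms by (simp add: mon_apply)
qed

text \<open>Extends the case of words additively. Two elements with the same value have the same
  normal form, hence the same class.\<close>

lemma cls_normal_form: "u \<in> carrier F \<Longrightarrow> fv u \<in> AQ \<and> cls u = Nf (fv u)"
proof (induction u rule: free_ring_induct)
  case zero
  then show ?case using AQ_zero by (simp add: fv_zero cls_zero Nf_zero)
next
  case (word w)
  then show ?case using word_normal_form[OF word] Nf_mon mon_AQ by (auto simp: fv_word)
next
  case (add u v)
  then show ?case using AQ_add[of "fv u" "fv v"] Nf_add[of "fv u" "fv v"] by (simp add: fv_add cls_ring_hom)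
next
  case (uminus u)
  have eq: "fv (\<ominus>\<^bsub>F\<^esub> u) = \<ominus>\<^bsub>Q\<^esub> fv u" using uminus fv_carrier by (simp add: fv_uminus Q_uminus)
  have m: "\<ominus>\<^bsub>Q\<^esub> fv u \<in> AQ" using AQ_uminus uminus by simp
  have "Nf (\<ominus>\<^bsub>Q\<^esub> fv u) \<oplus>\<^bsub>K\<^esub> Nf (fv u) = \<zero>\<^bsub>K\<^esub>"
    using Nf_add[OF m, of "fv u"] uminus fv_carrier by (simp add: Q.l_neg Nf_zero)
  then have "Nf (\<ominus>\<^bsub>Q\<^esub> fv u) = \<ominus>\<^bsub>K\<^esub> Nf (fv u)"
    using Nf_carrier m uminus by (metis K.minus_equality)
  then show ?case using uminus eq m by (simp add: cls_uminus)
qed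

lemma \<rho>_AQ [simp]: "a \<in> carrier A \<Longrightarrow> \<rho> a \<in> AQ"
  unfolding A_simps using cls_normal_form[THEN conjunct1] by (auto elim!: K_carrierE simp: \<rho>_cls)

lemma \<rho>_inj: "inj_on \<rho> (carrier A)"
proof (rule inj_onI)
  fix a b assume "a \<in> carrier A" "b \<in> carrier A" and eq: "\<rho> a = \<rho> b"
  then obtain u v where uv: "u \<in> carrier F" "a = cls u" "v \<in> carrier F" "b = cls v"
    unfolding A_simps by (metis K_carrierE)
  then have "fv u = fv v" using eq by (simp add: \<rho>_cls)
  then show "a = b"
    unfolding uv using cls_normal_form[OF uv(1), THEN conjunct2] cls_normal_form[OF uv(3), THEN conjunct2] by simp
qed

lemma \<rho>_add: "a \<in> carrier A \<Longrightarrow> b \<in> carrier A \<Longrightarrow> \<rho> (a \<oplus>\<^bsub>A\<^esub> b) = \<rho> a \<oplus>\<^bsub>Q\<^esub> \<rho> b"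
  unfolding A_simps by (auto elim!: K_carrierE simp: \<rho>_cls fv_add simp flip: cls_ring_hom)

lemma \<rho>_mult: "a \<in> carrier A \<Longrightarrow> b \<in> carrier A \<Longrightarrow> \<rho> (a \<otimes>\<^bsub>A\<^esub> b) = \<rho> a \<otimes>\<^bsub>Q\<^esub> \<rho> b"
  unfolding A_simps by (auto elim!: K_carrierE simp: \<rho>_cls fv_mult simp flip: cls_ring_hom)

lemma \<rho>_one: "\<rho> \<one>\<^bsub>A\<^esub> = mon 1 0"
  unfolding A_simps using \<rho>_cls[of "\<one>\<^bsub>F\<^esub>"] by (simp add: fv_one flip: cls_ring_hom)

lemma \<rho>_zero: "\<rho> \<zero>\<^bsub>A\<^esub> = \<zero>\<^bsub>Q\<^esub>"
  unfolding A_simps using \<rho>_cls[of "\<zero>\<^bsub>F\<^esub>"] by (simp add: fv_zero flip: cls_zero)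

lemma \<rho>_scalar: "\<rho> (scalar A c) = mon (of_poly [:c:]) 0"
  unfolding A_simps using \<rho>_cls[of "gen (Coef (of_poly [:c:]))"] by (simp add: fv_gen)

lemma \<rho>_coef: "r \<in> R \<Longrightarrow> \<rho> (gwa_coef T f r) = mon r 0" and \<rho>_x: "\<rho> (gwa_x T f) = mon 1 1"
  and \<rho>_y: "\<rho> (gwa_y T f) = mon (\<sigma> (- 1) (of_poly f)) (- 1)"
  using \<rho>_cls[of "gen (Coef r)"] \<rho>_cls[of "gen X"] \<rho>_cls[of "gen Y"]
  by (auto simp: fv_gen gwa_coef_def gwa_x_def gwa_y_def gwa_class_def)

lemma gwa_gens_carrier [simp]: "r \<in> R \<Longrightarrow> gwa_coef T f r \<in> carrier A" "gwa_x T f \<in> carrier A" "gwa_y T f \<in> carrier A"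
  by (simp_all add: gwa_coef_def gwa_x_def gwa_y_def gwa_class_def A_simps)

text \<open>A word with value c x^n; the division anticipates the factor \<open>\<omega> n\<close>
  that the letters \<open>Y\<close> contribute.\<close>

definition mword :: "'k ratfun \<Rightarrow> int \<Rightarrow> 'k ratfun letter list" where
  "mword c n = Coef (c / \<omega> n) # (if n \<ge> 0 then replicate (nat n) X else replicate (nat (- n)) Y)"

lemma mword_L: "\<omega> n dvdR c \<Longrightarrow> set (mword c n) \<subseteq> L"
  by (auto simp: mword_def L_letters dvdR_divide)

lemma mword_value: "word_value T f (mword c n) = mon c n"
proof -
  have 1: "word_value T f (replicate m X) = mon 1 (int m)" for m
    by (induction m) (auto simp: word_value_Cons mon_mon Q_one_mon word_value_def[of _ _ "[]"])
  have 2: "word_value T f (replicate m Y) = mon (\<omega> (- int m)) (- int m)" for m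
  proof (induction m)
    case 0
    then show ?case by (simp add: word_value_def Q_one_mon \<omega>_nonneg)
  next
    case (Suc m)
    have "- int m - 1 = - 1 - int m" by simp
    from arg_cong[OF this, of \<omega>] show ?case using \<omega>_Suc[of "- int m"] Suc by (simp add: word_value_Cons mon_mon \<sigma>_mult)
  qed
  show ?thesis by (auto simp: mword_def word_value_Cons 1 2 mon_mon \<omega>_nonneg)
qed

lemma mword_deg: "deg (mword c n) = n"
  by (auto simp: mword_def sum_list_replicate)

lemma fv_surj: "q \<in> AQ \<Longrightarrow> \<exists>u\<in>carrier F. fv u = q"
proof (induction "card {n. q n \<noteq> 0}" arbitrary: q rule: less_induct)
  case less
  have fin: "finite {n. q n \<noteq> 0}" using AQ_carrier[OF less.prems] by (simp add: Q_simps)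
  show ?case
  proof (cases "{n. q n \<noteq> 0} = {}")
    case True
    then have "q = \<zero>\<^bsub>Q\<^esub>" by (auto simp: Q_simps)
    then show ?thesis using fv_zero by (intro bexI[of _ "\<zero>\<^bsub>F\<^esub>"]) auto
  next
    case False
    then obtain n where n: "q n \<noteq> 0" by blast
    define p where "p = q(n := 0)"
    have sub: "{m. p m \<noteq> 0} \<subset> {m. q m \<noteq> 0}" using n by (auto simp: p_def)
    have "p \<in> AQ" using less.prems finite_subset[OF psubset_imp_subset[OF sub] fin] by (auto simp: AQ_def p_def Q_simps)
    then obtain u where u: "u \<in> carrier F" "fv u = p"
      using less.hyps[OF psubset_card_mono[OF fin sub]] by blast
    have w: "word (mword (q n) n) \<in> carrier F"
      using word_carrier[OF mword_L[OF AQ_dvd[OF less.prems]]] .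
    have "fv (u \<oplus>\<^bsub>F\<^esub> word (mword (q n) n)) = q"
      using u w by (auto simp: fv_add fv_word mword_value p_def Q_simps(5) mon_apply)
    then show ?thesis using u w by (intro bexI[of _ "u \<oplus>\<^bsub>F\<^esub> word (mword (q n) n)"]) auto
  qed
qed

lemma \<rho>_bij: "bij_betw \<rho> (carrier A) AQ"
  unfolding bij_betw_def
proof (intro conjI \<rho>_inj equalityI subsetI)
  fix q assume "q \<in> AQ"
  then obtain u where "u \<in> carrier F" "fv u = q" using fv_surj by blast
  then show "q \<in> \<rho> ` carrier A" unfolding A_simps by (intro image_eqI[of _ _ "cls u"]) (auto simp: \<rho>_cls)
qed auto

lemma A_in_Q_eq: "A_in_Q T f = AQ"
  using \<rho>_bij by (simp add: A_in_Q_def bij_betw_def)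

definition el :: "'k skew \<Rightarrow> 'k gwa_elem" where "el = inv_into (carrier A) \<rho>"

lemma el [simp]: "q \<in> AQ \<Longrightarrow> el q \<in> carrier A" "q \<in> AQ \<Longrightarrow> \<rho> (el q) = q" "a \<in> carrier A \<Longrightarrow> el (\<rho> a) = a"
  unfolding el_def using bij_betwE[OF bij_betw_inv_into[OF \<rho>_bij]] bij_betw_inv_into_right[OF \<rho>_bij]
    bij_betw_inv_into_left[OF \<rho>_bij] by auto

lemma \<rho>_eqI: "a \<in> carrier A \<Longrightarrow> b \<in> carrier A \<Longrightarrow> (\<And>n. \<rho> a n = \<rho> b n) \<Longrightarrow> a = b"
  by (rule inj_onD[OF \<rho>_inj ext])

text \<open>Words of degree \<open>d\<close> have values concentrated in degree \<open>d\<close>;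
  conversely \<open>mword\<close> gives a homogeneous representative.\<close>

lemma piece_A: "piece A d = {a \<in> carrier A. \<forall>n. n \<noteq> d \<longrightarrow> \<rho> a n = 0}"
proof (intro equalityI subsetI)
  fix a assume "a \<in> piece A d"
  then obtain u where u: "u \<in> carrier F" "a = cls u" and d: "\<And>w. u w \<noteq> 0 \<Longrightarrow> deg w = d" unfolding A_simps by blast
  have "fv u n = 0" if "n \<noteq> d" for n
    unfolding free_value_def
  proof (rule sum.neutral, intro ballI)
    fix w assume "w \<in> {w. u w \<noteq> 0}"
    then have w: "u w \<noteq> 0" by simp
    then have "set w \<subseteq> L" using u by (simp add: free_ring_simps)
    from word_normal_form[OF this] d[OF w] that show "of_int (u w) * word_value T f w n = 0" by (auto simp: mon_apply)
  qed
  then show "a \<in> {a \<in> carrier A. \<forall>n. n \<noteq> d \<longrightarrow> \<rho> a n = 0}" using u by (simp add: \<rho>_cls A_simps)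
next
  fix a assume "a \<in> {a \<in> carrier A. \<forall>n. n \<noteq> d \<longrightarrow> \<rho> a n = 0}"
  then have a: "a \<in> carrier A" "\<And>n. n \<noteq> d \<Longrightarrow> \<rho> a n = 0" by auto
  let ?w = "mword (\<rho> a d) d"
  have w: "set ?w \<subseteq> L" using mword_L AQ_dvd a by simp
  have "a = cls (word ?w)"
    by (rule \<rho>_eqI) (use a word_carrier[OF w] in \<open>auto simp: A_simps \<rho>_cls fv_word mword_value mon_apply\<close>)
  moreover have "\<forall>x. word ?w x \<noteq> 0 \<longrightarrow> deg x = d" using mword_deg by (auto simp: word_def)
  ultimately show "a \<in> piece A d" unfolding A_simps using word_carrier[OF w] by blast
qed

section \<open>The algebra A as a graded algebra\<close>

lemma ring_A: "ring A"
proof (rule ringI)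
  show "abelian_group A"
    by (rule abelian_groupI; (unfold A_simps)?)
      (auto simp: K.a_ac intro: K.l_neg bexI[OF _ K.a_inv_closed])
  show "Group.monoid A"
    by (rule monoidI; (unfold A_simps)?) (auto simp: K.m_assoc)
qed (auto simp: A_simps K.l_distr K.r_distr)

interpretation A: ring A by (rule ring_A)

lemma \<rho>_uminus: "a \<in> carrier A \<Longrightarrow> \<rho> (\<ominus>\<^bsub>A\<^esub> a) = \<ominus>\<^bsub>Q\<^esub> \<rho> a"
  by (rule additive_uminus[OF A.abelian_group_axioms Q.abelian_group_axioms]) (auto simp: \<rho>_add AQ_carrier)

lemma graded_A: "graded_group integer_group A"
proof (rule graded_groupI[where \<pi> = "\<lambda>n a. el (mon (\<rho> a n) n)"])
  show "abelian_group A" by (rule A.abelian_group_axioms)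
  have mq: "mon (\<rho> a n) n \<in> AQ" if "a \<in> carrier A" for a n using that by (intro mon_AQ AQ_dvd) simp
  have ez: "el (mon (\<rho> a n) n) = \<zero>\<^bsub>A\<^esub> \<longleftrightarrow> \<rho> a n = 0" if a: "a \<in> carrier A" for a n
  proof
    assume "el (mon (\<rho> a n) n) = \<zero>\<^bsub>A\<^esub>"
    then have "\<rho> (el (mon (\<rho> a n) n)) n = 0" by (simp add: \<rho>_zero Q_simps)
    then show "\<rho> a n = 0" using mq[OF a] by (simp add: mon_apply)
  next
    assume "\<rho> a n = 0"
    then have "el (mon (\<rho> a n) n) = el (\<rho> \<zero>\<^bsub>A\<^esub>)" by (simp add: \<rho>_zero)
    then show "el (mon (\<rho> a n) n) = \<zero>\<^bsub>A\<^esub>" by simp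
  qed
  fix n :: int
  show "additive_subgroup (piece A n) A"
  proof (rule additive_subgroup.intro, rule A.add.subgroupI)
    show "piece A n \<noteq> {}" using A.zero_closed by (auto simp: piece_A \<rho>_zero Q_simps)
  qed (auto simp: piece_A \<rho>_add \<rho>_uminus Q_uminus AQ_carrier Q_simps(5))
  fix a assume a: "a \<in> carrier A"
  show "el (mon (\<rho> a n) n) \<in> piece A n" using mq[OF a] by (simp add: piece_A mon_apply)
  have fin: "finite {i. \<rho> a i \<noteq> 0}" using AQ_carrier[OF \<rho>_AQ[OF a]] by (simp add: Q_simps)
  have eq: "{i \<in> carrier integer_group. el (mon (\<rho> a i) i) \<noteq> \<zero>\<^bsub>A\<^esub>} = {i. \<rho> a i \<noteq> 0}"
    using ez[OF a] by simp
  show "finite {i \<in> carrier integer_group. el (mon (\<rho> a i) i) \<noteq> \<zero>\<^bsub>A\<^esub>}" unfolding eq by (rule fin)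
  have cl: "(\<lambda>i. el (mon (\<rho> a i) i)) \<in> {i. \<rho> a i \<noteq> 0} \<rightarrow> carrier A" using mq[OF a] by simp
  show "a = finsum A (\<lambda>i. el (mon (\<rho> a i) i)) {i \<in> carrier integer_group. el (mon (\<rho> a i) i) \<noteq> \<zero>\<^bsub>A\<^esub>}"
    unfolding eq
  proof (rule \<rho>_eqI[OF a A.finsum_closed[OF cl]])
    fix m
    have "\<rho> (finsum A (\<lambda>i. el (mon (\<rho> a i) i)) {i. \<rho> a i \<noteq> 0}) =
        finsum Q (\<lambda>i. \<rho> (el (mon (\<rho> a i) i))) {i. \<rho> a i \<noteq> 0}"
      by (rule finsum_additive[OF A.abelian_group_axioms Q.abelian_group_axioms])
        (use fin cl in \<open>auto simp: \<rho>_add AQ_carrier\<close>)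
    then have "\<rho> (finsum A (\<lambda>i. el (mon (\<rho> a i) i)) {i. \<rho> a i \<noteq> 0}) m = (\<Sum>i | \<rho> a i \<noteq> 0. mon (\<rho> a i) i m)"
      using fin mq[OF a] by (simp add: Q_finsum)
    also have "\<dots> = (\<Sum>i | \<rho> a i \<noteq> 0. if i = m then \<rho> a m else 0)"
      by (rule sum.cong) (auto simp: mon_apply)
    also have "\<dots> = \<rho> a m" using fin by (auto simp: sum.delta)
    finally show "\<rho> a m = \<rho> (finsum A (\<lambda>i. el (mon (\<rho> a i) i)) {i. \<rho> a i \<noteq> 0}) m" ..
  qed
  fix b assume b: "b \<in> carrier A"
  show "el (mon (\<rho> (a \<oplus>\<^bsub>A\<^esub> b) n) n) = el (mon (\<rho> a n) n) \<oplus>\<^bsub>A\<^esub> el (mon (\<rho> b n) n)"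
    by (rule \<rho>_eqI) (use a b mq[OF a] mq[OF b] mq[of "a \<oplus>\<^bsub>A\<^esub> b" n] in \<open>auto simp: \<rho>_add Q_simps(5) mon_apply\<close>)
next
  fix i j a assume a: "a \<in> piece A j"
  then have ac: "a \<in> carrier A" "\<And>n. n \<noteq> j \<Longrightarrow> \<rho> a n = 0" by (auto simp: piece_A)
  have mq: "mon (\<rho> a i) i \<in> AQ" using ac by (intro mon_AQ AQ_dvd) simp
  show "el (mon (\<rho> a i) i) = (if i = j then a else \<zero>\<^bsub>A\<^esub>)"
    by (rule \<rho>_eqI) (use ac mq in \<open>auto simp: mon_apply \<rho>_zero Q_simps(4)\<close>)
qed

lemma graded_alg_A: "graded_alg integer_group A"
proof (intro graded_alg.intro graded_ring.intro graded_alg_axioms.intro graded_ring_axioms.intro graded_grpI)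
  show "ring A" by (rule ring_A)
  show "graded_group integer_group A" by (rule graded_A)
  show "group integer_group" by simp
  fix c d :: 'k and i j a b
  have mc: "mon (of_poly [:c:]) 0 \<in> AQ" for c :: 'k by (rule mon_AQ) (simp add: \<omega>_nonneg)
  have sc: "scalar A c \<in> carrier A" for c by (simp add: A_simps)
  show "\<one>\<^bsub>A\<^esub> \<in> piece A \<one>\<^bsub>integer_group\<^esub>" by (simp add: piece_A \<rho>_one mon_apply)
  show "scalar A c \<in> piece A \<one>\<^bsub>integer_group\<^esub>" using sc by (simp add: piece_A \<rho>_scalar mon_apply)
  show "scalar A (c + d) = scalar A c \<oplus>\<^bsub>A\<^esub> scalar A d"
    by (rule \<rho>_eqI) (use sc in \<open>auto simp: \<rho>_add \<rho>_scalar mon_add\<close>)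
  show "scalar A (c * d) = scalar A c \<otimes>\<^bsub>A\<^esub> scalar A d"
    by (rule \<rho>_eqI) (use sc in \<open>auto simp: \<rho>_mult \<rho>_scalar mon_mon mult.commute\<close>)
  show "scalar A 1 = \<one>\<^bsub>A\<^esub>"
    by (rule \<rho>_eqI) (use sc in \<open>auto simp: \<rho>_scalar \<rho>_one One_fract_def one_pCons\<close>)
  {
    assume a: "a \<in> carrier A"
    show "scalar A c \<otimes>\<^bsub>A\<^esub> a = a \<otimes>\<^bsub>A\<^esub> scalar A c"
      by (rule \<rho>_eqI) (use sc a in \<open>auto simp: \<rho>_mult \<rho>_scalar mon_mult mult_mon AQ_carrier mult.commute\<close>)
  }
  assume a: "a \<in> piece A i" and b: "b \<in> piece A j"
  have "\<rho> (a \<otimes>\<^bsub>A\<^esub> b) n = 0" if "n \<noteq> i + j" for n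
  proof (rule ccontr)
    assume "\<rho> (a \<otimes>\<^bsub>A\<^esub> b) n \<noteq> 0"
    then have "(\<rho> a \<otimes>\<^bsub>Q\<^esub> \<rho> b) n \<noteq> 0" using a b by (simp add: \<rho>_mult piece_A)
    then obtain k where "\<rho> a k \<noteq> 0" "\<rho> b (n - k) \<noteq> 0" using Q_mult_supp by blast
    then have "k = i" "n - k = j" using a b by (auto simp: piece_A)
    then show False using that by simp
  qed
  then show "a \<otimes>\<^bsub>A\<^esub> b \<in> piece A (i \<otimes>\<^bsub>integer_group\<^esub> j)" using a b by (simp add: piece_A)
qed

end

section \<open>Rank one projectives and the functors \<open>\<iota>\<close>\<close>

context gwa_setting
begin

interpretation Q: ring Q by (rule ring_Q)
interpretation A: graded_alg integer_group A by (rule graded_alg_A)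

declare A.piece_carrier [simp del] A.piece_add [simp del] A.piece_uminus [simp del] A.piece_zero [simp del]
  A.piece_mult [simp del] A.inv_mult_piece [simp del]

text \<open>The graded subgroup with component (\<open>d n\<close>) \<open>R\<close> x^n in degree
  n. Stability under right multiplication by \<open>A\<close> depends on \<open>d\<close> and is
  shown for the lattices \<open>proj h D\<close> in \<open>proj_act\<close>.\<close>

definition lat :: "(int \<Rightarrow> 'k ratfun) \<Rightarrow> 'k skew set" where
  "lat d = {q \<in> carrier Q. \<forall>n. d n dvdR q n}"

lemma AQ_lat: "AQ = lat \<omega>" by (simp add: AQ_def lat_def)

lemma lat_carrier: "q \<in> lat d \<Longrightarrow> q \<in> carrier Q" and lat_dvd: "q \<in> lat d \<Longrightarrow> d n dvdR q n"
  by (simp_all add: lat_def)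
lemma lat_add: "p \<in> lat d \<Longrightarrow> q \<in> lat d \<Longrightarrow> p \<oplus>\<^bsub>Q\<^esub> q \<in> lat d"
  using Q_add_closed by (auto simp: lat_def Q_simps(5) intro: dvdR_add)
lemma lat_zero: "\<zero>\<^bsub>Q\<^esub> \<in> lat d" by (simp add: lat_def Q_simps)
lemma mon_lat: "d n dvdR c \<Longrightarrow> mon c n \<in> lat d" by (auto simp: lat_def mon_apply)

lemma lat_induct [consumes 1, case_names zero mon add]:
  assumes "q \<in> lat d" and zero: "P \<zero>\<^bsub>Q\<^esub>" and mon: "\<And>c n. d n dvdR c \<Longrightarrow> P (mon c n)"
    and add: "\<And>p q. p \<in> lat d \<Longrightarrow> q \<in> lat d \<Longrightarrow> P p \<Longrightarrow> P q \<Longrightarrow> P (p \<oplus>\<^bsub>Q\<^esub> q)"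
  shows "P q"
  using assms(1)
proof (induction "card {n. q n \<noteq> 0}" arbitrary: q rule: less_induct)
  case less
  have fin: "finite {n. q n \<noteq> 0}" using lat_carrier[OF less.prems] by (simp add: Q_simps)
  show ?case
  proof (cases "{n. q n \<noteq> 0} = {}")
    case True
    then have "q = \<zero>\<^bsub>Q\<^esub>" by (auto simp: Q_simps)
    then show ?thesis using zero by simp
  next
    case False
    then obtain n where n: "q n \<noteq> 0" by blast
    define p where "p = q(n := 0)"
    have sub: "{m. p m \<noteq> 0} \<subset> {m. q m \<noteq> 0}" using n by (auto simp: p_def)
    have p: "p \<in> lat d" using less.prems finite_subset[OF psubset_imp_subset[OF sub] fin] by (auto simp: lat_def p_def Q_simps)
    have "q = p \<oplus>\<^bsub>Q\<^esub> mon (q n) n" by (auto simp: p_def Q_simps(5) mon_apply)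
    then show ?thesis
      using add[OF p mon_lat less.hyps[OF psubset_card_mono[OF fin sub] p] mon] lat_dvd[OF less.prems] by metis
  qed
qed

text \<open>Rank one projectives are encoded by a global factor \<open>h\<close> and a label set
  \<open>D\<close>: in degree n exactly the labels \<open>(\<alpha>, j)\<close> of \<open>D\<close>
  with j <= -n contribute. \<open>D0\<close> with factor 1 is \<open>A\<close> itself, since
  \<open>\<omega> n\<close> has the labels with 0 < j <= -n; \<open>adm\<close> keeps
  \<open>D\<close> a finite modification of it, so each degree sees finitely many labels.\<close>

definition D0 :: "('k \<times> int) set" where "D0 = roots f \<times> {0<..}"
definition adm :: "('k \<times> int) set \<Rightarrow> bool" where "adm D \<longleftrightarrow> D \<subseteq> roots f \<times> UNIV \<and> finite (sym_diff D D0)"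
definition dn :: "('k \<times> int) set \<Rightarrow> int \<Rightarrow> ('k \<times> int) set" where "dn D n = {e \<in> D. snd e \<le> - n}"
definition proj :: "'k ratfun \<Rightarrow> ('k \<times> int) set \<Rightarrow> 'k skew set" where
  "proj h D = lat (\<lambda>n. h * gprod (dn D n))"

lemma adm_D0: "adm D0" by (auto simp: adm_def D0_def)

lemma finite_dn [simp]: assumes "adm D" shows "finite (dn D n)"
proof -
  have "dn D n \<subseteq> sym_diff D D0 \<union> roots f \<times> {0<..-n}" by (auto simp: dn_def D0_def)
  then show ?thesis using assms by (auto simp: adm_def intro: finite_subset)
qed

lemma AQ_proj: "AQ = proj 1 D0"
proof -
  have "dn D0 n = roots f \<times> {0<..-n}" for n by (auto simp: dn_def D0_def)
  then show ?thesis by (simp add: AQ_lat proj_def \<omega>_def[abs_def])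
qed

lemma adm_sym_diff: "adm D \<Longrightarrow> S \<subseteq> roots f \<times> UNIV \<Longrightarrow> finite S \<Longrightarrow> adm (sym_diff D S)"
proof -
  assume *: "adm D" "S \<subseteq> roots f \<times> UNIV" "finite S"
  have "sym_diff (sym_diff D S) D0 \<subseteq> sym_diff D D0 \<union> S" by auto
  then show ?thesis using * unfolding adm_def by (auto intro: finite_subset)
qed

lemma \<sigma>_dvdR_iff: "\<sigma> i a dvdR \<sigma> i b \<longleftrightarrow> a dvdR b"
  using dvdR_\<sigma>[of "\<sigma> i a" "\<sigma> i b" "- i"] dvdR_\<sigma>[of a b i] by auto

lemma comax_\<sigma>: "comax a b \<Longrightarrow> comax (\<sigma> i a) (\<sigma> i b)"
  unfolding comax_def by (metis \<sigma>_R \<sigma>_1 \<sigma>_add \<sigma>_mult)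

subsection \<open>Quotients of the algebra\<close>

lemma regular_module_simps:
  "a_rcosets\<^bsub>regular_module A\<^esub> N = a_rcosets\<^bsub>A\<^esub> N" "N +>\<^bsub>regular_module A\<^esub> a = N +>\<^bsub>A\<^esub> a"
  "set_add (regular_module A) = set_add A" "carrier (regular_module A) = carrier A"
  "piece (regular_module A) = piece A" "act (regular_module A) = monoid.mult A"
  by (auto simp: regular_module_def A_RCOSETS_def' a_r_coset_def' set_add_def' fun_eq_iff)

text \<open>A common model of the two simple-module targets: \<open>N\<close> imposes divisibility
  by \<open>\<gamma>\<close> only in the degrees \<open>Rg\<close>, and \<open>s\<close> is the
  shift. \<open>M_minus\<close> uses \<open>Rg = {..0}\<close> and \<open>M_plus\<close> uses
  \<open>Rg = {0..}\<close>.\<close>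

context
  fixes \<gamma> :: "'k ratfun" and Rg :: "int set" and s :: int and N :: "'k gwa_elem set" and Mq
  assumes \<gamma>: "\<gamma> \<in> R" "\<gamma> \<noteq> 0"
    and N: "N = {a \<in> carrier A. \<forall>m\<in>Rg. \<gamma> * \<omega> m dvdR \<rho> a m}"
    and N_mult: "\<And>a b. a \<in> N \<Longrightarrow> b \<in> carrier A \<Longrightarrow> a \<otimes>\<^bsub>A\<^esub> b \<in> N"
    and Mq: "Mq = shift (quotient_module (regular_module A) N) s"
begin

lemma N_subgroup: "abelian_subgroup N A"
proof (rule abelian_subgroupI3[OF _ A.abelian_group_axioms], rule additive_subgroup.intro, rule A.add.subgroupI)
  show "N \<noteq> {}" using A.zero_closed by (auto simp: N \<rho>_zero Q_simps)
  fix a b assume a: "a \<in> N"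
  then show "\<ominus>\<^bsub>A\<^esub> a \<in> N" by (auto simp: N \<rho>_uminus Q_uminus AQ_carrier intro: dvdR_uminus)
  assume "b \<in> N"
  with a show "a \<oplus>\<^bsub>A\<^esub> b \<in> N" by (auto simp: N \<rho>_add Q_simps(5) intro: dvdR_add)
qed (auto simp: N)

interpretation N: abelian_subgroup N A by (rule N_subgroup)

abbreviation qc where "qc a \<equiv> N +>\<^bsub>A\<^esub> a"

lemma qc_eq: assumes "a \<in> carrier A" "b \<in> carrier A"
  shows "qc a = qc b \<longleftrightarrow> (\<forall>m\<in>Rg. \<gamma> * \<omega> m dvdR \<rho> a m - \<rho> b m)"
proof
  assume "qc a = qc b"
  then have "a \<in> qc b" using N.a_rcos_self[OF assms(1)] by simp
  then obtain c where c: "c \<in> N" "a = c \<oplus>\<^bsub>A\<^esub> b" unfolding a_r_coset_def' by blast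
  have cN: "c \<in> carrier A" "\<forall>m\<in>Rg. \<gamma> * \<omega> m dvdR \<rho> c m" using c(1) unfolding N by blast+
  have "\<rho> a = \<rho> c \<oplus>\<^bsub>Q\<^esub> \<rho> b" unfolding c(2) by (rule \<rho>_add[OF cN(1) assms(2)])
  then have "\<rho> a m - \<rho> b m = \<rho> c m" for m by (simp add: Q_simps(5))
  then show "\<forall>m\<in>Rg. \<gamma> * \<omega> m dvdR \<rho> a m - \<rho> b m" using cN(2) by simp
next
  assume *: "\<forall>m\<in>Rg. \<gamma> * \<omega> m dvdR \<rho> a m - \<rho> b m"
  have eq: "\<rho> (a \<ominus>\<^bsub>A\<^esub> b) m = \<rho> a m - \<rho> b m" for m
    using assms by (simp add: a_minus_def \<rho>_add \<rho>_uminus Q_uminus AQ_carrier Q_simps(5))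
  have "a \<ominus>\<^bsub>A\<^esub> b \<in> N" unfolding N
    by (intro CollectI conjI A.minus_closed assms) (unfold eq, rule *)
  moreover have "a = (a \<ominus>\<^bsub>A\<^esub> b) \<oplus>\<^bsub>A\<^esub> b" using assms by (simp add: a_minus_def A.a_assoc A.l_neg)
  ultimately have "a \<in> qc b" unfolding a_r_coset_def' by blast
  then show "qc a = qc b" using A.a_repr_independence[OF _ assms(2) N.a_subgroup] by metis
qed

lemma Mq_simps: "carrier Mq = qc ` carrier A" "\<zero>\<^bsub>Mq\<^esub> = N" "piece Mq n = qc ` piece A (n + s)"
  by (auto simp: Mq shift_def quotient_module_def regular_module_simps A_RCOSETS_def')

lemma N_qc: "N = qc \<zero>\<^bsub>A\<^esub>" using A.a_coset_add_zero[of N] N.a_subset by simp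

lemma Mq_add: "a \<in> carrier A \<Longrightarrow> b \<in> carrier A \<Longrightarrow> qc a \<oplus>\<^bsub>Mq\<^esub> qc b = qc (a \<oplus>\<^bsub>A\<^esub> b)"
  using N.a_rcos_sum[of a b] by (simp add: Mq shift_def quotient_module_def regular_module_simps)

text \<open>The action on a coset is a union over representatives, so all of them have to produce
  the same coset; \<open>N_mult\<close> ensures this.\<close>

lemma Mq_act:
  assumes "a \<in> carrier A" "b \<in> carrier A" shows "act Mq (qc a) b = qc (a \<otimes>\<^bsub>A\<^esub> b)"
proof -
  have "qc (x \<otimes>\<^bsub>A\<^esub> b) = qc (a \<otimes>\<^bsub>A\<^esub> b)" if "x \<in> qc a" for x
  proof -
    obtain c where c: "c \<in> N" "x = c \<oplus>\<^bsub>A\<^esub> a" using \<open>x \<in> qc a\<close> unfolding a_r_coset_def' by blast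
    then have cc: "c \<in> carrier A" using N.a_subset by blast
    then have "x \<otimes>\<^bsub>A\<^esub> b = c \<otimes>\<^bsub>A\<^esub> b \<oplus>\<^bsub>A\<^esub> a \<otimes>\<^bsub>A\<^esub> b" using assms c by (simp add: A.l_distr)
    moreover have "c \<otimes>\<^bsub>A\<^esub> b \<in> N" using N_mult c assms by simp
    ultimately have "x \<otimes>\<^bsub>A\<^esub> b \<in> qc (a \<otimes>\<^bsub>A\<^esub> b)" unfolding a_r_coset_def' by blast
    then show ?thesis using A.a_repr_independence[OF _ _ N.a_subgroup, of "x \<otimes>\<^bsub>A\<^esub> b" "a \<otimes>\<^bsub>A\<^esub> b"] assms by simp
  qed
  moreover have "a \<in> qc a" using N.a_rcos_self[OF assms(1)] .
  ultimately have "(\<Union>x\<in>qc a. qc (x \<otimes>\<^bsub>A\<^esub> b)) = qc (a \<otimes>\<^bsub>A\<^esub> b)" by blast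
  then show ?thesis by (simp add: Mq shift_def quotient_module_def regular_module_simps)
qed

lemma sub_Q_simps: "carrier (sub_Q T f P) = P" "p \<oplus>\<^bsub>sub_Q T f P\<^esub> q = p \<oplus>\<^bsub>Q\<^esub> q"
  "act (sub_Q T f P) q a = q \<otimes>\<^bsub>Q\<^esub> \<rho> a" "piece (sub_Q T f P) i = {q \<in> P. \<forall>n. n \<noteq> i \<longrightarrow> q n = 0}"
  "\<zero>\<^bsub>sub_Q T f P\<^esub> = \<zero>\<^bsub>Q\<^esub>"
  by (simp_all add: sub_Q_def)

text \<open>\<open>\<phi>\<close> is determined by the images of the generators \<open>d n\<close>
  x^n, each represented by \<open>u n * \<omega> (n + s)\<close> with \<open>u n\<close> in
  \<open>R\<close>. Surjectivity makes \<open>u n\<close> invertible modulo \<open>\<gamma>\<close>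
  in the degrees seen by \<open>N\<close>, so it drops out of the condition for lying in the kernel.
  The kernel is therefore the same for every surjection.\<close>

lemma surjection_kernel:
  assumes d: "\<And>n. d n \<noteq> 0"
    and \<phi>: "\<phi> \<in> graded_hom integer_group A (sub_Q T f (lat d)) Mq" and surj: "\<phi> ` lat d = carrier Mq"
  shows "{p \<in> lat d. \<phi> p = \<zero>\<^bsub>Mq\<^esub>} = {p \<in> lat d. \<forall>n. n + s \<in> Rg \<longrightarrow> \<sigma> (- s) \<gamma> * d n dvdR p n}"
proof -
  note \<phi>D = graded_homD[OF \<phi>, unfolded sub_Q_simps]
  have "\<exists>u\<in>R. \<phi> (mon (d n) n) = qc (el (mon (u * \<omega> (n + s)) (n + s)))" for n
  proof -
    have "\<phi> (mon (d n) n) \<in> piece Mq n"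
      using \<phi>D(4)[of n "mon (d n) n"] by (simp add: mon_lat mon_apply)
    then obtain a where a: "a \<in> piece A (n + s)" "\<phi> (mon (d n) n) = qc a" by (auto simp: Mq_simps)
    then have ac: "a \<in> carrier A" "\<And>m. m \<noteq> n + s \<Longrightarrow> \<rho> a m = 0" by (auto simp: piece_A)
    obtain u where u: "u \<in> R" "\<rho> a (n + s) = \<omega> (n + s) * u" using AQ_dvd[OF \<rho>_AQ[OF ac(1)]] by blast
    have "mon (u * \<omega> (n + s)) (n + s) \<in> AQ" using u by (intro mon_AQ) (auto simp: mult.commute)
    then have "a = el (mon (u * \<omega> (n + s)) (n + s))"
      by (intro \<rho>_eqI) (use ac u in \<open>auto simp: mon_apply mult.commute\<close>)
    then show ?thesis using a u by blast
  qed
  then obtain u where u: "\<And>n. u n \<in> R" "\<And>n. \<phi> (mon (d n) n) = qc (el (mon (u n * \<omega> (n + s)) (n + s)))" by metis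
  \<comment> \<open>The lift of \<open>\<phi>\<close> to \<open>A\<close> prescribed by the values
    on the generators.\<close>
  define \<Phi> where "\<Phi> p = (\<lambda>m. u (m - s) * \<omega> m * \<sigma> s (p (m - s) / d (m - s)))" for p
  have \<Phi>_AQ: "\<Phi> p \<in> AQ" if p: "p \<in> lat d" for p
  proof -
    have "{m. \<Phi> p m \<noteq> 0} \<subseteq> (\<lambda>n. n + s) ` {n. p n \<noteq> 0}"
    proof
      fix m assume "m \<in> {m. \<Phi> p m \<noteq> 0}"
      then have "p (m - s) \<noteq> 0" by (auto simp: \<Phi>_def)
      then show "m \<in> (\<lambda>n. n + s) ` {n. p n \<noteq> 0}" by (intro image_eqI[of _ _ "m - s"]) auto
    qed
    then have "finite {m. \<Phi> p m \<noteq> 0}" using lat_carrier[OF p] by (auto simp: Q_simps intro: finite_subset)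
    moreover have "p n / d n \<in> R" for n using lat_dvd[OF p, of n] d by (simp add: dvdR_divide)
    then have "\<omega> m dvdR \<Phi> p m" for m unfolding \<Phi>_def
      by (intro dvdRI[of "u (m - s) * \<sigma> s (p (m - s) / d (m - s))"]) (auto simp: u(1))
    ultimately show ?thesis by (simp add: AQ_def Q_simps)
  qed
  have rep: "\<phi> p = qc (el (\<Phi> p))" if "p \<in> lat d" for p
    using that
  proof (induction p rule: lat_induct)
    case zero
    have \<Phi>0: "\<Phi> \<zero>\<^bsub>Q\<^esub> = \<zero>\<^bsub>Q\<^esub>" by (simp add: \<Phi>_def Q_simps)
    have el0: "el \<zero>\<^bsub>Q\<^esub> = \<zero>\<^bsub>A\<^esub>" using el(3)[of "\<zero>\<^bsub>A\<^esub>"] by (simp add: \<rho>_zero)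
    obtain a where a: "a \<in> carrier A" "\<phi> \<zero>\<^bsub>Q\<^esub> = qc a" using \<phi>D(1)[OF lat_zero] by (auto simp: Mq_simps)
    have "qc (a \<oplus>\<^bsub>A\<^esub> a) = qc a" using \<phi>D(2)[OF lat_zero lat_zero] a Mq_add by simp
    moreover have "\<rho> (a \<oplus>\<^bsub>A\<^esub> a) m - \<rho> a m = \<rho> a m - \<rho> \<zero>\<^bsub>A\<^esub> m" for m
      using \<rho>_add[OF a(1) a(1)] by (simp add: \<rho>_zero Q_simps(4,5))
    ultimately have "qc a = qc \<zero>\<^bsub>A\<^esub>"
      using qc_eq[OF A.a_closed[OF a(1) a(1)] a(1)] qc_eq[OF a(1) A.zero_closed] by simp
    then show ?case using a \<Phi>0 el0 by simp
  next
    case (mon c n)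
    then obtain r where r: "r \<in> R" "c = d n * r" by blast
    have c1: "mon c n = mon (d n) n \<otimes>\<^bsub>Q\<^esub> \<rho> (gwa_coef T f (\<sigma> (- n) r))"
      using r by (simp add: \<rho>_coef mon_mon)
    have m: "mon (u n * \<omega> (n + s)) (n + s) \<in> AQ"
      by (rule mon_AQ, rule dvdRI[OF u(1)[of n]]) (rule mult.commute)
    have "\<phi> (mon c n) = act Mq (\<phi> (mon (d n) n)) (gwa_coef T f (\<sigma> (- n) r))"
      unfolding c1 by (rule \<phi>D(3)) (use r in \<open>auto intro: mon_lat\<close>)
    also have "\<dots> = qc (el (mon (u n * \<omega> (n + s)) (n + s)) \<otimes>\<^bsub>A\<^esub> gwa_coef T f (\<sigma> (- n) r))"
      unfolding u(2) using m r by (simp add: Mq_act)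
    also have "el (mon (u n * \<omega> (n + s)) (n + s)) \<otimes>\<^bsub>A\<^esub> gwa_coef T f (\<sigma> (- n) r) = el (\<Phi> (mon c n))"
    proof (rule \<rho>_eqI)
      show "el (\<Phi> (mon c n)) \<in> carrier A" using \<Phi>_AQ[OF mon_lat[of d n c]] mon by simp
    qed (use m r d \<Phi>_AQ[OF mon_lat[of d n c]] mon in \<open>auto simp: \<rho>_mult \<rho>_coef mon_mon mon_apply \<Phi>_def\<close>)
    finally show ?case .
  next
    case (add p q)
    have "\<Phi> (p \<oplus>\<^bsub>Q\<^esub> q) = \<Phi> p \<oplus>\<^bsub>Q\<^esub> \<Phi> q"
      by (auto simp: \<Phi>_def Q_simps(5) add_divide_distrib \<sigma>_add distrib_left)
    then have "el (\<Phi> (p \<oplus>\<^bsub>Q\<^esub> q)) = el (\<Phi> p) \<oplus>\<^bsub>A\<^esub> el (\<Phi> q)"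
      by (intro \<rho>_eqI) (use \<Phi>_AQ add AQ_add in \<open>auto simp: \<rho>_add\<close>)
    then show ?case using \<phi>D(2)[OF add.hyps] add \<Phi>_AQ by (simp add: Mq_add)
  qed
  \<comment> \<open>A preimage of the class of \<open>\<omega> (n + s)\<close> x^(n+s) has a
    coefficient that inverts \<open>u n\<close> modulo \<open>\<gamma>\<close>.\<close>
  have unit: "\<exists>r\<in>R. \<gamma> dvdR u n * \<sigma> s r - 1" if n: "n + s \<in> Rg" for n
  proof -
    have m: "mon (\<omega> (n + s)) (n + s) \<in> AQ" by (intro mon_AQ) auto
    then have "qc (el (mon (\<omega> (n + s)) (n + s))) \<in> \<phi> ` lat d" unfolding surj by (simp add: Mq_simps)
    then obtain p where p: "p \<in> lat d" "qc (el (\<Phi> p)) = qc (el (mon (\<omega> (n + s)) (n + s)))" using rep by auto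
    then have "\<forall>m\<in>Rg. \<gamma> * \<omega> m dvdR \<Phi> p m - mon (\<omega> (n + s)) (n + s) m"
      using qc_eq[of "el (\<Phi> p)" "el (mon (\<omega> (n + s)) (n + s))"] m \<Phi>_AQ[OF p(1)] by simp
    then have "\<gamma> * \<omega> (n + s) dvdR \<Phi> p (n + s) - \<omega> (n + s)" using n by (auto simp: mon_apply)
    then have "\<omega> (n + s) * \<gamma> dvdR \<omega> (n + s) * (u n * \<sigma> s (p n / d n) - 1)"
      by (simp add: \<Phi>_def algebra_simps)
    then have "\<gamma> dvdR u n * \<sigma> s (p n / d n) - 1" by (simp add: dvdR_cancel)
    then show ?thesis using lat_dvd[OF p(1), of n] d by (auto simp: dvdR_divide)
  qed
  have "\<phi> p = \<zero>\<^bsub>Mq\<^esub> \<longleftrightarrow> (\<forall>n. n + s \<in> Rg \<longrightarrow> \<sigma> (- s) \<gamma> * d n dvdR p n)" if p: "p \<in> lat d" for p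
  proof -
    have "\<phi> p = \<zero>\<^bsub>Mq\<^esub> \<longleftrightarrow> (\<forall>m\<in>Rg. \<gamma> * \<omega> m dvdR \<Phi> p m)"
      using qc_eq[of "el (\<Phi> p)" "\<zero>\<^bsub>A\<^esub>"] \<Phi>_AQ[OF p] by (simp add: rep[OF p] Mq_simps(2) flip: N_qc) (simp add: \<rho>_zero Q_simps)
    also have "\<dots> \<longleftrightarrow> (\<forall>n. n + s \<in> Rg \<longrightarrow> \<gamma> * \<omega> (n + s) dvdR \<Phi> p (n + s))"
      by (metis diff_add_cancel)
    also have "\<dots> \<longleftrightarrow> (\<forall>n. n + s \<in> Rg \<longrightarrow> \<sigma> (- s) \<gamma> * d n dvdR p n)"
    proof (intro all_cong1 imp_cong[OF refl])
      fix n assume n: "n + s \<in> Rg"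
      let ?r = "p n / d n"
      have r: "?r \<in> R" using lat_dvd[OF p, of n] d by (simp add: dvdR_divide)
      obtain r0 where r0: "r0 \<in> R" "\<gamma> dvdR u n * \<sigma> s r0 - 1" using unit[OF n] by blast
      have "\<gamma> * \<omega> (n + s) dvdR \<Phi> p (n + s) \<longleftrightarrow> \<omega> (n + s) * \<gamma> dvdR \<omega> (n + s) * (u n * \<sigma> s ?r)"
        by (simp add: \<Phi>_def algebra_simps)
      also have "\<dots> \<longleftrightarrow> \<gamma> dvdR u n * \<sigma> s ?r" by (simp add: dvdR_cancel)
      also have "\<dots> \<longleftrightarrow> \<gamma> dvdR \<sigma> s ?r"
      proof
        assume a: "\<gamma> dvdR u n * \<sigma> s ?r"
        \<comment> \<open>The difference equals \<open>\<sigma> s ?r\<close>: the products of three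
          factors cancel.\<close>
        have "\<gamma> dvdR (u n * \<sigma> s ?r) * \<sigma> s r0 - (u n * \<sigma> s r0 - 1) * \<sigma> s ?r"
          using dvdR_diff[OF dvdR_mult[OF a] dvdR_mult[OF r0(2)]] r r0 by blast
        then show "\<gamma> dvdR \<sigma> s ?r" by (simp add: algebra_simps)
      next
        assume "\<gamma> dvdR \<sigma> s ?r"
        then show "\<gamma> dvdR u n * \<sigma> s ?r" using dvdR_mult[OF _ u(1)] by (metis mult.commute)
      qed
      also have "\<dots> \<longleftrightarrow> \<sigma> (- s) \<gamma> dvdR ?r" using \<sigma>_dvdR_iff[of s "\<sigma> (- s) \<gamma>" ?r] by simp
      also have "\<dots> \<longleftrightarrow> \<sigma> (- s) \<gamma> * d n dvdR p n"
        using dvdR_cancel[of "d n" "\<sigma> (- s) \<gamma>" ?r] d[of n] by (simp add: mult.commute)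
      finally show "\<gamma> * \<omega> (n + s) dvdR \<Phi> p (n + s) \<longleftrightarrow> \<sigma> (- s) \<gamma> * d n dvdR p n" .
    qed
    finally show ?thesis .
  qed
  then show ?thesis by blast
qed

text \<open>The surjection is left multiplication by t x^s followed by the projection. The condition
  on \<open>t\<close> brings the lattice into \<open>A\<close>; comaximality makes the image
  generate modulo \<open>\<gamma>\<close> in every degree of \<open>Rg\<close>, and the other
  degrees vanish in the quotient.\<close>

lemma surjection_exists:
  assumes d: "\<And>n. d n \<noteq> 0" and lat_act: "\<And>q a. q \<in> lat d \<Longrightarrow> a \<in> carrier A \<Longrightarrow> q \<otimes>\<^bsub>Q\<^esub> \<rho> a \<in> lat d"
    and t: "\<And>n. \<omega> (n + s) dvdR t * \<sigma> s (d n)"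
    and co: "\<And>n. n + s \<in> Rg \<Longrightarrow> comax \<gamma> (t * \<sigma> s (d n) / \<omega> (n + s))"
  shows "\<exists>\<phi>\<in>graded_hom integer_group A (sub_Q T f (lat d)) Mq. \<phi> ` lat d = carrier Mq"
proof
  let ?\<phi> = "\<lambda>q\<in>lat d. qc (el (mon t s \<otimes>\<^bsub>Q\<^esub> q))"
  have tq: "(mon t s \<otimes>\<^bsub>Q\<^esub> q) m = t * \<sigma> s (q (m - s))" for q m by (simp add: mon_mult)
  have AQ: "mon t s \<otimes>\<^bsub>Q\<^esub> q \<in> AQ" if q: "q \<in> lat d" for q
  proof -
    have "\<omega> m dvdR t * \<sigma> s (q (m - s))" for m
    proof -
      obtain r where r: "r \<in> R" "q (m - s) = d (m - s) * r" using lat_dvd[OF q] by blast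
      have "\<omega> m dvdR t * \<sigma> s (d (m - s)) * \<sigma> s r" using dvdR_mult[OF t[of "m - s"] \<sigma>_R[OF r(1), of s]] by simp
      then show ?thesis using r by (simp add: \<sigma>_mult mult.assoc)
    qed
    then show ?thesis using Q_mult_closed[OF mon_carrier lat_carrier[OF q]] by (simp add: AQ_def tq)
  qed
  show "?\<phi> \<in> graded_hom integer_group A (sub_Q T f (lat d)) Mq"
    unfolding graded_hom_def sub_Q_simps
  proof (intro CollectI conjI ballI)
    show "?\<phi> \<in> lat d \<rightarrow>\<^sub>E carrier Mq" using AQ by (auto simp: Mq_simps)
    fix p assume p: "p \<in> lat d"
    show "?\<phi> (p \<oplus>\<^bsub>Q\<^esub> q) = ?\<phi> p \<oplus>\<^bsub>Mq\<^esub> ?\<phi> q" if q: "q \<in> lat d" for q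
    proof -
      have "mon t s \<otimes>\<^bsub>Q\<^esub> (p \<oplus>\<^bsub>Q\<^esub> q) = mon t s \<otimes>\<^bsub>Q\<^esub> p \<oplus>\<^bsub>Q\<^esub> mon t s \<otimes>\<^bsub>Q\<^esub> q"
        using p q by (simp add: Q.r_distr lat_carrier)
      then have "el (mon t s \<otimes>\<^bsub>Q\<^esub> (p \<oplus>\<^bsub>Q\<^esub> q)) = el (mon t s \<otimes>\<^bsub>Q\<^esub> p) \<oplus>\<^bsub>A\<^esub> el (mon t s \<otimes>\<^bsub>Q\<^esub> q)"
        by (intro \<rho>_eqI) (use AQ[OF p] AQ[OF q] AQ_add in \<open>auto simp: \<rho>_add\<close>)
      then show ?thesis using p q AQ lat_add[OF p q] by (simp add: Mq_add)
    qed
    show "?\<phi> (p \<otimes>\<^bsub>Q\<^esub> \<rho> a) = act Mq (?\<phi> p) a" if a: "a \<in> carrier A" for a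
    proof -
      have pa: "p \<otimes>\<^bsub>Q\<^esub> \<rho> a \<in> lat d" using lat_act p a .
      have "mon t s \<otimes>\<^bsub>Q\<^esub> (p \<otimes>\<^bsub>Q\<^esub> \<rho> a) = mon t s \<otimes>\<^bsub>Q\<^esub> p \<otimes>\<^bsub>Q\<^esub> \<rho> a"
        using p a by (simp add: Q.m_assoc lat_carrier AQ_carrier)
      then have "el (mon t s \<otimes>\<^bsub>Q\<^esub> (p \<otimes>\<^bsub>Q\<^esub> \<rho> a)) = el (mon t s \<otimes>\<^bsub>Q\<^esub> p) \<otimes>\<^bsub>A\<^esub> a"
        by (intro \<rho>_eqI) (use AQ[OF p] AQ[OF pa] a in \<open>auto simp: \<rho>_mult\<close>)
      then show ?thesis using p a pa AQ[OF p] by (simp add: Mq_act)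
    qed
  next
    fix i
    show "?\<phi> ` {q \<in> lat d. \<forall>n. n \<noteq> i \<longrightarrow> q n = 0} \<subseteq> piece Mq i"
    proof
      fix x assume "x \<in> ?\<phi> ` {q \<in> lat d. \<forall>n. n \<noteq> i \<longrightarrow> q n = 0}"
      then obtain q where q: "q \<in> lat d" "\<And>n. n \<noteq> i \<Longrightarrow> q n = 0" "x = qc (el (mon t s \<otimes>\<^bsub>Q\<^esub> q))" by auto
      have "el (mon t s \<otimes>\<^bsub>Q\<^esub> q) \<in> piece A (i + s)" using AQ[OF q(1)] q(2) by (auto simp: piece_A tq)
      then show "x \<in> piece Mq i" using q by (simp add: Mq_simps)
    qed
  qed
  show "?\<phi> ` lat d = carrier Mq"
  proof (intro equalityI subsetI)
    fix x assume "x \<in> carrier Mq"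
    then obtain a where a: "a \<in> carrier A" "x = qc a" by (auto simp: Mq_simps)
    have "\<exists>y\<in>R. \<gamma> dvdR t * \<sigma> s (d n) / \<omega> (n + s) * y - 1" if n: "n + s \<in> Rg" for n
    proof -
      obtain x y where "x \<in> R" "y \<in> R" "\<gamma> * x + t * \<sigma> s (d n) / \<omega> (n + s) * y = 1" using co[OF n] unfolding comax_def by blast
      then have "t * \<sigma> s (d n) / \<omega> (n + s) * y - 1 = \<gamma> * (- x)" by (simp add: algebra_simps)
      then show ?thesis using \<open>x \<in> R\<close> \<open>y \<in> R\<close> by blast
    qed
    then obtain y where y: "\<And>n. n + s \<in> Rg \<Longrightarrow> y n \<in> R" "\<And>n. n + s \<in> Rg \<Longrightarrow> \<gamma> dvdR t * \<sigma> s (d n) / \<omega> (n + s) * y n - 1"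
      by metis
    define r where "r m = \<rho> a m / \<omega> m" for m
    have r: "r m \<in> R" "\<rho> a m = \<omega> m * r m" for m
      using AQ_dvd[OF \<rho>_AQ[OF a(1)], of m] by (auto simp: r_def dvdR_divide)
    \<comment> \<open>A preimage built degree by degree: \<open>y n\<close> inverts the multiplier
      modulo \<open>\<gamma>\<close>, and degrees outside \<open>Rg\<close> may be set to
      zero.\<close>
    define q where "q n = (if n + s \<in> Rg then d n * \<sigma> (- s) (y n * r (n + s)) else 0)" for n
    have "{n. q n \<noteq> 0} \<subseteq> (\<lambda>m. m - s) ` {m. \<rho> a m \<noteq> 0}"
    proof
      fix n assume "n \<in> {n. q n \<noteq> 0}"
      then have "\<rho> a (n + s) \<noteq> 0" by (auto simp: q_def r_def split: if_splits)
      then show "n \<in> (\<lambda>m. m - s) ` {m. \<rho> a m \<noteq> 0}" by (intro image_eqI[of _ _ "n + s"]) auto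
    qed
    then have "finite {n. q n \<noteq> 0}" using AQ_carrier[OF \<rho>_AQ[OF a(1)]] by (auto simp: Q_simps intro: finite_subset)
    moreover have "d n dvdR q n" for n
    proof (cases "n + s \<in> Rg")
      case True
      then have "\<sigma> (- s) (y n * r (n + s)) \<in> R" using y(1) r(1) by blast
      then show ?thesis using True unfolding q_def by (intro dvdRI) auto
    qed (simp add: q_def)
    ultimately have q: "q \<in> lat d" by (simp add: lat_def Q_simps)
    have "qc (el (mon t s \<otimes>\<^bsub>Q\<^esub> q)) = qc a"
    proof (subst qc_eq)
      show "\<forall>m\<in>Rg. \<gamma> * \<omega> m dvdR \<rho> (el (mon t s \<otimes>\<^bsub>Q\<^esub> q)) m - \<rho> a m"
      proof
        fix m assume m: "m \<in> Rg"
        let ?n = "m - s"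
        have "\<rho> (el (mon t s \<otimes>\<^bsub>Q\<^esub> q)) m - \<rho> a m = t * \<sigma> s (d ?n) * (y ?n * r m) - \<omega> m * r m"
          using AQ[OF q] m r(2)[of m] by (simp add: tq q_def \<sigma>_mult mult.assoc)
        also have "\<dots> = \<omega> m * ((t * \<sigma> s (d ?n) / \<omega> (?n + s) * y ?n - 1) * r m)"
          by (simp add: algebra_simps)
        finally show "\<gamma> * \<omega> m dvdR \<rho> (el (mon t s \<otimes>\<^bsub>Q\<^esub> q)) m - \<rho> a m"
          using dvdR_mult[OF y(2)[of ?n] r(1)[of m]] m by (simp add: mult.commute[of \<gamma>] dvdR_cancel)
      qed
    qed (use AQ[OF q] a in auto)
    then show "x \<in> ?\<phi> ` lat d" using q a by (intro image_eqI[of _ _ q]) auto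
  qed (use AQ in \<open>auto simp: Mq_simps\<close>)
qed

end

end

section \<open>The two quotient modules, and iota on lattices\<close>

context gwa_setting
begin

interpretation Q: ring Q by (rule ring_Q)
interpretation A: ring A by (rule ring_A)

declare dvdR_trans [trans]

lemma gprod_subset: "finite S' \<Longrightarrow> S \<subseteq> S' \<Longrightarrow> gprod S' = gprod S * gprod (S' - S)"
  using gprod_union[of S "S' - S"] finite_subset[of S S'] by (simp add: Un_absorb1)

lemma gprod_subset_dvd: "finite S' \<Longrightarrow> S \<subseteq> S' \<Longrightarrow> gprod S dvdR gprod S'"
  using gprod_subset by blast

lemma root_factor_gfac: "root_factor f \<alpha> = gfac (\<alpha>, 0)"
  by (simp add: gfac_def)

lemma root_factor_R [simp]: "root_factor f \<alpha> \<in> R" and root_factor_nonzero [simp]: "root_factor f \<alpha> \<noteq> 0"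
  by (simp_all add: root_factor_gfac)

lemma root_factor_dvd: "\<alpha> \<in> roots f \<Longrightarrow> root_factor f \<alpha> dvdR of_poly f"
  using gprod_subset_dvd[of "roots f \<times> {0}" "{(\<alpha>, 0)}"] \<sigma>_f[of 0] by (simp add: root_factor_gfac)

lemma of_poly_f_nonzero [simp]: "of_poly f \<noteq> 0" using f_nonzero by (simp add: Fract_eq_0_iff)

lemma AQ_I:
  assumes "finite S" "\<And>n. q n \<noteq> 0 \<Longrightarrow> n \<in> S" "\<And>n. \<omega> n dvdR q n" shows "q \<in> AQ"
proof -
  have "{n. q n \<noteq> 0} \<subseteq> S" using assms(2) by blast
  then show ?thesis using assms(1,3) by (auto simp: AQ_def Q_simps intro: finite_subset)
qed

lemma AQ_finite: "q \<in> AQ \<Longrightarrow> finite {n. q n \<noteq> 0}"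
  using AQ_carrier by (simp add: Q_simps)

text \<open>In positive degrees x \<open>A\<close> is already all of \<open>A\<close>; in degree m
  <= 0 its coefficients are the multiples of \<open>f\<close> \<open>\<omega> m\<close>, which the
  root factor divides. Only nonpositive degrees carry a condition.\<close>

lemma right_ideal_minus:
  assumes \<alpha>: "\<alpha> \<in> roots f"
  shows "right_ideal2 A (gwa_coef T f (root_factor f \<alpha>)) (gwa_x T f) =
    {a \<in> carrier A. \<forall>m\<in>{..0}. root_factor f \<alpha> * \<omega> m dvdR \<rho> a m}"
proof -
  let ?g = "root_factor f \<alpha>"
  let ?c = "gwa_coef T f ?g" and ?x = "gwa_x T f"
  have val: "\<rho> (?c \<otimes>\<^bsub>A\<^esub> a \<oplus>\<^bsub>A\<^esub> ?x \<otimes>\<^bsub>A\<^esub> b) m = ?g * \<rho> a m + \<sigma> 1 (\<rho> b (m - 1))"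
    if "a \<in> carrier A" "b \<in> carrier A" for a b m
    using that by (simp add: \<rho>_add \<rho>_mult \<rho>_coef \<rho>_x mon_mult Q_simps(5))
  show ?thesis
  proof (intro equalityI subsetI)
    fix z assume "z \<in> right_ideal2 A ?c ?x"
    then obtain a b where ab: "a \<in> carrier A" "b \<in> carrier A" "z = ?c \<otimes>\<^bsub>A\<^esub> a \<oplus>\<^bsub>A\<^esub> ?x \<otimes>\<^bsub>A\<^esub> b"
      unfolding right_ideal2_def by blast
    have "?g * \<omega> m dvdR \<rho> z m" if m: "m \<le> 0" for m
    proof -
      have "\<sigma> 1 (\<omega> (m - 1)) dvdR \<sigma> 1 (\<rho> b (m - 1))" using AQ_dvd[OF \<rho>_AQ[OF ab(2)]] by (rule dvdR_\<sigma>)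
      moreover have "\<sigma> 1 (\<omega> (m - 1)) = of_poly f * \<omega> m" using \<sigma>_\<omega>_neg[of "m - 1"] m by simp
      ultimately have "?g * \<omega> m dvdR \<sigma> 1 (\<rho> b (m - 1))"
        using dvdR_trans[OF dvdR_mult_mono[OF root_factor_dvd[OF \<alpha>] dvdR_refl]] by simp
      moreover have "?g * \<omega> m dvdR ?g * \<rho> a m" using AQ_dvd[OF \<rho>_AQ[OF ab(1)]] by (simp add: dvdR_cancel)
      ultimately show ?thesis unfolding ab(3) val[OF ab(1,2)] by (rule dvdR_add[rotated])
    qed
    then show "z \<in> {a \<in> carrier A. \<forall>m\<in>{..0}. ?g * \<omega> m dvdR \<rho> a m}" using ab by simp
  next
    fix z assume "z \<in> {a \<in> carrier A. \<forall>m\<in>{..0}. ?g * \<omega> m dvdR \<rho> a m}"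
    then have z: "z \<in> carrier A" "\<And>m. m \<le> 0 \<Longrightarrow> ?g * \<omega> m dvdR \<rho> z m" by auto
    have fin: "finite {n. \<rho> z n \<noteq> 0}" by (rule AQ_finite[OF \<rho>_AQ[OF z(1)]])
    \<comment> \<open>The degrees m <= 0 are supplied by the root factor, the positive ones by x,
      whose inverse lowers the degree by one.\<close>
    let ?a = "\<lambda>m. if m \<le> 0 then \<rho> z m / ?g else 0"
    let ?b = "\<lambda>n. if n \<ge> 0 then \<sigma> (- 1) (\<rho> z (n + 1)) else 0"
    have a: "?a \<in> AQ"
    proof (rule AQ_I[OF fin])
      fix n show "\<omega> n dvdR ?a n"
      proof (cases "n \<le> 0")
        case True
        then obtain r where "r \<in> R" "\<rho> z n = ?g * \<omega> n * r" using z(2) by blast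
        then show ?thesis using True by (auto simp: mult.assoc)
      qed simp
    qed (auto split: if_splits)
    have b: "?b \<in> AQ"
    proof (rule AQ_I[of "(\<lambda>n. n - 1) ` {n. \<rho> z n \<noteq> 0}"])
      fix n show "\<omega> n dvdR ?b n"
      proof (cases "n \<ge> 0")
        case True
        then show ?thesis using AQ_dvd[OF \<rho>_AQ[OF z(1)], of "n + 1"] by (simp add: \<omega>_nonneg)
      qed simp
      assume "?b n \<noteq> 0"
      then have "\<rho> z (n + 1) \<noteq> 0" by (auto split: if_splits)
      then show "n \<in> (\<lambda>n. n - 1) ` {n. \<rho> z n \<noteq> 0}" by (intro image_eqI[of _ _ "n + 1"]) auto
    qed (use fin in simp)
    have "z = ?c \<otimes>\<^bsub>A\<^esub> el ?a \<oplus>\<^bsub>A\<^esub> ?x \<otimes>\<^bsub>A\<^esub> el ?b"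
    proof (rule \<rho>_eqI[OF z(1)])
      fix m show "\<rho> z m = \<rho> (?c \<otimes>\<^bsub>A\<^esub> el ?a \<oplus>\<^bsub>A\<^esub> ?x \<otimes>\<^bsub>A\<^esub> el ?b) m"
        unfolding val[OF el(1)[OF a] el(1)[OF b]] el(2)[OF a] el(2)[OF b] by simp
    qed (use el(1)[OF a] el(1)[OF b] in simp)
    then show "z \<in> right_ideal2 A ?c ?x" unfolding right_ideal2_def using el(1)[OF a] el(1)[OF b] by blast
  qed
qed

text \<open>Mirror image of \<open>right_ideal_minus\<close>: y \<open>A\<close> is all of
  \<open>A\<close> in negative degrees, and in degrees m >= 0 its coefficients are multiples of
  \<sigma>^(-1)(f).\<close>

lemma right_ideal_plus:
  assumes \<alpha>: "\<alpha> \<in> roots f"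
  shows "right_ideal2 A (gwa_coef T f (\<sigma> (- 1) (root_factor f \<alpha>))) (gwa_y T f) =
    {a \<in> carrier A. \<forall>m\<in>{0..}. \<sigma> (- 1) (root_factor f \<alpha>) * \<omega> m dvdR \<rho> a m}"
proof -
  let ?g = "\<sigma> (- 1) (root_factor f \<alpha>)"
  let ?c = "gwa_coef T f ?g" and ?y = "gwa_y T f"
  have val: "\<rho> (?c \<otimes>\<^bsub>A\<^esub> a \<oplus>\<^bsub>A\<^esub> ?y \<otimes>\<^bsub>A\<^esub> b) m = ?g * \<rho> a m + \<sigma> (- 1) (of_poly f) * \<sigma> (- 1) (\<rho> b (m + 1))"
    if "a \<in> carrier A" "b \<in> carrier A" for a b m
    using that by (simp add: \<rho>_add \<rho>_mult \<rho>_coef \<rho>_y mon_mult Q_simps(5))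
  show ?thesis
  proof (intro equalityI subsetI)
    fix z assume "z \<in> right_ideal2 A ?c ?y"
    then obtain a b where ab: "a \<in> carrier A" "b \<in> carrier A" "z = ?c \<otimes>\<^bsub>A\<^esub> a \<oplus>\<^bsub>A\<^esub> ?y \<otimes>\<^bsub>A\<^esub> b"
      unfolding right_ideal2_def by blast
    have "?g * \<omega> m dvdR \<rho> z m" if m: "m \<ge> 0" for m
    proof -
      have "\<rho> b (m + 1) \<in> R" "\<rho> a m \<in> R"
        using AQ_dvd[OF \<rho>_AQ[OF ab(2)], of "m + 1"] AQ_dvd[OF \<rho>_AQ[OF ab(1)], of m] m by (simp_all add: \<omega>_nonneg)
      then have "?g dvdR ?g * \<rho> a m + \<sigma> (- 1) (of_poly f) * \<sigma> (- 1) (\<rho> b (m + 1))"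
        using dvdR_mult[OF dvdR_\<sigma>[OF root_factor_dvd[OF \<alpha>]]] by (intro dvdR_add dvdR_mult[OF dvdR_refl]) auto
      then show ?thesis unfolding ab(3) val[OF ab(1,2)] using m by (simp add: \<omega>_nonneg)
    qed
    then show "z \<in> {a \<in> carrier A. \<forall>m\<in>{0..}. ?g * \<omega> m dvdR \<rho> a m}" using ab by simp
  next
    fix z assume "z \<in> {a \<in> carrier A. \<forall>m\<in>{0..}. ?g * \<omega> m dvdR \<rho> a m}"
    then have z: "z \<in> carrier A" "\<And>m. m \<ge> 0 \<Longrightarrow> ?g * \<omega> m dvdR \<rho> z m" by auto
    have fin: "finite {n. \<rho> z n \<noteq> 0}" by (rule AQ_finite[OF \<rho>_AQ[OF z(1)]])
    let ?a = "\<lambda>m. if m \<ge> 0 then \<rho> z m / ?g else 0"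
    let ?b = "\<lambda>n. if n \<le> 0 then \<sigma> 1 (\<rho> z (n - 1)) / of_poly f else 0"
    have a: "?a \<in> AQ"
    proof (rule AQ_I[OF fin])
      fix n show "\<omega> n dvdR ?a n"
      proof (cases "n \<ge> 0")
        case True
        then obtain r where "r \<in> R" "\<rho> z n = ?g * \<omega> n * r" using z(2) by blast
        then show ?thesis using True by (auto simp: mult.assoc)
      qed simp
    qed (auto split: if_splits)
    have b: "?b \<in> AQ"
    proof (rule AQ_I[of "(\<lambda>n. n + 1) ` {n. \<rho> z n \<noteq> 0}"])
      fix n show "\<omega> n dvdR ?b n"
      proof (cases "n \<le> 0")
        case True
        obtain r where r: "r \<in> R" "\<rho> z (n - 1) = \<omega> (n - 1) * r" using AQ_dvd[OF \<rho>_AQ[OF z(1)]] by blast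
        have "\<sigma> 1 (\<rho> z (n - 1)) = of_poly f * \<omega> n * \<sigma> 1 r"
          using True r \<omega>_Suc[OF True] by (simp add: \<sigma>_mult)
        then show ?thesis using True r by (auto simp: mult.assoc)
      qed simp
      assume "?b n \<noteq> 0"
      then have "\<rho> z (n - 1) \<noteq> 0" by (auto split: if_splits)
      then show "n \<in> (\<lambda>n. n + 1) ` {n. \<rho> z n \<noteq> 0}" by (intro image_eqI[of _ _ "n - 1"]) auto
    qed (use fin in simp)
    have "z = ?c \<otimes>\<^bsub>A\<^esub> el ?a \<oplus>\<^bsub>A\<^esub> ?y \<otimes>\<^bsub>A\<^esub> el ?b"
    proof (rule \<rho>_eqI[OF z(1)])
      fix m show "\<rho> z m = \<rho> (?c \<otimes>\<^bsub>A\<^esub> el ?a \<oplus>\<^bsub>A\<^esub> ?y \<otimes>\<^bsub>A\<^esub> el ?b) m"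
        unfolding val[OF el(1)[OF a] el(1)[OF b]] el(2)[OF a] el(2)[OF b] by (simp add: \<sigma>_divide)
    qed (use el(1)[OF a] el(1)[OF b] in simp)
    then show "z \<in> right_ideal2 A ?c ?y" unfolding right_ideal2_def using el(1)[OF a] el(1)[OF b] by blast
  qed
qed

lemma right_ideal2_mult:
  assumes "p \<in> carrier A" "q \<in> carrier A" "a \<in> right_ideal2 A p q" "b \<in> carrier A"
  shows "a \<otimes>\<^bsub>A\<^esub> b \<in> right_ideal2 A p q"
proof -
  obtain c d where cd: "c \<in> carrier A" "d \<in> carrier A" "a = p \<otimes>\<^bsub>A\<^esub> c \<oplus>\<^bsub>A\<^esub> q \<otimes>\<^bsub>A\<^esub> d"
    using assms(3) unfolding right_ideal2_def by blast
  have "a \<otimes>\<^bsub>A\<^esub> b = p \<otimes>\<^bsub>A\<^esub> (c \<otimes>\<^bsub>A\<^esub> b) \<oplus>\<^bsub>A\<^esub> q \<otimes>\<^bsub>A\<^esub> (d \<otimes>\<^bsub>A\<^esub> b)"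
    using assms cd by (simp add: A.l_distr A.m_assoc)
  then show ?thesis unfolding right_ideal2_def using assms cd by blast
qed

text \<open>Passing from degree i to n multiplies by \<sigma>^i of an element divisible by
  \<open>\<omega> (n - i)\<close>, which brings in all labels with -i < j <= -n. Together with the
  labels of degree i they include those required in degree n.\<close>

lemma proj_act:
  assumes D: "adm D" and q: "q \<in> proj h D" and a: "a \<in> carrier A" shows "q \<otimes>\<^bsub>Q\<^esub> \<rho> a \<in> proj h D"
proof -
  have "h * gprod (dn D n) dvdR q i * \<sigma> i (\<rho> a (n - i))" for n i
  proof -
    have "dn D n \<subseteq> dn D i \<union> roots f \<times> {-i<..-(n-i)-i}" using D by (auto simp: dn_def adm_def)
    then have "gprod (dn D n) dvdR gprod (dn D i \<union> roots f \<times> {-i<..-(n-i)-i})"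
      using finite_dn[OF D] by (intro gprod_subset_dvd) auto
    also have "gprod (dn D i \<union> roots f \<times> {-i<..-(n-i)-i}) = gprod (dn D i) * \<sigma> i (\<omega> (n - i))"
      unfolding \<sigma>_\<omega> by (rule gprod_union) (use finite_dn[OF D, of i] in \<open>auto simp: dn_def\<close>)
    finally have "h * gprod (dn D n) dvdR (h * gprod (dn D i)) * \<sigma> i (\<omega> (n - i))"
      using dvdR_mult_mono[OF dvdR_refl[of h]] by (simp add: mult.assoc)
    also have "\<dots> dvdR q i * \<sigma> i (\<rho> a (n - i))"
      using lat_dvd[OF q[unfolded proj_def], of i] dvdR_\<sigma>[OF AQ_dvd[OF \<rho>_AQ[OF a]]] by (rule dvdR_mult_mono)
    finally show ?thesis .
  qed
  then show ?thesis using Q_mult_closed[OF lat_carrier[OF q[unfolded proj_def]] AQ_carrier[OF \<rho>_AQ[OF a]]]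
    by (auto simp: proj_def lat_def Q_simps(2) intro!: dvdR_sum)
qed

lemma dn_split: "adm D \<Longrightarrow> gprod (dn D n) = gprod (dn D (n + 1)) * gprod {e \<in> D. snd e = - n}"
proof -
  assume D: "adm D"
  have "dn D n = dn D (n + 1) \<union> {e \<in> D. snd e = - n}" by (auto simp: dn_def)
  moreover have "finite {e \<in> D. snd e = - n}"
    by (rule finite_subset[OF _ finite_dn[OF D, of n]]) (auto simp: dn_def)
  moreover have "dn D (n + 1) \<inter> {e \<in> D. snd e = - n} = {}" by (auto simp: dn_def)
  ultimately show ?thesis using finite_dn[OF D] by (simp add: gprod_union)
qed

text \<open>The multiplier has to cancel \<open>h\<close> and to supply the labels j > s missing
  from \<open>D\<close>, because \<open>\<omega> (n + s)\<close> translated back has all labels with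
  s < j <= -n. What remains after dividing by it is a product of other labels; \<open>ne\<close>
  says that \<open>e\<close> is not among them, so it is comaximal with the factor of
  \<open>e\<close>.\<close>

lemma proj_surjection_exists:
  assumes D: "adm D" and h: "h \<noteq> 0"
    and \<gamma>: "\<gamma> \<in> R" "\<gamma> \<noteq> 0" and N: "N = {a \<in> carrier A. \<forall>m\<in>Rg. \<gamma> * \<omega> m dvdR \<rho> a m}"
    and N_mult: "\<And>a b. a \<in> N \<Longrightarrow> b \<in> carrier A \<Longrightarrow> a \<otimes>\<^bsub>A\<^esub> b \<in> N"
    and \<gamma>e: "\<sigma> (- s) \<gamma> = gfac e" and e: "e \<in> roots f \<times> UNIV"
    and ne: "\<And>n. n + s \<in> Rg \<Longrightarrow> e \<notin> dn D n" "snd e > s \<Longrightarrow> e \<in> D"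
  shows "\<exists>\<phi>\<in>graded_hom integer_group A (sub_Q T f (proj h D)) (shift (quotient_module (regular_module A) N) s).
    \<phi> ` proj h D = carrier (shift (quotient_module (regular_module A) N) s)"
proof -
  \<comment> \<open>Finite because \<open>D\<close> differs from \<open>D0\<close> in finitely many
    labels.\<close>
  define V where "V = {e \<in> roots f \<times> {s<..}. e \<notin> D}"
  have "V \<subseteq> sym_diff D D0 \<union> roots f \<times> {s<..0}" by (auto simp: V_def D0_def)
  then have V: "finite V" using D by (auto simp: adm_def intro: finite_subset)
  define t where "t = \<sigma> s (gprod V / h)"
  have main: "t * \<sigma> s (h * gprod (dn D n)) = \<omega> (n + s) * \<sigma> s (gprod (V \<union> dn D n - roots f \<times> {s<..-n}))" for n
  proof -
    have "t * \<sigma> s (h * gprod (dn D n)) = \<sigma> s (gprod V * gprod (dn D n))"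
      using h by (simp add: t_def \<sigma>_mult \<sigma>_divide)
    also have "gprod V * gprod (dn D n) = gprod (V \<union> dn D n)"
      by (rule gprod_union[symmetric]) (use V finite_dn[OF D, of n] D in \<open>auto simp: V_def dn_def adm_def\<close>)
    also have "\<dots> = gprod (roots f \<times> {s<..-n}) * gprod (V \<union> dn D n - roots f \<times> {s<..-n})"
      by (rule gprod_subset) (use V finite_dn[OF D, of n] D in \<open>auto simp: V_def dn_def adm_def\<close>)
    also have "gprod (roots f \<times> {s<..-n}) = \<sigma> (- s) (\<omega> (n + s))" by (simp add: \<sigma>_\<omega>)
    finally show ?thesis by (simp add: \<sigma>_mult)
  qed
  have sub: "V \<union> dn D n - roots f \<times> {s<..-n} \<subseteq> roots f \<times> UNIV" for n
    using D by (auto simp: V_def dn_def adm_def)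
  show ?thesis
    unfolding proj_def
  proof (rule surjection_exists[OF \<gamma> N N_mult refl])
    show "h * gprod (dn D n) \<noteq> 0" for n using h by simp
    show "q \<otimes>\<^bsub>Q\<^esub> \<rho> a \<in> lat (\<lambda>n. h * gprod (dn D n))" if "q \<in> lat (\<lambda>n. h * gprod (dn D n))" "a \<in> carrier A" for q a
      using proj_act[OF D, of q h a] that by (simp add: proj_def)
    show "\<omega> (n + s) dvdR t * \<sigma> s (h * gprod (dn D n))" for n unfolding main by (rule dvdRI[OF _ refl]) auto
    fix n assume n: "n + s \<in> Rg"
    have "e \<notin> V \<union> dn D n - roots f \<times> {s<..-n}" using ne(1)[OF n] ne(2) by (auto simp: V_def)
    from comax_\<sigma>[OF comax_gfac_gprod[OF sub e this], of s]
    have "comax \<gamma> (\<sigma> s (gprod (V \<union> dn D n - roots f \<times> {s<..-n})))" by (simp flip: \<gamma>e)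
    then show "comax \<gamma> (t * \<sigma> s (h * gprod (dn D n)) / \<omega> (n + s))" unfolding main by simp
  qed
qed

lemma shift_shift: "shift (shift M i) j = shift M (j + i)"
  by (simp add: shift_def algebra_simps)

text \<open>If the label is absent, the target is the minus module and degrees n <= -j acquire the
  factor: the label enters \<open>D\<close>. If it is present, the target is the plus module and
  degrees n > -j acquire the factor; then all degrees have it, so it moves from \<open>D\<close>
  into \<open>h\<close>. The definite description in \<open>iota\<close> also requires that the
  other target be impossible.\<close>

lemma iota_proj:
  assumes D: "adm D" and h: "h \<noteq> 0" and \<alpha>: "\<alpha> \<in> roots f"
  shows "iota T f \<alpha> j (proj h D) =
    proj (h * (if (\<alpha>, j) \<in> D then gfac (\<alpha>, j) else 1)) (sym_diff D {(\<alpha>, j)})"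
proof -
  let ?e = "(\<alpha>, j)" and ?d = "\<lambda>n. h * gprod (dn D n)"
  have e: "?e \<in> roots f \<times> UNIV" using \<alpha> by simp
  have d0: "?d n \<noteq> 0" for n using h by simp
  define Nm where "Nm = right_ideal2 A (gwa_coef T f (root_factor f \<alpha>)) (gwa_x T f)"
  define Np where "Np = right_ideal2 A (gwa_coef T f (\<sigma> (- 1) (root_factor f \<alpha>))) (gwa_y T f)"
  let ?Mm = "shift (quotient_module (regular_module A) Nm) j"
  \<comment> \<open>The offset comes from the shift by -1 built into \<open>M_plus\<close>.\<close>
  let ?Mp = "shift (quotient_module (regular_module A) Np) (j - 1)"
  have Mm: "shift (M_minus T f \<alpha>) j = ?Mm" by (simp add: M_minus_def Nm_def)
  have Mp: "shift (M_plus T f \<alpha>) j = ?Mp" by (simp add: M_plus_def Np_def shift_shift)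
  have Nm: "Nm = {a \<in> carrier A. \<forall>m\<in>{..0}. root_factor f \<alpha> * \<omega> m dvdR \<rho> a m}"
    unfolding Nm_def by (rule right_ideal_minus[OF \<alpha>])
  have Np: "Np = {a \<in> carrier A. \<forall>m\<in>{0..}. \<sigma> (- 1) (root_factor f \<alpha>) * \<omega> m dvdR \<rho> a m}"
    unfolding Np_def by (rule right_ideal_plus[OF \<alpha>])
  have Nm_mult: "a \<otimes>\<^bsub>A\<^esub> b \<in> Nm" if "a \<in> Nm" "b \<in> carrier A" for a b
    using that unfolding Nm_def by (intro right_ideal2_mult) auto
  have Np_mult: "a \<otimes>\<^bsub>A\<^esub> b \<in> Np" if "a \<in> Np" "b \<in> carrier A" for a b
    using that unfolding Np_def by (intro right_ideal2_mult) auto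
  have gm: "\<sigma> (- j) (root_factor f \<alpha>) = gfac ?e" by (simp add: gfac_def)
  have gp: "\<sigma> (- (j - 1)) (\<sigma> (- 1) (root_factor f \<alpha>)) = gfac ?e" by (simp add: gfac_def)
  have \<gamma>p: "\<sigma> (- 1) (root_factor f \<alpha>) \<in> R" "\<sigma> (- 1) (root_factor f \<alpha>) \<noteq> 0" by auto
  define Km where "Km = {p \<in> proj h D. \<forall>n. n + j \<in> {..0} \<longrightarrow> gfac ?e * ?d n dvdR p n}"
  define Kp where "Kp = {p \<in> proj h D. \<forall>n. n + (j - 1) \<in> {0..} \<longrightarrow> gfac ?e * ?d n dvdR p n}"
  have kerm: "{p \<in> proj h D. \<phi> p = \<zero>\<^bsub>?Mm\<^esub>} = Km"
    if "\<phi> \<in> graded_hom integer_group A (sub_Q T f (proj h D)) ?Mm" "\<phi> ` proj h D = carrier ?Mm" for \<phi>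
    unfolding Km_def proj_def gm[symmetric]
    by (rule surjection_kernel[OF root_factor_R root_factor_nonzero Nm Nm_mult refl d0]) (use that in \<open>simp_all add: proj_def\<close>)
  have kerp: "{p \<in> proj h D. \<phi> p = \<zero>\<^bsub>?Mp\<^esub>} = Kp"
    if "\<phi> \<in> graded_hom integer_group A (sub_Q T f (proj h D)) ?Mp" "\<phi> ` proj h D = carrier ?Mp" for \<phi>
    unfolding Kp_def proj_def gp[symmetric]
    by (rule surjection_kernel[OF \<gamma>p Np Np_mult refl d0]) (use that in \<open>simp_all add: proj_def\<close>)
  have actm: "act ?Mm \<zero>\<^bsub>?Mm\<^esub> a = \<zero>\<^bsub>?Mm\<^esub>" if "a \<in> carrier A" for a
    using Mq_act[OF root_factor_R root_factor_nonzero Nm Nm_mult refl[of ?Mm] A.zero_closed that]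
      N_qc[OF root_factor_R root_factor_nonzero Nm Nm_mult refl[of ?Mm]]
      Mq_simps(2)[OF root_factor_R root_factor_nonzero Nm Nm_mult refl[of ?Mm]] that by simp
  have actp: "act ?Mp \<zero>\<^bsub>?Mp\<^esub> a = \<zero>\<^bsub>?Mp\<^esub>" if "a \<in> carrier A" for a
    using Mq_act[OF \<gamma>p Np Np_mult refl[of ?Mp] A.zero_closed that]
      N_qc[OF \<gamma>p Np Np_mult refl[of ?Mp]]
      Mq_simps(2)[OF \<gamma>p Np Np_mult refl[of ?Mp]] that by simp
  have ker_act: "p \<otimes>\<^bsub>Q\<^esub> \<rho> a \<in> {p \<in> proj h D. \<phi> p = \<zero>\<^bsub>M\<^esub>}"
    if \<phi>: "\<phi> \<in> graded_hom integer_group A (sub_Q T f (proj h D)) M" and p: "p \<in> {p \<in> proj h D. \<phi> p = \<zero>\<^bsub>M\<^esub>}"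
      and a: "a \<in> carrier A" and z: "act M \<zero>\<^bsub>M\<^esub> a = \<zero>\<^bsub>M\<^esub>"
    for \<phi> p a and M :: "('k gwa_elem set, int, 'k gwa_elem) graded_module"
    using graded_homD(3)[OF \<phi>, of p a] p a z proj_act[OF D, of p h a] by (simp add: sub_Q_def)
  let ?S = "{e' \<in> D. snd e' = j}"
  have dd: "?d (- j) = ?d (1 - j) * gprod ?S" using dn_split[OF D, of "- j"] by (simp add: mult.assoc)
  have S2: "?S \<subseteq> roots f \<times> {j}" using D by (auto simp: adm_def)
  have S: "finite ?S" "?S \<subseteq> roots f \<times> {j}" using S2 finite_subset[OF S2] by auto
  \<comment> \<open>The kernel would contain the generator of degree 1 - j, where no condition is
    imposed. Multiplying it by y lands in degree -j; the label is present there only once, so the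
    required extra factor is missing.\<close>
  have no_m: "?e \<notin> D" if \<phi>: "\<phi> \<in> graded_hom integer_group A (sub_Q T f (proj h D)) ?Mm" "\<phi> ` proj h D = carrier ?Mm" for \<phi>
  proof
    assume eD: "?e \<in> D"
    let ?p = "mon (?d (1 - j)) (1 - j)"
    have "?p \<in> Km" by (auto simp: Km_def proj_def mon_apply intro!: mon_lat)
    then have "?p \<otimes>\<^bsub>Q\<^esub> \<rho> (gwa_y T f) \<in> Km"
      using ker_act[OF \<phi>(1) _ _ actm, of ?p "gwa_y T f"] kerm[OF \<phi>] by simp
    then have "gfac ?e * ?d (- j) dvdR (?p \<otimes>\<^bsub>Q\<^esub> \<rho> (gwa_y T f)) (- j)" by (auto simp: Km_def)
    then have "gfac ?e * ?d (- j) dvdR ?d (1 - j) * \<sigma> (- j) (of_poly f)"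
      by (simp add: \<rho>_y mon_mon mon_apply)
    also have "\<sigma> (- j) (of_poly f) = gprod ?S * gprod (roots f \<times> {j} - ?S)"
      using gprod_subset[OF _ S(2)] by (simp add: \<sigma>_f)
    finally have "?d (1 - j) * gprod ?S * gfac ?e dvdR ?d (1 - j) * gprod ?S * gprod (roots f \<times> {j} - ?S)"
      by (simp only: dd mult_ac)
    then have "gfac ?e dvdR gprod (roots f \<times> {j} - ?S)" using h by (subst (asm) dvdR_cancel) auto
    moreover have "\<not> gfac ?e dvdR gprod (roots f \<times> {j} - ?S)"
      by (rule gfac_not_dvd_gprod) (use \<alpha> eD in auto)
    ultimately show False by simp
  qed
  \<comment> \<open>Dually, the generator of degree -j would lie in the kernel, and multiplication
    by x carries it to degree 1 - j, where the absent label cannot provide the required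
    factor.\<close>
  have no_p: "?e \<in> D" if \<phi>: "\<phi> \<in> graded_hom integer_group A (sub_Q T f (proj h D)) ?Mp" "\<phi> ` proj h D = carrier ?Mp" for \<phi>
  proof (rule ccontr)
    assume eD: "?e \<notin> D"
    let ?p = "mon (?d (- j)) (- j)"
    have "?p \<in> Kp" by (auto simp: Kp_def proj_def mon_apply intro!: mon_lat)
    then have "?p \<otimes>\<^bsub>Q\<^esub> \<rho> (gwa_x T f) \<in> Kp"
      using ker_act[OF \<phi>(1) _ _ actp, of ?p "gwa_x T f"] kerp[OF \<phi>] by simp
    then have "gfac ?e * ?d (1 - j) dvdR (?p \<otimes>\<^bsub>Q\<^esub> \<rho> (gwa_x T f)) (1 - j)" by (auto simp: Kp_def)
    then have "gfac ?e * ?d (1 - j) dvdR ?d (- j)" by (simp add: \<rho>_x mon_mon mon_apply)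
    then have "?d (1 - j) * gfac ?e dvdR ?d (1 - j) * gprod ?S" by (simp only: dd mult_ac)
    then have "gfac ?e dvdR gprod ?S" using h by (subst (asm) dvdR_cancel) auto
    moreover have "\<not> gfac ?e dvdR gprod ?S"
      by (rule gfac_not_dvd_gprod) (use \<alpha> eD S in auto)
    ultimately show False by simp
  qed
  have lat_eq: "{p \<in> proj h D. \<forall>n. n \<in> Sn \<longrightarrow> gfac ?e * ?d n dvdR p n} = lat d'"
    if d': "\<And>n. d' n = (if n \<in> Sn then gfac ?e * ?d n else ?d n)" for d' :: "int \<Rightarrow> 'k ratfun" and Sn
  proof -
    have "?d n dvdR c" if "gfac ?e * ?d n dvdR c" for n c
      using that dvdR_trans[OF dvdRI[OF gfac_R, of "gfac ?e * ?d n" "?d n" ?e]] by (simp add: mult.commute)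
    then show ?thesis unfolding proj_def lat_def d' by auto
  qed
  have dn_e: "gprod (dn D n) = (if j \<le> - n then gfac ?e else 1) * gprod (dn (D - {?e}) n)" if "?e \<in> D" for n
  proof (cases "j \<le> - n")
    case True
    then have "dn D n = insert ?e (dn (D - {?e}) n)" using that by (auto simp: dn_def)
    moreover have "finite (dn (D - {?e}) n)" by (rule finite_subset[OF _ finite_dn[OF D, of n]]) (auto simp: dn_def)
    moreover have "?e \<notin> dn (D - {?e}) n" by (simp add: dn_def)
    ultimately show ?thesis using True by (simp add: gprod_def)
  next
    case False
    then have "dn D n = dn (D - {?e}) n" by (auto simp: dn_def)
    then show ?thesis using False by simp
  qed
  define res where "res = proj (h * (if ?e \<in> D then gfac ?e else 1)) (sym_diff D {?e})"
  have Km_res: "Km = res" if eD: "?e \<notin> D"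
  proof -
    have sd: "sym_diff D {?e} = insert ?e D" using eD by auto
    have "gprod (dn (insert ?e D) n) = (if j \<le> - n then gfac ?e else 1) * gprod (dn D n)" for n
    proof (cases "j \<le> - n")
      case True
      then have "dn (insert ?e D) n = insert ?e (dn D n)" by (auto simp: dn_def)
      moreover have "?e \<notin> dn D n" using eD by (simp add: dn_def)
      ultimately show ?thesis using True finite_dn[OF D, of n] by (simp add: gprod_def)
    next
      case False
      then have "dn (insert ?e D) n = dn D n" by (auto simp: dn_def)
      then show ?thesis using False by simp
    qed
    then have "h * gprod (dn (insert ?e D) n) = (if n \<in> {n. n + j \<in> {..0}} then gfac ?e * ?d n else ?d n)" for n
      by simp
    from lat_eq[of "\<lambda>n. h * gprod (dn (insert ?e D) n)" "{n. n + j \<in> {..0}}", OF this] show ?thesis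
      using eD unfolding Km_def res_def sd by (simp add: proj_def[of h "insert ?e D"])
  qed
  have Kp_res: "Kp = res" if eD: "?e \<in> D"
  proof -
    have sd: "sym_diff D {?e} = D - {?e}" using eD by auto
    have "h * gfac ?e * gprod (dn (D - {?e}) n) = (if n \<in> {n. n + (j - 1) \<in> {0..}} then gfac ?e * ?d n else ?d n)" for n
      by (simp add: dn_e[OF eD])
    from lat_eq[of "\<lambda>n. h * gfac ?e * gprod (dn (D - {?e}) n)" "{n. n + (j - 1) \<in> {0..}}", OF this] show ?thesis
      using eD unfolding Kp_def res_def sd by (simp add: proj_def[of "h * gfac ?e" "D - {?e}"])
  qed
  have ex: "\<exists>M\<in>{?Mm, ?Mp}. \<exists>\<phi>\<in>graded_hom integer_group A (sub_Q T f (proj h D)) M. \<phi> ` proj h D = carrier M \<and> res = {p \<in> proj h D. \<phi> p = \<zero>\<^bsub>M\<^esub>}"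
  proof (cases "?e \<in> D")
    case False
    obtain \<phi> where "\<phi> \<in> graded_hom integer_group A (sub_Q T f (proj h D)) ?Mm" "\<phi> ` proj h D = carrier ?Mm"
      using proj_surjection_exists[OF D h root_factor_R root_factor_nonzero Nm Nm_mult gm e] False by (auto simp: dn_def)
    then show ?thesis using kerm Km_res[OF False] by blast
  next
    case True
    obtain \<phi> where "\<phi> \<in> graded_hom integer_group A (sub_Q T f (proj h D)) ?Mp" "\<phi> ` proj h D = carrier ?Mp"
      using proj_surjection_exists[OF D h \<gamma>p Np Np_mult gp e] True by (auto simp: dn_def)
    then show ?thesis using kerp Kp_res[OF True] by blast
  qed
  have "iota T f \<alpha> j (proj h D) = res"
    unfolding iota_def Mm Mp
  proof (rule the_equality, rule ex)
    fix K assume "\<exists>M\<in>{?Mm, ?Mp}. \<exists>\<phi>\<in>graded_hom integer_group A (sub_Q T f (proj h D)) M. \<phi> ` proj h D = carrier M \<and> K = {p \<in> proj h D. \<phi> p = \<zero>\<^bsub>M\<^esub>}"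
    then obtain M \<phi> where M: "M = ?Mm \<or> M = ?Mp" and \<phi>: "\<phi> \<in> graded_hom integer_group A (sub_Q T f (proj h D)) M"
      "\<phi> ` proj h D = carrier M" and K: "K = {p \<in> proj h D. \<phi> p = \<zero>\<^bsub>M\<^esub>}" by blast
    show "K = res"
      using M
    proof
      assume "M = ?Mm"
      then show ?thesis using \<phi> K kerm[of \<phi>] no_m[of \<phi>] Km_res by simp
    next
      assume "M = ?Mp"
      then show ?thesis using \<phi> K kerp[of \<phi>] no_p[of \<phi>] Kp_res by simp
    qed
  qed
  then show ?thesis unfolding res_def .
qed

definition Epairs :: "('k \<Rightarrow> int set) \<Rightarrow> ('k \<times> int) set" where "Epairs J = (SIGMA \<alpha>:roots f. J \<alpha>)"

lemma Epairs_roots: "Epairs J \<subseteq> roots f \<times> UNIV" by (auto simp: Epairs_def)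

text \<open>Commutation of the operators is known on lattices \<open>proj h D\<close> only, while
  the fold ranges over all sets. The fold graph is therefore followed directly: whatever the order
  of insertion, the toggles give the same lattice.\<close>

lemma iotas_proj:
  assumes D: "adm D" and h: "h \<noteq> 0" and J: "finite (Epairs J)"
  shows "iotas T f J (proj h D) = proj (h * gprod (Epairs J \<inter> D)) (sym_diff D (Epairs J))"
proof -
  let ?g = "\<lambda>(\<alpha>, j) K. iota T f \<alpha> j K"
  have fg: "y = proj (h * gprod (S \<inter> D)) (sym_diff D S)"
    if "fold_graph ?g (proj h D) S y" "S \<subseteq> roots f \<times> UNIV" for S y
    using that
  proof (induction rule: fold_graph.induct)
    case emptyI
    then show ?case by simp
  next
    case (insertI x S y)
    obtain \<alpha> j where x: "x = (\<alpha>, j)" by (cases x)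
    have \<alpha>: "\<alpha> \<in> roots f" using insertI x by simp
    have fin: "finite S" using insertI(2) by induct simp_all
    have sd: "sym_diff (sym_diff D S) {x} = sym_diff D (insert x S)" using insertI(1) by auto
    have "gprod (insert x S \<inter> D) = gprod (S \<inter> D) * (if x \<in> sym_diff D S then gfac x else 1)"
      using insertI(1) fin by (auto simp: gprod_def Int_insert_left)
    moreover have "adm (sym_diff D S)" using adm_sym_diff[OF D _ fin] insertI by auto
    moreover have "y = proj (h * gprod (S \<inter> D)) (sym_diff D S)" using insertI by auto
    ultimately show ?case
      using iota_proj[of "sym_diff D S" "h * gprod (S \<inter> D)" \<alpha> j] h \<alpha> sd x by (simp add: mult.assoc)
  qed
  obtain y where y: "fold_graph ?g (proj h D) (Epairs J) y"
    using finite_imp_fold_graph[OF J, of ?g "proj h D"] by (rule exE)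
  have "iotas T f J (proj h D) = (THE y. fold_graph ?g (proj h D) (Epairs J) y)"
    using J by (simp add: iotas_def Finite_Set.fold_def Epairs_def)
  also have "\<dots> = y" by (rule the_equality, rule y) (simp only: fg[OF y Epairs_roots] fg[OF _ Epairs_roots])
  finally show ?thesis using fg[OF y Epairs_roots] by simp
qed

lemma h_elem_gprod: "(\<And>\<alpha>. \<alpha> \<in> roots f \<Longrightarrow> finite (J \<alpha>)) \<Longrightarrow> h_elem T f J = gprod (Epairs J)"
  unfolding h_elem_def gprod_def Epairs_def
  by (subst prod.Sigma) (auto simp: gfac_def intro!: prod.cong)

end

section \<open>The graded ring \<open>B\<close>\<close>

lemma group_Zfin: "group Zfin"
  by (rule groupI) (auto simp: Zfin_def intro: exI[of _ "_ :: int set"])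

context gwa_setting
begin

interpretation Q: ring Q by (rule ring_Q)
interpretation A: ring A by (rule ring_A)

abbreviation "\<Gamma> \<equiv> Gamma f"

lemma Gamma_carrier: "carrier \<Gamma> = (\<Pi>\<^sub>E \<alpha>\<in>roots f. {S. finite S})"
proof -
  have "carrier (sum_group (roots f) (\<lambda>_. Zfin)) =
      {x \<in> \<Pi>\<^sub>E i\<in>roots f. carrier Zfin. finite {i \<in> roots f. x i \<noteq> \<one>\<^bsub>Zfin\<^esub>}}"
    by (rule carrier_sum_group) (rule group_Zfin)
  then show ?thesis unfolding Gamma_def using finite_roots by (auto simp: Zfin_def)
qed

lemma Gamma_mult: "I \<otimes>\<^bsub>\<Gamma>\<^esub> J = (\<lambda>\<alpha>\<in>roots f. sym_diff (I \<alpha>) (J \<alpha>))"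
  by (simp add: Gamma_def Zfin_def)

lemma Gamma_one: "\<one>\<^bsub>\<Gamma>\<^esub> = (\<lambda>\<alpha>\<in>roots f. {})"
  by (simp add: Gamma_def Zfin_def)

lemma group_Gamma: "group \<Gamma>" unfolding Gamma_def by (rule sum_group) (rule group_Zfin)

interpretation G: group \<Gamma> by (rule group_Gamma)

lemma Gamma_eqI: "I \<in> carrier \<Gamma> \<Longrightarrow> J \<in> carrier \<Gamma> \<Longrightarrow> Epairs I = Epairs J \<Longrightarrow> I = J"
  by (rule PiE_ext[of I "roots f" "\<lambda>_. {S. finite S}"]) (auto simp: Gamma_carrier Epairs_def set_eq_iff)

lemma Epairs_mult: "Epairs (I \<otimes>\<^bsub>\<Gamma>\<^esub> J) = sym_diff (Epairs I) (Epairs J)"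
  and Epairs_one [simp]: "Epairs \<one>\<^bsub>\<Gamma>\<^esub> = {}"
  and Epairs_inter: "Epairs (Gamma_inter f I J) = Epairs I \<inter> Epairs J"
  by (auto simp: Epairs_def Gamma_mult Gamma_one Gamma_inter_def)

lemma Epairs_finite [simp]: "J \<in> carrier \<Gamma> \<Longrightarrow> finite (Epairs J)"
  by (auto simp: Epairs_def Gamma_carrier)

lemma Gamma_comm: "I \<in> carrier \<Gamma> \<Longrightarrow> J \<in> carrier \<Gamma> \<Longrightarrow> I \<otimes>\<^bsub>\<Gamma>\<^esub> J = J \<otimes>\<^bsub>\<Gamma>\<^esub> I"
  by (rule Gamma_eqI) (auto simp: Epairs_mult)

lemma Gamma_cancel [simp]: "I \<in> carrier \<Gamma> \<Longrightarrow> J \<in> carrier \<Gamma> \<Longrightarrow> I \<otimes>\<^bsub>\<Gamma>\<^esub> (I \<otimes>\<^bsub>\<Gamma>\<^esub> J) = J"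
  "I \<in> carrier \<Gamma> \<Longrightarrow> J \<in> carrier \<Gamma> \<Longrightarrow> (I \<otimes>\<^bsub>\<Gamma>\<^esub> J) \<otimes>\<^bsub>\<Gamma>\<^esub> J = I"
  by (rule Gamma_eqI; auto simp: Epairs_mult)+

lemma Gamma_inv [simp]: "J \<in> carrier \<Gamma> \<Longrightarrow> inv\<^bsub>\<Gamma>\<^esub> J = J"
  by (rule G.inv_equality) (auto intro!: Gamma_eqI simp: Epairs_mult)

lemma countable_Gamma: "countable (carrier \<Gamma>)"
proof (rule countable_image_inj_on)
  show "inj_on Epairs (carrier \<Gamma>)" by (rule inj_onI) (rule Gamma_eqI)
  have "Epairs ` carrier \<Gamma> \<subseteq> Fpow (roots f \<times> UNIV)" using Epairs_roots by (auto simp: Fpow_def)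
  then show "countable (Epairs ` carrier \<Gamma>)"
    by (rule countable_subset) (intro countable_Fpow countable_SIGMA, auto intro: countable_finite)
qed

lemma AQ_one [simp]: "mon 1 0 \<in> AQ" by (rule mon_AQ) (simp add: \<omega>_nonneg)

section \<open>Homogeneous elements of B as left multiplications\<close>

definition lm :: "'k ratfun \<Rightarrow> 'k skew \<Rightarrow> 'k skew" where "lm c = (\<lambda>q\<in>AQ. mon c 0 \<otimes>\<^bsub>Q\<^esub> q)"

lemma lm_apply: "q \<in> AQ \<Longrightarrow> lm c q = (\<lambda>n. c * q n)" by (simp add: lm_def mon_mult)

definition cv :: "('k skew \<Rightarrow> 'k skew) \<Rightarrow> 'k ratfun" where "cv \<phi> = \<phi> (mon 1 0) 0"

lemma cv_lm [simp]: "cv (lm c) = c" by (simp add: cv_def lm_apply mon_apply)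

abbreviation "AJ J \<equiv> iotas T f J AQ"

lemma AJ_proj: "J \<in> carrier \<Gamma> \<Longrightarrow> AJ J = proj (gprod (Epairs J \<inter> D0)) (sym_diff D0 (Epairs J))"
  using iotas_proj[OF adm_D0, of 1 J] by (simp add: AQ_proj)

lemma adm_AJ [simp]: "J \<in> carrier \<Gamma> \<Longrightarrow> adm (sym_diff D0 (Epairs J))"
  by (rule adm_sym_diff[OF adm_D0 Epairs_roots]) simp

lemma finite_dn_D0 [simp]: "finite (dn D0 n)" by (rule finite_dn[OF adm_D0])

lemma proj_mono: "(\<And>n. h' * gprod (dn D' n) dvdR h * gprod (dn D n)) \<Longrightarrow> proj h D \<subseteq> proj h' D'"
  unfolding proj_def lat_def by (auto intro: dvdR_trans)

lemma dn_iff: "e \<in> dn D n \<longleftrightarrow> e \<in> D \<and> snd e \<le> - n"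
  by (simp add: dn_def)

lemma AJ_dvd:
  assumes J: "J \<in> carrier \<Gamma>"
  shows "gprod (dn D0 n) dvdR gprod (Epairs J \<inter> D0) * gprod (dn (sym_diff D0 (Epairs J)) n)"
proof -
  have "gprod (dn D0 n) * gprod {} * gprod {} dvdR
      gprod (Epairs J \<inter> D0) * gprod (dn (sym_diff D0 (Epairs J)) n) * gprod {}"
    by (rule gprod_dvd3) (use J finite_dn[OF adm_AJ[OF J], of n] in \<open>auto simp: dn_iff\<close>)
  then show ?thesis by simp
qed

lemma AJ_AQ: assumes J: "J \<in> carrier \<Gamma>" shows "AJ J \<subseteq> AQ"
proof -
  have "proj (gprod (Epairs J \<inter> D0)) (sym_diff D0 (Epairs J)) \<subseteq> proj 1 D0"
    by (rule proj_mono) (simp add: AJ_dvd[OF J])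
  then show ?thesis by (metis AJ_proj[OF J] AQ_proj)
qed

lemma B_hom_eq: "B_hom T f J = graded_hom integer_group A (sub_Q T f AQ) (sub_Q T f (AJ J))"
  by (simp add: B_hom_def A_in_Q_eq)

lemma lm_AJ:
  assumes J: "J \<in> carrier \<Gamma>" and c: "gprod (Epairs J) dvdR c" and q: "q \<in> AQ"
  shows "lm c q \<in> AJ J"
proof -
  have "gprod (Epairs J \<inter> D0) * gprod (dn (sym_diff D0 (Epairs J)) n) dvdR gprod (Epairs J) * gprod (dn D0 n)" for n
  proof -
    have "gprod (Epairs J \<inter> D0) * gprod (dn (sym_diff D0 (Epairs J)) n) * gprod {} dvdR
        gprod (Epairs J) * gprod (dn D0 n) * gprod {}"
      by (rule gprod_dvd3) (use J finite_dn[OF adm_AJ[OF J], of n] in \<open>auto simp: dn_iff\<close>)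
    then show ?thesis by simp
  qed
  moreover have "gprod (Epairs J) * gprod (dn D0 n) dvdR c * q n" for n
    using q lat_dvd[of q "\<lambda>n. 1 * gprod (dn D0 n)" n] by (intro dvdR_mult_mono[OF c]) (simp add: AQ_proj proj_def)
  ultimately have "gprod (Epairs J \<inter> D0) * gprod (dn (sym_diff D0 (Epairs J)) n) dvdR c * q n" for n
    using dvdR_trans by blast
  moreover have "mon c 0 \<otimes>\<^bsub>Q\<^esub> q \<in> carrier Q" using q AQ_carrier by (intro Q_mult_closed) auto
  ultimately show ?thesis using q by (simp add: AJ_proj[OF J] proj_def lat_def lm_def mon_mult)
qed

lemma lm_hom:
  assumes J: "J \<in> carrier \<Gamma>" and c: "gprod (Epairs J) dvdR c" shows "lm c \<in> B_hom T f J"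
proof -
  have "q \<otimes>\<^bsub>Q\<^esub> \<rho> a \<in> AQ" if "q \<in> AQ" "a \<in> carrier A" for q a
    using proj_act[OF adm_D0, of q 1 a] that by (simp add: AQ_proj)
  then show ?thesis unfolding B_hom_eq graded_hom_def sub_Q_def
    using lm_AJ[OF J c] AQ_add
    by (auto simp: lm_apply Q_simps(5) distrib_left lm_def[of c] Q.m_assoc AQ_carrier simp flip: Q_simps(5))
      (auto simp: mon_mult Q_simps(5) distrib_left)
qed

text \<open>\<open>A\<close> is generated by 1, which has degree 0, so a degree-0 homomorphism is
  left multiplication by its value there. That value lies in the degree 0 part of
  \<open>AJ J\<close>, which is generated by \<open>gprod (Epairs J)\<close>.\<close>

lemma hom_lm:
  assumes J: "J \<in> carrier \<Gamma>" and \<phi>: "\<phi> \<in> B_hom T f J"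
  shows "gprod (Epairs J) dvdR cv \<phi>" "\<phi> = lm (cv \<phi>)"
proof -
  note D = graded_homD[OF \<phi>[unfolded B_hom_eq], unfolded sub_Q_def, simplified]
  have 1: "\<phi> (mon 1 0) \<in> AJ J" "\<And>n. n \<noteq> 0 \<Longrightarrow> \<phi> (mon 1 0) n = 0"
    using D(4)[of "mon 1 0" 0] by (auto simp: mon_apply)
  then have \<phi>1: "\<phi> (mon 1 0) = mon (cv \<phi>) 0" by (auto simp: cv_def mon_apply)
  have "gprod (Epairs J \<inter> D0) * gprod (dn (sym_diff D0 (Epairs J)) 0) dvdR cv \<phi>"
    using 1(1) lat_dvd[of "\<phi> (mon 1 0)" _ 0] unfolding AJ_proj[OF J] proj_def cv_def by blast
  \<comment> \<open>Labels of \<open>D0\<close> have j > 0 and do not contribute in degree 0; those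
    that \<open>J\<close> removes from \<open>D0\<close> have moved into the global factor
    instead.\<close>
  moreover have "dn (sym_diff D0 (Epairs J)) 0 = Epairs J - D0"
    using Epairs_roots[of J] by (auto simp: dn_def D0_def)
  moreover have "gprod (Epairs J) = gprod (Epairs J \<inter> D0) * gprod (Epairs J - D0)"
    using gprod_subset[of "Epairs J" "Epairs J \<inter> D0"] J by (simp add: Diff_Int_distrib Diff_Int)
  ultimately show "gprod (Epairs J) dvdR cv \<phi>" by simp
  have "\<phi> q = lm (cv \<phi>) q" if q: "q \<in> AQ" for q
  proof -
    have "\<phi> (mon 1 0 \<otimes>\<^bsub>Q\<^esub> \<rho> (el q)) = \<phi> (mon 1 0) \<otimes>\<^bsub>Q\<^esub> \<rho> (el q)" by (rule D(3)) (use q in auto)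
    then show ?thesis using q \<phi>1 AQ_carrier[OF q] by (simp add: lm_def flip: Q_one_mon)
  qed
  then show "\<phi> = lm (cv \<phi>)" using D(5) by (auto simp: fun_eq_iff lm_def PiE_iff extensional_def)
qed

text \<open>The element \<open>h_elem\<close> of the intersection, by whose inverse
  \<open>tau\<close> multiplies; it is the 2-cocycle twisting the product of
  \<open>B\<close>.\<close>

definition \<kappa> where "\<kappa> I J = gprod (Epairs I \<inter> Epairs J)"

lemma \<kappa>_nonzero [simp]: "\<kappa> I J \<noteq> 0" by (simp add: \<kappa>_def)

lemma B_times_dvd:
  assumes I: "I \<in> carrier \<Gamma>" "J \<in> carrier \<Gamma>" and a: "gprod (Epairs I) dvdR a" and b: "gprod (Epairs J) dvdR b"
  shows "gprod (Epairs (I \<otimes>\<^bsub>\<Gamma>\<^esub> J)) dvdR a * b / \<kappa> I J"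
proof -
  have "\<kappa> I J * gprod (Epairs (I \<otimes>\<^bsub>\<Gamma>\<^esub> J)) dvdR gprod (Epairs I) * gprod (Epairs J)"
    using gprod_dvd3[of "Epairs I \<inter> Epairs J" "Epairs (I \<otimes>\<^bsub>\<Gamma>\<^esub> J)" "{}" "Epairs I" "Epairs J" "{}"] I
    by (auto simp: \<kappa>_def Epairs_mult)
  also have "\<dots> dvdR a * b" by (rule dvdR_mult_mono[OF a b])
  finally have "\<kappa> I J * gprod (Epairs (I \<otimes>\<^bsub>\<Gamma>\<^esub> J)) dvdR \<kappa> I J * (a * b / \<kappa> I J)" by simp
  then show ?thesis by (subst (asm) dvdR_cancel) auto
qed

text \<open>All maps in the product act as left multiplications, so the formula is clear once their
  domains match. As every map is extensional, the values of each one must lie in the domain of the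
  next, in particular in that of the restricted \<open>tau\<close>.\<close>

lemma B_times_lm:
  assumes I: "I \<in> carrier \<Gamma>" "J \<in> carrier \<Gamma>" and a: "gprod (Epairs I) dvdR a" and b: "gprod (Epairs J) dvdR b"
  shows "B_times T f I J (lm a) (lm b) = lm (a * b / \<kappa> I J)"
proof -
  let ?N = "Gamma_inter f I J"
  let ?EN = "Epairs I \<inter> Epairs J"
  have N: "?N \<in> carrier \<Gamma>" using I by (auto simp: Gamma_carrier Gamma_inter_def)
  have IJ: "I \<otimes>\<^bsub>\<Gamma>\<^esub> J \<in> carrier \<Gamma>" using I by simp
  have sd: "sym_diff (sym_diff D0 ?EN) ?EN = D0" by auto
  have fin: "finite ?EN" using I by simp
  have EN: "?EN \<inter> D0 \<union> ?EN \<inter> sym_diff D0 ?EN = ?EN" "?EN \<inter> D0 \<inter> (?EN \<inter> sym_diff D0 ?EN) = {}" by auto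
  have gEN: "gprod (?EN \<inter> D0) * gprod (?EN \<inter> sym_diff D0 ?EN) = gprod ?EN"
    using gprod_union[OF finite_Int[OF disjI1[OF fin]] finite_Int[OF disjI1[OF fin]] EN(2)] unfolding EN(1) by (rule sym)
  \<comment> \<open>Toggling the same labels twice restores \<open>D0\<close> and leaves their
    product as global factor: the square of \<iota> maps \<open>A\<close> to h
    \<open>A\<close>.\<close>
  have "iotas T f ?N (proj (gprod (?EN \<inter> D0)) (sym_diff D0 ?EN)) =
      proj (gprod (?EN \<inter> D0) * gprod (?EN \<inter> sym_diff D0 ?EN)) (sym_diff (sym_diff D0 ?EN) ?EN)"
    by (rule iotas_proj[OF adm_AJ[OF N], where J = ?N, unfolded Epairs_inter]) (simp, rule fin)
  then have NN: "iotas T f ?N (AJ ?N) = proj (gprod ?EN) D0"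
    unfolding AJ_proj[OF N] Epairs_inter gEN sd .
  let ?W = "iotas T f (I \<otimes>\<^bsub>\<Gamma>\<^esub> J) (proj (gprod ?EN) D0)"
  have W: "?W = proj (gprod ?EN * gprod (Epairs (I \<otimes>\<^bsub>\<Gamma>\<^esub> J) \<inter> D0)) (sym_diff D0 (Epairs (I \<otimes>\<^bsub>\<Gamma>\<^esub> J)))"
    by (rule iotas_proj[OF adm_D0]) (use IJ in auto)
  have W_sub: "?W \<subseteq> proj (gprod ?EN) D0"
    unfolding W using dvdR_mult_mono[OF dvdR_refl AJ_dvd[OF IJ]] by (intro proj_mono) (simp add: mult.assoc)
  \<comment> \<open>The values reach the restricted domain of \<open>tau\<close>; label by label
    this is an inequality between the multiplicities of the lattices involved.\<close>
  have abq: "(\<lambda>n. a * (b * q n)) \<in> ?W" if q: "q \<in> AQ" for q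
  proof -
    have bq: "lm b q \<in> AJ J" by (rule lm_AJ[OF I(2) b q])
    have "gprod ?EN * gprod (Epairs (I \<otimes>\<^bsub>\<Gamma>\<^esub> J) \<inter> D0) * gprod (dn (sym_diff D0 (Epairs (I \<otimes>\<^bsub>\<Gamma>\<^esub> J))) n) dvdR a * (b * q n)" for n
    proof -
      have "gprod ?EN * gprod (Epairs (I \<otimes>\<^bsub>\<Gamma>\<^esub> J) \<inter> D0) * gprod (dn (sym_diff D0 (Epairs (I \<otimes>\<^bsub>\<Gamma>\<^esub> J))) n) dvdR
          gprod (Epairs I) * gprod (Epairs J \<inter> D0) * gprod (dn (sym_diff D0 (Epairs J)) n)"
        by (rule gprod_dvd3) (use I IJ finite_dn[OF adm_AJ[OF IJ], of n] finite_dn[OF adm_AJ[OF I(2)], of n]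
            in \<open>auto simp: Epairs_mult dn_def\<close>)
      also have "\<dots> = gprod (Epairs I) * (gprod (Epairs J \<inter> D0) * gprod (dn (sym_diff D0 (Epairs J)) n))" by simp
      also have "\<dots> dvdR a * (b * q n)"
        using bq q lat_dvd[of "lm b q" "\<lambda>n. gprod (Epairs J \<inter> D0) * gprod (dn (sym_diff D0 (Epairs J)) n)" n]
        unfolding AJ_proj[OF I(2)] proj_def by (intro dvdR_mult_mono[OF a]) (simp add: lm_apply)
      finally show ?thesis .
    qed
    moreover have "mon (a * b) 0 \<otimes>\<^bsub>Q\<^esub> q \<in> carrier Q" using q AQ_carrier by (intro Q_mult_closed) auto
    then have "(\<lambda>n. a * (b * q n)) \<in> carrier Q" by (simp add: mon_mult mult.assoc)
    ultimately show ?thesis unfolding W by (simp add: proj_def lat_def)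
  qed
  have h: "h_elem T f ?N = \<kappa> I J"
    unfolding \<kappa>_def Epairs_inter[symmetric] by (rule h_elem_gprod) (use N in \<open>auto simp: Gamma_carrier\<close>)
  have bJ: "lm b q \<in> AJ J" "lm b q \<in> AQ" if "q \<in> AQ" for q using lm_AJ[OF I(2) b that] AJ_AQ[OF I(2)] by auto
  have ab: "lm a (lm b q) = (\<lambda>n. a * (b * q n))" if "q \<in> AQ" for q
    using bJ[OF that] that by (simp add: lm_apply)
  show ?thesis
  proof (rule extensionalityI[of _ AQ])
    fix q assume q: "q \<in> AQ"
    have "B_times T f I J (lm a) (lm b) q = mon (inverse (\<kappa> I J)) 0 \<otimes>\<^bsub>Q\<^esub> (\<lambda>n. a * (b * q n))"
      using q abq[OF q] subsetD[OF W_sub abq[OF q]]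
      by (simp add: B_times_def Let_def A_in_Q_eq compose_def iotas_map_def tau_def NN bJ ab[OF q] h)
    also have "\<dots> = lm (a * b / \<kappa> I J) q" using q by (simp add: mon_mult lm_apply field_simps)
    finally show "B_times T f I J (lm a) (lm b) q = lm (a * b / \<kappa> I J) q" .
  qed (auto simp: B_times_def Let_def A_in_Q_eq compose_def lm_def)
qed

section \<open>Coordinates on B and its graded algebra structure\<close>

abbreviation "BB \<equiv> B_alg T f"

text \<open>Coordinates in which \<open>B\<close> is the direct sum of the ideals
  \<open>gprod (Epairs J)\<close> \<open>R\<close>; \<open>mk\<close> goes back. All further
  computation in \<open>B\<close> takes place in \<open>R\<close>.\<close>

definition bc :: "'k B_elem \<Rightarrow> ('k \<Rightarrow> int set) \<Rightarrow> 'k ratfun" where "bc b J = cv (b J)"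
definition mk :: "(('k \<Rightarrow> int set) \<Rightarrow> 'k ratfun) \<Rightarrow> 'k B_elem" where "mk c = (\<lambda>J\<in>carrier \<Gamma>. lm (c J))"
abbreviation "bsupp b \<equiv> {J \<in> carrier \<Gamma>. bc b J \<noteq> 0}"

lemma B_zero_lm: "B_zero_hom T f = lm 0"
proof (rule ext)
  fix q show "B_zero_hom T f q = lm 0 q"
    by (cases "q \<in> AQ") (simp_all add: B_zero_hom_def A_in_Q_eq Q_simps(4) lm_apply, simp add: lm_def)
qed

lemma lm_eq_iff: "lm c = lm d \<longleftrightarrow> c = d" by (metis cv_lm)

lemma BB_carrier: "carrier BB = B_carrier T f" by (simp add: B_alg_def Let_def)

lemma B_val: assumes "b \<in> carrier BB" "J \<in> carrier \<Gamma>"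
  shows "b J = lm (bc b J)" "gprod (Epairs J) dvdR bc b J"
  using assms hom_lm[OF assms(2), of "b J"] by (auto simp: BB_carrier B_carrier_def bc_def)

lemma B_support_eq: assumes b: "b \<in> carrier BB" shows "B_support T f b = bsupp b"
proof -
  have "b J \<noteq> lm 0 \<longleftrightarrow> bc b J \<noteq> 0" if "J \<in> carrier \<Gamma>" for J
    using B_val(1)[OF b that] lm_eq_iff[of "bc b J" 0] by metis
  then show ?thesis unfolding B_support_def B_zero_lm by blast
qed

lemma B_supp_finite: assumes b: "b \<in> carrier BB" shows "finite (bsupp b)"
proof -
  have "finite (B_support T f b)" using b unfolding BB_carrier B_carrier_def by blast
  then show ?thesis unfolding B_support_eq[OF b] .
qed

lemma bc_mk [simp]: "J \<in> carrier \<Gamma> \<Longrightarrow> bc (mk c) J = c J" by (simp add: bc_def mk_def)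

lemma mk_carrier:
  assumes "\<And>J. J \<in> carrier \<Gamma> \<Longrightarrow> gprod (Epairs J) dvdR c J" "finite S" "\<And>J. J \<in> carrier \<Gamma> \<Longrightarrow> c J \<noteq> 0 \<Longrightarrow> J \<in> S"
  shows "mk c \<in> carrier BB"
proof -
  have "B_support T f (mk c) \<subseteq> S" using assms(3) by (auto simp: B_support_def B_zero_lm mk_def lm_eq_iff)
  then show ?thesis using assms(1,2) lm_hom by (auto simp: BB_carrier B_carrier_def mk_def intro: finite_subset)
qed

lemma mk_bc: assumes b: "b \<in> carrier BB" shows "mk (bc b) = b"
proof (rule extensionalityI[of _ "carrier \<Gamma>"])
  show "mk (bc b) \<in> extensional (carrier \<Gamma>)" by (simp add: mk_def)
  show "b \<in> extensional (carrier \<Gamma>)" using b unfolding BB_carrier B_carrier_def PiE_def by blast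
  fix J assume J: "J \<in> carrier \<Gamma>"
  have "mk (bc b) J = lm (bc b J)" using J by (simp add: mk_def)
  then show "mk (bc b) J = b J" using B_val(1)[OF b J] by (rule trans[OF _ sym])
qed

lemma mk_cong: "(\<And>J. J \<in> carrier \<Gamma> \<Longrightarrow> c J = d J) \<Longrightarrow> mk c = mk d"
  by (auto simp: mk_def)

lemma B_eqI: "a \<in> carrier BB \<Longrightarrow> b \<in> carrier BB \<Longrightarrow> (\<And>J. J \<in> carrier \<Gamma> \<Longrightarrow> bc a J = bc b J) \<Longrightarrow> a = b"
  using mk_cong[of "bc a" "bc b"] mk_bc by metis

lemma BB_zero: "\<zero>\<^bsub>BB\<^esub> = mk (\<lambda>J. 0)" by (simp add: B_alg_def Let_def B_zero_lm mk_def)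
lemma BB_one: "\<one>\<^bsub>BB\<^esub> = mk (\<lambda>J. if J = \<one>\<^bsub>\<Gamma>\<^esub> then 1 else 0)"
proof -
  have "(\<lambda>q\<in>AQ. q) = lm 1" by (auto simp: lm_def mon_mult)
  then show ?thesis by (auto simp: B_alg_def Let_def B_zero_lm mk_def A_in_Q_eq)
qed
lemma BB_scalar: "scalar BB c = mk (\<lambda>J. if J = \<one>\<^bsub>\<Gamma>\<^esub> then of_poly [:c:] else 0)"
proof -
  have "(\<lambda>q\<in>AQ. q \<otimes>\<^bsub>Q\<^esub> mon (of_poly [:c:]) 0) = lm (of_poly [:c:])"
    by (auto simp: lm_def mon_mult mult_mon AQ_carrier mult.commute)
  then show ?thesis by (auto simp: B_alg_def Let_def B_zero_lm mk_def A_in_Q_eq)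
qed
lemma BB_add: assumes "a \<in> carrier BB" "b \<in> carrier BB" shows "a \<oplus>\<^bsub>BB\<^esub> b = mk (\<lambda>J. bc a J + bc b J)"
proof -
  have "(\<lambda>q\<in>AQ. a J q \<oplus>\<^bsub>Q\<^esub> b J q) = lm (bc a J + bc b J)" if "J \<in> carrier \<Gamma>" for J
    using B_val(1)[OF assms(1) that] B_val(1)[OF assms(2) that]
    by (auto simp: lm_def mon_mult Q_simps(5) distrib_right)
  then show ?thesis by (auto simp: B_alg_def Let_def mk_def A_in_Q_eq)
qed
lemma BB_piece: "piece BB J = {b \<in> carrier BB. bsupp b \<subseteq> {J}}"
  using B_support_eq by (auto simp: B_alg_def Let_def)

text \<open>A twisted convolution. Every element of the group is its own inverse, so the partner of
  \<open>I\<close> in degree \<open>K'\<close> is \<open>I \<otimes> K'\<close>.\<close>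

lemma BB_mult:
  assumes a: "a \<in> carrier BB" and b: "b \<in> carrier BB"
  shows "a \<otimes>\<^bsub>BB\<^esub> b = mk (\<lambda>K'. \<Sum>I\<in>bsupp a. bc a I * bc b (I \<otimes>\<^bsub>\<Gamma>\<^esub> K') / \<kappa> I (I \<otimes>\<^bsub>\<Gamma>\<^esub> K'))"
proof -
  have "(\<lambda>q\<in>AQ. finsum Q (\<lambda>(I, J). B_times T f I J (a I) (b J) q)
         {(I, J) \<in> bsupp a \<times> bsupp b. I \<otimes>\<^bsub>\<Gamma>\<^esub> J = K'}) =
      lm (\<Sum>I\<in>bsupp a. bc a I * bc b (I \<otimes>\<^bsub>\<Gamma>\<^esub> K') / \<kappa> I (I \<otimes>\<^bsub>\<Gamma>\<^esub> K'))" if K': "K' \<in> carrier \<Gamma>" for K'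
  proof (rule extensionalityI[of _ AQ])
    fix q assume q: "q \<in> AQ"
    let ?S = "{(I, J) \<in> bsupp a \<times> bsupp b. I \<otimes>\<^bsub>\<Gamma>\<^esub> J = K'}"
    let ?t = "\<lambda>(I, J). bc a I * bc b J / \<kappa> I J"
    have fin: "finite ?S" using B_supp_finite[OF a] B_supp_finite[OF b]
      by (rule_tac finite_subset[of _ "bsupp a \<times> bsupp b"]) auto
    have t: "(case x of (I, J) \<Rightarrow> B_times T f I J (a I) (b J) q) = lm (?t x) q" if "x \<in> ?S" for x
      using that B_val[OF a, of "fst x"] B_val[OF b, of "snd x"] B_times_lm[of "fst x" "snd x" "bc a (fst x)" "bc b (snd x)"]
      by (auto simp: case_prod_beta)
    have tc: "lm (?t x) q \<in> carrier Q" for x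
      using q Q_mult_closed[OF mon_carrier AQ_carrier[OF q]] by (simp add: lm_def)
    have "finsum Q (\<lambda>(I, J). B_times T f I J (a I) (b J) q) ?S = finsum Q (\<lambda>x. lm (?t x) q) ?S"
      by (rule Q.finsum_cong') (use t tc in auto)
    also have "\<dots> = (\<lambda>n. (\<Sum>x\<in>?S. ?t x) * q n)"
    proof (rule ext)
      fix n
      have "finsum Q (\<lambda>x. lm (?t x) q) ?S n = (\<Sum>x\<in>?S. lm (?t x) q n)"
        by (rule Q_finsum[OF fin]) (rule funcsetI, rule tc)
      also have "\<dots> = (\<Sum>x\<in>?S. ?t x) * q n" by (simp only: lm_apply[OF q] sum_distrib_right)
      finally show "finsum Q (\<lambda>x. lm (?t x) q) ?S n = (\<Sum>x\<in>?S. ?t x) * q n" .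
    qed
    also have "(\<Sum>x\<in>?S. ?t x) = (\<Sum>I\<in>{I \<in> bsupp a. I \<otimes>\<^bsub>\<Gamma>\<^esub> K' \<in> bsupp b}. bc a I * bc b (I \<otimes>\<^bsub>\<Gamma>\<^esub> K') / \<kappa> I (I \<otimes>\<^bsub>\<Gamma>\<^esub> K'))"
      by (rule sum.reindex_bij_witness[of _ "\<lambda>I. (I, I \<otimes>\<^bsub>\<Gamma>\<^esub> K')" fst]) (use K' in auto)
    also have "\<dots> = (\<Sum>I\<in>bsupp a. bc a I * bc b (I \<otimes>\<^bsub>\<Gamma>\<^esub> K') / \<kappa> I (I \<otimes>\<^bsub>\<Gamma>\<^esub> K'))"
      by (rule sum.mono_neutral_left) (use B_supp_finite[OF a] K' in auto)
    finally show "(\<lambda>q\<in>AQ. finsum Q (\<lambda>(I, J). B_times T f I J (a I) (b J) q) ?S) q =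
      lm (\<Sum>I\<in>bsupp a. bc a I * bc b (I \<otimes>\<^bsub>\<Gamma>\<^esub> K') / \<kappa> I (I \<otimes>\<^bsub>\<Gamma>\<^esub> K')) q" using q by (simp add: lm_apply)
  qed (auto simp: lm_def)
  then show ?thesis by (auto simp: B_alg_def Let_def mk_def A_in_Q_eq B_support_eq[OF a] B_support_eq[OF b])
qed

lemma bc_add [simp]: "a \<in> carrier BB \<Longrightarrow> b \<in> carrier BB \<Longrightarrow> J \<in> carrier \<Gamma> \<Longrightarrow> bc (a \<oplus>\<^bsub>BB\<^esub> b) J = bc a J + bc b J"
  and bc_zero [simp]: "J \<in> carrier \<Gamma> \<Longrightarrow> bc \<zero>\<^bsub>BB\<^esub> J = 0"
  and bc_one: "J \<in> carrier \<Gamma> \<Longrightarrow> bc \<one>\<^bsub>BB\<^esub> J = (if J = \<one>\<^bsub>\<Gamma>\<^esub> then 1 else 0)"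
  and bc_scalar: "J \<in> carrier \<Gamma> \<Longrightarrow> bc (scalar BB c) J = (if J = \<one>\<^bsub>\<Gamma>\<^esub> then of_poly [:c:] else 0)"
  by (simp_all add: BB_add BB_zero BB_one BB_scalar)

lemma bc_mult:
  assumes a: "a \<in> carrier BB" and b: "b \<in> carrier BB" and K': "K' \<in> carrier \<Gamma>"
    and S: "finite S" "S \<subseteq> carrier \<Gamma>" "bsupp a \<subseteq> S"
  shows "bc (a \<otimes>\<^bsub>BB\<^esub> b) K' = (\<Sum>I\<in>S. bc a I * bc b (I \<otimes>\<^bsub>\<Gamma>\<^esub> K') / \<kappa> I (I \<otimes>\<^bsub>\<Gamma>\<^esub> K'))"
  unfolding BB_mult[OF a b] bc_mk[OF K'] by (rule sum.mono_neutral_left) (use S in auto)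

lemma BB_add_closed:
  assumes a: "a \<in> carrier BB" and b: "b \<in> carrier BB" shows "a \<oplus>\<^bsub>BB\<^esub> b \<in> carrier BB"
  unfolding BB_add[OF a b]
proof (rule mk_carrier)
  show "finite (bsupp a \<union> bsupp b)" using B_supp_finite[OF a] B_supp_finite[OF b] by (rule finite_UnI)
  fix J assume J: "J \<in> carrier \<Gamma>"
  show "gprod (Epairs J) dvdR bc a J + bc b J" by (intro dvdR_add B_val(2)[OF a J] B_val(2)[OF b J])
  assume "bc a J + bc b J \<noteq> 0"
  then show "J \<in> bsupp a \<union> bsupp b" using J by auto
qed

lemma BB_zero_closed: "\<zero>\<^bsub>BB\<^esub> \<in> carrier BB"
  unfolding BB_zero by (rule mk_carrier[of _ "{}"]) auto

lemma BB_mult_closed: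
  assumes a: "a \<in> carrier BB" and b: "b \<in> carrier BB" shows "a \<otimes>\<^bsub>BB\<^esub> b \<in> carrier BB"
  unfolding BB_mult[OF a b]
proof (rule mk_carrier)
  show "finite ((\<lambda>(I, J). I \<otimes>\<^bsub>\<Gamma>\<^esub> J) ` (bsupp a \<times> bsupp b))"
    using B_supp_finite[OF a] B_supp_finite[OF b] by blast
  fix K' assume K': "K' \<in> carrier \<Gamma>"
  show "gprod (Epairs K') dvdR (\<Sum>I\<in>bsupp a. bc a I * bc b (I \<otimes>\<^bsub>\<Gamma>\<^esub> K') / \<kappa> I (I \<otimes>\<^bsub>\<Gamma>\<^esub> K'))"
  proof (rule dvdR_sum)
    fix I assume "I \<in> bsupp a"
    then have I: "I \<in> carrier \<Gamma>" by simp
    then show "gprod (Epairs K') dvdR bc a I * bc b (I \<otimes>\<^bsub>\<Gamma>\<^esub> K') / \<kappa> I (I \<otimes>\<^bsub>\<Gamma>\<^esub> K')"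
      using B_times_dvd[OF I G.m_closed[OF I K'] B_val(2)[OF a I] B_val(2)[OF b G.m_closed[OF I K']]] K' by simp
  qed
  assume "(\<Sum>I\<in>bsupp a. bc a I * bc b (I \<otimes>\<^bsub>\<Gamma>\<^esub> K') / \<kappa> I (I \<otimes>\<^bsub>\<Gamma>\<^esub> K')) \<noteq> 0"
  then obtain I where I: "I \<in> bsupp a" "bc a I * bc b (I \<otimes>\<^bsub>\<Gamma>\<^esub> K') / \<kappa> I (I \<otimes>\<^bsub>\<Gamma>\<^esub> K') \<noteq> 0"
    by (rule sum.not_neutral_contains_not_neutral)
  then show "K' \<in> (\<lambda>(I, J). I \<otimes>\<^bsub>\<Gamma>\<^esub> J) ` (bsupp a \<times> bsupp b)"
    using K' by (intro image_eqI[of _ _ "(I, I \<otimes>\<^bsub>\<Gamma>\<^esub> K')"]) auto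
qed

lemma abelian_group_BB: "abelian_group BB"
proof (rule abelian_groupI)
  fix a assume a: "a \<in> carrier BB"
  have m: "mk (\<lambda>J. - bc a J) \<in> carrier BB"
    by (rule mk_carrier[OF _ B_supp_finite[OF a]]) (auto intro: dvdR_uminus B_val[OF a])
  show "\<exists>y\<in>carrier BB. y \<oplus>\<^bsub>BB\<^esub> a = \<zero>\<^bsub>BB\<^esub>"
    by (rule bexI[OF _ m]) (rule B_eqI, use m a BB_add_closed BB_zero_closed in auto)
next
  show "x \<oplus>\<^bsub>BB\<^esub> y \<oplus>\<^bsub>BB\<^esub> z = x \<oplus>\<^bsub>BB\<^esub> (y \<oplus>\<^bsub>BB\<^esub> z)"
    if "x \<in> carrier BB" "y \<in> carrier BB" "z \<in> carrier BB" for x y z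
    by (rule B_eqI) (use that in \<open>simp_all add: BB_add_closed add.assoc\<close>)
  show "x \<oplus>\<^bsub>BB\<^esub> y = y \<oplus>\<^bsub>BB\<^esub> x" if "x \<in> carrier BB" "y \<in> carrier BB" for x y
    by (rule B_eqI) (use that in \<open>simp_all add: BB_add_closed add.commute\<close>)
  show "\<zero>\<^bsub>BB\<^esub> \<oplus>\<^bsub>BB\<^esub> x = x" if "x \<in> carrier BB" for x
    by (rule B_eqI) (use that in \<open>simp_all add: BB_add_closed BB_zero_closed\<close>)
qed (auto intro: BB_add_closed BB_zero_closed)

interpretation BA: abelian_group BB by (rule abelian_group_BB)

definition sg :: "('k \<Rightarrow> int set) \<Rightarrow> 'k ratfun \<Rightarrow> 'k B_elem" where "sg J c = mk (\<lambda>K'. if K' = J then c else 0)"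

lemma sg_carrier [simp]: "J \<in> carrier \<Gamma> \<Longrightarrow> gprod (Epairs J) dvdR c \<Longrightarrow> sg J c \<in> carrier BB"
  unfolding sg_def by (rule mk_carrier[of _ "{J}"]) (auto split: if_splits)
lemma bc_sg: "K' \<in> carrier \<Gamma> \<Longrightarrow> bc (sg J c) K' = (if K' = J then c else 0)" by (simp add: sg_def)
lemma sg_piece: "J \<in> carrier \<Gamma> \<Longrightarrow> gprod (Epairs J) dvdR c \<Longrightarrow> sg J c \<in> piece BB J"
  by (auto simp: BB_piece bc_sg split: if_splits)
lemma BB_pieceD: "b \<in> piece BB J \<Longrightarrow> K' \<in> carrier \<Gamma> \<Longrightarrow> K' \<noteq> J \<Longrightarrow> bc b K' = 0"
  unfolding BB_piece by blast
lemma piece_sg: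
  assumes "J \<in> carrier \<Gamma>" "b \<in> piece BB J"
  shows "b = sg J (bc b J)" "gprod (Epairs J) dvdR bc b J" "b \<in> carrier BB"
proof -
  show b: "b \<in> carrier BB" using assms by (simp add: BB_piece)
  show d: "gprod (Epairs J) dvdR bc b J" by (rule B_val[OF b assms(1)])
  show "b = sg J (bc b J)" by (rule B_eqI[OF b sg_carrier[OF assms(1) d]]) (use assms in \<open>auto simp: bc_sg BB_piece\<close>)
qed

lemma bc_uminus: "a \<in> carrier BB \<Longrightarrow> J \<in> carrier \<Gamma> \<Longrightarrow> bc (\<ominus>\<^bsub>BB\<^esub> a) J = - bc a J"
  using bc_add[of "\<ominus>\<^bsub>BB\<^esub> a" a J] by (simp add: BA.l_neg eq_neg_iff_add_eq_0)

lemma bc_finsum: "finite S \<Longrightarrow> F' \<in> S \<rightarrow> carrier BB \<Longrightarrow> K' \<in> carrier \<Gamma> \<Longrightarrow> bc (finsum BB F' S) K' = (\<Sum>i\<in>S. bc (F' i) K')"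
  by (induction S rule: finite_induct) auto

lemma graded_BB: "graded_group \<Gamma> BB"
proof (rule graded_groupI[where \<pi> = "\<lambda>J b. sg J (bc b J)"])
  show "abelian_group BB" by (rule abelian_group_BB)
  fix J assume J: "J \<in> carrier \<Gamma>"
  show "additive_subgroup (piece BB J) BB"
  proof (rule additive_subgroup.intro, rule BA.add.subgroupI)
    show "piece BB J \<noteq> {}" using sg_piece[OF J, of 0] by auto
    fix a assume a: "a \<in> piece BB J"
    then show "\<ominus>\<^bsub>BB\<^esub> a \<in> piece BB J" by (auto simp: BB_piece bc_uminus)
    fix b assume "b \<in> piece BB J"
    then have "bc a K' + bc b K' = 0" if "K' \<in> carrier \<Gamma>" "K' \<noteq> J" for K'
      using that BB_pieceD[OF a] BB_pieceD[OF \<open>b \<in> piece BB J\<close>] by simp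
    then show "a \<oplus>\<^bsub>BB\<^esub> b \<in> piece BB J" using a \<open>b \<in> piece BB J\<close> by (auto simp: BB_piece)
  qed (auto simp: BB_piece)
  fix b assume b: "b \<in> carrier BB"
  show "sg J (bc b J) \<in> piece BB J" by (rule sg_piece[OF J B_val(2)[OF b J]])
  fix c assume c: "c \<in> carrier BB"
  show "sg J (bc (b \<oplus>\<^bsub>BB\<^esub> c) J) = sg J (bc b J) \<oplus>\<^bsub>BB\<^esub> sg J (bc c J)"
    by (rule B_eqI) (use J b c B_val in \<open>auto simp: bc_sg dvdR_add\<close>)
next
  fix b assume b: "b \<in> carrier BB"
  have eq: "{J \<in> carrier \<Gamma>. sg J (bc b J) \<noteq> \<zero>\<^bsub>BB\<^esub>} = bsupp b"
  proof -
    have "sg J (bc b J) = \<zero>\<^bsub>BB\<^esub> \<longleftrightarrow> bc b J = 0" if J: "J \<in> carrier \<Gamma>" for J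
    proof
      assume "sg J (bc b J) = \<zero>\<^bsub>BB\<^esub>"
      then show "bc b J = 0" using bc_sg[OF J, of J "bc b J"] J by simp
    qed (simp add: sg_def BB_zero cong: if_cong)
    then show ?thesis by auto
  qed
  show "finite {J \<in> carrier \<Gamma>. sg J (bc b J) \<noteq> \<zero>\<^bsub>BB\<^esub>}" unfolding eq by (rule B_supp_finite[OF b])
  have F': "(\<lambda>J. sg J (bc b J)) \<in> bsupp b \<rightarrow> carrier BB" using b B_val by auto
  show "b = finsum BB (\<lambda>J. sg J (bc b J)) {J \<in> carrier \<Gamma>. sg J (bc b J) \<noteq> \<zero>\<^bsub>BB\<^esub>}"
    unfolding eq
  proof (rule B_eqI[OF b BA.finsum_closed[OF F']])
    fix K' assume K': "K' \<in> carrier \<Gamma>"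
    have "bc (finsum BB (\<lambda>J. sg J (bc b J)) (bsupp b)) K' = (\<Sum>J\<in>bsupp b. bc (sg J (bc b J)) K')"
      by (rule bc_finsum[OF B_supp_finite[OF b] F' K'])
    also have "\<dots> = (\<Sum>J\<in>bsupp b. if J = K' then bc b K' else 0)" by (rule sum.cong) (auto simp: bc_sg K')
    also have "\<dots> = bc b K'" using K' B_supp_finite[OF b] by (auto simp: sum.delta)
    finally show "bc b K' = bc (finsum BB (\<lambda>J. sg J (bc b J)) (bsupp b)) K'" ..
  qed
next
  fix I J b assume *: "I \<in> carrier \<Gamma>" "J \<in> carrier \<Gamma>" "b \<in> piece BB J"
  show "sg I (bc b I) = (if I = J then b else \<zero>\<^bsub>BB\<^esub>)"
  proof (cases "I = J")
    case False
    then have "bc b I = 0" using * by (auto simp: BB_piece)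
    then show ?thesis using False by (simp add: sg_def BB_zero cong: if_cong)
  qed (use piece_sg[OF *(2,3)] in simp)
qed

interpretation BG: graded_grp \<Gamma> BB by (rule graded_grpI[OF graded_BB])

lemma \<kappa>_sym: "\<kappa> I J = \<kappa> J I" by (simp add: \<kappa>_def Int_commute)

text \<open>The twist \<open>\<kappa>\<close> is symmetric, and both the grading group and
  \<open>R\<close> are commutative. This also settles the remaining distributive law, the right unit
  and the centrality of scalars.\<close>

lemma BB_comm:
  assumes a: "a \<in> carrier BB" and b: "b \<in> carrier BB" shows "a \<otimes>\<^bsub>BB\<^esub> b = b \<otimes>\<^bsub>BB\<^esub> a"
proof (rule B_eqI[OF BB_mult_closed[OF a b] BB_mult_closed[OF b a]])
  fix K' assume K': "K' \<in> carrier \<Gamma>"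
  let ?S = "bsupp a \<union> bsupp b"
  \<comment> \<open>Closing the supports under translation by \<open>K'\<close> makes this
    involution a bijection of the index set.\<close>
  let ?W = "?S \<union> (\<lambda>I. I \<otimes>\<^bsub>\<Gamma>\<^esub> K') ` ?S"
  have W: "finite ?W" "?W \<subseteq> carrier \<Gamma>" using B_supp_finite[OF a] B_supp_finite[OF b] K' by auto
  have sW: "bsupp a \<subseteq> ?W" "bsupp b \<subseteq> ?W" by blast+
  have "bc (a \<otimes>\<^bsub>BB\<^esub> b) K' = (\<Sum>I\<in>?W. bc a I * bc b (I \<otimes>\<^bsub>\<Gamma>\<^esub> K') / \<kappa> I (I \<otimes>\<^bsub>\<Gamma>\<^esub> K'))"
    by (rule bc_mult[OF a b K' W sW(1)])
  also have "\<dots> = (\<Sum>I\<in>?W. bc b I * bc a (I \<otimes>\<^bsub>\<Gamma>\<^esub> K') / \<kappa> I (I \<otimes>\<^bsub>\<Gamma>\<^esub> K'))"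
    by (rule sum.reindex_bij_witness[of _ "\<lambda>I. I \<otimes>\<^bsub>\<Gamma>\<^esub> K'" "\<lambda>I. I \<otimes>\<^bsub>\<Gamma>\<^esub> K'"])
      (use K' in \<open>auto simp: \<kappa>_sym mult.commute\<close>)
  also have "\<dots> = bc (b \<otimes>\<^bsub>BB\<^esub> a) K'" by (rule bc_mult[OF b a K' W sW(2), symmetric])
  finally show "bc (a \<otimes>\<^bsub>BB\<^esub> b) K' = bc (b \<otimes>\<^bsub>BB\<^esub> a) K'" .
qed

lemma BB_r_distr:
  assumes a: "a \<in> carrier BB" and b: "b \<in> carrier BB" and c: "c \<in> carrier BB"
  shows "a \<otimes>\<^bsub>BB\<^esub> (b \<oplus>\<^bsub>BB\<^esub> c) = a \<otimes>\<^bsub>BB\<^esub> b \<oplus>\<^bsub>BB\<^esub> a \<otimes>\<^bsub>BB\<^esub> c"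
proof (rule B_eqI)
  fix K' assume K': "K' \<in> carrier \<Gamma>"
  note S = B_supp_finite[OF a] Collect_restrict[of "carrier \<Gamma>"] subset_refl[of "bsupp a"]
  show "bc (a \<otimes>\<^bsub>BB\<^esub> (b \<oplus>\<^bsub>BB\<^esub> c)) K' = bc (a \<otimes>\<^bsub>BB\<^esub> b \<oplus>\<^bsub>BB\<^esub> a \<otimes>\<^bsub>BB\<^esub> c) K'"
    unfolding bc_add[OF BB_mult_closed[OF a b] BB_mult_closed[OF a c] K'] bc_mult[OF a b K' S] bc_mult[OF a c K' S]
      bc_mult[OF a BB_add_closed[OF b c] K' S] sum.distrib[symmetric]
    using b c K' by (intro sum.cong) (auto simp: algebra_simps add_divide_distrib)
qed (use assms in \<open>auto intro: BB_mult_closed BB_add_closed\<close>)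

lemma BB_l_distr:
  assumes "a \<in> carrier BB" "b \<in> carrier BB" "c \<in> carrier BB"
  shows "(a \<oplus>\<^bsub>BB\<^esub> b) \<otimes>\<^bsub>BB\<^esub> c = a \<otimes>\<^bsub>BB\<^esub> c \<oplus>\<^bsub>BB\<^esub> b \<otimes>\<^bsub>BB\<^esub> c"
  using assms BB_r_distr[of c a b] BB_comm[of c] BB_add_closed by simp

lemma sg_mult:
  assumes I: "I \<in> carrier \<Gamma>" "J \<in> carrier \<Gamma>" and p: "gprod (Epairs I) dvdR p" "gprod (Epairs J) dvdR q"
  shows "sg I p \<otimes>\<^bsub>BB\<^esub> sg J q = sg (I \<otimes>\<^bsub>\<Gamma>\<^esub> J) (p * q / \<kappa> I J)"
proof (rule B_eqI)
  show "sg I p \<otimes>\<^bsub>BB\<^esub> sg J q \<in> carrier BB" using assms by (intro BB_mult_closed) auto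
  show "sg (I \<otimes>\<^bsub>\<Gamma>\<^esub> J) (p * q / \<kappa> I J) \<in> carrier BB" using assms B_times_dvd by (intro sg_carrier) auto
  fix K' assume K': "K' \<in> carrier \<Gamma>"
  have IK: "I \<otimes>\<^bsub>\<Gamma>\<^esub> K' = J \<longleftrightarrow> K' = I \<otimes>\<^bsub>\<Gamma>\<^esub> J" using I K' by auto
  have "bc (sg I p \<otimes>\<^bsub>BB\<^esub> sg J q) K' = (\<Sum>L'\<in>{I}. bc (sg I p) L' * bc (sg J q) (L' \<otimes>\<^bsub>\<Gamma>\<^esub> K') / \<kappa> L' (L' \<otimes>\<^bsub>\<Gamma>\<^esub> K'))"
    by (rule bc_mult) (use I K' p in \<open>auto simp: bc_sg split: if_splits\<close>)
  then show "bc (sg I p \<otimes>\<^bsub>BB\<^esub> sg J q) K' = bc (sg (I \<otimes>\<^bsub>\<Gamma>\<^esub> J) (p * q / \<kappa> I J)) K'"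
    using I K' by (auto simp: bc_sg IK)
qed

text \<open>On both sides a label is counted once if it lies in at least two of the three sets, and
  not at all otherwise.\<close>

lemma \<kappa>_cocycle:
  assumes "I \<in> carrier \<Gamma>" "J \<in> carrier \<Gamma>" "L' \<in> carrier \<Gamma>"
  shows "\<kappa> I J * \<kappa> (I \<otimes>\<^bsub>\<Gamma>\<^esub> J) L' = \<kappa> J L' * \<kappa> I (J \<otimes>\<^bsub>\<Gamma>\<^esub> L')"
  unfolding \<kappa>_def by (rule gprod_eq2) (use assms in \<open>auto simp: Epairs_mult\<close>)

text \<open>By distributivity it is enough to treat homogeneous elements, where both bracketings are
  one product divided by the two sides of \<open>\<kappa>_cocycle\<close>.\<close>

lemma BB_assoc:
  assumes a: "a \<in> carrier BB" and b: "b \<in> carrier BB" and c: "c \<in> carrier BB"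
  shows "a \<otimes>\<^bsub>BB\<^esub> b \<otimes>\<^bsub>BB\<^esub> c = a \<otimes>\<^bsub>BB\<^esub> (b \<otimes>\<^bsub>BB\<^esub> c)"
proof -
  have ne: "carrier \<Gamma> \<noteq> {}" using G.one_closed by blast
  have 1: "a \<otimes>\<^bsub>BB\<^esub> b \<otimes>\<^bsub>BB\<^esub> c = a \<otimes>\<^bsub>BB\<^esub> (b \<otimes>\<^bsub>BB\<^esub> c)"
    if I: "I \<in> carrier \<Gamma>" "J \<in> carrier \<Gamma>" "L' \<in> carrier \<Gamma>" and abc: "a \<in> piece BB I" "b \<in> piece BB J" "c \<in> piece BB L'" for a b c I J L'
  proof -
    note a = piece_sg[OF I(1) abc(1)] and b = piece_sg[OF I(2) abc(2)] and c = piece_sg[OF I(3) abc(3)]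
    have "sg I (bc a I) \<otimes>\<^bsub>BB\<^esub> sg J (bc b J) \<otimes>\<^bsub>BB\<^esub> sg L' (bc c L') = sg I (bc a I) \<otimes>\<^bsub>BB\<^esub> (sg J (bc b J) \<otimes>\<^bsub>BB\<^esub> sg L' (bc c L'))"
      using I a(2) b(2) c(2) B_times_dvd \<kappa>_cocycle[OF I] by (simp add: sg_mult G.m_assoc field_simps)
    then show ?thesis using a(1) b(1) c(1) by simp
  qed
  have 2: "a \<otimes>\<^bsub>BB\<^esub> b \<otimes>\<^bsub>BB\<^esub> c = a \<otimes>\<^bsub>BB\<^esub> (b \<otimes>\<^bsub>BB\<^esub> c)"
    if I: "I \<in> carrier \<Gamma>" "J \<in> carrier \<Gamma>" "a \<in> piece BB I" "b \<in> piece BB J" and c: "c \<in> carrier BB" for a b c I J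
    using c
  proof (induction rule: BG.graded_induct)
    case (add x y)
    have "a \<in> carrier BB" "b \<in> carrier BB" using I piece_sg by auto
    then show ?case using add by (simp add: BB_r_distr BB_mult_closed)
  qed (use I ne 1 in auto)
  have 3: "a \<otimes>\<^bsub>BB\<^esub> b \<otimes>\<^bsub>BB\<^esub> c = a \<otimes>\<^bsub>BB\<^esub> (b \<otimes>\<^bsub>BB\<^esub> c)"
    if I: "I \<in> carrier \<Gamma>" "a \<in> piece BB I" and b: "b \<in> carrier BB" and c: "c \<in> carrier BB" for a b c I
    using b
  proof (induction rule: BG.graded_induct)
    case (add x y)
    have "a \<in> carrier BB" using I piece_sg by auto
    then show ?case using add c by (simp add: BB_r_distr BB_l_distr BB_mult_closed)
  qed (use I ne 2 c in auto)
  show ?thesis using a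
  proof (induction rule: BG.graded_induct)
    case (add x y)
    then show ?case using b c by (simp add: BB_l_distr BB_mult_closed)
  qed (use b c ne 3 in auto)
qed

lemma BB_one_sg: "\<one>\<^bsub>BB\<^esub> = sg \<one>\<^bsub>\<Gamma>\<^esub> 1" by (simp add: BB_one sg_def)
lemma BB_scalar_sg: "scalar BB c = sg \<one>\<^bsub>\<Gamma>\<^esub> (of_poly [:c:])" by (simp add: BB_scalar sg_def)

lemma BB_l_one: assumes a: "a \<in> carrier BB" shows "\<one>\<^bsub>BB\<^esub> \<otimes>\<^bsub>BB\<^esub> a = a"
proof (rule B_eqI[OF BB_mult_closed[OF _ a] a])
  show o: "\<one>\<^bsub>BB\<^esub> \<in> carrier BB" unfolding BB_one_sg by (rule sg_carrier) auto
  fix K' assume K': "K' \<in> carrier \<Gamma>"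
  have "bc (\<one>\<^bsub>BB\<^esub> \<otimes>\<^bsub>BB\<^esub> a) K' = (\<Sum>L'\<in>{\<one>\<^bsub>\<Gamma>\<^esub>}. bc \<one>\<^bsub>BB\<^esub> L' * bc a (L' \<otimes>\<^bsub>\<Gamma>\<^esub> K') / \<kappa> L' (L' \<otimes>\<^bsub>\<Gamma>\<^esub> K'))"
    by (rule bc_mult[OF o a K']) (auto simp: bc_one split: if_splits)
  then show "bc (\<one>\<^bsub>BB\<^esub> \<otimes>\<^bsub>BB\<^esub> a) K' = bc a K'" using K' by (simp add: bc_one \<kappa>_def)
qed

lemma ring_BB: "ring BB"
proof (rule ringI)
  have o: "\<one>\<^bsub>BB\<^esub> \<in> carrier BB" unfolding BB_one_sg by (rule sg_carrier) auto
  show "Group.monoid BB"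
  proof (rule monoidI)
    show "a \<otimes>\<^bsub>BB\<^esub> \<one>\<^bsub>BB\<^esub> = a" if "a \<in> carrier BB" for a
      using BB_comm[OF that o] BB_l_one[OF that] by simp
  qed (auto simp: BB_mult_closed o BB_assoc BB_l_one)
qed (auto simp: abelian_group_BB BB_l_distr BB_r_distr)

lemma graded_alg_BB: "graded_alg \<Gamma> BB"
proof (intro graded_alg.intro graded_ring.intro graded_alg_axioms.intro graded_ring_axioms.intro graded_grpI)
  show "ring BB" by (rule ring_BB)
  show "graded_group \<Gamma> BB" by (rule graded_BB)
  show "group \<Gamma>" by (rule group_Gamma)
  show "\<one>\<^bsub>BB\<^esub> \<in> piece BB \<one>\<^bsub>\<Gamma>\<^esub>" unfolding BB_one_sg by (rule sg_piece) auto
  fix c d :: 'k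
  have sc: "scalar BB c \<in> carrier BB" for c unfolding BB_scalar_sg by (rule sg_carrier) auto
  show "scalar BB c \<in> piece BB \<one>\<^bsub>\<Gamma>\<^esub>" unfolding BB_scalar_sg by (rule sg_piece) auto
  show "scalar BB (c + d) = scalar BB c \<oplus>\<^bsub>BB\<^esub> scalar BB d"
    by (rule B_eqI) (use sc BB_add_closed in \<open>auto simp: bc_scalar\<close>)
  show "scalar BB (c * d) = scalar BB c \<otimes>\<^bsub>BB\<^esub> scalar BB d"
    unfolding BB_scalar_sg by (subst sg_mult) (auto simp: \<kappa>_def mult.commute)
  show "scalar BB 1 = \<one>\<^bsub>BB\<^esub>" by (simp add: BB_scalar_sg BB_one_sg One_fract_def one_pCons)
  show "scalar BB c \<otimes>\<^bsub>BB\<^esub> a = a \<otimes>\<^bsub>BB\<^esub> scalar BB c" if "a \<in> carrier BB" for a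
    by (rule BB_comm[OF sc that])
  fix I J a b assume *: "I \<in> carrier \<Gamma>" "J \<in> carrier \<Gamma>" "a \<in> piece BB I" "b \<in> piece BB J"
  note a = piece_sg[OF *(1,3)] and b = piece_sg[OF *(2,4)]
  have "sg I (bc a I) \<otimes>\<^bsub>BB\<^esub> sg J (bc b J) \<in> piece BB (I \<otimes>\<^bsub>\<Gamma>\<^esub> J)"
    using *(1,2) a(2) b(2) B_times_dvd by (simp add: sg_mult sg_piece)
  then show "a \<otimes>\<^bsub>BB\<^esub> b \<in> piece BB (I \<otimes>\<^bsub>\<Gamma>\<^esub> J)" using a(1) b(1) by simp
qed

end

section \<open>The equivalence\<close>

context gwa_setting
begin

interpretation Q: ring Q by (rule ring_Q)
interpretation A: ring A by (rule ring_A)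
interpretation G: group \<Gamma> by (rule group_Gamma)

text \<open>At most one of the two intervals is nonempty. Toggling these labels turns
  \<open>D0\<close> into the set of all labels with j > -n, the divisor of x^n \<open>A\<close>; the
  global factor is 1 for n >= 0 and \<open>\<omega> n\<close> for n < 0, which gives y^(-n)
  \<open>A\<close>.\<close>

definition Jn :: "int \<Rightarrow> 'k \<Rightarrow> int set" where "Jn n = (\<lambda>\<alpha>\<in>roots f. {-n<..0} \<union> {0<..-n})"
text \<open>The degree joining \<open>Jn n\<close> and \<open>Jn m\<close> requires the factors of
  both \<open>lam m n\<close> and \<open>lam n m\<close>, one of which is 1. An element of
  \<open>A\<close> of degree m - n brings the former; the latter is the rescaling that has to be put
  in by hand.\<close>

definition lam :: "int \<Rightarrow> int \<Rightarrow> 'k ratfun" where "lam n m = gprod (roots f \<times> {-m<..-n})"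

lemma Jn_Gamma [simp]: "Jn n \<in> carrier \<Gamma>" by (auto simp: Gamma_carrier Jn_def)

lemma lam_nonzero [simp]: "lam n m \<noteq> 0" by (simp add: lam_def)

lemma Epairs_Jn: "Epairs (Jn n) = roots f \<times> ({-n<..0} \<union> {0<..-n})"
  by (auto simp: Epairs_def Jn_def)

lemma Epairs_Jn2: "Epairs (Jn n \<otimes>\<^bsub>\<Gamma>\<^esub> Jn m) = roots f \<times> {-n<..-m} \<union> roots f \<times> {-m<..-n}"
  by (auto simp: Epairs_mult Epairs_Jn)

lemma gprod_Jn2: "gprod (Epairs (Jn n \<otimes>\<^bsub>\<Gamma>\<^esub> Jn m)) = lam m n * lam n m"
  unfolding Epairs_Jn2 lam_def by (rule gprod_union) auto

lemma \<sigma>_\<omega>_lam: "\<sigma> n (\<omega> (m - n)) = lam m n" by (simp add: \<sigma>_\<omega> lam_def)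

text \<open>Embeds \<open>GWA T f\<close> as the full subcategory of \<open>B\<close> on the objects \<open>Jn n\<close>: \<open>\<iota>\<^sub>J A\<close> with
  \<open>J = Jn n\<close> is isomorphic to a shift of \<open>A\<close> by \<open>n\<close>.\<close>

definition \<Theta> :: "int \<Rightarrow> int \<Rightarrow> 'k gwa_elem \<Rightarrow> 'k B_elem" where
  "\<Theta> n m a = sg (Jn n \<otimes>\<^bsub>\<Gamma>\<^esub> Jn m) (\<sigma> n (\<rho> a (m - n)) * lam n m)"

lemma \<Theta>_dvd:
  assumes a: "a \<in> carrier A" shows "gprod (Epairs (Jn n \<otimes>\<^bsub>\<Gamma>\<^esub> Jn m)) dvdR \<sigma> n (\<rho> a (m - n)) * lam n m"
proof -
  have "lam m n dvdR \<sigma> n (\<rho> a (m - n))"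
    using dvdR_\<sigma>[OF AQ_dvd[OF \<rho>_AQ[OF a], of "m - n"], of n] by (simp add: \<sigma>_\<omega>_lam)
  then show ?thesis unfolding gprod_Jn2 by (rule dvdR_mult_mono) (rule dvdR_refl)
qed

lemma piece_A_carrier: "a \<in> piece A d \<Longrightarrow> a \<in> carrier A" by (simp add: piece_A)

lemma piece_A_mon: "a \<in> piece A d \<Longrightarrow> \<rho> a = mon (\<rho> a d) d"
  by (auto simp: piece_A mon_apply fun_eq_iff)

lemma sg_add:
  assumes "J \<in> carrier \<Gamma>" "gprod (Epairs J) dvdR c" "gprod (Epairs J) dvdR d"
  shows "sg J (c + d) = sg J c \<oplus>\<^bsub>BB\<^esub> sg J d"
proof (rule B_eqI)
  show "sg J (c + d) \<in> carrier BB" using assms dvdR_add by simp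
  show "sg J c \<oplus>\<^bsub>BB\<^esub> sg J d \<in> carrier BB" using assms BB_add_closed by simp
  fix J' assume "J' \<in> carrier \<Gamma>"
  then show "bc (sg J (c + d)) J' = bc (sg J c \<oplus>\<^bsub>BB\<^esub> sg J d) J'" using assms by (simp add: bc_sg)
qed

lemma \<Theta>_add:
  assumes "a \<in> carrier A" "a' \<in> carrier A"
  shows "\<Theta> n m (a \<oplus>\<^bsub>A\<^esub> a') = \<Theta> n m a \<oplus>\<^bsub>BB\<^esub> \<Theta> n m a'"
proof -
  have "\<sigma> n (\<rho> (a \<oplus>\<^bsub>A\<^esub> a') (m - n)) * lam n m = \<sigma> n (\<rho> a (m - n)) * lam n m + \<sigma> n (\<rho> a' (m - n)) * lam n m"
    using assms by (simp add: \<rho>_add Q_simps(5) \<sigma>_add distrib_right)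
  then show ?thesis using sg_add[OF _ \<Theta>_dvd[OF assms(1)] \<Theta>_dvd[OF assms(2)], of n m] by (simp add: \<Theta>_def)
qed

text \<open>Along the degrees \<open>Jn n\<close> the twist \<open>\<kappa>\<close> is the
  coboundary of \<open>lam\<close>. This makes \<open>\<Theta>\<close> multiplicative.\<close>

lemma lam_mult:
  "lam n m * lam m p = \<kappa> (Jn n \<otimes>\<^bsub>\<Gamma>\<^esub> Jn m) (Jn m \<otimes>\<^bsub>\<Gamma>\<^esub> Jn p) * lam n p"
  unfolding \<kappa>_def Epairs_Jn2 lam_def by (rule gprod_eq2) auto

lemma \<Theta>_mult:
  assumes a: "a \<in> piece A (m - n)" and a': "a' \<in> piece A (p - m)"
  shows "\<Theta> n p (a \<otimes>\<^bsub>A\<^esub> a') = \<Theta> n m a \<otimes>\<^bsub>BB\<^esub> \<Theta> m p a'"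
proof -
  let ?x = "\<rho> a (m - n)" and ?y = "\<rho> a' (p - m)"
  note aA = piece_A_carrier[OF a] and a'A = piece_A_carrier[OF a']
  have "\<rho> (a \<otimes>\<^bsub>A\<^esub> a') = mon ?x (m - n) \<otimes>\<^bsub>Q\<^esub> mon ?y (p - m)"
    by (rule trans[OF \<rho>_mult[OF aA a'A] arg_cong2[where f = "monoid.mult Q", OF piece_A_mon[OF a] piece_A_mon[OF a']]])
  then have aa': "\<rho> (a \<otimes>\<^bsub>A\<^esub> a') (p - n) = ?x * \<sigma> (m - n) ?y" by (simp add: mon_mon mon_apply)
  have J: "(Jn n \<otimes>\<^bsub>\<Gamma>\<^esub> Jn m) \<otimes>\<^bsub>\<Gamma>\<^esub> (Jn m \<otimes>\<^bsub>\<Gamma>\<^esub> Jn p) = Jn n \<otimes>\<^bsub>\<Gamma>\<^esub> Jn p"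
    by (rule Gamma_eqI) (auto simp: Epairs_mult)
  let ?k = "\<kappa> (Jn n \<otimes>\<^bsub>\<Gamma>\<^esub> Jn m) (Jn m \<otimes>\<^bsub>\<Gamma>\<^esub> Jn p)"
  have "(\<sigma> n ?x * lam n m) * (\<sigma> m ?y * lam m p) = (\<sigma> n ?x * \<sigma> m ?y) * (lam n m * lam m p)"
    by (simp only: ac_simps)
  also have "\<dots> = ((\<sigma> n ?x * \<sigma> m ?y) * lam n p) * ?k" unfolding lam_mult by (simp only: ac_simps)
  finally have "(\<sigma> n ?x * lam n m) * (\<sigma> m ?y * lam m p) / ?k = (\<sigma> n ?x * \<sigma> m ?y) * lam n p"
    unfolding nonzero_divide_eq_eq[OF \<kappa>_nonzero] .
  moreover have "\<sigma> n (?x * \<sigma> (m - n) ?y) = \<sigma> n ?x * \<sigma> m ?y" by (simp add: \<sigma>_mult)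
  moreover have "\<Theta> n m a \<otimes>\<^bsub>BB\<^esub> \<Theta> m p a' =
      sg (Jn n \<otimes>\<^bsub>\<Gamma>\<^esub> Jn p) ((\<sigma> n ?x * lam n m) * (\<sigma> m ?y * lam m p) / ?k)"
    unfolding \<Theta>_def J[symmetric] by (rule sg_mult) (use \<Theta>_dvd[OF aA] \<Theta>_dvd[OF a'A] in auto)
  ultimately show ?thesis unfolding \<Theta>_def aa' by simp
qed

lemma Gamma_square: "J \<in> carrier \<Gamma> \<Longrightarrow> J \<otimes>\<^bsub>\<Gamma>\<^esub> J = \<one>\<^bsub>\<Gamma>\<^esub>"
  by (rule Gamma_eqI) (auto simp: Epairs_mult)

lemma \<Theta>_scalar: "\<Theta> n n (scalar A c) = scalar BB c"
  by (simp add: \<Theta>_def Gamma_square \<rho>_scalar mon_apply lam_def BB_scalar_sg)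

lemma \<Theta>_bij: "bij_betw (\<Theta> n m) (piece A (m - n)) (piece BB (Jn n \<otimes>\<^bsub>\<Gamma>\<^esub> Jn m))"
proof (rule bij_betwI)
  let ?J = "Jn n \<otimes>\<^bsub>\<Gamma>\<^esub> Jn m"
  let ?c = "\<lambda>b. \<sigma> (-n) (bc b ?J / lam n m)"
  let ?g = "\<lambda>b. el (mon (?c b) (m - n))"
  have J: "?J \<in> carrier \<Gamma>" by simp
  show "\<Theta> n m \<in> piece A (m - n) \<rightarrow> piece BB ?J"
    unfolding \<Theta>_def using sg_piece[OF J \<Theta>_dvd[OF piece_A_carrier]] by blast
  have m: "mon (?c b) (m - n) \<in> AQ" if b: "b \<in> piece BB ?J" for b
  proof (rule mon_AQ)
    have "lam n m * lam m n dvdR lam n m * (bc b ?J / lam n m)"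
      using piece_sg(2)[OF J b] unfolding gprod_Jn2 by (simp add: mult.commute)
    then have "lam m n dvdR bc b ?J / lam n m" by (subst (asm) dvdR_cancel) auto
    then have "\<sigma> (-n) (\<sigma> n (\<omega> (m - n))) dvdR ?c b" unfolding \<sigma>_\<omega>_lam by (rule dvdR_\<sigma>)
    then show "\<omega> (m - n) dvdR ?c b" by simp
  qed
  show "?g \<in> piece BB ?J \<rightarrow> piece A (m - n)" using m by (auto simp: piece_A mon_apply)
  show "?g (\<Theta> n m a) = a" if a: "a \<in> piece A (m - n)" for a
  proof -
    have "?c (\<Theta> n m a) = \<rho> a (m - n)" by (simp add: \<Theta>_def bc_sg)
    then show ?thesis using piece_A_mon[OF a] el(3)[OF piece_A_carrier[OF a]] by simp
  qed
  show "\<Theta> n m (?g b) = b" if b: "b \<in> piece BB ?J" for b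
  proof -
    have "\<Theta> n m (?g b) = sg ?J (bc b ?J)" using m[OF b] by (simp add: \<Theta>_def mon_apply)
    also have "\<dots> = b" by (rule piece_sg(1)[OF J b, symmetric])
    finally show ?thesis .
  qed
qed

text \<open>Degrees have order two and \<open>\<kappa> J J\<close> is
  \<open>gprod (Epairs J)\<close>, so squaring the generator of degree \<open>J\<close> returns it
  to degree \<open>\<one>\<close> with the same coefficient instead of its square.\<close>

lemma sg_square:
  assumes J: "J \<in> carrier \<Gamma>" and u: "u \<in> R"
  shows "sg J (gprod (Epairs J)) \<otimes>\<^bsub>BB\<^esub> sg J (gprod (Epairs J) * u) = sg \<one>\<^bsub>\<Gamma>\<^esub> (gprod (Epairs J) * u)"
proof -
  have "gprod (Epairs J) dvdR gprod (Epairs J) * u" using u by (auto simp: dvdR_def)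
  then show ?thesis using sg_mult[OF J J dvdR_refl, of "gprod (Epairs J) * u"] by (simp add: Gamma_square J \<kappa>_def)
qed

text \<open>For large N the labels of \<open>J \<otimes> Jn N\<close> are those of \<open>J\<close>
  above 0 together with the missing ones in (-N, 0]; for -N the two ranges are exchanged. The two
  sets are disjoint, so their products are comaximal, and by \<open>sg_square\<close> each term of a
  Bezout identity factors through one of the two degrees.\<close>

lemma summand:
  assumes J: "J \<in> carrier \<Gamma>"
  shows "\<exists>n1 n2. \<exists>u1\<in>piece BB (J \<otimes>\<^bsub>\<Gamma>\<^esub> Jn n1). \<exists>v1\<in>piece BB (Jn n1 \<otimes>\<^bsub>\<Gamma>\<^esub> J).
    \<exists>u2\<in>piece BB (J \<otimes>\<^bsub>\<Gamma>\<^esub> Jn n2). \<exists>v2\<in>piece BB (Jn n2 \<otimes>\<^bsub>\<Gamma>\<^esub> J).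
      u1 \<otimes>\<^bsub>BB\<^esub> v1 \<oplus>\<^bsub>BB\<^esub> u2 \<otimes>\<^bsub>BB\<^esub> v2 = \<one>\<^bsub>BB\<^esub>"
proof -
  let ?M = "insert 0 ((\<lambda>e. \<bar>snd e\<bar>) ` Epairs J)"
  \<comment> \<open>Strictly larger than every |j| occurring in \<open>J\<close>, so that all labels
    of \<open>J\<close> lie inside the two toggled ranges. The inserted 0 keeps the maximum defined
    for empty \<open>J\<close> and makes N positive.\<close>
  define N where "N = 1 + Max ?M"
  have fin: "finite ?M" using J by simp
  have "0 \<le> Max ?M" by (rule Max_ge[OF fin]) simp
  then have N: "N > 0" by (simp add: N_def)
  have N_J: "\<bar>j\<bar> < N" if "(\<alpha>, j) \<in> Epairs J" for \<alpha> j
  proof -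
    have "\<bar>j\<bar> \<le> Max ?M" by (rule Max_ge[OF fin]) (use that in force)
    then show ?thesis unfolding N_def by linarith
  qed
  let ?J1 = "J \<otimes>\<^bsub>\<Gamma>\<^esub> Jn N" and ?J2 = "J \<otimes>\<^bsub>\<Gamma>\<^esub> Jn (-N)"
  have J12: "?J1 \<in> carrier \<Gamma>" "?J2 \<in> carrier \<Gamma>" using J by simp_all
  have comm: "Jn n \<otimes>\<^bsub>\<Gamma>\<^esub> J = J \<otimes>\<^bsub>\<Gamma>\<^esub> Jn n" for n using J by (simp add: Gamma_comm)
  have "\<not> ((\<alpha>, j) \<in> Epairs ?J1 \<and> (\<alpha>, j) \<in> Epairs ?J2)" for \<alpha> j
  proof (cases "(\<alpha>, j) \<in> Epairs J")
    case True
    then have "- N < j" "j < N" "\<alpha> \<in> roots f" using N_J[OF True] Epairs_roots[of J] by auto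
    then show ?thesis using True by (auto simp: Epairs_mult Epairs_Jn)
  next
    case False
    then show ?thesis using N by (auto simp: Epairs_mult Epairs_Jn)
  qed
  then have "Epairs ?J1 \<inter> Epairs ?J2 = {}" by auto
  then have "comax (gprod (Epairs ?J1)) (gprod (Epairs ?J2))" by (intro comax_gprod Epairs_roots)
  then obtain u v where uv: "u \<in> R" "v \<in> R" "gprod (Epairs ?J1) * u + gprod (Epairs ?J2) * v = 1"
    unfolding comax_def by blast
  have p: "sg J' (gprod (Epairs J')) \<in> piece BB J'" "sg J' (gprod (Epairs J') * w) \<in> piece BB J'"
    if "J' \<in> carrier \<Gamma>" "w \<in> R" for J' w
    using that by (auto intro!: sg_piece simp: dvdR_def)
  have "sg ?J1 (gprod (Epairs ?J1)) \<otimes>\<^bsub>BB\<^esub> sg ?J1 (gprod (Epairs ?J1) * u) \<oplus>\<^bsub>BB\<^esub>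
      sg ?J2 (gprod (Epairs ?J2)) \<otimes>\<^bsub>BB\<^esub> sg ?J2 (gprod (Epairs ?J2) * v) = \<one>\<^bsub>BB\<^esub>"
    unfolding sg_square[OF J12(1) uv(1)] sg_square[OF J12(2) uv(2)] BB_one_sg uv(3)[symmetric]
    by (rule sg_add[symmetric]) (use uv in simp_all)
  then show ?thesis unfolding comm using p[OF J12(1) uv(1)] p[OF J12(2) uv(2)] by blast
qed

lemma morita: "graded_morita integer_group A \<Gamma> BB Jn \<Theta>"
proof (intro graded_morita.intro graded_morita_axioms.intro graded_alg_A graded_alg_BB)
  have mn: "inv\<^bsub>integer_group\<^esub> n \<otimes>\<^bsub>integer_group\<^esub> m = m - n" for n m by simp
  show "Jn n \<in> carrier \<Gamma>" for n by simp
  show "bij_betw (\<Theta> n m) (piece A (inv\<^bsub>integer_group\<^esub> n \<otimes>\<^bsub>integer_group\<^esub> m)) (piece BB (inv\<^bsub>\<Gamma>\<^esub> Jn n \<otimes>\<^bsub>\<Gamma>\<^esub> Jn m))" for n m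
    unfolding mn Gamma_inv[OF Jn_Gamma] by (rule \<Theta>_bij)
  show "\<Theta> n m (a \<oplus>\<^bsub>A\<^esub> a') = \<Theta> n m a \<oplus>\<^bsub>BB\<^esub> \<Theta> n m a'"
    if "a \<in> piece A (inv\<^bsub>integer_group\<^esub> n \<otimes>\<^bsub>integer_group\<^esub> m)" "a' \<in> piece A (inv\<^bsub>integer_group\<^esub> n \<otimes>\<^bsub>integer_group\<^esub> m)" for n m a a'
    using that by (intro \<Theta>_add piece_A_carrier)
  show "\<Theta> n p (a \<otimes>\<^bsub>A\<^esub> a') = \<Theta> n m a \<otimes>\<^bsub>BB\<^esub> \<Theta> m p a'"
    if "a \<in> piece A (inv\<^bsub>integer_group\<^esub> n \<otimes>\<^bsub>integer_group\<^esub> m)" "a' \<in> piece A (inv\<^bsub>integer_group\<^esub> m \<otimes>\<^bsub>integer_group\<^esub> p)" for n m p a a'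
    using that unfolding mn by (rule \<Theta>_mult)
  show "\<Theta> n n (scalar A c) = scalar BB c" for n c by (rule \<Theta>_scalar)
  fix J assume J: "J \<in> carrier \<Gamma>"
  show "\<exists>n1\<in>carrier integer_group. \<exists>n2\<in>carrier integer_group. \<exists>u1\<in>piece BB (inv\<^bsub>\<Gamma>\<^esub> J \<otimes>\<^bsub>\<Gamma>\<^esub> Jn n1).
        \<exists>v1\<in>piece BB (inv\<^bsub>\<Gamma>\<^esub> Jn n1 \<otimes>\<^bsub>\<Gamma>\<^esub> J). \<exists>u2\<in>piece BB (inv\<^bsub>\<Gamma>\<^esub> J \<otimes>\<^bsub>\<Gamma>\<^esub> Jn n2). \<exists>v2\<in>piece BB (inv\<^bsub>\<Gamma>\<^esub> Jn n2 \<otimes>\<^bsub>\<Gamma>\<^esub> J).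
        u1 \<otimes>\<^bsub>BB\<^esub> v1 \<oplus>\<^bsub>BB\<^esub> u2 \<otimes>\<^bsub>BB\<^esub> v2 = \<one>\<^bsub>BB\<^esub>"
    unfolding Gamma_inv[OF J] Gamma_inv[OF Jn_Gamma] using summand[OF J] by simp
qed

end

theorem theorem5p3:
  fixes T :: "'k::{alg_closed_field, field_char_0} base"
    and f :: "'k poly"
    and U :: "'m set set"
  assumes base: "T = Shift \<or>
      (\<exists>\<xi>. T = QShift \<xi> \<and> \<xi> \<noteq> 0 \<and> (\<forall>n>0. \<xi> ^ n \<noteq> 1) \<and> poly f 0 \<noteq> 0)"
    and monic: "lead_coeff f = 1"
    and simple: "\<And>\<alpha> \<beta> n. \<lbrakk>\<alpha> \<in> roots f; \<beta> \<in> roots f; \<beta> = sigma_k T n \<alpha>\<rbrakk> \<Longrightarrow> \<beta> = \<alpha>"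
    and universe: "\<And>S S'. \<lbrakk>S \<in> U; S' \<subseteq> S\<rbrakk> \<Longrightarrow> S' \<in> U"
  shows "equivalent_categories
      (GrMod U integer_group (GWA T f))
      (GrMod U (Gamma f) (B_alg T f))"
proof -
  interpret gwa_setting T f by unfold_locales (fact base monic simple)+
  interpret M: graded_morita integer_group "GWA T f" "Gamma f" "B_alg T f" Jn \<Theta> by (rule morita)
  have "countable (carrier integer_group :: int set)" by simp
  \<comment> \<open>The Morita equivalence runs from modules over \<open>B\<close> to modules over
    \<open>A\<close>, hence the appeal to symmetry.\<close>
  then show ?thesis
    by (rule equivalent_categories_sym[OF M.graded_morita_equivalence[OF _ countable_Gamma infinite_UNIV_char_0 universe]])
qed

end
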